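(* Let $k$ be a unital commutative ring with $k\supseteq\mathbb{Q}$ and let $A$ be an augmented, commutative $k$-algebra with augmentation ideal $I$. Let $M$ be a symmetric $A$-bimodule which is flat over $k$. There is an isomorphism of $k$-modules \[ H_{n}\left(e_{\star}^{(1)}C_{\star}(I,M)\right)\cong Harr_{n}\left(A,M\right)\] for each $n\geqslant 0$.
   Context: All tensor products are over $k$ unless indicated. A $k$-algebra $A$ (associative, unital) is augmented if equipped with a $k$-algebra homomorphism $\varepsilon\colon A\to k$; its augmentation ideal is $I=\mathrm{Ker}(\varepsilon)$, and $A\cong I\oplus k$ as $k$-modules. A bimodule $M$ is symmetric if $am=ma$ for all $a\in A$, $m\in M$. Hochschild complex: $C_\star(A,M)$ is the chain complex with $C_n(A,M)=M\otimes A^{\otimes n}$ and boundary $b=\sum_{i=0}^n(-1)^i\partial_i$, where $\partial_0(m\otimes a_1\otimes\cdots\otimes a_n)=ma_1\otimes a_2\otimes\cdots\otimes a_n$, $\partial_i(m\otimes a_1\otimes\cdots\otimes a_n)=m\otimes a_1\otimes\cdots\otimes a_ia_{i+1}\otimes\cdots\otimes a_n$ for $1\leqslant i\leqslant n-1$, $\partial_n(m\otimes a_1\otimes\cdots\otimes a_n)=a_nm\otimes a_1\otimes\cdots\otimes a_{n-1}$. Write $C_\star(A)=C_\star(A,A)$. The chain complex $C_\star(I,M)$ has $C_n(I,M)=M\otimes I^{\otimes n}$ with boundary given by the same formula $b$. $\Sigma_n$ acts on $M\otimes A^{\otimes n}$ by $\sigma(m\otimes a_1\otimes\cdots\otimes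 a_n)=m\otimes a_{\sigma^{-1}(1)}\otimes\cdots\otimes a_{\sigma^{-1}(n)}$, and similarly on $M\otimes I^{\otimes n}$. $\sigma\in\Sigma_n$ is an $i$-shuffle if $\sigma(1)<\cdots<\sigma(i)$ and $\sigma(i+1)<\cdots<\sigma(n)$; $sh_{i,n-i}=\sum_{i\text{-shuffles }\sigma}\mathrm{sgn}(\sigma)\sigma$ and $sh_n=\sum_{i=1}^{n-1}sh_{i,n-i}$ in the group algebra of $\Sigma_n$. Harrison homology: the shuffle complex $Sh_\star(A)\subseteq C_\star(A)$ has $Sh_n(A)$ the $k$-submodule generated by all elements $sh_n(a_0\otimes a_1\otimes\cdots\otimes a_n)$ (it is a subcomplex since $sh_n$ is a chain map; $Sh_0(A)=Sh_1(A)=0$). $CHarr_\star(A)=C_\star(A)/Sh_\star(A)$, $CHarr_\star(A,M)=M\otimes_A CHarr_\star(A)$ (with $A$ acting on the tensor factor $a_0$), and $Harr_n(A,M)=H_n(CHarr_\star(A,M))$. Eulerian idempotents: for $n\geqslant1$, $e_n^{(1)},\dots,e_n^{(n)}\in\mathbb{Q}[\Sigma_n]$ are the pairwise-orthogonal idempotents with sum the identity given by $e_n^{(i)}=\prod_{1\leqslant j\leqslant n,\,j\neq i}\frac{sh_n-(2^j-2)}{2^i-2^j}$ (so $sh_n=\sum_i(2^i-2)e_n^{(i)}$); in degree $0$, $e_0^{(1)}$ is the identity. The action of $e_n^{(1)}$ commutes with $b$, and $e_\star^{(1)}C_\star(I,M)$ is the subcomplex of $C_\star(I,M)$ given in degree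 $n$ by the image of $e_n^{(1)}$. *)

theory Defs
  imports Complex_Main "HOL-Algebra.Module" "HOL-Algebra.AbelCoset" "HOL-Algebra.RingHom"
    "HOL-Combinatorics.Permutations"
begin

section \<open>Modules\<close>

definition lin_maps ::
    "('k, 'r) ring_scheme \<Rightarrow> ('k, 'x) module \<Rightarrow> ('k, 'y) module \<Rightarrow> ('x \<Rightarrow> 'y) set" where
  "lin_maps R M N = {f \<in> carrier M \<rightarrow> carrier N.
     (\<forall>x\<in>carrier M. \<forall>y\<in>carrier M. f (x \<oplus>\<^bsub>M\<^esub> y) = f x \<oplus>\<^bsub>N\<^esub> f y) \<and>
     (\<forall>c\<in>carrier R. \<forall>x\<in>carrier M. f (c \<odot>\<^bsub>M\<^esub> x) = c \<odot>\<^bsub>N\<^esub> f x)}"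

definition lin_isos ::
    "('k, 'r) ring_scheme \<Rightarrow> ('k, 'x) module \<Rightarrow> ('k, 'y) module \<Rightarrow> ('x \<Rightarrow> 'y) set" where
  "lin_isos R M N = {f \<in> lin_maps R M N. bij_betw f (carrier M) (carrier N)}"

definition mod_span ::
    "('k, 'r) ring_scheme \<Rightarrow> ('k, 'x) module \<Rightarrow> 'x set \<Rightarrow> 'x set" where
  "mod_span R M S = \<Inter>{N. submodule N R M \<and> S \<subseteq> N}"

text \<open>Modules are records extending rings; the multiplicative fields of the modules
  built below carry no meaning.\<close>

definition quotient_module :: "('k, 'x) module \<Rightarrow> 'x set \<Rightarrow> ('k, 'x set) module" where
  "quotient_module M N =
    \<lparr>carrier = a_rcosets\<^bsub>M\<^esub> N, monoid.mult = undefined, one = undefined,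
     zero = N, add = (\<lambda>X Y. X <+>\<^bsub>M\<^esub> Y),
     smult = (\<lambda>c X. \<Union>x\<in>X. N +>\<^bsub>M\<^esub> (c \<odot>\<^bsub>M\<^esub> x))\<rparr>"

text \<open>The map out of a quotient module induced by a map that is constant on cosets.\<close>

definition induced :: "('x \<Rightarrow> 'y) \<Rightarrow> 'x set \<Rightarrow> 'y" where
  "induced f X = the_elem (f ` X)"

definition free_module :: "('k, 'r) ring_scheme \<Rightarrow> 'x set \<Rightarrow> ('k, 'x \<Rightarrow> 'k) module" where
  "free_module R X =
    \<lparr>carrier = {\<phi>. finite {x. \<phi> x \<noteq> \<zero>\<^bsub>R\<^esub>} \<and> {x. \<phi> x \<noteq> \<zero>\<^bsub>R\<^esub>} \<subseteq> X \<and> range \<phi> \<subseteq> carrier R},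
     monoid.mult = undefined, one = undefined,
     zero = (\<lambda>x. \<zero>\<^bsub>R\<^esub>), add = (\<lambda>\<phi> \<psi> x. \<phi> x \<oplus>\<^bsub>R\<^esub> \<psi> x),
     smult = (\<lambda>c \<phi> x. c \<otimes>\<^bsub>R\<^esub> \<phi> x)\<rparr>"

definition free_gen :: "('k, 'r) ring_scheme \<Rightarrow> 'x \<Rightarrow> 'x \<Rightarrow> 'k" where
  "free_gen R x = (\<lambda>y. if y = x then \<one>\<^bsub>R\<^esub> else \<zero>\<^bsub>R\<^esub>)"

definition free_extend ::
    "('k, 'r) ring_scheme \<Rightarrow> ('k, 'y) module \<Rightarrow> ('x \<Rightarrow> 'y) \<Rightarrow> ('x \<Rightarrow> 'k) \<Rightarrow> 'y" where
  "free_extend R N f \<phi> = (\<Oplus>\<^bsub>N\<^esub>x\<in>{x. \<phi> x \<noteq> \<zero>\<^bsub>R\<^esub>}. \<phi> x \<odot>\<^bsub>N\<^esub> f x)"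

text \<open>The module with generators \<^term>\<open>X\<close> and relations \<^term>\<open>S\<close>, the class of a generator,
  and the linear map out of it with prescribed values on the generators
  (well defined if these values satisfy the relations).\<close>

definition pres_module ::
    "('k, 'r) ring_scheme \<Rightarrow> 'x set \<Rightarrow> ('x \<Rightarrow> 'k) set \<Rightarrow> ('k, ('x \<Rightarrow> 'k) set) module" where
  "pres_module R X S = quotient_module (free_module R X) (mod_span R (free_module R X) S)"

definition pres_gen ::
    "('k, 'r) ring_scheme \<Rightarrow> 'x set \<Rightarrow> ('x \<Rightarrow> 'k) set \<Rightarrow> 'x \<Rightarrow> ('x \<Rightarrow> 'k) set" where
  "pres_gen R X S x = mod_span R (free_module R X) S +>\<^bsub>free_module R X\<^esub> free_gen R x"

definition pres_lift ::
    "('k, 'r) ring_scheme \<Rightarrow> ('k, 'y) module \<Rightarrow> ('x \<Rightarrow> 'y) \<Rightarrow> ('x \<Rightarrow> 'k) set \<Rightarrow> 'y" where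
  "pres_lift R N f = induced (free_extend R N f)"

text \<open>Replaces the scalar multiplication, possibly changing the ring of scalars.\<close>

definition with_smult :: "('k, 'x) module \<Rightarrow> ('l \<Rightarrow> 'x \<Rightarrow> 'x) \<Rightarrow> ('l, 'x) module" where
  "with_smult M s =
    \<lparr>carrier = carrier M, monoid.mult = monoid.mult M, one = one M, zero = zero M, add = add M, smult = s\<rparr>"

text \<open>Restriction of scalars along the structure map \<open>c \<mapsto> c \<odot> \<one>\<close> of an algebra.\<close>

definition restrict_scalars :: "('k, 'a) module \<Rightarrow> ('a, 'x) module \<Rightarrow> ('k, 'x) module" where
  "restrict_scalars A M = with_smult M (\<lambda>c x. (c \<odot>\<^bsub>A\<^esub> \<one>\<^bsub>A\<^esub>) \<odot>\<^bsub>M\<^esub> x)"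


section \<open>Binary tensor products and flatness\<close>

definition tensor_rels ::
    "('k, 'r) ring_scheme \<Rightarrow> ('k, 'x) module \<Rightarrow> ('k, 'y) module \<Rightarrow> ('x \<times> 'y \<Rightarrow> 'k) set" where
  "tensor_rels R M N = (let F = free_module R (carrier M \<times> carrier N); g = free_gen R in
     {g (x \<oplus>\<^bsub>M\<^esub> x', y) \<ominus>\<^bsub>F\<^esub> (g (x, y) \<oplus>\<^bsub>F\<^esub> g (x', y)) | x x' y.
        x \<in> carrier M \<and> x' \<in> carrier M \<and> y \<in> carrier N} \<union>
     {g (x, y \<oplus>\<^bsub>N\<^esub> y') \<ominus>\<^bsub>F\<^esub> (g (x, y) \<oplus>\<^bsub>F\<^esub> g (x, y')) | x y y'.
        x \<in> carrier M \<and> y \<in> carrier N \<and> y' \<in> carrier N} \<union>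
     {g (c \<odot>\<^bsub>M\<^esub> x, y) \<ominus>\<^bsub>F\<^esub> c \<odot>\<^bsub>F\<^esub> g (x, y) | c x y.
        c \<in> carrier R \<and> x \<in> carrier M \<and> y \<in> carrier N} \<union>
     {g (x, c \<odot>\<^bsub>N\<^esub> y) \<ominus>\<^bsub>F\<^esub> c \<odot>\<^bsub>F\<^esub> g (x, y) | c x y.
        c \<in> carrier R \<and> x \<in> carrier M \<and> y \<in> carrier N})"

definition tensor :: "('k, 'r) ring_scheme \<Rightarrow> ('k, 'x) module \<Rightarrow> ('k, 'y) module \<Rightarrow>
    ('k, ('x \<times> 'y \<Rightarrow> 'k) set) module" where
  "tensor R M N = pres_module R (carrier M \<times> carrier N) (tensor_rels R M N)"

definition tensor_pure :: "('k, 'r) ring_scheme \<Rightarrow> ('k, 'x) module \<Rightarrow> ('k, 'y) module \<Rightarrow>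
    'x \<Rightarrow> 'y \<Rightarrow> ('x \<times> 'y \<Rightarrow> 'k) set" where
  "tensor_pure R M N x y = pres_gen R (carrier M \<times> carrier N) (tensor_rels R M N) (x, y)"

text \<open>The map \<open>id \<otimes> g\<close> from \<open>M \<otimes> N\<close> to \<open>M \<otimes> N'\<close>.\<close>

definition id_tensor :: "('k, 'r) ring_scheme \<Rightarrow> ('k, 'x) module \<Rightarrow> ('k, 'z) module \<Rightarrow>
    ('y \<Rightarrow> 'z) \<Rightarrow> ('x \<times> 'y \<Rightarrow> 'k) set \<Rightarrow> ('x \<times> 'z \<Rightarrow> 'k) set" where
  "id_tensor R M N' g = pres_lift R (tensor R M N') (\<lambda>(x, y). tensor_pure R M N' x (g y))"

text \<open>Flatness: \<open>M \<otimes> _\<close> preserves injective linear maps. HOL cannot quantify over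
  modules in all types, so the test modules have carriers in \<^typ>\<open>nat \<Rightarrow> 'k\<close>. This is no
  restriction: every countably generated module (a quotient of a free module on at
  most countably many generators) is isomorphic to one with carrier in this type (take coset
  representatives), in particular the ring and its ideals, which suffice to detect flatness.\<close>

definition flat_module :: "('k, 'r) ring_scheme \<Rightarrow> ('k, 'm) module \<Rightarrow> bool" where
  "flat_module R M \<longleftrightarrow> module R M \<and>
    (\<forall>(N :: ('k, nat \<Rightarrow> 'k) module) (N' :: ('k, nat \<Rightarrow> 'k) module).
       \<forall>g \<in> lin_maps R N N'.
       module R N \<longrightarrow> module R N' \<longrightarrow> inj_on g (carrier N) \<longrightarrow>
       inj_on (id_tensor R M N' g) (carrier (tensor R M N)))"


section \<open>Augmented algebras and bimodules\<close>

locale augmented_algebra = algebra R A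
  for R :: "('k, 'r) ring_scheme" (structure) and A :: "('k, 'a) module" (structure) +
  fixes \<epsilon> :: "'a \<Rightarrow> 'k"
  assumes aug_ring_hom: "\<epsilon> \<in> ring_hom A R"
    and aug_smult: "\<lbrakk>c \<in> carrier R; a \<in> carrier A\<rbrakk> \<Longrightarrow> \<epsilon> (c \<odot>\<^bsub>A\<^esub> a) = c \<otimes>\<^bsub>R\<^esub> \<epsilon> a"

text \<open>The augmentation ideal, as a module with the (nonunital) multiplication of \<^term>\<open>A\<close>.\<close>

definition aug_ideal ::
    "('k, 'r) ring_scheme \<Rightarrow> ('k, 'a) module \<Rightarrow> ('a \<Rightarrow> 'k) \<Rightarrow> ('k, 'a) module" where
  "aug_ideal R A \<epsilon> = A\<lparr>carrier := a_kernel A R \<epsilon>\<rparr>"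

text \<open>Bimodules over a \<open>k\<close>-algebra: \<open>l a m\<close> is \<open>am\<close> and \<open>r m a\<close> is \<open>ma\<close>.\<close>

locale alg_bimodule = algebra R A + MM: module R M
  for R :: "('k, 'r) ring_scheme" (structure) and A :: "('k, 'a) module" (structure)
    and M :: "('k, 'm) module" (structure) +
  fixes l :: "'a \<Rightarrow> 'm \<Rightarrow> 'm" and r :: "'m \<Rightarrow> 'a \<Rightarrow> 'm"
  assumes l_closed: "\<lbrakk>a \<in> carrier A; m \<in> carrier M\<rbrakk> \<Longrightarrow> l a m \<in> carrier M"
    and r_closed: "\<lbrakk>a \<in> carrier A; m \<in> carrier M\<rbrakk> \<Longrightarrow> r m a \<in> carrier M"
    and l_add_left: "\<lbrakk>a \<in> carrier A; a' \<in> carrier A; m \<in> carrier M\<rbrakk> \<Longrightarrow>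
      l (a \<oplus>\<^bsub>A\<^esub> a') m = l a m \<oplus>\<^bsub>M\<^esub> l a' m"
    and l_add_right: "\<lbrakk>a \<in> carrier A; m \<in> carrier M; m' \<in> carrier M\<rbrakk> \<Longrightarrow>
      l a (m \<oplus>\<^bsub>M\<^esub> m') = l a m \<oplus>\<^bsub>M\<^esub> l a m'"
    and r_add_left: "\<lbrakk>a \<in> carrier A; m \<in> carrier M; m' \<in> carrier M\<rbrakk> \<Longrightarrow>
      r (m \<oplus>\<^bsub>M\<^esub> m') a = r m a \<oplus>\<^bsub>M\<^esub> r m' a"
    and r_add_right: "\<lbrakk>a \<in> carrier A; a' \<in> carrier A; m \<in> carrier M\<rbrakk> \<Longrightarrow>
      r m (a \<oplus>\<^bsub>A\<^esub> a') = r m a \<oplus>\<^bsub>M\<^esub> r m a'"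
    and l_smult_left: "\<lbrakk>c \<in> carrier R; a \<in> carrier A; m \<in> carrier M\<rbrakk> \<Longrightarrow>
      l (c \<odot>\<^bsub>A\<^esub> a) m = c \<odot>\<^bsub>M\<^esub> l a m"
    and l_smult_right: "\<lbrakk>c \<in> carrier R; a \<in> carrier A; m \<in> carrier M\<rbrakk> \<Longrightarrow>
      l a (c \<odot>\<^bsub>M\<^esub> m) = c \<odot>\<^bsub>M\<^esub> l a m"
    and r_smult_left: "\<lbrakk>c \<in> carrier R; a \<in> carrier A; m \<in> carrier M\<rbrakk> \<Longrightarrow>
      r (c \<odot>\<^bsub>M\<^esub> m) a = c \<odot>\<^bsub>M\<^esub> r m a"
    and r_smult_right: "\<lbrakk>c \<in> carrier R; a \<in> carrier A; m \<in> carrier M\<rbrakk> \<Longrightarrow>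
      r m (c \<odot>\<^bsub>A\<^esub> a) = c \<odot>\<^bsub>M\<^esub> r m a"
    and l_one: "m \<in> carrier M \<Longrightarrow> l \<one>\<^bsub>A\<^esub> m = m"
    and r_one: "m \<in> carrier M \<Longrightarrow> r m \<one>\<^bsub>A\<^esub> = m"
    and l_assoc: "\<lbrakk>a \<in> carrier A; a' \<in> carrier A; m \<in> carrier M\<rbrakk> \<Longrightarrow>
      l (a \<otimes>\<^bsub>A\<^esub> a') m = l a (l a' m)"
    and r_assoc: "\<lbrakk>a \<in> carrier A; a' \<in> carrier A; m \<in> carrier M\<rbrakk> \<Longrightarrow>
      r m (a \<otimes>\<^bsub>A\<^esub> a') = r (r m a) a'"
    and l_r_assoc: "\<lbrakk>a \<in> carrier A; a' \<in> carrier A; m \<in> carrier M\<rbrakk> \<Longrightarrow>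
      r (l a m) a' = l a (r m a')"

locale symmetric_bimodule = alg_bimodule +
  assumes symmetric: "\<lbrakk>a \<in> carrier A; m \<in> carrier M\<rbrakk> \<Longrightarrow> l a m = r m a"


section \<open>The Hochschild complex\<close>

text \<open>\<open>M \<otimes> B\<^sup>\<otimes>\<^sup>n\<close> as the universal recipient of \<open>k\<close>-multilinear maps; the pure tensor
  \<open>m \<otimes> b\<^sub>1 \<otimes> \<dots> \<otimes> b\<^sub>n\<close> is the class of \<open>(m, [b\<^sub>1, \<dots>, b\<^sub>n])\<close>. Here \<^term>\<open>B\<close> is either an
  algebra or its augmentation ideal.\<close>

definition hoch_gens :: "('k, 'a) module \<Rightarrow> ('k, 'm) module \<Rightarrow> nat \<Rightarrow> ('m \<times> 'a list) set" where
  "hoch_gens B M n = carrier M \<times> {bs. length bs = n \<and> set bs \<subseteq> carrier B}"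

definition hoch_rels :: "('k, 'r) ring_scheme \<Rightarrow> ('k, 'a) module \<Rightarrow> ('k, 'm) module \<Rightarrow> nat \<Rightarrow>
    ('m \<times> 'a list \<Rightarrow> 'k) set" where
  "hoch_rels R B M n = (let F = free_module R (hoch_gens B M n); g = free_gen R in
     {g (m \<oplus>\<^bsub>M\<^esub> m', bs) \<ominus>\<^bsub>F\<^esub> (g (m, bs) \<oplus>\<^bsub>F\<^esub> g (m', bs)) | m m' bs.
        (m, bs) \<in> hoch_gens B M n \<and> m' \<in> carrier M} \<union>
     {g (c \<odot>\<^bsub>M\<^esub> m, bs) \<ominus>\<^bsub>F\<^esub> c \<odot>\<^bsub>F\<^esub> g (m, bs) | c m bs.
        c \<in> carrier R \<and> (m, bs) \<in> hoch_gens B M n} \<union>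
     {g (m, bs[i := b \<oplus>\<^bsub>B\<^esub> b']) \<ominus>\<^bsub>F\<^esub> (g (m, bs[i := b]) \<oplus>\<^bsub>F\<^esub> g (m, bs[i := b'])) | m bs i b b'.
        (m, bs) \<in> hoch_gens B M n \<and> i < n \<and> b \<in> carrier B \<and> b' \<in> carrier B} \<union>
     {g (m, bs[i := c \<odot>\<^bsub>B\<^esub> b]) \<ominus>\<^bsub>F\<^esub> c \<odot>\<^bsub>F\<^esub> g (m, bs[i := b]) | c m bs i b.
        c \<in> carrier R \<and> (m, bs) \<in> hoch_gens B M n \<and> i < n \<and> b \<in> carrier B})"

definition hoch :: "('k, 'r) ring_scheme \<Rightarrow> ('k, 'a) module \<Rightarrow> ('k, 'm) module \<Rightarrow> nat \<Rightarrow>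
    ('k, ('m \<times> 'a list \<Rightarrow> 'k) set) module" where
  "hoch R B M n = pres_module R (hoch_gens B M n) (hoch_rels R B M n)"

definition hoch_pure :: "('k, 'r) ring_scheme \<Rightarrow> ('k, 'a) module \<Rightarrow> ('k, 'm) module \<Rightarrow> nat \<Rightarrow>
    'm \<times> 'a list \<Rightarrow> ('m \<times> 'a list \<Rightarrow> 'k) set" where
  "hoch_pure R B M n = pres_gen R (hoch_gens B M n) (hoch_rels R B M n)"

text \<open>The face \<open>\<partial>\<^sub>i\<close> on \<open>M \<otimes> B\<^sup>\<otimes>\<^sup>n\<close>; the tensor factor \<open>b\<^sub>j\<close> is \<^term>\<open>bs ! (j - 1)\<close>.\<close>

definition face :: "('k, 'a) module \<Rightarrow> ('a \<Rightarrow> 'm \<Rightarrow> 'm) \<Rightarrow> ('m \<Rightarrow> 'a \<Rightarrow> 'm) \<Rightarrow> nat \<Rightarrow> nat \<Rightarrow>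
    'm \<times> 'a list \<Rightarrow> 'm \<times> 'a list" where
  "face B l r n i = (\<lambda>(m, bs).
     if i = 0 then (r m (bs ! 0), tl bs)
     else if i < n then (m, take (i - 1) bs @ (bs ! (i - 1) \<otimes>\<^bsub>B\<^esub> bs ! i) # drop (i + 1) bs)
     else (l (bs ! (n - 1)) m, butlast bs))"

text \<open>The boundary from degree \<^term>\<open>n\<close> to degree \<^term>\<open>n - 1\<close>, meaningful for \<^prop>\<open>n \<ge> 1\<close>.\<close>

definition hoch_boundary :: "('k, 'r) ring_scheme \<Rightarrow> ('k, 'a) module \<Rightarrow> ('k, 'm) module \<Rightarrow>
    ('a \<Rightarrow> 'm \<Rightarrow> 'm) \<Rightarrow> ('m \<Rightarrow> 'a \<Rightarrow> 'm) \<Rightarrow> nat \<Rightarrow>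
    ('m \<times> 'a list \<Rightarrow> 'k) set \<Rightarrow> ('m \<times> 'a list \<Rightarrow> 'k) set" where
  "hoch_boundary R B M l r n = pres_lift R (hoch R B M (n - 1))
     (\<lambda>x. \<Oplus>\<^bsub>hoch R B M (n - 1)\<^esub>i\<in>{0..n}.
        ((\<ominus>\<^bsub>R\<^esub> \<one>\<^bsub>R\<^esub>) [^]\<^bsub>R\<^esub> i) \<odot>\<^bsub>hoch R B M (n - 1)\<^esub> hoch_pure R B M (n - 1) (face B l r n i x))"


section \<open>Homology\<close>

text \<open>A complex is given by its modules \<^term>\<open>C n\<close> and boundaries \<^term>\<open>d n\<close> from \<^term>\<open>C n\<close>
  to \<^term>\<open>C (n - 1)\<close> for \<^prop>\<open>n \<ge> 1\<close>; everything in degree \<open>0\<close> is a cycle.\<close>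

definition cycles :: "(nat \<Rightarrow> ('k, 'x) module) \<Rightarrow> (nat \<Rightarrow> 'x \<Rightarrow> 'x) \<Rightarrow> nat \<Rightarrow> 'x set" where
  "cycles C d n = {x \<in> carrier (C n). n = 0 \<or> d n x = \<zero>\<^bsub>C (n - 1)\<^esub>}"

definition boundaries :: "(nat \<Rightarrow> ('k, 'x) module) \<Rightarrow> (nat \<Rightarrow> 'x \<Rightarrow> 'x) \<Rightarrow> nat \<Rightarrow> 'x set" where
  "boundaries C d n = d (n + 1) ` carrier (C (n + 1))"

definition homology ::
    "(nat \<Rightarrow> ('k, 'x) module) \<Rightarrow> (nat \<Rightarrow> 'x \<Rightarrow> 'x) \<Rightarrow> nat \<Rightarrow> ('k, 'x set) module" where
  "homology C d n = quotient_module ((C n)\<lparr>carrier := cycles C d n\<rparr>) (boundaries C d n)"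


section \<open>Shuffles and Eulerian idempotents\<close>

text \<open>The symmetric group is realised on \<open>{0, \<dots>, n - 1}\<close> instead of \<open>{1, \<dots>, n}\<close>; elements
  of its rational group algebra are functions vanishing off the permutations.\<close>

type_synonym group_alg = "(nat \<Rightarrow> nat) \<Rightarrow> rat"

definition sym_perms :: "nat \<Rightarrow> (nat \<Rightarrow> nat) set" where
  "sym_perms n = {\<sigma>. \<sigma> permutes {..<n}}"

definition ga_one :: group_alg where
  "ga_one = (\<lambda>\<sigma>. if \<sigma> = id then 1 else 0)"

definition ga_mult :: "nat \<Rightarrow> group_alg \<Rightarrow> group_alg \<Rightarrow> group_alg" where
  "ga_mult n f g = (\<lambda>\<sigma>. if \<sigma> \<in> sym_perms n then \<Sum>\<tau>\<in>sym_perms n. f \<tau> * g (inv_into UNIV \<tau> \<circ> \<sigma>) else 0)"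

definition shuffle_perms :: "nat \<Rightarrow> nat \<Rightarrow> (nat \<Rightarrow> nat) set" where
  "shuffle_perms n i =
    {\<sigma> \<in> sym_perms n. strict_mono_on {..<i} \<sigma> \<and> strict_mono_on {i..<n} \<sigma>}"

definition sh_part :: "nat \<Rightarrow> nat \<Rightarrow> group_alg" where
  "sh_part n i = (\<lambda>\<sigma>. if \<sigma> \<in> shuffle_perms n i then of_int (sign \<sigma>) else 0)"

definition sh :: "nat \<Rightarrow> group_alg" where
  "sh n = (\<lambda>\<sigma>. \<Sum>i\<in>{1..<n}. sh_part n i \<sigma>)"

definition eulerian :: "nat \<Rightarrow> nat \<Rightarrow> group_alg" where
  "eulerian n i = foldr (ga_mult n)
     (map (\<lambda>j \<sigma>. (sh n \<sigma> - (2 ^ j - 2) * ga_one \<sigma>) / (2 ^ i - 2 ^ j))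
       (filter (\<lambda>j. j \<noteq> i) [1..<n + 1])) ga_one"

text \<open>The left action \<open>\<sigma>(m \<otimes> b\<^sub>1 \<otimes> \<dots> \<otimes> b\<^sub>n) = m \<otimes> b\<^bsub>\<sigma>\<^sup>-\<^sup>1(1)\<^esub> \<otimes> \<dots> \<otimes> b\<^bsub>\<sigma>\<^sup>-\<^sup>1(n)\<^esub>\<close>.\<close>

definition perm_act :: "('k, 'r) ring_scheme \<Rightarrow> ('k, 'a) module \<Rightarrow> ('k, 'm) module \<Rightarrow> nat \<Rightarrow>
    (nat \<Rightarrow> nat) \<Rightarrow> ('m \<times> 'a list \<Rightarrow> 'k) set \<Rightarrow> ('m \<times> 'a list \<Rightarrow> 'k) set" where
  "perm_act R B M n \<sigma> = pres_lift R (hoch R B M n)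
     (\<lambda>(m, bs). hoch_pure R B M n (m, permute_list (inv_into UNIV \<sigma>) bs))"

text \<open>Rational coefficients act through the embedding \<^term>\<open>\<iota>\<close> of the rationals into the
  ground ring.\<close>

definition ga_act :: "('k, 'r) ring_scheme \<Rightarrow> (rat \<Rightarrow> 'k) \<Rightarrow> ('k, 'a) module \<Rightarrow> ('k, 'm) module \<Rightarrow>
    nat \<Rightarrow> group_alg \<Rightarrow> ('m \<times> 'a list \<Rightarrow> 'k) set \<Rightarrow> ('m \<times> 'a list \<Rightarrow> 'k) set" where
  "ga_act R \<iota> B M n f x =
     (\<Oplus>\<^bsub>hoch R B M n\<^esub>\<sigma>\<in>sym_perms n. \<iota> (f \<sigma>) \<odot>\<^bsub>hoch R B M n\<^esub> perm_act R B M n \<sigma> x)"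

definition eulerian1_complex :: "('k, 'r) ring_scheme \<Rightarrow> (rat \<Rightarrow> 'k) \<Rightarrow> ('k, 'a) module \<Rightarrow>
    ('k, 'm) module \<Rightarrow> nat \<Rightarrow> ('k, ('m \<times> 'a list \<Rightarrow> 'k) set) module" where
  "eulerian1_complex R \<iota> B M n = (hoch R B M n)
     \<lparr>carrier := ga_act R \<iota> B M n (eulerian n 1) ` carrier (hoch R B M n)\<rparr>"


section \<open>Harrison homology\<close>

definition shuffle_sub :: "('k, 'r) ring_scheme \<Rightarrow> (rat \<Rightarrow> 'k) \<Rightarrow> ('k, 'a) module \<Rightarrow> nat \<Rightarrow>
    ('a \<times> 'a list \<Rightarrow> 'k) set set" where
  "shuffle_sub R \<iota> A n = mod_span R (hoch R A A n)
     {ga_act R \<iota> A A n (sh n) (hoch_pure R A A n x) | x. x \<in> hoch_gens A A n}"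

text \<open>\<open>C\<^sub>n(A)\<close> as an \<open>A\<close>-module through the tensor factor \<open>a\<^sub>0\<close>.\<close>

definition hoch_alg :: "('k, 'r) ring_scheme \<Rightarrow> ('k, 'a) module \<Rightarrow> nat \<Rightarrow>
    ('a, ('a \<times> 'a list \<Rightarrow> 'k) set) module" where
  "hoch_alg R A n = with_smult (hoch R A A n) (\<lambda>a. pres_lift R (hoch R A A n)
     (\<lambda>(a0, as). hoch_pure R A A n (a \<otimes>\<^bsub>A\<^esub> a0, as)))"

definition charr :: "('k, 'r) ring_scheme \<Rightarrow> (rat \<Rightarrow> 'k) \<Rightarrow> ('k, 'a) module \<Rightarrow> nat \<Rightarrow>
    ('a, ('a \<times> 'a list \<Rightarrow> 'k) set set) module" where
  "charr R \<iota> A n = quotient_module (hoch_alg R A n) (shuffle_sub R \<iota> A n)"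

definition charr_boundary :: "('k, 'r) ring_scheme \<Rightarrow> (rat \<Rightarrow> 'k) \<Rightarrow> ('k, 'a) module \<Rightarrow> nat \<Rightarrow>
    ('a \<times> 'a list \<Rightarrow> 'k) set set \<Rightarrow> ('a \<times> 'a list \<Rightarrow> 'k) set set" where
  "charr_boundary R \<iota> A n = induced (\<lambda>x. shuffle_sub R \<iota> A (n - 1) +>\<^bsub>hoch R A A (n - 1)\<^esub>
     hoch_boundary R A A (monoid.mult A) (monoid.mult A) n x)"

text \<open>\<open>M \<otimes>\<^sub>A CHarr(A)\<close>, formed with the right action on \<^term>\<open>M\<close>.\<close>

definition charr_coeff :: "('k, 'r) ring_scheme \<Rightarrow> (rat \<Rightarrow> 'k) \<Rightarrow> ('k, 'a) module \<Rightarrow>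
    ('k, 'm) module \<Rightarrow> ('m \<Rightarrow> 'a \<Rightarrow> 'm) \<Rightarrow> nat \<Rightarrow>
    ('k, ('m \<times> ('a \<times> 'a list \<Rightarrow> 'k) set set \<Rightarrow> 'a) set) module" where
  "charr_coeff R \<iota> A M r n =
     restrict_scalars A (tensor A (with_smult M (\<lambda>a m. r m a)) (charr R \<iota> A n))"

definition charr_coeff_boundary :: "('k, 'r) ring_scheme \<Rightarrow> (rat \<Rightarrow> 'k) \<Rightarrow> ('k, 'a) module \<Rightarrow>
    ('k, 'm) module \<Rightarrow> ('m \<Rightarrow> 'a \<Rightarrow> 'm) \<Rightarrow> nat \<Rightarrow>
    ('m \<times> ('a \<times> 'a list \<Rightarrow> 'k) set set \<Rightarrow> 'a) set \<Rightarrow>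
    ('m \<times> ('a \<times> 'a list \<Rightarrow> 'k) set set \<Rightarrow> 'a) set" where
  "charr_coeff_boundary R \<iota> A M r n =
     id_tensor A (with_smult M (\<lambda>a m. r m a)) (charr R \<iota> A (n - 1)) (charr_boundary R \<iota> A n)"

definition harr :: "('k, 'r) ring_scheme \<Rightarrow> (rat \<Rightarrow> 'k) \<Rightarrow> ('k, 'a) module \<Rightarrow>
    ('k, 'm) module \<Rightarrow> ('m \<Rightarrow> 'a \<Rightarrow> 'm) \<Rightarrow> nat \<Rightarrow>
    ('k, ('m \<times> ('a \<times> 'a list \<Rightarrow> 'k) set set \<Rightarrow> 'a) set set) module" where
  "harr R \<iota> A M r = homology (charr_coeff R \<iota> A M r) (charr_coeff_boundary R \<iota> A M r)"

definition rat_ring :: "rat ring" where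
  "rat_ring = \<lparr>carrier = UNIV, monoid.mult = (*), one = 1, zero = 0, add = (+)\<rparr>"

end

theory Submission
  imports Defs "HOL-Library.Infinite_Set" "HOL-Computational_Algebra.Polynomial"
begin

text \<open>
  Write \<open>C\<close> and \<open>K\<close> for the Hochschild complexes of \<open>A\<close> and of \<open>I\<close> with coefficients in \<open>M\<close>,
  \<open>Q\<close> for the Harrison complex \<open>M \<otimes>\<^sub>A CHarr(A)\<close>, and \<open>e\<close> for the idempotent \<open>e\<^sup>(\<^sup>1\<^sup>)\<close>. The complexes
  \<open>e K\<close> and \<open>Q\<close> are homotopy equivalent, through \<open>C\<close>, by explicit maps.

  The first half is the identification of \<open>Q\<close> with \<open>e C\<close>. The map \<open>to_harr\<close> sends \<open>m \<otimes> as\<close> to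
  \<open>m \<otimes> [1 \<otimes> as]\<close>, and \<open>from_harr\<close> sends \<open>m \<otimes> [a \<otimes> as]\<close> to \<open>e (am \<otimes> as)\<close>. The latter kills shuffles
  because \<open>e sh = 0\<close>; one composite is \<open>e\<close> by construction (\<open>from_harr_to_harr\<close>), and the other is the
  identity because \<open>e\<close> differs from \<open>1\<close> by a multiple of \<open>sh\<close>, which vanishes in \<open>Q\<close> (\<open>to_harr_from_harr\<close>).

  The second half compares \<open>C\<close> with \<open>K\<close>. The linear projection \<open>\<pi> a = a - \<epsilon>(a) 1\<close> of \<open>A\<close> onto \<open>I\<close> is
  not multiplicative, yet it induces a chain map \<open>C \<rightarrow> K\<close> that is a retraction of the inclusion:
  the alternating sum of the insertions
  \<open>m \<otimes> \<pi> a\<^sub>1 \<otimes> \<dots> \<otimes> \<pi> a\<^sub>j \<otimes> 1 \<otimes> a\<^sub>j\<^sub>+\<^sub>1 \<otimes> \<dots> \<otimes> a\<^sub>n\<close> is a homotopy from the identity of \<open>C\<close> to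
  inclusion after projection (\<open>homotopy_pure\<close>, \<open>homotopy\<close>), and this forces the projection to commute
  with the boundary (\<open>proj_d\<close>). Inclusion and projection commute with \<open>e\<close>, so they restrict to \<open>e K\<close>.
  The composite \<open>e K \<rightarrow> C \<rightarrow> Q \<rightarrow> C \<rightarrow> K\<close> is \<open>e\<close>, hence the identity of \<open>e K\<close>, and \<open>Q \<rightarrow> C \<rightarrow> K \<rightarrow> C \<rightarrow> Q\<close>
  is homotopic to the identity (\<open>EK_homology_iso\<close>).

  What remains is the algebra of \<open>sh\<close> and \<open>e\<close>: that \<open>e sh = sh e = 0\<close>, that \<open>e = 1 + sh q = 1 + q sh\<close>
  for some \<open>q\<close> in the group algebra (\<open>eulerian_1_sh\<close>, \<open>sh_eulerian_1\<close>, \<open>eulerian_1_decomp\<close>), and that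
  \<open>sh\<close> commutes with the boundary (\<open>shuffle_boundary\<close>, \<open>sh_boundary\<close>). Both are read off a combinatorial
  model of shuffles. A labelling \<open>f : {0..<n} \<rightarrow> {0..<p}\<close> records a way to riffle \<open>p\<close> consecutive blocks
  into each other, the label of a position being the block from which its entry is drawn, and
  \<open>adams n p\<close> is the signed sum of the resulting permutations; \<open>adams n 2\<close> is \<open>sh + 2\<close>
  for \<open>n \<ge> 1\<close> (\<open>adams_two\<close>). Two riffles compose to one (\<open>adams_mult\<close>) and the coefficients of \<open>adams n p\<close> are
  polynomials in \<open>p\<close> of degree at most \<open>n\<close> without constant term (\<open>adams_polynomial\<close>). So \<open>adams n 2\<close>
  acts on the coefficient of \<open>p\<^sup>i\<close> as multiplication by \<open>2\<^sup>i\<close>, and the product defining \<open>e\<close> isolates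
  the coefficient of \<open>p\<^sup>1\<close>, on which \<open>sh\<close> is zero.
\<close>

section \<open>Labellings and sorting permutations\<close>

text \<open>Labellings vanish outside \<open>{..<n}\<close>, so that they are determined by their \<open>n\<close> values and form a
  finite set.\<close>

definition labels :: "nat \<Rightarrow> nat \<Rightarrow> (nat \<Rightarrow> nat) set" where
  "labels n p = {f. (\<forall>i<n. f i < p) \<and> (\<forall>i\<ge>n. f i = 0)}"

definition before :: "(nat \<Rightarrow> nat) \<Rightarrow> nat \<Rightarrow> nat \<Rightarrow> bool" where
  "before f i j \<longleftrightarrow> f i < f j \<or> (f i = f j \<and> i < j)"

text \<open>The position of \<open>i\<close> after a stable sort by \<open>f\<close>, as a permutation of \<open>{..<n}\<close>. Equivalently, if
  position \<open>i\<close> of a riffled list was drawn from block \<open>f i\<close>, then its entry stood at this position of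
  the original list.\<close>

definition sort_rank :: "nat \<Rightarrow> (nat \<Rightarrow> nat) \<Rightarrow> nat \<Rightarrow> nat" where
  "sort_rank n f i = (if i < n then card {j. j < n \<and> before f j i} else i)"

lemma finite_labels [simp]: "finite (labels n p)"
proof -
  have "labels n p = {f. \<forall>i. (i \<in> {..<n} \<longrightarrow> f i \<in> {..<p}) \<and> (i \<notin> {..<n} \<longrightarrow> f i = 0)}"
    unfolding labels_def lessThan_iff not_less by blast
  then show ?thesis using finite_set_of_finite_funs[of "{..<n}" "{..<p}" 0] by simp
qed

lemma before_trans: "before f i j \<Longrightarrow> before f j k \<Longrightarrow> before f i k"
  by (auto simp: before_def)

lemma before_irrefl: "\<not> before f i i"
  by (auto simp: before_def)

lemma before_total: "i \<noteq> j \<Longrightarrow> before f i j \<or> before f j i"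
  by (auto simp: before_def)

lemma sort_rank_mono:
  assumes "i < n" "j < n" "before f i j"
  shows "sort_rank n f i < sort_rank n f j"
proof -
  have "{k. k < n \<and> before f k i} \<subset> {k. k < n \<and> before f k j}"
    using assms before_trans before_irrefl by blast
  then show ?thesis using assms by (simp add: sort_rank_def psubset_card_mono)
qed

lemma sort_rank_less_iff:
  assumes "i < n" "j < n"
  shows "sort_rank n f i < sort_rank n f j \<longleftrightarrow> before f i j"
  by (metis assms before_total less_asym less_irrefl sort_rank_mono)

lemma sort_rank_lt: "i < n \<Longrightarrow> sort_rank n f i < n"
proof -
  assume i: "i < n"
  have "{k. k < n \<and> before f k i} \<subset> {..<n}" using i before_irrefl by blast
  then have "card {k. k < n \<and> before f k i} < card {..<n}" by (rule psubset_card_mono[rotated]) simp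
  then show ?thesis using i by (simp add: sort_rank_def)
qed

lemma sort_rank_permutes: "sort_rank n f permutes {..<n}"
proof (rule bij_imp_permutes)
  have inj: "inj_on (sort_rank n f) {..<n}"
    by (rule inj_onI) (metis before_total lessThan_iff less_irrefl sort_rank_mono)
  moreover have "sort_rank n f ` {..<n} \<subseteq> {..<n}" using sort_rank_lt by auto
  ultimately show "bij_betw (sort_rank n f) {..<n} {..<n}"
    by (simp add: bij_betw_def endo_inj_surj)
  show "\<And>x. x \<notin> {..<n} \<Longrightarrow> sort_rank n f x = x" by (simp add: sort_rank_def)
qed

text \<open>Every comparison of ranks is prescribed, and a permutation of \<open>{..<n}\<close> is determined by the order
  in which it arranges its arguments.\<close>

lemma sort_rank_unique:
  assumes \<rho>: "\<rho> permutes {..<n}"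
    and ord: "\<And>i j. i < n \<Longrightarrow> j < n \<Longrightarrow> \<rho> i < \<rho> j \<longleftrightarrow> before f i j"
  shows "sort_rank n f = \<rho>"
proof
  fix i
  show "sort_rank n f i = \<rho> i"
  proof (cases "i < n")
    case True
    then have ri: "\<rho> i < n" using permutes_in_image[OF \<rho>] by auto
    have "{j. j < n \<and> before f j i} = {j. j < n \<and> \<rho> j < \<rho> i}" using ord True by auto
    moreover have "\<rho> ` {j. j < n \<and> \<rho> j < \<rho> i} = {..<\<rho> i}"
    proof
      show "{..<\<rho> i} \<subseteq> \<rho> ` {j. j < n \<and> \<rho> j < \<rho> i}"
      proof
        fix x assume x: "x \<in> {..<\<rho> i}"
        then have "x \<in> \<rho> ` {..<n}" using permutes_image[OF \<rho>] ri by auto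
        then show "x \<in> \<rho> ` {j. j < n \<and> \<rho> j < \<rho> i}" using x by auto
      qed
    qed auto
    moreover have "card (\<rho> ` {j. j < n \<and> \<rho> j < \<rho> i}) = card {j. j < n \<and> \<rho> j < \<rho> i}"
      by (rule card_image) (use permutes_inj[OF \<rho>] inj_on_subset in blast)
    ultimately show ?thesis using True by (simp add: sort_rank_def)
  next
    case False
    then show ?thesis using permutes_not_in[OF \<rho>] by (simp add: sort_rank_def)
  qed
qed

text \<open>Sorting twice is sorting once, by the lexicographic order with the second key first: stability of
  the second pass preserves the outcome of the first.\<close>

lemma sort_rank_comp:
  assumes h: "\<And>i j. i < n \<Longrightarrow> j < n \<Longrightarrow> before h i j \<longleftrightarrow>
     g (sort_rank n f i) < g (sort_rank n f j) \<or>
     (g (sort_rank n f i) = g (sort_rank n f j) \<and> before f i j)"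
  shows "sort_rank n h = sort_rank n g \<circ> sort_rank n f"
proof (rule sort_rank_unique)
  show "sort_rank n g \<circ> sort_rank n f permutes {..<n}"
    by (intro permutes_compose sort_rank_permutes)
  fix i j assume "i < n" "j < n"
  then show "(sort_rank n g \<circ> sort_rank n f) i < (sort_rank n g \<circ> sort_rank n f) j \<longleftrightarrow> before h i j"
    using h sort_rank_lt by (simp add: sort_rank_less_iff before_def)
qed

abbreviation pinv :: "(nat \<Rightarrow> nat) \<Rightarrow> nat \<Rightarrow> nat" where
  "pinv \<sigma> \<equiv> inv_into UNIV \<sigma>"

section \<open>Adams elements of the group algebra\<close>

definition ga_elems :: "nat \<Rightarrow> group_alg set" where
  "ga_elems n = {a. \<forall>\<sigma>. \<sigma> \<notin> sym_perms n \<longrightarrow> a \<sigma> = 0}"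

lemma finite_sym_perms [simp]: "finite (sym_perms n)"
  by (simp add: sym_perms_def finite_permutations)

lemma sym_perms_comp: "\<sigma> \<in> sym_perms n \<Longrightarrow> \<tau> \<in> sym_perms n \<Longrightarrow> \<sigma> \<circ> \<tau> \<in> sym_perms n"
  by (simp add: sym_perms_def permutes_compose)

lemma sym_perms_inv: "\<sigma> \<in> sym_perms n \<Longrightarrow> pinv \<sigma> \<in> sym_perms n"
  by (simp add: sym_perms_def permutes_inv)

lemma id_sym_perms: "id \<in> sym_perms n"
  by (simp add: sym_perms_def permutes_id)

lemma sort_rank_sym_perms: "sort_rank n f \<in> sym_perms n"
  by (simp add: sym_perms_def sort_rank_permutes)

text \<open>Elements of the group algebra are compared through the functionals they define on functions of
  permutations; in this form the product is composition and the convolution sum disappears.\<close>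

lemma sum_ga_mult:
  "(\<Sum>\<sigma>\<in>sym_perms n. ga_mult n a b \<sigma> * F \<sigma>)
     = (\<Sum>\<sigma>\<in>sym_perms n. a \<sigma> * (\<Sum>\<tau>\<in>sym_perms n. b \<tau> * F (\<sigma> \<circ> \<tau>)))"
proof -
  have "(\<Sum>\<sigma>\<in>sym_perms n. ga_mult n a b \<sigma> * F \<sigma>)
      = (\<Sum>\<rho>\<in>sym_perms n. \<Sum>\<sigma>\<in>sym_perms n. a \<sigma> * b (pinv \<sigma> \<circ> \<rho>) * F \<rho>)"
    by (simp add: ga_mult_def sum_distrib_right)
  also have "\<dots> = (\<Sum>\<sigma>\<in>sym_perms n. \<Sum>\<rho>\<in>sym_perms n. a \<sigma> * b (pinv \<sigma> \<circ> \<rho>) * F \<rho>)"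
    by (rule sum.swap)
  also have "\<dots> = (\<Sum>\<sigma>\<in>sym_perms n. \<Sum>\<tau>\<in>sym_perms n. a \<sigma> * b \<tau> * F (\<sigma> \<circ> \<tau>))"
  proof (rule sum.cong[OF refl])
    fix \<sigma> assume \<sigma>: "\<sigma> \<in> sym_perms n"
    then have p: "\<sigma> permutes {..<n}" by (simp add: sym_perms_def)
    show "(\<Sum>\<rho>\<in>sym_perms n. a \<sigma> * b (pinv \<sigma> \<circ> \<rho>) * F \<rho>)
        = (\<Sum>\<tau>\<in>sym_perms n. a \<sigma> * b \<tau> * F (\<sigma> \<circ> \<tau>))"
      by (rule sum.reindex_bij_witness[where i = "\<lambda>\<tau>. \<sigma> \<circ> \<tau>" and j = "\<lambda>\<rho>. pinv \<sigma> \<circ> \<rho>"])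
        (use \<sigma> in \<open>simp_all add: o_assoc permutes_inv_o[OF p] sym_perms_comp sym_perms_inv\<close>)
  qed
  finally show ?thesis by (simp add: sum_distrib_left mult.assoc)
qed

lemma ga_eqI:
  assumes "a \<in> ga_elems n" "b \<in> ga_elems n"
    and "\<And>F. (\<Sum>\<sigma>\<in>sym_perms n. a \<sigma> * F \<sigma>) = (\<Sum>\<sigma>\<in>sym_perms n. b \<sigma> * F \<sigma>)"
  shows "a = b"
proof
  fix \<sigma>
  show "a \<sigma> = b \<sigma>"
  proof (cases "\<sigma> \<in> sym_perms n")
    case True
    then show ?thesis using assms(3)[of "\<lambda>\<tau>. if \<tau> = \<sigma> then 1 else 0"]
      by (simp add: if_distrib[where f = "(*) _"] cong: if_cong)
  next
    case False
    then show ?thesis using assms by (simp add: ga_elems_def)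
  qed
qed

lemma ga_mult_elems [simp]: "ga_mult n a b \<in> ga_elems n"
  by (simp add: ga_elems_def ga_mult_def)

lemma ga_one_elems [simp]: "ga_one \<in> ga_elems n"
  by (auto simp: ga_elems_def ga_one_def id_sym_perms)

lemma sum_ga_one: "(\<Sum>\<sigma>\<in>sym_perms n. ga_one \<sigma> * F \<sigma>) = F id"
  using id_sym_perms[of n] by (simp add: ga_one_def if_distrib[where f = "\<lambda>x. x * _"] cong: if_cong)

lemma ga_mult_assoc: "ga_mult n (ga_mult n a b) c = ga_mult n a (ga_mult n b c)"
proof (rule ga_eqI[of _ n])
  fix F :: "(nat \<Rightarrow> nat) \<Rightarrow> rat"
  show "(\<Sum>\<sigma>\<in>sym_perms n. ga_mult n (ga_mult n a b) c \<sigma> * F \<sigma>)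
      = (\<Sum>\<sigma>\<in>sym_perms n. ga_mult n a (ga_mult n b c) \<sigma> * F \<sigma>)"
    by (simp add: sum_ga_mult o_assoc)
qed simp_all

lemma ga_mult_one_left: "a \<in> ga_elems n \<Longrightarrow> ga_mult n ga_one a = a"
proof (rule ga_eqI[of _ n])
  fix F :: "(nat \<Rightarrow> nat) \<Rightarrow> rat"
  show "(\<Sum>\<sigma>\<in>sym_perms n. ga_mult n ga_one a \<sigma> * F \<sigma>) = (\<Sum>\<sigma>\<in>sym_perms n. a \<sigma> * F \<sigma>)"
    by (simp add: sum_ga_mult sum_ga_one)
qed simp_all

lemma ga_mult_one_right: "a \<in> ga_elems n \<Longrightarrow> ga_mult n a ga_one = a"
proof (rule ga_eqI[of _ n])
  fix F :: "(nat \<Rightarrow> nat) \<Rightarrow> rat"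
  show "(\<Sum>\<sigma>\<in>sym_perms n. ga_mult n a ga_one \<sigma> * F \<sigma>) = (\<Sum>\<sigma>\<in>sym_perms n. a \<sigma> * F \<sigma>)"
    by (simp add: sum_ga_mult sum_ga_one)
qed simp_all

lemma ga_mult_lin_left:
  "ga_mult n (\<lambda>\<sigma>. u * a \<sigma> + v * a' \<sigma>) b = (\<lambda>\<sigma>. u * ga_mult n a b \<sigma> + v * ga_mult n a' b \<sigma>)"
  by (rule ext) (simp add: ga_mult_def sum.distrib sum_distrib_left algebra_simps)

lemma ga_mult_lin_right:
  "ga_mult n b (\<lambda>\<sigma>. u * a \<sigma> + v * a' \<sigma>) = (\<lambda>\<sigma>. u * ga_mult n b a \<sigma> + v * ga_mult n b a' \<sigma>)"
  by (rule ext) (simp add: ga_mult_def sum.distrib sum_distrib_left algebra_simps)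

text \<open>The \<open>p\<close>-th Adams operation, the \<open>p\<close>-fold convolution power of the identity of the shuffle
  bialgebra: the signed sum of all riffles of \<open>p\<close> blocks, some of which may be empty.\<close>

definition adams :: "nat \<Rightarrow> nat \<Rightarrow> group_alg" where
  "adams n p \<sigma> = (\<Sum>f\<in>labels n p. if pinv (sort_rank n f) = \<sigma> then of_int (sign \<sigma>) else 0)"

lemma adams_elems [simp]: "adams n p \<in> ga_elems n"
  unfolding ga_elems_def adams_def
  by (auto intro!: sum.neutral simp: sym_perms_inv sort_rank_sym_perms)

lemma sign_inv_sort_rank: "sign (pinv (sort_rank n f)) = sign (sort_rank n f)"
  using sort_rank_permutes[of n f] finite_lessThan[of n]
  by (metis permutation_permutes sign_inverse)

lemma sum_adams:
  "(\<Sum>\<sigma>\<in>sym_perms n. adams n p \<sigma> * F \<sigma>)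
     = (\<Sum>f\<in>labels n p. of_int (sign (sort_rank n f)) * F (pinv (sort_rank n f)))"
proof -
  have "(\<Sum>\<sigma>\<in>sym_perms n. adams n p \<sigma> * F \<sigma>)
    = (\<Sum>f\<in>labels n p. \<Sum>\<sigma>\<in>sym_perms n. (if pinv (sort_rank n f) = \<sigma> then of_int (sign \<sigma>) * F \<sigma> else 0))"
    unfolding adams_def by (subst sum.swap) (auto simp: sum_distrib_right intro!: sum.cong)
  then show ?thesis
    by (simp add: sym_perms_inv sort_rank_sym_perms sign_inv_sort_rank)
qed

lemma inv_comp_sort_rank:
  "pinv (sort_rank n g \<circ> sort_rank n f) = pinv (sort_rank n f) \<circ> pinv (sort_rank n g)"
  by (rule o_inv_distrib) (use sort_rank_permutes permutes_bij in blast)+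

text \<open>Radix sort: sorting by a digit \<open>f\<close> below \<open>p\<close> and then by a digit \<open>g\<close> below \<open>q\<close> is sorting by the
  two-digit number \<open>p * g + f\<close> below \<open>q * p\<close>.\<close>

lemma sum_labels_mult:
  fixes H :: "(nat \<Rightarrow> nat) \<Rightarrow> rat"
  shows "(\<Sum>f\<in>labels n p. \<Sum>g\<in>labels n q. H (sort_rank n g \<circ> sort_rank n f))
    = (\<Sum>h\<in>labels n (q * p). H (sort_rank n h))"
proof -
  \<comment> \<open>\<open>J\<close> forms the two-digit numbers; the digit \<open>g\<close> is attached to the positions after the first sort. \<open>I\<close> reads the digits off.\<close>
  define J where "J = (\<lambda>(f, g). \<lambda>i. if i < n then p * g (sort_rank n f i) + f i else 0 :: nat)"
  define I where "I = (\<lambda>h. let f = (\<lambda>i. if i < n then h i mod p else 0 :: nat)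
     in (f, \<lambda>j. if j < n then h (pinv (sort_rank n f) j) div p else 0 :: nat))"
  have invlt: "pinv (sort_rank n f) i < n" if "i < n" for f i
    using permutes_in_image[OF permutes_inv[OF sort_rank_permutes[of n f]]] that by auto
  have inv1: "pinv (sort_rank n f) (sort_rank n f i) = i" for f i
    using permutes_inverses[OF sort_rank_permutes] by simp
  have inv2: "sort_rank n f (pinv (sort_rank n f) i) = i" for f i
    using permutes_inverses[OF sort_rank_permutes] by simp
  have "(\<Sum>f\<in>labels n p. \<Sum>g\<in>labels n q. H (sort_rank n g \<circ> sort_rank n f))
     = (\<Sum>(f, g)\<in>labels n p \<times> labels n q. H (sort_rank n g \<circ> sort_rank n f))"
    by (simp add: sum.cartesian_product)
  also have "\<dots> = (\<Sum>h\<in>labels n (q * p). H (sort_rank n h))"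
  proof (rule sum.reindex_bij_witness[where i = I and j = J])
    fix a assume a: "a \<in> labels n p \<times> labels n q"
    obtain f g where fg: "a = (f, g)" by force
    with a have f: "\<And>i. i < n \<Longrightarrow> f i < p" "\<And>i. i \<ge> n \<Longrightarrow> f i = 0"
      and g: "\<And>i. i < n \<Longrightarrow> g i < q" "\<And>i. i \<ge> n \<Longrightarrow> g i = 0" by (auto simp: labels_def)
    have f': "(\<lambda>i. if i < n then J a i mod p else 0) = f"
      using f by (auto simp: J_def fg fun_eq_iff)
    have "(\<lambda>j. if j < n then J a (pinv (sort_rank n f) j) div p else 0) = g"
    proof
      fix j
      show "(if j < n then J a (pinv (sort_rank n f) j) div p else 0) = g j"
      proof (cases "j < n")
        case True
        then have "p > 0" using f(1)[OF True] by simp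
        then show ?thesis using True invlt f(1)[OF invlt[OF True]] by (simp add: J_def fg inv2)
      qed (simp add: g)
    qed
    note g' = this
    show "I (J a) = a" unfolding I_def Let_def f' g' by (simp add: fg)
    show "J a \<in> labels n (q * p)"
    proof -
      have "p * g (sort_rank n f i) + f i < q * p" if "i < n" for i
      proof -
        have "p * g (sort_rank n f i) + f i < p * Suc (g (sort_rank n f i))" using f(1)[OF that] by simp
        also have "\<dots> \<le> p * q" using g(1)[OF sort_rank_lt[OF that, of f]] by (intro mult_le_mono2) simp
        finally show ?thesis by (simp add: mult.commute)
      qed
      then show ?thesis by (simp add: labels_def J_def fg)
    qed
    have "sort_rank n (J a) = sort_rank n g \<circ> sort_rank n f"
    proof (rule sort_rank_comp)
      fix i j assume ij: "i < n" "j < n"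
      have lex: "p * x + u < p * y + v \<longleftrightarrow> x < y \<or> (x = y \<and> u < v)" if "u < p" "v < p" for x y u v :: nat
      proof -
        have A: "p * x + u < p * y + v" if "x < y" "u < p" for x y u v :: nat
        proof -
          have "p * x + u < p * Suc x" using that by simp
          also have "\<dots> \<le> p * y" using that by (intro mult_le_mono2) simp
          finally show ?thesis by simp
        qed
        show ?thesis using A[of x y u v] A[of y x v u] that by (cases x y rule: linorder_cases) auto
      qed
      have eq: "p * x + u = p * y + v \<longleftrightarrow> x = y \<and> u = v" if "u < p" "v < p" for x y u v :: nat
        using lex[of u v x y] lex[of v u y x] that by (metis linorder_less_linear nat_neq_iff)
      show "before (J a) i j \<longleftrightarrow>
         g (sort_rank n f i) < g (sort_rank n f j) \<or>
         (g (sort_rank n f i) = g (sort_rank n f j) \<and> before f i j)"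
        using ij f(1) by (auto simp: before_def J_def fg lex eq)
    qed
    then show "H (sort_rank n (J a)) = (case a of (f, g) \<Rightarrow> H (sort_rank n g \<circ> sort_rank n f))"
      by (simp add: fg)
  next
    fix h assume h: "h \<in> labels n (q * p)"
    define f where "f = (\<lambda>i. if i < n then h i mod p else 0 :: nat)"
    define g where "g = (\<lambda>j. if j < n then h (pinv (sort_rank n f) j) div p else 0 :: nat)"
    have Ih: "I h = (f, g)" unfolding I_def Let_def g_def f_def ..
    have pos: "p > 0" if "i < n" for i using h that by (cases p) (auto simp: labels_def)
    show "J (I h) = h"
      using h by (auto simp: Ih J_def fun_eq_iff g_def sort_rank_lt inv1 f_def[symmetric])
         (auto simp: f_def labels_def)
    show "I h \<in> labels n p \<times> labels n q"
      using h pos invlt by (auto simp: Ih labels_def f_def[symmetric] g_def less_mult_imp_div_less)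
         (auto simp: f_def)
  qed
  finally show ?thesis .
qed

text \<open>Riffling \<open>p\<close> blocks and then \<open>q\<close> blocks amounts to one riffle of \<open>p * q\<close> blocks.\<close>

lemma adams_mult: "ga_mult n (adams n q) (adams n p) = adams n (p * q)"
proof (rule ga_eqI[of _ n])
  fix F :: "(nat \<Rightarrow> nat) \<Rightarrow> rat"
  let ?s = "\<lambda>f. of_int (sign (sort_rank n f)) :: rat"
  have sg: "sign (sort_rank n g \<circ> sort_rank n f) = sign (sort_rank n g) * sign (sort_rank n f)" for f g
    using sort_rank_permutes[of n] finite_lessThan[of n] by (metis permutation_permutes sign_compose)
  have "(\<Sum>\<sigma>\<in>sym_perms n. ga_mult n (adams n q) (adams n p) \<sigma> * F \<sigma>) = (\<Sum>f\<in>labels n q. \<Sum>g\<in>labels n p.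
       of_int (sign (sort_rank n g \<circ> sort_rank n f)) * F (pinv (sort_rank n g \<circ> sort_rank n f)))"
    unfolding sum_ga_mult sum_adams
    by (simp add: sum_distrib_left inv_comp_sort_rank sg mult_ac)
  also have "\<dots> = (\<Sum>\<sigma>\<in>sym_perms n. adams n (p * q) \<sigma> * F \<sigma>)"
    by (simp add: sum_adams sum_labels_mult[where H = "\<lambda>\<sigma>. of_int (sign \<sigma>) * F (pinv \<sigma>)"])
  finally show "(\<Sum>\<sigma>\<in>sym_perms n. ga_mult n (adams n q) (adams n p) \<sigma> * F \<sigma>)
      = (\<Sum>\<sigma>\<in>sym_perms n. adams n (p * q) \<sigma> * F \<sigma>)" .
qed simp_all

lemma adams_one: "adams n 1 = ga_one"
proof (rule ga_eqI[of _ n])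
  fix F :: "(nat \<Rightarrow> nat) \<Rightarrow> rat"
  have l: "labels n 1 = {\<lambda>_. 0}" by (auto simp: labels_def fun_eq_iff) (meson not_le)
  have "sort_rank n (\<lambda>_. 0) = id"
    by (rule sort_rank_unique) (auto simp: before_def permutes_id)
  then show "(\<Sum>\<sigma>\<in>sym_perms n. adams n 1 \<sigma> * F \<sigma>) = (\<Sum>\<sigma>\<in>sym_perms n. ga_one \<sigma> * F \<sigma>)"
    by (simp only: sum_adams sum_ga_one l) (simp add: sign_id inv_id)
qed simp_all

section \<open>The shuffle element and the first Eulerian idempotent\<close>

lemma adams_card:
  "adams n p \<sigma> = of_int (sign \<sigma>) * of_nat (card {f \<in> labels n p. pinv (sort_rank n f) = \<sigma>})"
  unfolding adams_def by (simp add: sum.If_cases Int_def conj_commute mult.commute)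

lemma pinv_sort_rank_eq_iff:
  assumes "\<sigma> \<in> sym_perms n"
  shows "pinv (sort_rank n f) = \<sigma> \<longleftrightarrow> sort_rank n f = pinv \<sigma>"
  using assms sort_rank_permutes[of n f] by (metis mem_Collect_eq permutes_inv_inv sym_perms_def)

lemma sort_rank_shuffle:
  assumes f: "f \<in> labels n 2" and q: "q < n"
  shows "sort_rank n f q < card {j. j < n \<and> f j = 0} \<longleftrightarrow> f q = 0"
proof (cases "f q = 0")
  case True
  have "{j. j < n \<and> before f j q} \<subset> {j. j < n \<and> f j = 0}"
    using True q by (auto simp: before_def)
  then have "card {j. j < n \<and> before f j q} < card {j. j < n \<and> f j = 0}"
    by (rule psubset_card_mono[rotated]) simp
  then show ?thesis using True q by (simp add: sort_rank_def)
next
  case False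
  have "{j. j < n \<and> f j = 0} \<subseteq> {j. j < n \<and> before f j q}"
    using False q by (auto simp: before_def)
  then have "card {j. j < n \<and> f j = 0} \<le> card {j. j < n \<and> before f j q}"
    by (rule card_mono[rotated]) simp
  then show ?thesis using False q by (simp add: sort_rank_def)
qed

text \<open>A labelling with two labels amounts to the number \<open>i\<close> of positions labelled \<open>0\<close> together with an
  \<open>i\<close>-shuffle. The same permutation may be an \<open>i\<close>-shuffle for several \<open>i\<close>, so both sides count
  multiplicities.\<close>

lemma card_sort_shuffle:
  assumes \<sigma>: "\<sigma> \<in> sym_perms n"
  shows "card {f \<in> labels n 2. sort_rank n f = pinv \<sigma>} = card {i. i \<le> n \<and> \<sigma> \<in> shuffle_perms n i}"
proof -
  have p: "\<sigma> permutes {..<n}" using \<sigma> by (simp add: sym_perms_def)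
  have i1: "\<sigma> (pinv \<sigma> q) = q" and i2: "pinv \<sigma> (\<sigma> q) = q" for q
    using permutes_inverses[OF p] by auto
  have lt: "\<sigma> q < n \<longleftrightarrow> q < n" "pinv \<sigma> q < n \<longleftrightarrow> q < n" for q
    using permutes_in_image[OF p] permutes_in_image[OF permutes_inv[OF p]] by auto
  define I where "I = (\<lambda>f :: nat \<Rightarrow> nat. card {j. j < n \<and> f j = 0})"
  define J where "J = (\<lambda>i q. if q < n \<and> \<not> pinv \<sigma> q < i then 1 else 0 :: nat)"
  have "bij_betw J {i. i \<le> n \<and> \<sigma> \<in> shuffle_perms n i} {f \<in> labels n 2. sort_rank n f = pinv \<sigma>}"
  proof (rule bij_betw_byWitness[where f' = I])
    show "\<forall>a\<in>{i. i \<le> n \<and> \<sigma> \<in> shuffle_perms n i}. I (J a) = a"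
    proof
      fix i assume "i \<in> {i. i \<le> n \<and> \<sigma> \<in> shuffle_perms n i}"
      then have i: "i \<le> n" by simp
      have "q \<in> {j. j < n \<and> J i j = 0} \<longleftrightarrow> q \<in> \<sigma> ` {..<i}" for q
      proof -
        have "q \<in> \<sigma> ` {..<i} \<longleftrightarrow> pinv \<sigma> q < i" by (metis i1 i2 imageE imageI lessThan_iff)
        moreover have "q < n" if "pinv \<sigma> q < i" using that i lt(2)[of q] by linarith
        moreover have "J i q = 0 \<and> q < n \<longleftrightarrow> pinv \<sigma> q < i"
          by (cases "pinv \<sigma> q < i") (use \<open>pinv \<sigma> q < i \<Longrightarrow> q < n\<close> in \<open>simp_all add: J_def\<close>)
        ultimately show ?thesis unfolding mem_Collect_eq by metis
      qed
      then have "{j. j < n \<and> J i j = 0} = \<sigma> ` {..<i}" by (rule Set.set_eqI)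
      then show "I (J i) = i"
        using card_image[OF inj_on_subset[OF permutes_inj[OF p] subset_UNIV], of "{..<i}"]
        by (simp add: I_def)
    qed
    show "\<forall>f\<in>{f \<in> labels n 2. sort_rank n f = pinv \<sigma>}. J (I f) = f"
    proof
      fix f assume f: "f \<in> {f \<in> labels n 2. sort_rank n f = pinv \<sigma>}"
      show "J (I f) = f"
      proof
        fix q
        show "J (I f) q = f q"
        proof (cases "q < n")
          case True
          then have "f q < 2" using f by (auto simp: labels_def)
          then show ?thesis using sort_rank_shuffle[of f n q] f True by (auto simp: J_def I_def)
        next
          case False
          then show ?thesis using f by (auto simp: J_def labels_def)
        qed
      qed
    qed
    show "J ` {i. i \<le> n \<and> \<sigma> \<in> shuffle_perms n i} \<subseteq> {f \<in> labels n 2. sort_rank n f = pinv \<sigma>}"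
    proof clarify
      fix i assume i: "i \<le> n" and sh: "\<sigma> \<in> shuffle_perms n i"
      have m1: "\<sigma> x < \<sigma> y \<longleftrightarrow> x < y" if "x < i" "y < i" for x y
        using sh that strict_mono_on_less[of "{..<i}" \<sigma> x y] by (simp add: shuffle_perms_def)
      have m2: "\<sigma> x < \<sigma> y \<longleftrightarrow> x < y" if "i \<le> x" "x < n" "i \<le> y" "y < n" for x y
        using sh that strict_mono_on_less[of "{i..<n}" \<sigma> x y] by (simp add: shuffle_perms_def)
      have "sort_rank n (J i) = pinv \<sigma>"
      proof (rule sort_rank_unique[OF permutes_inv[OF p]])
        fix a b assume ab: "a < n" "b < n"
        show "pinv \<sigma> a < pinv \<sigma> b \<longleftrightarrow> before (J i) a b"
          using ab m1[of "pinv \<sigma> a" "pinv \<sigma> b"] m2[of "pinv \<sigma> a" "pinv \<sigma> b"] lt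
          by (auto simp: before_def J_def i1)
      qed
      then show "J i \<in> labels n 2 \<and> sort_rank n (J i) = pinv \<sigma>"
        by (simp add: J_def labels_def)
    qed
    show "I ` {f \<in> labels n 2. sort_rank n f = pinv \<sigma>} \<subseteq> {i. i \<le> n \<and> \<sigma> \<in> shuffle_perms n i}"
    proof clarify
      fix f assume f: "f \<in> labels n 2" and sr: "sort_rank n f = pinv \<sigma>"
      have le: "I f \<le> n" unfolding I_def
        using card_mono[of "{..<n}" "{j. j < n \<and> f j = 0}"] by auto
      have z: "f (\<sigma> a) = 0 \<longleftrightarrow> a < I f" if "a < n" for a
        using sort_rank_shuffle[OF f, of "\<sigma> a"] that lt by (simp add: sr i2 I_def)
      have f2: "f (\<sigma> a) < 2" if "a < n" for a using f that lt by (simp add: labels_def)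
      have b: "before f (\<sigma> a) (\<sigma> b) \<longleftrightarrow> a < b" if "a < n" "b < n" for a b
        using sort_rank_less_iff[of "\<sigma> a" n "\<sigma> b" f] that lt by (simp add: sr i2)
      have "strict_mono_on {..<I f} \<sigma>"
      proof (rule strict_mono_onI)
        fix a c assume "a \<in> {..<I f}" "c \<in> {..<I f}" "a < c"
        then show "\<sigma> a < \<sigma> c" using z[of a] z[of c] b[of a c] le by (auto simp: before_def)
      qed
      moreover have "strict_mono_on {I f..<n} \<sigma>"
      proof (rule strict_mono_onI)
        fix a c assume "a \<in> {I f..<n}" "c \<in> {I f..<n}" "a < c"
        then show "\<sigma> a < \<sigma> c" using z[of a] z[of c] b[of a c] f2[of a] f2[of c]
          by (auto simp: before_def)
      qed
      ultimately show "I f \<le> n \<and> \<sigma> \<in> shuffle_perms n (I f)"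
        using le \<sigma> by (simp add: shuffle_perms_def)
    qed
  qed
  from bij_betw_same_card[OF this] show ?thesis by (rule sym)
qed

lemma shuffle_perms_trivial:
  "shuffle_perms n 0 = {id}" "shuffle_perms n n = {id}"
proof -
  have *: "\<sigma> = id" if "\<sigma> permutes {..<n}" "strict_mono_on {..<n} \<sigma>" for \<sigma>
  proof -
    have "sort_rank n (\<lambda>_. 0) = \<sigma>"
    proof (rule sort_rank_unique[OF that(1)])
      fix i j assume "i < n" "j < n"
      then show "\<sigma> i < \<sigma> j \<longleftrightarrow> before (\<lambda>_. 0) i j"
        using strict_mono_on_less[OF that(2), of i j] by (simp add: before_def)
    qed
    moreover have "sort_rank n (\<lambda>_. 0) = id"
      by (rule sort_rank_unique) (auto simp: before_def permutes_id)
    ultimately show ?thesis by simp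
  qed
  have id: "strict_mono_on S id" for S :: "nat set" by (simp add: strict_mono_on_def)
  show "shuffle_perms n 0 = {id}" "shuffle_perms n n = {id}"
    unfolding shuffle_perms_def sym_perms_def atLeast0LessThan
    using *[of _] id permutes_id[of "{..<n}"] by (blast, blast)
qed

text \<open>The constant labellings, that is the shuffles with an empty block, contribute the identity twice;
  the others make up \<^term>\<open>sh n\<close>.\<close>

lemma adams_two:
  assumes n: "n \<ge> 1"
  shows "adams n 2 = (\<lambda>\<sigma>. sh n \<sigma> + 2 * ga_one \<sigma>)"
proof
  fix \<sigma>
  show "adams n 2 \<sigma> = sh n \<sigma> + 2 * ga_one \<sigma>"
  proof (cases "\<sigma> \<in> sym_perms n")
    case True
    have "{f \<in> labels n 2. pinv (sort_rank n f) = \<sigma>} = {f \<in> labels n 2. sort_rank n f = pinv \<sigma>}"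
      using pinv_sort_rank_eq_iff[OF True] by blast
    then have "adams n 2 \<sigma> = of_int (sign \<sigma>) * of_nat (card {i. i \<le> n \<and> \<sigma> \<in> shuffle_perms n i})"
      using card_sort_shuffle[OF True] by (simp add: adams_card)
    also have "\<dots> = (\<Sum>i\<in>{0..n}. sh_part n i \<sigma>)"
      unfolding sh_part_def by (simp add: sum.If_cases Int_def conj_commute mult.commute)
    also have "{0..n} = insert 0 (insert n {1..<n})" using n by auto
    also have "(\<Sum>i\<in>insert 0 (insert n {1..<n}). sh_part n i \<sigma>)
        = sh_part n 0 \<sigma> + sh_part n n \<sigma> + sh n \<sigma>"
      using n by (simp add: sh_def)
    also have "sh_part n 0 \<sigma> + sh_part n n \<sigma> = 2 * ga_one \<sigma>"
      by (simp add: sh_part_def shuffle_perms_trivial ga_one_def sign_id)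
    finally show ?thesis by simp
  next
    case False
    then have "adams n 2 \<sigma> = 0" using adams_elems[of n 2] by (simp add: ga_elems_def)
    moreover have "sh n \<sigma> = 0" using False by (simp add: sh_def sh_part_def shuffle_perms_def)
    moreover have "ga_one \<sigma> = 0" using False id_sym_perms by (auto simp: ga_one_def)
    ultimately show ?thesis by simp
  qed
qed

lemma sh_elems [simp]: "sh n \<in> ga_elems n"
  by (simp add: ga_elems_def sh_def sh_part_def shuffle_perms_def)

text \<open>Sorting depends only on the relative order of the labels. Relabelling the values monotonically
  therefore shows that the count depends on the set \<open>J\<close> of labels in use only through its size.\<close>

lemma card_sort_rank_image:
  assumes J: "finite J"
  shows "card {f \<in> labels n p. f ` {..<n} = J \<and> sort_rank n f = \<tau>}
     = (if J \<subseteq> {..<p} then card {g \<in> labels n (card J). g ` {..<n} = {..<card J} \<and> sort_rank n g = \<tau>} else 0)"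
proof (cases "J \<subseteq> {..<p}")
  case False
  then have "{f \<in> labels n p. f ` {..<n} = J \<and> sort_rank n f = \<tau>} = {}"
    by (auto simp: labels_def)
  then show ?thesis using False by simp
next
  case True
  \<comment> \<open>\<open>e\<close> enumerates \<open>J\<close> in increasing order; relabelling by \<open>e\<close> therefore preserves ranks.\<close>
  obtain e where e: "bij_betw e {..<card J} J" and em: "strict_mono_on {..<card J} e"
    using ex_bij_betw_strict_mono_card[OF J] by blast
  define e' where "e' = inv_into {..<card J} e"
  have ei: "e' (e x) = x" if "x < card J" for x
    using e that by (simp add: e'_def bij_betw_def inv_into_f_f)
  have ie: "e (e' y) = y" "e' y < card J" if "y \<in> J" for y
    using e that inv_into_into[of y e "{..<card J}"] by (auto simp: e'_def bij_betw_def f_inv_into_f)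
  have eJ: "e x \<in> J" if "x < card J" for x using e that by (auto simp: bij_betw_def)
  have eless: "e x < e y \<longleftrightarrow> x < y" if "x < card J" "y < card J" for x y
    using em strict_mono_on_less that by blast
  have eeq: "e x = e y \<longleftrightarrow> x = y" if "x < card J" "y < card J" for x y
    using ei that by metis
  have sr: "sort_rank n f = sort_rank n g"
    if "\<And>i. i < n \<Longrightarrow> g i < card J" "\<And>i. i < n \<Longrightarrow> f i = e (g i)" for f g
    by (rule sort_rank_unique[OF sort_rank_permutes])
      (use that in \<open>simp add: sort_rank_less_iff before_def eless eeq\<close>)
  let ?A = "{g \<in> labels n (card J). g ` {..<n} = {..<card J} \<and> sort_rank n g = \<tau>}"
  let ?B = "{f \<in> labels n p. f ` {..<n} = J \<and> sort_rank n f = \<tau>}"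
  have "bij_betw (\<lambda>g i. if i < n then e (g i) else 0) ?A ?B"
  proof (rule bij_betw_byWitness[where f' = "\<lambda>f i. if i < n then e' (f i) else 0"])
    show "\<forall>a\<in>?A. (\<lambda>i. if i < n then e' (if i < n then e (a i) else 0) else 0) = a"
      by (auto simp: labels_def ei fun_eq_iff)
    show "\<forall>a\<in>?B. (\<lambda>i. if i < n then e (if i < n then e' (a i) else 0) else 0) = a"
      by (auto simp: labels_def ie fun_eq_iff)
    show "(\<lambda>g i. if i < n then e (g i) else 0) ` ?A \<subseteq> ?B"
    proof clarify
      fix g assume g: "g \<in> labels n (card J)" "g ` {..<n} = {..<card J}" "\<tau> = sort_rank n g"
      let ?f = "\<lambda>i. if i < n then e (g i) else 0"
      have lt: "\<And>i. i < n \<Longrightarrow> g i < card J" using g(1) by (simp add: labels_def)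
      have "?f ` {..<n} = e ` g ` {..<n}" by (auto simp: image_iff)
      then have "?f ` {..<n} = J" using g(2) e by (simp add: bij_betw_def)
      moreover have "sort_rank n ?f = sort_rank n g" by (rule sr) (simp_all add: lt)
      moreover have "?f \<in> labels n p" using True eJ lt by (auto simp: labels_def)
      ultimately show "?f \<in> labels n p \<and> ?f ` {..<n} = J \<and> sort_rank n ?f = sort_rank n g" by blast
    qed
    show "(\<lambda>f i. if i < n then e' (f i) else 0) ` ?B \<subseteq> ?A"
    proof clarify
      fix f assume f: "f \<in> labels n p" "J = f ` {..<n}" "\<tau> = sort_rank n f"
      let ?g = "\<lambda>i. if i < n then e' (f i) else 0"
      have inJ: "f i \<in> J" if "i < n" for i using f(2) that by auto
      have "?g ` {..<n} = e' ` J" using f(2) by (auto simp: image_iff)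
      also have "\<dots> = {..<card J}" using ei eJ ie by (force simp: image_iff)
      finally have "?g ` {..<n} = {..<card J}" .
      moreover have "sort_rank n f = sort_rank n ?g" by (rule sr) (simp_all add: ie inJ)
      moreover have "?g \<in> labels n (card J)" using ie inJ by (auto simp: labels_def)
      ultimately show "?g \<in> labels n (card (f ` {..<n})) \<and> ?g ` {..<n} = {..<card (f ` {..<n})}
          \<and> sort_rank n ?g = sort_rank n f"
        using f(2) by simp
    qed
  qed
  then have "card ?A = card ?B" by (rule bij_betw_same_card)
  then show ?thesis using True by simp
qed

text \<open>Labellings are grouped by the set of labels in use, which has between \<open>1\<close> and \<open>n\<close> elements.\<close>

lemma card_sort_rank_binomial:
  assumes n: "n \<ge> 1"
  shows "\<exists>d. \<forall>p. card {f \<in> labels n p. sort_rank n f = \<tau>} = (\<Sum>j\<in>{1..n}. (p choose j) * d j)"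
proof -
  define d where "d j = card {g \<in> labels n j. g ` {..<n} = {..<j} \<and> sort_rank n g = \<tau>}" for j
  have d0: "d j = 0" if "j \<notin> {1..n}" for j
  proof -
    have "g ` {..<n} \<noteq> {..<j}" for g
    proof
      assume g: "g ` {..<n} = {..<j}"
      then have "j \<le> n" using card_image_le[of "{..<n}" g] by simp
      then have "j = 0" using that by auto
      then show False using g n by (auto simp: lessThan_empty_iff)
    qed
    then show ?thesis by (simp add: d_def)
  qed
  have "card {f \<in> labels n p. sort_rank n f = \<tau>} = (\<Sum>j\<in>{1..n}. (p choose j) * d j)" for p
  proof -
    have U: "{f \<in> labels n p. sort_rank n f = \<tau>}
       = (\<Union>J\<in>Pow {..<p}. {f \<in> labels n p. f ` {..<n} = J \<and> sort_rank n f = \<tau>})"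
    proof -
      have "f ` {..<n} \<in> Pow {..<p}" if "f \<in> labels n p" for f using that by (auto simp: labels_def)
      then show ?thesis by blast
    qed
    have "card {f \<in> labels n p. sort_rank n f = \<tau>}
       = (\<Sum>J\<in>Pow {..<p}. card {f \<in> labels n p. f ` {..<n} = J \<and> sort_rank n f = \<tau>})"
      unfolding U by (rule card_UN_disjoint) (simp, simp, blast)
    also have "\<dots> = (\<Sum>J\<in>Pow {..<p}. d (card J))"
    proof (rule sum.cong[OF refl])
      fix J assume "J \<in> Pow {..<p}"
      then have J: "J \<subseteq> {..<p}" by simp
      then have "finite J" by (rule finite_subset) simp
      from card_sort_rank_image[OF this, of n p \<tau>] J
      show "card {f \<in> labels n p. f ` {..<n} = J \<and> sort_rank n f = \<tau>} = d (card J)"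
        unfolding d_def by simp
    qed
    finally have 1: "card {f \<in> labels n p. sort_rank n f = \<tau>} = (\<Sum>J\<in>Pow {..<p}. d (card J))" .
    have le: "card J \<le> p" if "J \<subseteq> {..<p}" for J using card_mono[of "{..<p}" J] that by simp
    have "(\<Sum>J\<in>Pow {..<p}. d (card J)) = (\<Sum>j\<in>{0..p}. \<Sum>J\<in>{J \<in> Pow {..<p}. card J = j}. d (card J))"
      by (rule sum.group[symmetric]) (simp, simp, use le in \<open>simp add: image_subset_iff\<close>)
    also have "\<dots> = (\<Sum>j\<in>{0..p}. (p choose j) * d j)"
      using n_subsets[of "{..<p}"] by (intro sum.cong) (auto simp: Pow_def)
    also have "\<dots> = (\<Sum>j\<in>{0..p} \<union> {1..n}. (p choose j) * d j)"
      by (rule sum.mono_neutral_left) auto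
    also have "\<dots> = (\<Sum>j\<in>{1..n}. (p choose j) * d j)"
      by (rule sum.mono_neutral_right) (auto simp: d0)
    finally show ?thesis unfolding 1 .
  qed
  then show ?thesis by blast
qed

text \<open>A binomial coefficient \<open>p choose j\<close> with \<open>j \<ge> 1\<close> has the root \<open>p = 0\<close>; hence the sum starts at
  \<open>i = 1\<close>.\<close>

lemma choose_polynomial:
  assumes "1 \<le> j" "j \<le> n"
  shows "\<exists>c :: nat \<Rightarrow> rat. \<forall>p. of_nat (p choose j) = (\<Sum>i\<in>{1..n}. c i * of_nat p ^ i)"
proof -
  define P :: "rat poly" where "P = smult (1 / fact j) (\<Prod>i<j. [:- of_nat i, 1:])"
  have deg: "degree P \<le> n"
  proof -
    have "degree (\<Prod>i<j. [:- of_nat i, 1:] :: rat poly) \<le> (\<Sum>i<j. degree [:- of_nat i, 1 :: rat:])"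
      using degree_prod_sum_le[of "{..<j}" "\<lambda>i. [:- of_nat i, 1 :: rat:]"] by simp
    then have "degree (\<Prod>i<j. [:- of_nat i, 1:] :: rat poly) \<le> j" by simp
    moreover have "degree P \<le> degree (\<Prod>i<j. [:- of_nat i, 1:] :: rat poly)"
      unfolding P_def by (rule degree_smult_le)
    ultimately show ?thesis using assms by linarith
  qed
  have "poly P 0 = 0" using assms unfolding P_def by (auto simp: poly_prod)
  then have c0: "coeff P 0 = 0" by (simp add: poly_0_coeff_0)
  have "of_nat (p choose j) = (\<Sum>i\<in>{1..n}. coeff P i * of_nat p ^ i)" for p
  proof -
    have "of_nat (p choose j) = (of_nat p gchoose j :: rat)" by (simp add: binomial_gbinomial)
    also have "\<dots> = poly P (of_nat p)"
      by (simp add: gbinomial_prod_rev P_def poly_prod atLeast0LessThan)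
    also have "\<dots> = (\<Sum>i\<le>n. coeff P i * of_nat p ^ i)"
      unfolding poly_altdef using deg by (intro sum.mono_neutral_left) (auto simp: coeff_eq_0)
    also have "\<dots> = (\<Sum>i\<in>{1..n}. coeff P i * of_nat p ^ i)"
      using c0 by (intro sum.mono_neutral_right) (auto simp: not_le less_Suc_eq_0_disj)
    finally show ?thesis .
  qed
  then show ?thesis by blast
qed

lemma adams_polynomial:
  assumes n: "n \<ge> 1"
  shows "\<exists>c. \<forall>p. adams n p \<sigma> = (\<Sum>i\<in>{1..n}. c i * of_nat p ^ i)"
proof (cases "\<sigma> \<in> sym_perms n")
  case True
  obtain d where d: "\<And>p. card {f \<in> labels n p. sort_rank n f = pinv \<sigma>} = (\<Sum>j\<in>{1..n}. (p choose j) * d j)"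
    using card_sort_rank_binomial[OF n] by blast
  have "\<forall>j\<in>{1..n}. \<exists>c :: nat \<Rightarrow> rat. \<forall>p. of_nat (p choose j) = (\<Sum>i\<in>{1..n}. c i * of_nat p ^ i)"
    using choose_polynomial by simp
  then obtain c :: "nat \<Rightarrow> nat \<Rightarrow> rat" where
    c: "\<And>j p. j \<in> {1..n} \<Longrightarrow> of_nat (p choose j) = (\<Sum>i\<in>{1..n}. c j i * of_nat p ^ i)"
    by metis
  define C where "C i = of_int (sign \<sigma>) * (\<Sum>j\<in>{1..n}. of_nat (d j) * c j i)" for i
  have "adams n p \<sigma> = (\<Sum>i\<in>{1..n}. C i * of_nat p ^ i)" for p
  proof -
    have "{f \<in> labels n p. pinv (sort_rank n f) = \<sigma>} = {f \<in> labels n p. sort_rank n f = pinv \<sigma>}"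
      using pinv_sort_rank_eq_iff[OF True] by blast
    then have "adams n p \<sigma> = of_int (sign \<sigma>) * (\<Sum>j\<in>{1..n}. of_nat (p choose j) * of_nat (d j))"
      by (simp add: adams_card d)
    also have "(\<Sum>j\<in>{1..n}. of_nat (p choose j) * of_nat (d j) :: rat)
       = (\<Sum>j\<in>{1..n}. \<Sum>i\<in>{1..n}. c j i * of_nat p ^ i * of_nat (d j))"
      by (rule sum.cong) (simp_all add: c sum_distrib_right)
    also have "\<dots> = (\<Sum>i\<in>{1..n}. \<Sum>j\<in>{1..n}. c j i * of_nat p ^ i * of_nat (d j))"
      by (rule sum.swap)
    finally show ?thesis
      by (simp add: C_def sum_distrib_left sum_distrib_right mult_ac)
  qed
  then show ?thesis by blast
next
  case False
  then have "\<forall>p. adams n p \<sigma> = 0" using adams_elems[of n] by (auto simp: ga_elems_def)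
  then show ?thesis by (intro exI[of _ "\<lambda>_. 0"]) simp
qed

lemma eulerian_elems [simp]: "eulerian n i \<in> ga_elems n"
proof -
  have "foldr (ga_mult n) xs ga_one \<in> ga_elems n" for xs by (cases xs) simp_all
  then show ?thesis unfolding eulerian_def .
qed

text \<open>The operator \<open>\<Prod>\<^sub>j (adams n 2 - 2\<^sup>j) / (2 - 2\<^sup>j)\<close> of left multiplication on the group algebra. For
  \<open>js = [2..<n + 1]\<close> it is left multiplication by the first Eulerian idempotent.\<close>

definition eul_fold :: "nat \<Rightarrow> nat list \<Rightarrow> group_alg \<Rightarrow> group_alg" where
  "eul_fold n js = foldr (\<lambda>j x \<sigma>. (ga_mult n (adams n 2) x \<sigma> - 2 ^ j * x \<sigma>) / (2 - 2 ^ j)) js"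

lemma ga_mult_lin_comb:
  "ga_mult n b (\<lambda>\<sigma>. (a \<sigma> - v * a' \<sigma>) / w) = (\<lambda>\<sigma>. (ga_mult n b a \<sigma> - v * ga_mult n b a' \<sigma>) / w)"
  using ga_mult_lin_right[of n b "1 / w" a "- v / w" a'] by (simp add: field_simps diff_divide_distrib)

lemma adams_two_eul_fold:
  "ga_mult n (adams n 2) (eul_fold n js (adams n p)) = eul_fold n js (adams n (2 * p))"
proof (induction js)
  case Nil
  then show ?case by (simp add: eul_fold_def adams_mult mult.commute)
next
  case (Cons j js)
  have "ga_mult n (adams n 2) (eul_fold n (j # js) (adams n p))
     = (\<lambda>\<sigma>. (ga_mult n (adams n 2) (ga_mult n (adams n 2) (eul_fold n js (adams n p))) \<sigma>
          - 2 ^ j * ga_mult n (adams n 2) (eul_fold n js (adams n p)) \<sigma>) / (2 - 2 ^ j))"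
    by (simp add: eul_fold_def ga_mult_lin_comb)
  then show ?case unfolding Cons.IH by (simp add: eul_fold_def)
qed

text \<open>Left multiplication by \<open>adams n 2\<close> turns \<open>adams n p\<close> into \<open>adams n (2 * p)\<close>, so it scales the
  coefficient of \<open>p\<^sup>i\<close> by \<open>2\<^sup>i\<close>: the polynomial expansion diagonalizes it.\<close>

lemma eul_fold_polynomial:
  assumes c: "\<And>p. adams n p \<sigma> = (\<Sum>i\<in>{1..n}. c i * of_nat p ^ i)"
  shows "eul_fold n js (adams n p) \<sigma>
    = (\<Sum>i\<in>{1..n}. c i * (\<Prod>j\<leftarrow>js. (2 ^ i - 2 ^ j) / (2 - 2 ^ j)) * of_nat p ^ i)"
proof (induction js arbitrary: p)
  case Nil
  then show ?case by (simp add: eul_fold_def c)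
next
  case (Cons j js)
  let ?P = "\<lambda>i. (\<Prod>j\<leftarrow>js. (2 ^ i - 2 ^ j) / (2 - 2 ^ j)) :: rat"
  have "eul_fold n (j # js) (adams n p) \<sigma>
     = (eul_fold n js (adams n (2 * p)) \<sigma> - 2 ^ j * eul_fold n js (adams n p) \<sigma>) / (2 - 2 ^ j)"
    using adams_two_eul_fold[of n js p] by (simp add: eul_fold_def)
  also have "\<dots> = (\<Sum>i\<in>{1..n}. (c i * ?P i * of_nat (2 * p) ^ i - 2 ^ j * (c i * ?P i * of_nat p ^ i)) / (2 - 2 ^ j))"
    by (simp only: Cons.IH sum_divide_distrib sum_subtractf sum_distrib_left diff_divide_distrib)
  also have "\<dots> = (\<Sum>i\<in>{1..n}. c i * (\<Prod>j\<leftarrow>j # js. (2 ^ i - 2 ^ j) / (2 - 2 ^ j)) * of_nat p ^ i)"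
    by (rule sum.cong) (simp_all add: power_mult_distrib algebra_simps divide_inverse)
  finally show ?case .
qed

lemma eulerian_1_eul_fold:
  assumes "n \<ge> 1"
  shows "eulerian n 1 = eul_fold n [2..<n + 1] ga_one"
proof -
  have js: "filter (\<lambda>j. j \<noteq> 1) [1..<n + 1] = [2..<n + 1]"
  proof -
    have "[1..<n + 1] = 1 # [2..<n + 1]"
      using upt_conv_Cons[of 1 "n + 1", unfolded Suc_1] assms by simp
    moreover have "filter (\<lambda>j. j \<noteq> 1) [2..<n + 1] = [2..<n + 1]" by (rule filter_True) (auto simp del: upt_Suc)
    ultimately show ?thesis by simp
  qed
  have el: "foldr (\<lambda>j x \<sigma>. (ga_mult n (adams n 2) x \<sigma> - 2 ^ j * x \<sigma>) / (2 - 2 ^ j)) js ga_one \<in> ga_elems n" for js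
    by (induction js) (auto simp: ga_elems_def ga_one_def id_sym_perms ga_mult_def)
  have "foldr (ga_mult n) (map (\<lambda>j \<sigma>. (sh n \<sigma> - (2 ^ j - 2) * ga_one \<sigma>) / (2 ^ 1 - 2 ^ j)) js) ga_one
     = foldr (\<lambda>j x \<sigma>. (ga_mult n (adams n 2) x \<sigma> - 2 ^ j * x \<sigma>) / (2 - 2 ^ j)) js ga_one" for js
  proof (induction js)
    case (Cons j js)
    let ?x = "foldr (\<lambda>j x \<sigma>. (ga_mult n (adams n 2) x \<sigma> - 2 ^ j * x \<sigma>) / (2 - 2 ^ j)) js ga_one"
    have "(\<lambda>\<sigma>. (sh n \<sigma> - (2 ^ j - 2) * ga_one \<sigma>) / (2 ^ 1 - 2 ^ j))
       = (\<lambda>\<sigma>. (1 / (2 - 2 ^ j)) * adams n 2 \<sigma> + (- (2 ^ j) / (2 - 2 ^ j)) * ga_one \<sigma>)"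
      unfolding adams_two[OF assms] power_one_right
      by (rule ext) (simp only: divide_inverse, simp only: algebra_simps mult_minus_left mult_1_left)
    note f = this
    have "ga_mult n (\<lambda>\<sigma>. (sh n \<sigma> - (2 ^ j - 2) * ga_one \<sigma>) / (2 ^ 1 - 2 ^ j)) ?x
      = (\<lambda>\<sigma>. (1 / (2 - 2 ^ j)) * ga_mult n (adams n 2) ?x \<sigma> + (- (2 ^ j) / (2 - 2 ^ j)) * ?x \<sigma>)"
      unfolding f ga_mult_lin_left ga_mult_one_left[OF el] ..
    also have "\<dots> = (\<lambda>\<sigma>. (ga_mult n (adams n 2) ?x \<sigma> - 2 ^ j * ?x \<sigma>) / (2 - 2 ^ j))"
      by (rule ext) (simp add: diff_divide_distrib)
    finally show ?case unfolding list.map foldr_Cons o_apply Cons.IH .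
  qed simp
  then show ?thesis unfolding eulerian_def js eul_fold_def by simp
qed

text \<open>The factors \<open>2\<^sup>i - 2\<^sup>j\<close> for \<open>2 \<le> j \<le> n\<close> kill every coefficient with \<open>i \<noteq> 1\<close>, and \<open>sh = adams n 2 - 2\<close>
  acts on the remaining one as \<open>2\<^sup>1 - 2 = 0\<close>.\<close>

lemma sh_eulerian_1: "ga_mult n (sh n) (eulerian n 1) = (\<lambda>_. 0)"
proof (cases "n \<ge> 1")
  case False
  then show ?thesis by (simp add: sh_def ga_mult_def fun_eq_iff)
next
  case True
  let ?e = "eul_fold n [2..<n + 1]"
  have e: "eulerian n 1 = ?e (adams n 1)" using eulerian_1_eul_fold[OF True] adams_one by simp
  have "sh n = (\<lambda>\<sigma>. 1 * adams n 2 \<sigma> + (- 2) * ga_one \<sigma>)" by (simp add: adams_two[OF True])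
  then have "ga_mult n (sh n) (eulerian n 1)
     = (\<lambda>\<sigma>. 1 * ga_mult n (adams n 2) (eulerian n 1) \<sigma> + (- 2) * ga_mult n ga_one (eulerian n 1) \<sigma>)"
    using ga_mult_lin_left by metis
  also have "\<dots> = (\<lambda>\<sigma>. ?e (adams n 2) \<sigma> - 2 * ?e (adams n 1) \<sigma>)"
  proof -
    have "ga_mult n (adams n 2) (eulerian n 1) = ?e (adams n 2)"
      using adams_two_eul_fold[of n "[2..<n + 1]" 1] unfolding e mult_1_right .
    then show ?thesis unfolding ga_mult_one_left[OF eulerian_elems] unfolding e by (simp del: upt_Suc)
  qed
  also have "\<dots> = (\<lambda>_. 0)"
  proof
    fix \<sigma>
    obtain c where c: "\<And>p. adams n p \<sigma> = (\<Sum>i\<in>{1..n}. c i * of_nat p ^ i)"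
      using adams_polynomial[OF True] by metis
    have z: "(\<Prod>j\<leftarrow>[2..<n + 1]. (2 ^ i - 2 ^ j) / (2 - 2 ^ j)) * (2 ^ i - 2) = (0 :: rat)"
      if "i \<in> {1..n}" for i
      using that by (cases "i = 1") (auto simp: prod_list_zero_iff)
    have "?e (adams n 2) \<sigma> - 2 * ?e (adams n 1) \<sigma>
       = (\<Sum>i\<in>{1..n}. c i * ((\<Prod>j\<leftarrow>[2..<n + 1]. (2 ^ i - 2 ^ j) / (2 - 2 ^ j)) * (2 ^ i - 2)))"
      unfolding eul_fold_polynomial[OF c] sum_distrib_left sum_subtractf[symmetric]
      by (rule sum.cong) (simp_all add: algebra_simps)
    also have "\<dots> = 0" using z by (intro sum.neutral) simp
    finally show "?e (adams n 2) \<sigma> - 2 * ?e (adams n 1) \<sigma> = 0" .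
  qed
  finally show ?thesis .
qed

text \<open>Each factor \<open>(sh - (2\<^sup>j - 2)) / (2 - 2\<^sup>j)\<close> of the idempotent is \<open>1\<close> plus a multiple of \<open>sh\<close>; so the
  product is \<open>1\<close> plus a polynomial in \<open>sh\<close> without constant term. Commutation with the cofactor \<open>q\<close>
  allows \<open>sh\<close> to be split off on either side.\<close>

lemma eulerian_1_decomp:
  "\<exists>q \<in> ga_elems n. eulerian n 1 = (\<lambda>\<sigma>. ga_one \<sigma> + ga_mult n (sh n) q \<sigma>) \<and>
     ga_mult n (sh n) q = ga_mult n q (sh n)"
proof -
  let ?s = "sh n"
  have "\<exists>q \<in> ga_elems n. foldr (ga_mult n) (map (\<lambda>j \<sigma>. (?s \<sigma> - (2 ^ j - 2) * ga_one \<sigma>) / (2 ^ 1 - 2 ^ j)) js) ga_one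
      = (\<lambda>\<sigma>. ga_one \<sigma> + ga_mult n ?s q \<sigma>) \<and> ga_mult n ?s q = ga_mult n q ?s"
    if "1 \<notin> set js" for js
    using that
  proof (induction js)
    case Nil
    show ?case by (rule bexI[of _ "\<lambda>_. 0"]) (auto simp: ga_mult_def ga_elems_def fun_eq_iff)
  next
    case (Cons j js)
    define w :: rat where "w = 1 / (2 - 2 ^ j)"
    have j: "(2 :: rat) - 2 ^ j \<noteq> 0" using Cons.prems power_inject_exp[of "2 :: rat" 1 j] by auto
    obtain q where q: "q \<in> ga_elems n" and
      eq: "foldr (ga_mult n) (map (\<lambda>j \<sigma>. (?s \<sigma> - (2 ^ j - 2) * ga_one \<sigma>) / (2 ^ 1 - 2 ^ j)) js) ga_one
        = (\<lambda>\<sigma>. ga_one \<sigma> + ga_mult n ?s q \<sigma>)" and cm: "ga_mult n ?s q = ga_mult n q ?s"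
      using Cons by auto
    have f: "(\<lambda>\<sigma>. (?s \<sigma> - (2 ^ j - 2) * ga_one \<sigma>) / (2 ^ 1 - 2 ^ j)) = (\<lambda>\<sigma>. w * ?s \<sigma> + 1 * ga_one \<sigma>)"
      using j by (simp add: w_def field_simps fun_eq_iff)
    let ?x = "\<lambda>\<sigma>. 1 * ga_one \<sigma> + 1 * ga_mult n ?s q \<sigma>"
    let ?y = "\<lambda>\<sigma>. w * ga_one \<sigma> + 1 * q \<sigma>"
    let ?q = "\<lambda>\<sigma>. w * ga_mult n ?s q \<sigma> + 1 * ?y \<sigma>"
    have y: "?y \<in> ga_elems n" using q ga_one_elems[of n] by (simp add: ga_elems_def)
    have x: "?x \<in> ga_elems n" using ga_one_elems[of n] ga_mult_elems[of n ?s q] by (simp add: ga_elems_def)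
    have "ga_mult n (\<lambda>\<sigma>. w * ?s \<sigma> + 1 * ga_one \<sigma>) ?x
        = (\<lambda>\<sigma>. w * ga_mult n ?s ?x \<sigma> + 1 * ga_mult n ga_one ?x \<sigma>)" by (rule ga_mult_lin_left)
    also have "\<dots> = (\<lambda>\<sigma>. w * (1 * ?s \<sigma> + 1 * ga_mult n ?s (ga_mult n ?s q) \<sigma>) + 1 * ?x \<sigma>)"
      using ga_mult_one_left[OF x] ga_mult_lin_right[of n ?s 1 ga_one 1 "ga_mult n ?s q"]
      by (simp add: ga_mult_one_right)
    also have "\<dots> = (\<lambda>\<sigma>. ga_one \<sigma> + ga_mult n ?s ?q \<sigma>)"
    proof -
      have "ga_mult n ?s ?q = (\<lambda>\<sigma>. w * ga_mult n ?s (ga_mult n ?s q) \<sigma> + 1 * ga_mult n ?s ?y \<sigma>)"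
        by (rule ga_mult_lin_right)
      moreover have "ga_mult n ?s ?y = (\<lambda>\<sigma>. w * ?s \<sigma> + 1 * ga_mult n ?s q \<sigma>)"
        using ga_mult_lin_right[of n ?s w ga_one 1 q] by (simp add: ga_mult_one_right)
      ultimately show ?thesis by (simp add: algebra_simps fun_eq_iff)
    qed
    finally have 1: "ga_mult n (\<lambda>\<sigma>. w * ?s \<sigma> + 1 * ga_one \<sigma>) ?x = (\<lambda>\<sigma>. ga_one \<sigma> + ga_mult n ?s ?q \<sigma>)" .
    have "ga_mult n ?q ?s = (\<lambda>\<sigma>. w * ga_mult n (ga_mult n ?s q) ?s \<sigma> + 1 * ga_mult n ?y ?s \<sigma>)"
      by (rule ga_mult_lin_left)
    moreover have "ga_mult n ?y ?s = (\<lambda>\<sigma>. w * ?s \<sigma> + 1 * ga_mult n q ?s \<sigma>)"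
      using ga_mult_lin_left[of n w ga_one 1 q ?s] by (simp add: ga_mult_one_left)
    moreover have "ga_mult n ?s ?q = (\<lambda>\<sigma>. w * ga_mult n ?s (ga_mult n ?s q) \<sigma> + 1 * ga_mult n ?s ?y \<sigma>)"
      by (rule ga_mult_lin_right)
    moreover have "ga_mult n ?s ?y = (\<lambda>\<sigma>. w * ?s \<sigma> + 1 * ga_mult n ?s q \<sigma>)"
      using ga_mult_lin_right[of n ?s w ga_one 1 q] by (simp add: ga_mult_one_right)
    moreover have "ga_mult n (ga_mult n ?s q) ?s = ga_mult n ?s (ga_mult n ?s q)"
      by (metis ga_mult_assoc cm)
    ultimately have 2: "ga_mult n ?s ?q = ga_mult n ?q ?s"
      by (simp add: cm)
    have 3: "?q \<in> ga_elems n" using y ga_mult_elems[of n ?s q] by (simp add: ga_elems_def)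
    show ?case
      by (rule bexI[OF _ 3], rule conjI) (use 1 2 eq f in simp_all)
  qed
  from this[of "filter (\<lambda>j. j \<noteq> 1) [1..<n + 1]"] show ?thesis unfolding eulerian_def by simp
qed

lemma eulerian_1_sh: "ga_mult n (eulerian n 1) (sh n) = (\<lambda>_. 0)"
proof -
  obtain q where q: "q \<in> ga_elems n" "eulerian n 1 = (\<lambda>\<sigma>. 1 * ga_one \<sigma> + 1 * ga_mult n (sh n) q \<sigma>)"
    "ga_mult n (sh n) q = ga_mult n q (sh n)"
    using eulerian_1_decomp[of n] by auto
  have "ga_mult n (eulerian n 1) (sh n)
      = (\<lambda>\<sigma>. 1 * ga_mult n ga_one (sh n) \<sigma> + 1 * ga_mult n (ga_mult n (sh n) q) (sh n) \<sigma>)"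
    unfolding q(2) by (rule ga_mult_lin_left)
  also have "\<dots> = (\<lambda>\<sigma>. 1 * ga_mult n (sh n) ga_one \<sigma> + 1 * ga_mult n (sh n) (ga_mult n (sh n) q) \<sigma>)"
  proof -
    have "ga_mult n (ga_mult n (sh n) q) (sh n) = ga_mult n (sh n) (ga_mult n (sh n) q)"
      by (metis ga_mult_assoc q(3))
    then show ?thesis by (simp add: ga_mult_one_left ga_mult_one_right)
  qed
  also have "\<dots> = ga_mult n (sh n) (eulerian n 1)"
    unfolding q(2) by (rule ga_mult_lin_right[symmetric])
  finally show ?thesis unfolding sh_eulerian_1 .
qed

section \<open>Shuffles and faces\<close>

text \<open>The increasing injection whose image omits only \<open>q\<close>.\<close>

definition skip :: "nat \<Rightarrow> nat \<Rightarrow> nat" where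
  "skip q k = (if k < q then k else Suc k)"

lemma skip_simps [simp]: "k < q \<Longrightarrow> skip q k = k" "q \<le> k \<Longrightarrow> skip q k = Suc k"
  by (simp_all add: skip_def)

text \<open>Taking an item out before sorting or after sorting leaves the same arrangement of the other items.\<close>

lemma sort_rank_shift:
  assumes q: "q < Suc n" and k: "k < n"
  shows "sort_rank (Suc n) f (skip q k)
    = skip (sort_rank (Suc n) f q) (sort_rank n (f \<circ> skip q) k)"
proof -
  have lt: "skip q k < Suc n" using k by (simp add: skip_def)
  have ne: "sort_rank (Suc n) f (skip q k) \<noteq> sort_rank (Suc n) f q"
    using permutes_inj[OF sort_rank_permutes] by (auto simp: inj_eq skip_def)
  let ?A = "{j. j < Suc n \<and> before f j (skip q k)}"
  let ?C = "{j. j < n \<and> before (f \<circ> skip q) j k}"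
  let ?D = "{j. j = q \<and> before f q (skip q k)}"
  have bef: "before (f \<circ> skip q) j k \<longleftrightarrow> before f (skip q j) (skip q k)" for j
    by (auto simp: before_def skip_def)
  have "?A = skip q ` ?C \<union> ?D"
  proof (rule Set.set_eqI)
    fix j
    show "j \<in> ?A \<longleftrightarrow> j \<in> skip q ` ?C \<union> ?D"
    proof (cases "j = q")
      case True
      have "q \<notin> skip q ` ?C" by (auto simp: skip_def split: if_splits)
      then show ?thesis using True q by auto
    next
      case False
      define i where "i = (if j < q then j else j - 1)"
      have j: "j = skip q i" using False by (auto simp: i_def skip_def)
      have inj: "skip q x = skip q y \<longleftrightarrow> x = y" for x y by (auto simp: skip_def)
      have "i < n \<longleftrightarrow> j < Suc n" using False q by (auto simp: i_def)
      then show ?thesis using False bef[of i] unfolding j by (auto simp: inj)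
    qed
  qed
  moreover have "finite (skip q ` ?C)" "finite ?D" "skip q ` ?C \<inter> ?D = {}"
    by (auto simp: skip_def split: if_splits)
  ultimately have "card ?A = card (skip q ` ?C) + card ?D" by (simp add: card_Un_disjoint)
  moreover have "card (skip q ` ?C) = card ?C" by (rule card_image) (auto simp: inj_on_def skip_def split: if_splits)
  moreover have "card ?D = (if before f q (skip q k) then 1 else 0)" by simp
  ultimately have "sort_rank (Suc n) f (skip q k)
     = sort_rank n (f \<circ> skip q) k + (if sort_rank (Suc n) f q < sort_rank (Suc n) f (skip q k) then 1 else 0)"
    using k lt sort_rank_less_iff[OF q lt, of f] by (simp add: sort_rank_def)
  then show ?thesis using ne by (auto simp: skip_def split: if_splits)
qed

text \<open>The cycle on \<open>{q..n}\<close> that sends \<open>n\<close> to \<open>q\<close> and moves the rest up by one.\<close>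

definition move_last :: "nat \<Rightarrow> nat \<Rightarrow> nat \<Rightarrow> nat" where
  "move_last n q k = (if k < n then skip q k else if k = n then q else k)"

lemma sign_move_last:
  assumes "q \<le> n"
  shows "permutation (move_last n q) \<and> sign (move_last n q) = (- 1) ^ (n - q)"
  using assms
proof (induction q rule: inc_induct)
  case base
  have "move_last n n = id" by (auto simp: move_last_def skip_def fun_eq_iff)
  then show ?case by (simp add: permutation_id)
next
  case (step q)
  have eq: "move_last n q = transpose q (Suc q) \<circ> move_last n (Suc q)"
    using step.hyps by (auto simp: move_last_def skip_def fun_eq_iff Transposition.transpose_def)
  have p: "permutation (move_last n (Suc q))" using step.IH by simp
  have "n - q = Suc (n - Suc q)" using step.hyps by simp
  moreover have "sign (move_last n q) = sign (transpose q (Suc q)) * sign (move_last n (Suc q))"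
    unfolding eq by (rule sign_compose[OF permutation_swap_id p])
  moreover have "permutation (move_last n q)"
    unfolding eq by (rule permutation_compose[OF permutation_swap_id p])
  ultimately show ?case using step.IH by (simp add: sign_swap_id)
qed

text \<open>Together with \<open>lsort n f as\<close>, the list produced by the riffle with labelling \<open>f\<close>, this is the term of \<^term>\<open>adams n p\<close>
  that belongs to \<open>f\<close>, applied to \<open>as\<close>.\<close>

definition lsign :: "nat \<Rightarrow> (nat \<Rightarrow> nat) \<Rightarrow> rat" where
  "lsign n f = of_int (sign (sort_rank n f))"

definition lsort :: "nat \<Rightarrow> (nat \<Rightarrow> nat) \<Rightarrow> 'a list \<Rightarrow> 'a list" where
  "lsort n f as = permute_list (sort_rank n f) as"

lemma permutation_sort_rank: "permutation (sort_rank n f)"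
  using permutation_permutes sort_rank_permutes finite_lessThan by blast

text \<open>A permutation \<open>s\<close> of \<open>n + 1\<close> items that sends \<open>q\<close> to \<open>t\<close> becomes, after composition with the cycles that
  move \<open>q\<close> and \<open>t\<close> to the end, a permutation of \<open>n\<close> items. The cycles have signs \<open>(-1)\<^sup>n\<^sup>-\<^sup>q\<close> and
  \<open>(-1)\<^sup>n\<^sup>-\<^sup>t\<close>.\<close>

lemma lsign_remove:
  assumes q: "q < Suc n"
  shows "lsign (Suc n) f = (-1) ^ (q + sort_rank (Suc n) f q) * lsign n (f \<circ> skip q)"
proof -
  let ?t = "sort_rank (Suc n) f q"
  have t: "?t \<le> n" using sort_rank_lt[OF q, of f] by simp
  have "sort_rank (Suc n) f \<circ> move_last n q = move_last n ?t \<circ> sort_rank n (f \<circ> skip q)"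
  proof
    fix k
    consider "k < n" | "k = n" | "k > n" by linarith
    then show "(sort_rank (Suc n) f \<circ> move_last n q) k = (move_last n ?t \<circ> sort_rank n (f \<circ> skip q)) k"
    proof cases
      case 1
      then show ?thesis using sort_rank_shift[OF q 1, of f] sort_rank_lt[OF 1, of "f \<circ> skip q"]
        by (simp add: move_last_def)
    qed (simp_all add: move_last_def sort_rank_def)
  qed
  then have "sign (sort_rank (Suc n) f \<circ> move_last n q) = sign (move_last n ?t \<circ> sort_rank n (f \<circ> skip q))"
    by simp
  then have "sign (sort_rank (Suc n) f) * (- 1) ^ (n - q) = (- 1) ^ (n - ?t) * sign (sort_rank n (f \<circ> skip q))"
    using q t by (simp add: sign_compose permutation_sort_rank sign_move_last)
  note eq = this
  have aa: "((- 1) ^ (n - q) * (- 1) ^ (n - q) :: int) = 1"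
    by (simp add: power_add[symmetric] mult_2[symmetric])
  have "sign (sort_rank (Suc n) f) = (sign (sort_rank (Suc n) f) * (- 1) ^ (n - q)) * (- 1) ^ (n - q)"
    unfolding mult.assoc aa by simp
  also have "\<dots> = ((- 1) ^ (n - q) * (- 1) ^ (n - ?t)) * sign (sort_rank n (f \<circ> skip q))"
    unfolding eq by (simp only: mult_ac)
  finally have "sign (sort_rank (Suc n) f)
      = ((- 1) ^ (n - q) * (- 1) ^ (n - ?t)) * sign (sort_rank n (f \<circ> skip q))" .
  moreover have "((- 1) ^ (n - q) * (- 1) ^ (n - ?t) :: int) = (- 1) ^ (q + ?t)"
    using q t by (auto simp: uminus_power_if power_add[symmetric])
  ultimately have "sign (sort_rank (Suc n) f) = (- 1) ^ (q + ?t) * sign (sort_rank n (f \<circ> skip q))" by simp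
  then show ?thesis by (simp add: lsign_def)
qed

lemma length_lsort [simp]: "length (lsort n f as) = length as"
  by (simp add: lsort_def)

lemma nth_lsort: "length as = n \<Longrightarrow> i < n \<Longrightarrow> lsort n f as ! i = as ! sort_rank n f i"
  by (simp add: lsort_def permute_list_nth sort_rank_permutes)

lemma set_lsort [simp]: "length as = n \<Longrightarrow> set (lsort n f as) = set as"
  unfolding lsort_def using sort_rank_permutes[of n f] by (simp add: set_permute_list)

definition del :: "nat \<Rightarrow> 'a list \<Rightarrow> 'a list" where
  "del t as = take t as @ drop (Suc t) as"

lemma length_del: "t < length as \<Longrightarrow> length (del t as) = length as - 1"
  by (simp add: del_def)

lemma nth_del: "t < length as \<Longrightarrow> k < length as - 1 \<Longrightarrow> del t as ! k = as ! skip t k"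
  by (auto simp: del_def nth_append skip_def)

text \<open>The effect on the tensor factors of a face that multiplies two neighbours.\<close>

definition mrg :: "('a \<Rightarrow> 'a \<Rightarrow> 'a) \<Rightarrow> nat \<Rightarrow> 'a list \<Rightarrow> 'a list" where
  "mrg mu q as = take q as @ mu (as ! q) (as ! Suc q) # drop (q + 2) as"

lemma length_mrg: "Suc q < length as \<Longrightarrow> length (mrg mu q as) = length as - 1"
  by (simp add: mrg_def)

lemma nth_mrg:
  "Suc q < length as \<Longrightarrow> k < length as - 1 \<Longrightarrow>
   mrg mu q as ! k = (if k < q then as ! k else if k = q then mu (as ! q) (as ! Suc q) else as ! Suc k)"
  by (auto simp: mrg_def nth_append nth_Cons Suc_diff_Suc intro!: arg_cong[of _ _ "(!) as"] split: nat.split)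

lemma del_lsort:
  assumes as: "length as = Suc n" and q: "q < Suc n"
  shows "del q (lsort (Suc n) f as) = lsort n (f \<circ> skip q) (del (sort_rank (Suc n) f q) as)"
proof (rule nth_equalityI)
  have t: "sort_rank (Suc n) f q < Suc n" by (rule sort_rank_lt[OF q])
  then show "length (del q (lsort (Suc n) f as))
      = length (lsort n (f \<circ> skip q) (del (sort_rank (Suc n) f q) as))"
    using as q by (simp add: length_del)
  fix k assume "k < length (del q (lsort (Suc n) f as))"
  then have k: "k < n" using as q by (simp add: length_del)
  then have k': "skip q k < Suc n" by (simp add: skip_def)
  have s: "sort_rank n (f \<circ> skip q) k < n" using k by (rule sort_rank_lt)
  have "del q (lsort (Suc n) f as) ! k = as ! sort_rank (Suc n) f (skip q k)"
    using as q k k' by (simp add: nth_del nth_lsort)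
  also have "\<dots> = lsort n (f \<circ> skip q) (del (sort_rank (Suc n) f q) as) ! k"
    unfolding sort_rank_shift[OF q k] using as t k s by (simp add: nth_lsort length_del nth_del)
  finally show "del q (lsort (Suc n) f as) ! k
     = lsort n (f \<circ> skip q) (del (sort_rank (Suc n) f q) as) ! k" .
qed

text \<open>Repeats the label at position \<open>q\<close>. These are the labellings of \<open>n + 1\<close> positions in which \<open>q\<close> and
  \<open>q + 1\<close> are drawn from the same block.\<close>

definition dup :: "nat \<Rightarrow> (nat \<Rightarrow> nat) \<Rightarrow> nat \<Rightarrow> nat" where
  "dup q f k = (if k \<le> q then f k else f (k - 1))"

lemma dup_skip: "dup q f \<circ> skip (Suc q) = f"
  by (auto simp: dup_def skip_def fun_eq_iff)

text \<open>Two neighbouring positions drawn from the same block are neighbours in the original list as well.\<close>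

lemma sort_rank_dup:
  assumes q: "q < n"
  shows "sort_rank (Suc n) (dup q f) (Suc q) = Suc (sort_rank n f q)"
    and "sort_rank (Suc n) (dup q f) q = sort_rank n f q"
proof -
  let ?s = "sort_rank (Suc n) (dup q f)"
  have p: "?s permutes {..<Suc n}" by (rule sort_rank_permutes)
  have lt: "?s q < ?s (Suc q)" using q by (simp add: sort_rank_less_iff before_def dup_def)
  have sq: "?s q = skip (?s (Suc q)) (sort_rank n f q)"
    using sort_rank_shift[of "Suc q" n q "dup q f"] q by (simp add: dup_skip)
  have adj: "?s (Suc q) = Suc (?s q)"
  proof (rule ccontr)
    assume "?s (Suc q) \<noteq> Suc (?s q)"
    with lt have b: "Suc (?s q) < ?s (Suc q)" by simp
    also have "?s (Suc q) < Suc n" using q by (intro sort_rank_lt) simp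
    finally have "Suc (?s q) \<in> ?s ` {..<Suc n}" using permutes_image[OF p] by simp
    then obtain j where j: "j < Suc n" "?s j = Suc (?s q)" by auto
    have "before (dup q f) q j" "before (dup q f) j (Suc q)"
      using sort_rank_less_iff[of q "Suc n" j "dup q f"] sort_rank_less_iff[of j "Suc n" "Suc q" "dup q f"] j b q
      by auto
    then show False by (auto simp: before_def dup_def)
  qed
  have "sort_rank n f q < ?s (Suc q)"
    using sq lt by (auto simp: skip_def split: if_splits)
  then show "?s q = sort_rank n f q" using sq by (simp add: skip_def)
  then show "?s (Suc q) = Suc (sort_rank n f q)" using adj by simp
qed

lemma lsign_dup:
  assumes "q < n"
  shows "lsign (Suc n) (dup q f) = (-1) ^ (q + sort_rank n f q) * lsign n f"
  using lsign_remove[of "Suc q" n "dup q f"] assms by (simp add: dup_skip sort_rank_dup)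

text \<open>Multiplying two neighbours that were drawn from the same block is the same as multiplying them before
  the riffle.\<close>

lemma mrg_lsort_dup:
  assumes as: "length as = Suc n" and q: "q < n"
  shows "mrg mu q (lsort (Suc n) (dup q f) as) = lsort n f (mrg mu (sort_rank n f q) as)"
proof (rule nth_equalityI)
  let ?t = "sort_rank n f q"
  have t: "?t < n" using q by (rule sort_rank_lt)
  show "length (mrg mu q (lsort (Suc n) (dup q f) as)) = length (lsort n f (mrg mu ?t as))"
    using as q t by (simp add: length_mrg)
  fix k assume "k < length (mrg mu q (lsort (Suc n) (dup q f) as))"
  then have k: "k < n" using as q by (simp add: length_mrg)
  have sk: "sort_rank n f k < n" using k by (rule sort_rank_lt)
  have sh: "sort_rank (Suc n) (dup q f) (skip (Suc q) k) = skip (Suc ?t) (sort_rank n f k)"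
    using sort_rank_shift[of "Suc q" n k "dup q f"] q k by (simp add: dup_skip sort_rank_dup)
  have inj: "sort_rank n f k = ?t \<longleftrightarrow> k = q"
    using permutes_inj[OF sort_rank_permutes] by (auto simp: inj_eq)
  show "mrg mu q (lsort (Suc n) (dup q f) as) ! k = lsort n f (mrg mu ?t as) ! k"
  proof (cases "k = q")
    case True
    then show ?thesis using as q t k by (simp add: nth_mrg nth_lsort length_mrg sort_rank_dup)
  next
    case False
    then have "mrg mu q (lsort (Suc n) (dup q f) as) ! k
        = as ! sort_rank (Suc n) (dup q f) (skip (Suc q) k)"
      using as q k by (auto simp: nth_mrg nth_lsort skip_def)
    also have "\<dots> = mrg mu ?t as ! sort_rank n f k"
      unfolding sh using as t sk False inj by (auto simp: nth_mrg skip_def)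
    also have "\<dots> = lsort n f (mrg mu ?t as) ! k" using as t k by (simp add: nth_lsort length_mrg)
    finally show ?thesis .
  qed
qed

text \<open>Neighbouring positions with different labels are drawn from different blocks, so exchanging the
  labels exchanges the two entries.\<close>

lemma sort_rank_swap:
  assumes q: "Suc q < n" and ne: "f q \<noteq> f (Suc q)"
  shows "sort_rank n (f \<circ> transpose q (Suc q)) = sort_rank n f \<circ> transpose q (Suc q)"
proof (rule sort_rank_unique)
  have tp: "transpose q (Suc q) permutes {..<n}" using q by (intro permutes_swap_id) auto
  then show "sort_rank n f \<circ> transpose q (Suc q) permutes {..<n}"
    by (intro permutes_compose sort_rank_permutes)
  fix i j assume ij: "i < n" "j < n"
  then have "transpose q (Suc q) i < n" "transpose q (Suc q) j < n"
    using permutes_in_image[OF tp] by auto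
  then have "(sort_rank n f \<circ> transpose q (Suc q)) i < (sort_rank n f \<circ> transpose q (Suc q)) j
     \<longleftrightarrow> before f (transpose q (Suc q) i) (transpose q (Suc q) j)"
    by (simp add: sort_rank_less_iff)
  also have "\<dots> \<longleftrightarrow> before (f \<circ> transpose q (Suc q)) i j"
    using ne by (auto simp: before_def Transposition.transpose_def)
  finally show "(sort_rank n f \<circ> transpose q (Suc q)) i < (sort_rank n f \<circ> transpose q (Suc q)) j
     \<longleftrightarrow> before (f \<circ> transpose q (Suc q)) i j" .
qed

lemma lsign_swap:
  assumes q: "Suc q < n" and ne: "f q \<noteq> f (Suc q)"
  shows "lsign n (f \<circ> transpose q (Suc q)) = - lsign n f"
proof -
  have "sign (sort_rank n f \<circ> transpose q (Suc q)) = sign (sort_rank n f) * sign (transpose q (Suc q))"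
  proof (rule sign_compose)
    show "permutation (sort_rank n f)"
      using permutation_permutes sort_rank_permutes finite_lessThan by blast
    show "permutation (transpose q (Suc q))" by (rule permutation_swap_id)
  qed
  then show ?thesis by (simp add: lsign_def sort_rank_swap[OF assms] sign_swap_id)
qed

lemma mrg_lsort_swap:
  assumes as: "length as = n" and q: "Suc q < n" and ne: "f q \<noteq> f (Suc q)"
    and comm: "\<And>x y. x \<in> set as \<Longrightarrow> y \<in> set as \<Longrightarrow> mu x y = mu y x"
  shows "mrg mu q (lsort n (f \<circ> transpose q (Suc q)) as) = mrg mu q (lsort n f as)"
proof (rule nth_equalityI)
  show "length (mrg mu q (lsort n (f \<circ> transpose q (Suc q)) as)) = length (mrg mu q (lsort n f as))"
    using as q by (simp add: length_mrg)
  fix k assume "k < length (mrg mu q (lsort n (f \<circ> transpose q (Suc q)) as))"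
  then have k: "k < n - 1" using as q by (simp add: length_mrg)
  have s: "as ! sort_rank n f i \<in> set as" if "i < n" for i
    using as sort_rank_lt[OF that] by (auto intro: nth_mem)
  show "mrg mu q (lsort n (f \<circ> transpose q (Suc q)) as) ! k = mrg mu q (lsort n f as) ! k"
  proof (cases "k = q")
    case True
    have "mu (as ! sort_rank n f (Suc q)) (as ! sort_rank n f q) = mu (as ! sort_rank n f q) (as ! sort_rank n f (Suc q))"
      using q by (intro comm s) auto
    then show ?thesis using True as q k
      by (simp add: nth_mrg nth_lsort sort_rank_swap[OF q ne])
  next
    case False
    then show ?thesis using as q k
      by (simp add: nth_mrg nth_lsort sort_rank_swap[OF q ne] transpose_apply_other)
  qed
qed

text \<open>The exchange of the labels at \<open>q\<close> and \<open>q + 1\<close> is an involution of the index set that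
  reverses the sign of the summands.\<close>

lemma sum_labels_swap:
  fixes X :: "(nat \<Rightarrow> nat) \<Rightarrow> rat"
  assumes q: "Suc q < n"
    and X: "\<And>f. f q \<noteq> f (Suc q) \<Longrightarrow> X (f \<circ> transpose q (Suc q)) = - X f"
  shows "(\<Sum>f\<in>{f \<in> labels n p. f q \<noteq> f (Suc q)}. X f) = 0"
proof -
  let ?A = "{f \<in> labels n p. f q \<noteq> f (Suc q)}" and ?t = "transpose q (Suc q)"
  have mem: "f \<circ> ?t \<in> ?A" if "f \<in> ?A" for f
    using that q by (auto simp: labels_def Transposition.transpose_def)
  have "(\<Sum>f\<in>?A. X f) = (\<Sum>f\<in>?A. - X f)"
    by (rule sum.reindex_bij_witness[where i = "\<lambda>f. f \<circ> ?t" and j = "\<lambda>f. f \<circ> ?t"])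
      (use mem X in \<open>auto simp: comp_assoc\<close>)
  then have "(\<Sum>f\<in>?A. X f) = - (\<Sum>f\<in>?A. X f)" by (simp add: sum_negf)
  then show ?thesis by simp
qed

lemma sum_labels_dup:
  fixes X :: "(nat \<Rightarrow> nat) \<Rightarrow> rat"
  assumes q: "q < n"
  shows "(\<Sum>f\<in>{f \<in> labels (Suc n) p. f q = f (Suc q)}. X f) = (\<Sum>f\<in>labels n p. X (dup q f))"
proof (rule sum.reindex_bij_witness[where j = "\<lambda>f. f \<circ> skip (Suc q)" and i = "dup q"])
  fix f assume "f \<in> {f \<in> labels (Suc n) p. f q = f (Suc q)}"
  then have f: "f \<in> labels (Suc n) p" "f q = f (Suc q)" by auto
  show d: "dup q (f \<circ> skip (Suc q)) = f"
  proof
    fix k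
    show "dup q (f \<circ> skip (Suc q)) k = f k"
      using f(2) by (cases k) (auto simp: dup_def skip_def le_Suc_eq not_le less_Suc_eq)
  qed
  show "f \<circ> skip (Suc q) \<in> labels n p"
    using f(1) q by (auto simp: labels_def skip_def)
  show "X (dup q (f \<circ> skip (Suc q))) = X f" unfolding d ..
next
  fix f assume f: "f \<in> labels n p"
  show "dup q f \<circ> skip (Suc q) = f" by (rule dup_skip)
  show "dup q f \<in> {f \<in> labels (Suc n) p. f q = f (Suc q)}"
    using f q by (auto simp: labels_def dup_def)
qed

definition lcons :: "nat \<Rightarrow> (nat \<Rightarrow> nat) \<Rightarrow> nat \<Rightarrow> nat" where
  "lcons s f = case_nat s f"

lemma lcons_skip: "lcons s f \<circ> skip 0 = f"
  by (auto simp: lcons_def skip_def fun_eq_iff)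

lemma sum_labels_cons:
  fixes X :: "(nat \<Rightarrow> nat) \<Rightarrow> rat"
  shows "(\<Sum>f\<in>labels (Suc n) p. X f) = (\<Sum>s<p. \<Sum>f\<in>labels n p. X (lcons s f))"
proof -
  have "(\<Sum>f\<in>labels (Suc n) p. X f) = (\<Sum>(s, f)\<in>{..<p} \<times> labels n p. X (lcons s f))"
  proof (rule sum.reindex_bij_witness[where j = "\<lambda>f. (f 0, f \<circ> Suc)" and i = "\<lambda>(s, f). lcons s f"])
    fix f assume f: "f \<in> labels (Suc n) p"
    show "(case (f 0, f \<circ> Suc) of (s, f) \<Rightarrow> lcons s f) = f"
      by (auto simp: lcons_def fun_eq_iff split: nat.split)
    then show "(case (f 0, f \<circ> Suc) of (s, f) \<Rightarrow> X (lcons s f)) = X f" by simp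
    show "(f 0, f \<circ> Suc) \<in> {..<p} \<times> labels n p" using f by (auto simp: labels_def)
  next
    fix a assume "a \<in> {..<p} \<times> labels n p"
    then show "((case a of (s, f) \<Rightarrow> lcons s f) 0, (case a of (s, f) \<Rightarrow> lcons s f) \<circ> Suc) = a"
      "(case a of (s, f) \<Rightarrow> lcons s f) \<in> labels (Suc n) p"
      by (auto simp: lcons_def labels_def fun_eq_iff split: nat.split)
  qed
  then show ?thesis by (simp add: sum.cartesian_product)
qed

lemma fun_upd_skip: "f \<in> labels n p \<Longrightarrow> f(n := s) \<circ> skip n = f"
  by (auto simp: labels_def skip_def fun_eq_iff)

lemma sum_labels_snoc:
  fixes X :: "(nat \<Rightarrow> nat) \<Rightarrow> rat"
  shows "(\<Sum>f\<in>labels (Suc n) p. X f) = (\<Sum>s<p. \<Sum>f\<in>labels n p. X (f(n := s)))"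
proof -
  have "(\<Sum>f\<in>labels (Suc n) p. X f) = (\<Sum>(s, f)\<in>{..<p} \<times> labels n p. X (f(n := s)))"
  proof (rule sum.reindex_bij_witness[where j = "\<lambda>f. (f n, f(n := 0))" and i = "\<lambda>(s, f). f(n := s)"])
    fix f assume f: "f \<in> labels (Suc n) p"
    show "(case (f n, f(n := 0)) of (s, f) \<Rightarrow> f(n := s)) = f" by simp
    show "(case (f n, f(n := 0)) of (s, f) \<Rightarrow> X (f(n := s))) = X f" by simp
    show "(f n, f(n := 0)) \<in> {..<p} \<times> labels n p" using f by (auto simp: labels_def)
  next
    fix a assume "a \<in> {..<p} \<times> labels n p"
    then show "((case a of (s, f) \<Rightarrow> f(n := s)) n, (case a of (s, f) \<Rightarrow> f(n := s))(n := 0)) = a"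
      "(case a of (s, f) \<Rightarrow> f(n := s)) \<in> labels (Suc n) p"
      by (auto simp: labels_def fun_eq_iff)
  qed
  then show ?thesis by (simp add: sum.cartesian_product)
qed

lemma sort_rank_lcons_0: "sort_rank (Suc n) (lcons 0 f) 0 = 0"
  by (simp add: sort_rank_def lcons_def before_def)

lemma sort_rank_snoc_max:
  assumes f: "f \<in> labels n 2"
  shows "sort_rank (Suc n) (f(n := 1)) n = n"
proof -
  have "f j < 2" if "j < n" for j using f that by (simp add: labels_def)
  then have "{j. j < Suc n \<and> before (f(n := 1)) j n} = {..<n}"
    by (fastforce simp: before_def less_Suc_eq)
  then show ?thesis by (simp add: sort_rank_def)
qed

text \<open>Both sides are the index of the cut between the two blocks: the first entry of block \<open>1\<close> on the left,
  with block \<open>0\<close> in front of it, and the last entry of block \<open>0\<close> on the right, with the other entries of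
  block \<open>0\<close> in front of it.\<close>

lemma sort_rank_lcons_1:
  assumes f: "f \<in> labels n 2"
  shows "sort_rank (Suc n) (lcons 1 f) 0 = sort_rank (Suc n) (f(n := 0)) n"
proof -
  have "{j. j < Suc n \<and> before (lcons 1 f) j 0} = Suc ` {j. j < n \<and> f j = 0}"
  proof (rule Set.set_eqI)
    fix j show "j \<in> {j. j < Suc n \<and> before (lcons 1 f) j 0} \<longleftrightarrow> j \<in> Suc ` {j. j < n \<and> f j = 0}"
      by (cases j) (auto simp: before_def lcons_def)
  qed
  moreover have "{j. j < Suc n \<and> before (f(n := 0)) j n} = {j. j < n \<and> f j = 0}"
    by (auto simp: before_def)
  ultimately show ?thesis by (simp add: sort_rank_def card_image)
qed

lemma lsort_eq_Cons:
  assumes "length as = Suc n"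
  shows "lsort (Suc n) f as ! 0 = as ! sort_rank (Suc n) f 0"
    and "tl (lsort (Suc n) f as) = lsort n (f \<circ> skip 0) (del (sort_rank (Suc n) f 0) as)"
  using assms del_lsort[OF assms, of 0 f] by (simp_all add: nth_lsort del_def drop_Suc)

lemma lsort_eq_snoc:
  assumes "length as = Suc n"
  shows "lsort (Suc n) f as ! n = as ! sort_rank (Suc n) f n"
    and "butlast (lsort (Suc n) f as) = lsort n (f \<circ> skip n) (del (sort_rank (Suc n) f n) as)"
  using assms del_lsort[OF assms, of n f] by (simp_all add: nth_lsort del_def butlast_conv_take)

lemma sum_faces:
  fixes X :: "nat \<Rightarrow> rat"
  shows "(\<Sum>i\<in>{0..Suc n}. X i) = X 0 + (\<Sum>q<n. X (Suc q)) + X (Suc n)"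
  unfolding atLeast0AtMost sum.atMost_Suc
  by (subst sum.atMost_shift) simp

lemma face_simps:
  "face B l r n 0 (m, as) = (r m (as ! 0), tl as)"
  "q < n - 1 \<Longrightarrow> face B l r n (Suc q) (m, as) = (m, mrg (monoid.mult B) q as)"
  "face B l r (Suc n) (Suc n) (m, as) = (l (as ! n) m, butlast as)"
  by (auto simp: face_def mrg_def)

text \<open>The two sides are the boundary of a riffle and the riffles of the boundary, evaluated on an arbitrary
  function \<open>F\<close> of generators. On the left the pairs of a labelling and a face are of three kinds. An
  inner face that multiplies entries from different blocks cancels against the labelling with the two
  labels exchanged, because the product is commutative. An inner face that multiplies entries from the
  same block comes from an inner face on the right. An outer face acts on \<open>m\<close> by the first entry of
  block \<open>0\<close> or by the last entry of block \<open>1\<close>, which are the outer faces on the right, or it acts by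
  the first entry of block \<open>1\<close>, at the front, or by the last entry of block \<open>0\<close>, at the end; in the
  last two situations the removed entry comes from the cut between the blocks, and they cancel in pairs
  because the bimodule is symmetric.\<close>

lemma shuffle_boundary:
  fixes F :: "'m \<times> 'a list \<Rightarrow> rat"
  assumes as: "length as = Suc n"
    and comm: "\<And>x y. x \<in> set as \<Longrightarrow> y \<in> set as \<Longrightarrow> x \<otimes>\<^bsub>B\<^esub> y = y \<otimes>\<^bsub>B\<^esub> x"
    and sym: "\<And>x. x \<in> set as \<Longrightarrow> l x m = r m x"
  shows "(\<Sum>f\<in>labels (Suc n) 2. \<Sum>i\<in>{0..Suc n}.
        lsign (Suc n) f * (-1) ^ i * F (face B l r (Suc n) i (m, lsort (Suc n) f as)))
    = (\<Sum>f\<in>labels n 2. \<Sum>j\<in>{0..Suc n}.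
        lsign n f * (-1) ^ j * F (map_prod id (lsort n f) (face B l r (Suc n) j (m, as))))"
proof -
  let ?N = "Suc n" and ?mu = "monoid.mult B"
  define W where "W f i = lsign ?N f * (-1) ^ i * F (face B l r ?N i (m, lsort ?N f as))" for f i
  define V where "V f j = lsign n f * (-1) ^ j * F (map_prod id (lsort n f) (face B l r ?N j (m, as)))" for f j
  have two: "{..<2 :: nat} = {0, 1}" by auto
  have s0: "as ! sort_rank ?N f 0 \<in> set as" for f
    using as sort_rank_lt[of 0 ?N f] by (auto intro: nth_mem)
  have del0: "del 0 as = tl as" by (simp add: del_def drop_Suc)
  have deln: "del n as = butlast as" using as by (simp add: del_def butlast_conv_take)
  \<comment> \<open>The first entry of block \<open>0\<close> is the first entry of \<open>as\<close>.\<close>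
  have c0: "W (lcons 0 f) 0 = V f 0" for f
    using lsign_remove[of 0 n "lcons 0 f"]
    by (simp add: W_def V_def face_simps lsort_eq_Cons[OF as] sort_rank_lcons_0 lcons_skip del0)
  \<comment> \<open>The last entry of block \<open>1\<close> is the last entry of \<open>as\<close>.\<close>
  have c1: "W (f(n := 1)) ?N = V f ?N" if f: "f \<in> labels n 2" for f
    using lsign_remove[of n n "f(n := 1)"] sort_rank_snoc_max[OF f] fun_upd_skip[OF f, of 1]
    by (simp add: W_def V_def face_simps lsort_eq_snoc[OF as] deln power_add[symmetric] mult_2[symmetric])
  \<comment> \<open>Both faces act on \<open>m\<close> by the entry at the index \<open>?c\<close>, the number of labels \<open>0\<close> in \<open>f\<close>.\<close>
  have c2: "W (lcons 1 f) 0 + W (f(n := 0)) ?N = 0" if f: "f \<in> labels n 2" for f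
  proof -
    let ?c = "sort_rank ?N (f(n := 0)) n"
    have "?c < ?N" by (simp add: sort_rank_lt)
    then have "as ! ?c \<in> set as" using as by simp
    then have eq: "face B l r ?N 0 (m, lsort ?N (lcons 1 f) as) = face B l r ?N ?N (m, lsort ?N (f(n := 0)) as)"
      using sort_rank_lcons_1[OF f] fun_upd_skip[OF f, of 0] lcons_skip[of 1 f] sym
      by (simp add: face_simps lsort_eq_Cons[OF as] lsort_eq_snoc[OF as])
    have "lsign ?N (lcons 1 f) = (-1) ^ ?c * lsign n f"
      using lsign_remove[of 0 n "lcons 1 f"] sort_rank_lcons_1[OF f] lcons_skip[of 1 f] by simp
    moreover have "lsign ?N (f(n := 0)) = (-1) ^ (n + ?c) * lsign n f"
      using lsign_remove[of n n "f(n := 0)"] fun_upd_skip[OF f, of 0] by simp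
    moreover have "(-1) ^ n * ((-1) ^ n * x) = (x :: rat)" for x
      by (simp add: mult.assoc[symmetric] power_add[symmetric] mult_2[symmetric])
    ultimately show ?thesis unfolding W_def eq by (simp add: power_add algebra_simps)
  qed
  \<comment> \<open>Unequal labels at \<open>q\<close> and \<open>q + 1\<close> cancel; equal labels give a face of the original list at the place from which they were drawn.\<close>
  have mid: "(\<Sum>f\<in>labels ?N 2. W f (Suc q))
      = (\<Sum>f\<in>labels n 2. V f (Suc (sort_rank n f q)))" if q: "q < n" for q
  proof -
    have fc: "face B l r ?N (Suc q) (m, xs) = (m, mrg ?mu q xs)" for xs using q by (simp add: face_simps)
    have "(\<Sum>f\<in>labels ?N 2. W f (Suc q))
       = (\<Sum>f\<in>{f \<in> labels ?N 2. f q = f (Suc q)}. W f (Suc q))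
         + (\<Sum>f\<in>{f \<in> labels ?N 2. f q \<noteq> f (Suc q)}. W f (Suc q))"
      by (subst sum.union_disjoint[symmetric]) (auto intro!: sum.cong)
    also have "(\<Sum>f\<in>{f \<in> labels ?N 2. f q \<noteq> f (Suc q)}. W f (Suc q)) = 0"
    proof (rule sum_labels_swap)
      show "Suc q < ?N" using q by simp
      fix f :: "nat \<Rightarrow> nat" assume ne: "f q \<noteq> f (Suc q)"
      show "W (f \<circ> transpose q (Suc q)) (Suc q) = - W f (Suc q)"
        unfolding W_def fc using lsign_swap[of q ?N f] mrg_lsort_swap[of as ?N q f ?mu] q as comm ne by simp
    qed
    also have "(\<Sum>f\<in>{f \<in> labels ?N 2. f q = f (Suc q)}. W f (Suc q)) = (\<Sum>f\<in>labels n 2. W (dup q f) (Suc q))"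
      using q by (rule sum_labels_dup)
    also have "(\<Sum>f\<in>labels n 2. W (dup q f) (Suc q)) = (\<Sum>f\<in>labels n 2. V f (Suc (sort_rank n f q)))"
    proof (rule sum.cong[OF refl])
      fix f
      have t: "sort_rank n f q < n" using q by (rule sort_rank_lt)
      have "(-1) ^ q * ((-1) ^ q * x) = (x :: rat)" for x
        by (simp add: mult.assoc[symmetric] power_add[symmetric] mult_2[symmetric])
      then show "W (dup q f) (Suc q) = V f (Suc (sort_rank n f q))"
        unfolding W_def V_def fc using mrg_lsort_dup[OF as q] lsign_dup[OF q] t
        by (simp add: face_simps power_add algebra_simps)
    qed
    finally show ?thesis by simp
  qed
  \<comment> \<open>Each inner face of the original list is met exactly once, as sorting is a permutation.\<close>
  have reidx: "(\<Sum>q<n. V f (Suc (sort_rank n f q))) = (\<Sum>q<n. V f (Suc q))" for f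
    using sum.permute[OF sort_rank_permutes[of n f], of "\<lambda>q. V f (Suc q)"] by (simp add: o_def)
  have "(\<Sum>f\<in>labels ?N 2. \<Sum>i\<in>{0..?N}. W f i)
     = (\<Sum>f\<in>labels ?N 2. W f 0) + (\<Sum>f\<in>labels ?N 2. \<Sum>q<n. W f (Suc q)) + (\<Sum>f\<in>labels ?N 2. W f ?N)"
    unfolding sum_faces sum.distrib ..
  also have "(\<Sum>f\<in>labels ?N 2. W f 0) = (\<Sum>f\<in>labels n 2. V f 0) + (\<Sum>f\<in>labels n 2. W (lcons 1 f) 0)"
    by (simp add: sum_labels_cons two c0)
  also have "(\<Sum>f\<in>labels ?N 2. W f ?N) = (\<Sum>f\<in>labels n 2. W (f(n := 0)) ?N) + (\<Sum>f\<in>labels n 2. V f ?N)"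
    using c1 by (simp add: sum_labels_snoc two)
  also have "(\<Sum>f\<in>labels ?N 2. \<Sum>q<n. W f (Suc q)) = (\<Sum>f\<in>labels n 2. \<Sum>q<n. V f (Suc q))"
  proof -
    have "(\<Sum>f\<in>labels ?N 2. \<Sum>q<n. W f (Suc q)) = (\<Sum>q<n. \<Sum>f\<in>labels n 2. V f (Suc (sort_rank n f q)))"
      by (subst sum.swap) (use mid in simp)
    also have "\<dots> = (\<Sum>f\<in>labels n 2. \<Sum>q<n. V f (Suc q))"
      by (subst sum.swap) (simp add: reidx)
    finally show ?thesis .
  qed
  also have "(\<Sum>f\<in>labels n 2. V f 0) + (\<Sum>f\<in>labels n 2. W (lcons 1 f) 0)
       + (\<Sum>f\<in>labels n 2. \<Sum>q<n. V f (Suc q))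
       + ((\<Sum>f\<in>labels n 2. W (f(n := 0)) ?N) + (\<Sum>f\<in>labels n 2. V f ?N))
     = (\<Sum>f\<in>labels n 2. V f 0 + (\<Sum>q<n. V f (Suc q)) + V f ?N)
       + (\<Sum>f\<in>labels n 2. W (lcons 1 f) 0 + W (f(n := 0)) ?N)"
    by (simp add: sum.distrib)
  also have "(\<Sum>f\<in>labels n 2. W (lcons 1 f) 0 + W (f(n := 0)) ?N) = 0"
    using c2 by (intro sum.neutral) simp
  finally show ?thesis unfolding W_def V_def unfolding sum_faces add_0_right .
qed

section \<open>Faces and insertions\<close>

lemma mrg_mrg:
  assumes as: "length as = Suc N" and pq: "p \<le> q" "Suc q < N"
    and assoc: "\<And>x y z. x \<in> set as \<Longrightarrow> y \<in> set as \<Longrightarrow> z \<in> set as \<Longrightarrow> mu (mu x y) z = mu x (mu y z)"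
  shows "mrg mu q (mrg mu p as) = mrg mu p (mrg mu (Suc q) as)"
proof (rule nth_equalityI)
  show len: "length (mrg mu q (mrg mu p as)) = length (mrg mu p (mrg mu (Suc q) as))"
    using as pq by (simp add: length_mrg)
  fix k assume "k < length (mrg mu q (mrg mu p as))"
  then have k: "k < N - 1" using as pq by (simp add: length_mrg)
  have s: "as ! i \<in> set as" if "i < Suc N" for i using as that by simp
  have a: "mu (mu (as ! p) (as ! Suc p)) (as ! Suc (Suc p)) = mu (as ! p) (mu (as ! Suc p) (as ! Suc (Suc p)))"
    by (rule assoc) (use s pq in simp_all)
  show "mrg mu q (mrg mu p as) ! k = mrg mu p (mrg mu (Suc q) as) ! k"
    using as pq k a by (auto simp: nth_mrg length_mrg)
qed

lemma face_face:
  assumes as: "length as = Suc N" and N: "N \<ge> 1" and ij: "i \<le> j" "j \<le> N"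
    and assoc: "\<And>x y z. x \<in> set as \<Longrightarrow> y \<in> set as \<Longrightarrow> z \<in> set as \<Longrightarrow>
        (x \<otimes>\<^bsub>B\<^esub> y) \<otimes>\<^bsub>B\<^esub> z = x \<otimes>\<^bsub>B\<^esub> (y \<otimes>\<^bsub>B\<^esub> z)"
    and rr: "\<And>x y. x \<in> set as \<Longrightarrow> y \<in> set as \<Longrightarrow> r m (x \<otimes>\<^bsub>B\<^esub> y) = r (r m x) y"
    and ll: "\<And>x y. x \<in> set as \<Longrightarrow> y \<in> set as \<Longrightarrow> l (x \<otimes>\<^bsub>B\<^esub> y) m = l x (l y m)"
    and lr: "\<And>x y. x \<in> set as \<Longrightarrow> y \<in> set as \<Longrightarrow> r (l x m) y = l x (r m y)"
  shows "face B l r N j (face B l r (Suc N) i (m, as)) = face B l r N i (face B l r (Suc N) (Suc j) (m, as))"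
proof -
  let ?mu = "monoid.mult B"
  have s: "as ! k \<in> set as" if "k < Suc N" for k using as that by simp
  obtain N' where N': "N = Suc N'" using N by (cases N) auto
  have f0: "face B l r k 0 (m, xs) = (r m (xs ! 0), tl xs)" for k xs m by (simp add: face_def)
  have fm: "face B l r k (Suc q) (m, xs) = (m, mrg ?mu q xs)" if "Suc q < k" for k xs q m
    using that by (simp add: face_def mrg_def)
  have fn: "face B l r (Suc k) (Suc k) (m, xs) = (l (xs ! k) m, butlast xs)" for k xs m
    by (simp add: face_def)
  have tlm: "tl (mrg ?mu (Suc q) xs) = mrg ?mu q (tl xs)" if "Suc (Suc q) < length xs" for q xs
    using that by (cases xs) (simp_all add: mrg_def)
  have blm: "butlast (mrg ?mu q xs) = mrg ?mu q (butlast xs)" if "Suc (Suc q) < length xs" for q xs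
    using that by (intro nth_equalityI) (auto simp: nth_butlast nth_mrg length_mrg)
  have blm': "butlast (mrg ?mu q xs) = butlast (butlast xs)" if "length xs = Suc (Suc q)" for q xs
    using that by (intro nth_equalityI) (auto simp: nth_butlast nth_mrg length_mrg)
  have nth_tl': "tl as ! k = as ! Suc k" if "k < N" for k using as that by (simp add: nth_tl)
  show ?thesis
  proof (cases i)
    case 0
    consider "j = 0" | q where "j = Suc q" "j < N" | "j = N" "j \<noteq> 0" using ij by (cases j) force+
    then show ?thesis
    proof cases
      case 1
      have "tl (mrg ?mu 0 as) = tl (tl as)" "mrg ?mu 0 as ! 0 = as ! 0 \<otimes>\<^bsub>B\<^esub> as ! 1"
        using as N by (simp_all add: mrg_def drop_Suc numeral_2_eq_2)
      then show ?thesis unfolding 0 1 using N s[of 0] s[of 1]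
        by (simp add: f0 fm rr nth_tl')
    next
      case (2 q)
      have "tl (mrg ?mu (Suc q) as) = mrg ?mu q (tl as)" by (rule tlm) (use as 2 in simp)
      moreover have "mrg ?mu (Suc q) as ! 0 = as ! 0" using as 2 by (simp add: nth_mrg)
      ultimately show ?thesis unfolding 0 using 2 by (simp add: f0 fm)
    next
      case 3
      have "butlast (tl as) = tl (butlast as)" by (simp add: butlast_tl)
      moreover have "butlast as ! 0 = as ! 0" using as N by (simp add: nth_butlast)
      ultimately show ?thesis unfolding 0 3(1) N' using lr[OF s s, of N 0] N' by (simp add: f0 fn nth_tl')
    qed
  next
    case (Suc p)
    show ?thesis
    proof (cases "j = N")
      case False
      then obtain q where q: "j = Suc q" "Suc q < N" "p \<le> q" using ij Suc by (cases j) auto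
      have "mrg ?mu q (mrg ?mu p as) = mrg ?mu p (mrg ?mu (Suc q) as)"
        by (rule mrg_mrg[OF as q(3) q(2)]) (rule assoc)
      then show ?thesis unfolding Suc q(1) using q by (simp add: fm)
    next
      case True
      show ?thesis
      proof (cases "Suc p = N")
        case False
        then have p: "Suc p < N" using ij Suc True by simp
        have "butlast (mrg ?mu p as) = mrg ?mu p (butlast as)" by (rule blm) (use as p in simp)
        moreover have "mrg ?mu p as ! N' = as ! N" using as p N' by (simp add: nth_mrg)
        ultimately show ?thesis unfolding Suc True using p
          by (simp add: fm fn N')
      next
        case eq: True
        have "butlast (mrg ?mu p as) = butlast (butlast as)" by (rule blm') (use as eq in simp)
        moreover have "mrg ?mu p as ! p = as ! p \<otimes>\<^bsub>B\<^esub> as ! Suc p" using as eq by (simp add: nth_mrg)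
        moreover have "butlast as ! p = as ! p" using as eq by (simp add: nth_butlast)
        moreover have "l (as ! p \<otimes>\<^bsub>B\<^esub> as ! Suc p) m = l (as ! p) (l (as ! Suc p) m)"
          using eq by (intro ll s) auto
        ultimately show ?thesis unfolding Suc True eq[symmetric]
          by (simp add: fm fn)
      qed
    qed
  qed
qed

text \<open>The involution that pairs \<open>(i, j)\<close> for \<open>i \<le> j\<close> with \<open>(j + 1, i)\<close> reverses the sign.\<close>

lemma alternating_faces_cancel:
  fixes g :: "nat \<Rightarrow> nat \<Rightarrow> rat"
  assumes g: "\<And>i j. i \<le> j \<Longrightarrow> j \<le> N \<Longrightarrow> g i j = g (Suc j) i"
  shows "(\<Sum>i\<in>{0..Suc N}. \<Sum>j\<in>{0..N}. (-1) ^ i * (-1) ^ j * g i j) = 0"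
proof -
  let ?h = "\<lambda>(i, j). (-1) ^ i * (-1) ^ j * g i j"
  let ?P = "{(i, j). i \<le> j \<and> j \<le> N}" and ?Q = "{(i, j). j < i \<and> i \<le> Suc N}"
  have fin: "finite ?P" "finite ?Q"
    by (rule finite_subset[of _ "{0..Suc N} \<times> {0..Suc N}"], auto)+
  have "(\<Sum>i\<in>{0..Suc N}. \<Sum>j\<in>{0..N}. (-1) ^ i * (-1) ^ j * g i j) = (\<Sum>x\<in>{0..Suc N} \<times> {0..N}. ?h x)"
    by (simp only: sum.cartesian_product)
  also have "{0..Suc N} \<times> {0..N} = ?P \<union> ?Q" by auto
  also have "(\<Sum>x\<in>?P \<union> ?Q. ?h x) = (\<Sum>x\<in>?P. ?h x) + (\<Sum>x\<in>?Q. ?h x)"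
    using fin by (intro sum.union_disjoint) auto
  also have "(\<Sum>x\<in>?Q. ?h x) = (\<Sum>x\<in>?P. - ?h x)"
  proof (rule sum.reindex_bij_witness[where j = "\<lambda>(i, j). (j, i - 1)" and i = "\<lambda>(i, j). (Suc j, i)"])
    fix a assume "a \<in> ?Q"
    then obtain i j where a: "a = (Suc i, j)" "j \<le> i" "i \<le> N"
      by (cases a; cases "fst a") auto
    then show "- ?h (case a of (i, j) \<Rightarrow> (j, i - 1)) = ?h a" using g by simp
  qed auto
  finally show ?thesis by (simp add: sum_negf)
qed

text \<open>The \<open>j\<close>-th term of the insertion homotopy: a unit \<open>e\<close> is inserted at position \<open>j\<close>, and \<open>\<pi>\<close> is applied
  to the entries in front of it.\<close>

definition hins :: "('a \<Rightarrow> 'a) \<Rightarrow> 'a \<Rightarrow> nat \<Rightarrow> 'a list \<Rightarrow> 'a list" where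
  "hins \<pi> e j as = map \<pi> (take j as) @ e # drop j as"

lemma length_hins: "j \<le> length as \<Longrightarrow> length (hins \<pi> e j as) = Suc (length as)"
  by (simp add: hins_def)

lemma nth_hins:
  "j \<le> length as \<Longrightarrow> k \<le> length as \<Longrightarrow>
   hins \<pi> e j as ! k = (if k < j then \<pi> (as ! k) else if k = j then e else as ! (k - 1))"
  by (auto simp: hins_def nth_append nth_Cons intro!: arg_cong[of _ _ "(!) as"] split: nat.split)

text \<open>The two faces that multiply the inserted unit with one of its neighbours both just remove it.\<close>

lemma face_hins_unit:
  assumes as: "length as = n" and j: "j \<le> n"
    and unit: "r m e = m" "l e m = m" "\<And>x. x \<in> set as \<Longrightarrow> e \<otimes>\<^bsub>B\<^esub> x = x"
      "\<And>x. x \<in> set as \<Longrightarrow> \<pi> x \<otimes>\<^bsub>B\<^esub> e = \<pi> x"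
  shows "face B l r (Suc n) j (m, hins \<pi> e j as) = (m, map \<pi> (take j as) @ drop j as)"
    and "face B l r (Suc n) (Suc j) (m, hins \<pi> e j as) = (m, map \<pi> (take j as) @ drop j as)"
proof -
  show "face B l r (Suc n) j (m, hins \<pi> e j as) = (m, map \<pi> (take j as) @ drop j as)"
  proof (cases j)
    case 0
    then show ?thesis using unit by (simp add: face_def hins_def)
  next
    case (Suc q)
    have "mrg (monoid.mult B) q (hins \<pi> e (Suc q) as) = map \<pi> (take (Suc q) as) @ drop (Suc q) as"
    proof (rule nth_equalityI)
      have L: "length (hins \<pi> e (Suc q) as) = Suc n" using as j Suc by (simp add: length_hins)
      show "length (mrg (monoid.mult B) q (hins \<pi> e (Suc q) as)) = length (map \<pi> (take (Suc q) as) @ drop (Suc q) as)"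
        using as j Suc by (simp add: length_mrg L)
      have qn: "Suc q < Suc n" using j Suc by simp
      fix i assume "i < length (mrg (monoid.mult B) q (hins \<pi> e (Suc q) as))"
      then have i: "i < n" using j Suc by (simp add: length_mrg L)
      show "mrg (monoid.mult B) q (hins \<pi> e (Suc q) as) ! i = (map \<pi> (take (Suc q) as) @ drop (Suc q) as) ! i"
        using as j Suc i unit(4)[of "as ! q"]
          nth_mrg[of q "hins \<pi> e (Suc q) as" i "monoid.mult B", unfolded L, OF qn]
        by (auto simp: nth_hins nth_append not_less less_Suc_eq)
    qed
    then show ?thesis using j Suc by (simp add: face_simps)
  qed
  show "face B l r (Suc n) (Suc j) (m, hins \<pi> e j as) = (m, map \<pi> (take j as) @ drop j as)"
  proof (cases "j = n")
    case True
    have "hins \<pi> e j as = (map \<pi> as) @ [e]" using as True by (simp add: hins_def)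
    then show ?thesis using as True unit by (simp add: face_simps nth_append)
  next
    case False
    have "mrg (monoid.mult B) j (hins \<pi> e j as) = map \<pi> (take j as) @ drop j as"
    proof (rule nth_equalityI)
      have L: "length (hins \<pi> e j as) = Suc n" using as j by (simp add: length_hins)
      show "length (mrg (monoid.mult B) j (hins \<pi> e j as)) = length (map \<pi> (take j as) @ drop j as)"
        using as j False by (simp add: length_mrg L)
      fix i assume "i < length (mrg (monoid.mult B) j (hins \<pi> e j as))"
      then have i: "i < n" using j False by (simp add: length_mrg L)
      show "mrg (monoid.mult B) j (hins \<pi> e j as) ! i = (map \<pi> (take j as) @ drop j as) ! i"
        using as j False i unit(3)[of "as ! j"]
        by (auto simp: nth_mrg L nth_hins nth_append not_less)
    qed
    then show ?thesis using j False by (simp add: face_simps)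
  qed
qed

text \<open>Faces behind the inserted unit do not see it, apart from the shift of the index by one.\<close>

lemma face_hins_commute:
  assumes as: "length as = n" and ji: "j < i" "i \<le> n"
  shows "face B l r (Suc n) (Suc i) (m, hins \<pi> e j as) = map_prod id (hins \<pi> e j) (face B l r n i (m, as))"
proof (cases "i = n")
  case True
  then obtain n' where n': "n = Suc n'" using ji by (cases n) auto
  have "butlast (hins \<pi> e j as) = hins \<pi> e j (butlast as)"
    using as ji by (simp add: hins_def butlast_append butlast_drop take_butlast)
  moreover have "hins \<pi> e j as ! n = as ! n'" using as ji True n' by (simp add: nth_hins)
  ultimately show ?thesis using True n' by (simp add: face_simps)
next
  case False
  obtain q where q: "i = Suc q" using ji by (cases i) auto
  have "mrg (monoid.mult B) i (hins \<pi> e j as) = hins \<pi> e j (mrg (monoid.mult B) q as)"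
    using as ji False q
    by (intro nth_equalityI) (auto simp: length_mrg length_hins nth_mrg nth_hins)
  then show ?thesis using False ji q by (simp add: face_simps)
qed

text \<open>Here \<open>a j i\<close> stands for the \<open>i\<close>-th face of the \<open>j\<close>-th insertion and \<open>b j i\<close> for the \<open>j\<close>-th insertion
  into the \<open>i\<close>-th face. The faces at the unit cancel, the faces behind it cancel against the insertions
  into faces, and the faces in front of it remain, where \<open>\<pi>\<close> of a product meets the product of two
  values of \<open>\<pi>\<close>.\<close>

lemma homotopy_cancel:
  fixes a b :: "nat \<Rightarrow> nat \<Rightarrow> rat"
  assumes 1: "\<And>j. j \<le> n \<Longrightarrow> a j j = a j (Suc j)"
    and 2: "\<And>i j. j < i \<Longrightarrow> i \<le> n \<Longrightarrow> a j (Suc i) = b j i"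
  shows "(\<Sum>j\<in>{0..n}. \<Sum>i\<in>{0..Suc n}. (-1) ^ j * (-1) ^ i * a j i)
      + (\<Sum>i\<in>{0..n}. \<Sum>j<n. (-1) ^ i * (-1) ^ j * b j i)
    = (\<Sum>j<n. \<Sum>i\<in>{0..j}. (-1) ^ j * (-1) ^ i * (b j i - a (Suc j) i))"
proof -
  have A: "(\<Sum>i\<in>{0..Suc n}. (-1) ^ j * (-1) ^ i * a j i)
     = (\<Sum>i<j. (-1) ^ j * (-1) ^ i * a j i) - (\<Sum>i\<in>{j<..n}. (-1) ^ j * (-1) ^ i * b j i)"
    if j: "j \<le> n" for j
  proof -
    have s: "{0..Suc n} = {..<j} \<union> ({j, Suc j} \<union> Suc ` {j<..n})"
    proof (rule Set.set_eqI)
      fix x show "x \<in> {0..Suc n} \<longleftrightarrow> x \<in> {..<j} \<union> ({j, Suc j} \<union> Suc ` {j<..n})"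
        using j by (cases x) auto
    qed
    have "(\<Sum>i\<in>{0..Suc n}. (-1) ^ j * (-1) ^ i * a j i)
       = (\<Sum>i<j. (-1) ^ j * (-1) ^ i * a j i) + ((\<Sum>i\<in>{j, Suc j}. (-1) ^ j * (-1) ^ i * a j i)
         + (\<Sum>i\<in>Suc ` {j<..n}. (-1) ^ j * (-1) ^ i * a j i))"
      unfolding s by (subst sum.union_disjoint, simp, simp, force, subst sum.union_disjoint) auto
    also have "(\<Sum>i\<in>{j, Suc j}. (-1) ^ j * (-1) ^ i * a j i) = 0" using 1[OF j] by simp
    also have "(\<Sum>i\<in>Suc ` {j<..n}. (-1) ^ j * (-1) ^ i * a j i) = (\<Sum>i\<in>{j<..n}. - ((-1) ^ j * (-1) ^ i * b j i))"
      using 2 by (subst sum.reindex) auto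
    finally show ?thesis by (simp add: sum_negf)
  qed
  have B: "(\<Sum>i\<in>{0..n}. (-1) ^ i * (-1) ^ j * b j i)
     = (\<Sum>i\<in>{0..j}. (-1) ^ j * (-1) ^ i * b j i) + (\<Sum>i\<in>{j<..n}. (-1) ^ j * (-1) ^ i * b j i)"
    if j: "j < n" for j
  proof -
    have "{0..n} = {0..j} \<union> {j<..n}" "{0..j} \<inter> {j<..n} = {}" using j by auto
    then show ?thesis by (simp add: sum.union_disjoint mult.commute)
  qed
  have "(\<Sum>j\<in>{0..n}. \<Sum>i\<in>{0..Suc n}. (-1) ^ j * (-1) ^ i * a j i)
     = (\<Sum>j\<in>{0..n}. (\<Sum>i<j. (-1) ^ j * (-1) ^ i * a j i)) - (\<Sum>j\<in>{0..n}. (\<Sum>i\<in>{j<..n}. (-1) ^ j * (-1) ^ i * b j i))"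
    using A by (simp add: sum_subtractf del: sum.atLeast0_atMost_Suc)
  also have "(\<Sum>j\<in>{0..n}. (\<Sum>i\<in>{j<..n}. (-1) ^ j * (-1) ^ i * b j i)) = (\<Sum>j<n. (\<Sum>i\<in>{j<..n}. (-1) ^ j * (-1) ^ i * b j i))"
    by (rule sum.mono_neutral_right) auto
  also have "(\<Sum>j\<in>{0..n}. (\<Sum>i<j. (-1) ^ j * (-1) ^ i * a j i)) = (\<Sum>j<n. \<Sum>i\<in>{0..j}. - ((-1) ^ j * (-1) ^ i * a (Suc j) i))"
    by (simp add: atLeast0AtMost lessThan_Suc_atMost sum.atMost_shift del: sum.atMost_Suc)
  finally have "(\<Sum>j\<in>{0..n}. \<Sum>i\<in>{0..Suc n}. (-1) ^ j * (-1) ^ i * a j i)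
     = (\<Sum>j<n. \<Sum>i\<in>{0..j}. - ((-1) ^ j * (-1) ^ i * a (Suc j) i))
       - (\<Sum>j<n. (\<Sum>i\<in>{j<..n}. (-1) ^ j * (-1) ^ i * b j i))" .
  moreover have "(\<Sum>i\<in>{0..n}. \<Sum>j<n. (-1) ^ i * (-1) ^ j * b j i)
     = (\<Sum>j<n. (\<Sum>i\<in>{0..j}. (-1) ^ j * (-1) ^ i * b j i) + (\<Sum>i\<in>{j<..n}. (-1) ^ j * (-1) ^ i * b j i))"
    by (subst sum.swap) (use B in simp)
  ultimately show ?thesis
    by (simp add: sum.distrib sum_subtractf sum_negf algebra_simps)
qed

section \<open>Linear maps\<close>

lemma lin_mapsI:
  assumes "\<And>x. x \<in> carrier M \<Longrightarrow> f x \<in> carrier N"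
    and "\<And>x y. x \<in> carrier M \<Longrightarrow> y \<in> carrier M \<Longrightarrow> f (x \<oplus>\<^bsub>M\<^esub> y) = f x \<oplus>\<^bsub>N\<^esub> f y"
    and "\<And>c x. c \<in> carrier R \<Longrightarrow> x \<in> carrier M \<Longrightarrow> f (c \<odot>\<^bsub>M\<^esub> x) = c \<odot>\<^bsub>N\<^esub> f x"
  shows "f \<in> lin_maps R M N"
  using assms by (simp add: lin_maps_def)

lemma
  assumes "f \<in> lin_maps R M N"
  shows lin_closed: "x \<in> carrier M \<Longrightarrow> f x \<in> carrier N"
    and lin_add: "x \<in> carrier M \<Longrightarrow> y \<in> carrier M \<Longrightarrow> f (x \<oplus>\<^bsub>M\<^esub> y) = f x \<oplus>\<^bsub>N\<^esub> f y"
    and lin_smult: "c \<in> carrier R \<Longrightarrow> x \<in> carrier M \<Longrightarrow> f (c \<odot>\<^bsub>M\<^esub> x) = c \<odot>\<^bsub>N\<^esub> f x"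
  using assms by (auto simp: lin_maps_def)

lemma module_cring: "module R M \<Longrightarrow> cring R"
  by (simp add: module_def)

lemma lin_zero:
  assumes "module R M" "module R N" "f \<in> lin_maps R M N"
  shows "f \<zero>\<^bsub>M\<^esub> = \<zero>\<^bsub>N\<^esub>"
proof -
  interpret M: module R M by fact
  interpret N: module R N by fact
  have "f \<zero>\<^bsub>M\<^esub> = f (\<zero>\<^bsub>R\<^esub> \<odot>\<^bsub>M\<^esub> \<zero>\<^bsub>M\<^esub>)" by simp
  also have "\<dots> = \<zero>\<^bsub>N\<^esub>"
    using lin_smult[OF assms(3), of "\<zero>\<^bsub>R\<^esub>" "\<zero>\<^bsub>M\<^esub>"] lin_closed[OF assms(3)] by simp
  finally show ?thesis .
qed

lemma lin_minus:
  assumes "module R M" "module R N" "f \<in> lin_maps R M N" "x \<in> carrier M"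
  shows "f (\<ominus>\<^bsub>M\<^esub> x) = \<ominus>\<^bsub>N\<^esub> f x"
proof -
  interpret M: module R M by fact
  interpret N: module R N by fact
  have "f (\<ominus>\<^bsub>M\<^esub> x) \<oplus>\<^bsub>N\<^esub> f x = \<zero>\<^bsub>N\<^esub>"
    using lin_add[OF assms(3), of "\<ominus>\<^bsub>M\<^esub> x" x] assms lin_zero[OF assms(1-3)] by (simp add: M.M.l_neg)
  then show ?thesis
    using N.M.minus_equality[of "f (\<ominus>\<^bsub>M\<^esub> x)" "f x"] lin_closed[OF assms(3)] assms(4) by simp
qed

lemma lin_diff:
  assumes "module R M" "module R N" "f \<in> lin_maps R M N" "x \<in> carrier M" "y \<in> carrier M"
  shows "f (x \<ominus>\<^bsub>M\<^esub> y) = f x \<ominus>\<^bsub>N\<^esub> f y"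
proof -
  interpret M: module R M by fact
  show ?thesis using lin_minus[OF assms(1-3,5)] lin_add[OF assms(3,4)] assms(5) by (simp add: a_minus_def)
qed

lemma lin_finsum:
  assumes "module R M" "module R N" "f \<in> lin_maps R M N" and g: "\<And>i. i \<in> S \<Longrightarrow> g i \<in> carrier M"
  shows "f (\<Oplus>\<^bsub>M\<^esub>i\<in>S. g i) = (\<Oplus>\<^bsub>N\<^esub>i\<in>S. f (g i))"
proof -
  interpret M: module R M by fact
  interpret N: module R N by fact
  note c = lin_closed[OF assms(3)]
  show ?thesis
  proof (cases "finite S")
    case True
    then show ?thesis using g
    proof (induction S)
      case empty
      then show ?case using lin_zero[OF assms(1-3)] by simp
    next
      case (insert i S)
      have "f (\<Oplus>\<^bsub>M\<^esub>i\<in>insert i S. g i) = f (g i \<oplus>\<^bsub>M\<^esub> (\<Oplus>\<^bsub>M\<^esub>i\<in>S. g i))"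
        using insert by (simp add: Pi_def)
      also have "\<dots> = f (g i) \<oplus>\<^bsub>N\<^esub> (\<Oplus>\<^bsub>N\<^esub>i\<in>S. f (g i))"
        using insert by (subst lin_add[OF assms(3)]) (auto intro!: M.M.finsum_closed)
      also have "\<dots> = (\<Oplus>\<^bsub>N\<^esub>i\<in>insert i S. f (g i))"
        using insert c by (simp add: Pi_def)
      finally show ?case .
    qed
  next
    case False
    then show ?thesis using lin_zero[OF assms(1-3)] by (simp add: M.M.finsum_infinite N.M.finsum_infinite)
  qed
qed

lemma lin_comp:
  "f \<in> lin_maps R M N \<Longrightarrow> g \<in> lin_maps R N P \<Longrightarrow> (\<lambda>x. g (f x)) \<in> lin_maps R M P"
  by (rule lin_mapsI) (simp_all add: lin_closed lin_add lin_smult)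

lemma lin_id: "(\<lambda>x. x) \<in> lin_maps R M M"
  by (rule lin_mapsI) simp_all

lemma lin_sum_fun:
  assumes N: "module R N" and S: "finite S" and f: "\<And>i. i \<in> S \<Longrightarrow> f i \<in> lin_maps R M N"
  shows "(\<lambda>x. \<Oplus>\<^bsub>N\<^esub>i\<in>S. f i x) \<in> lin_maps R M N"
proof -
  interpret N: module R N by fact
  have cl: "\<And>i x. i \<in> S \<Longrightarrow> x \<in> carrier M \<Longrightarrow> f i x \<in> carrier N" by (rule lin_closed[OF f])
  show ?thesis
  proof (rule lin_mapsI)
    fix x y assume x: "x \<in> carrier M" and y: "y \<in> carrier M"
    show "(\<Oplus>\<^bsub>N\<^esub>i\<in>S. f i x) \<in> carrier N" using cl x by (auto intro!: N.M.finsum_closed)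
    have "(\<Oplus>\<^bsub>N\<^esub>i\<in>S. f i (x \<oplus>\<^bsub>M\<^esub> y)) = (\<Oplus>\<^bsub>N\<^esub>i\<in>S. f i x \<oplus>\<^bsub>N\<^esub> f i y)"
      using x y by (intro N.M.finsum_cong') (auto simp: lin_add[OF f] cl)
    also have "\<dots> = (\<Oplus>\<^bsub>N\<^esub>i\<in>S. f i x) \<oplus>\<^bsub>N\<^esub> (\<Oplus>\<^bsub>N\<^esub>i\<in>S. f i y)"
      using x y by (intro N.M.finsum_addf) (auto simp: cl)
    finally show "(\<Oplus>\<^bsub>N\<^esub>i\<in>S. f i (x \<oplus>\<^bsub>M\<^esub> y)) = (\<Oplus>\<^bsub>N\<^esub>i\<in>S. f i x) \<oplus>\<^bsub>N\<^esub> (\<Oplus>\<^bsub>N\<^esub>i\<in>S. f i y)" .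
  next
    fix c x assume c: "c \<in> carrier R" and x: "x \<in> carrier M"
    have "(\<Oplus>\<^bsub>N\<^esub>i\<in>S. f i (c \<odot>\<^bsub>M\<^esub> x)) = (\<Oplus>\<^bsub>N\<^esub>i\<in>S. c \<odot>\<^bsub>N\<^esub> f i x)"
      using x c by (intro N.M.finsum_cong') (auto simp: lin_smult[OF f] cl)
    also have "\<dots> = c \<odot>\<^bsub>N\<^esub> (\<Oplus>\<^bsub>N\<^esub>i\<in>S. f i x)"
      using x c S by (intro N.finsum_smult_ldistr[symmetric]) (auto simp: cl)
    finally show "(\<Oplus>\<^bsub>N\<^esub>i\<in>S. f i (c \<odot>\<^bsub>M\<^esub> x)) = c \<odot>\<^bsub>N\<^esub> (\<Oplus>\<^bsub>N\<^esub>i\<in>S. f i x)" .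
  qed
qed

lemma lin_smult_fun:
  assumes N: "module R N" and d: "d \<in> carrier R" and f: "f \<in> lin_maps R M N"
  shows "(\<lambda>x. d \<odot>\<^bsub>N\<^esub> f x) \<in> lin_maps R M N"
proof -
  interpret N: module R N by fact
  show ?thesis
    by (rule lin_mapsI)
      (use d in \<open>simp_all add: lin_closed[OF f] lin_add[OF f] lin_smult[OF f] N.smult_r_distr
         N.smult_assoc1[symmetric] N.R.m_comm\<close>)
qed

lemma lin_add_fun:
  assumes N: "module R N" and f: "f \<in> lin_maps R M N" and g: "g \<in> lin_maps R M N"
  shows "(\<lambda>x. f x \<oplus>\<^bsub>N\<^esub> g x) \<in> lin_maps R M N"
proof -
  interpret N: module R N by fact
  show ?thesis
    by (rule lin_mapsI)
      (simp_all add: lin_closed[OF f] lin_add[OF f] lin_smult[OF f] lin_closed[OF g] lin_add[OF g]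
         lin_smult[OF g] N.smult_r_distr N.M.a_ac)
qed

lemma lin_diff_fun:
  assumes N: "module R N" and f: "f \<in> lin_maps R M N" and g: "g \<in> lin_maps R M N"
  shows "(\<lambda>x. f x \<ominus>\<^bsub>N\<^esub> g x) \<in> lin_maps R M N"
proof -
  interpret N: module R N by fact
  show ?thesis unfolding a_minus_def
  proof (rule lin_add_fun[OF N f], rule lin_mapsI)
    show "\<ominus>\<^bsub>N\<^esub> g (x \<oplus>\<^bsub>M\<^esub> y) = \<ominus>\<^bsub>N\<^esub> g x \<oplus>\<^bsub>N\<^esub> \<ominus>\<^bsub>N\<^esub> g y" if "x \<in> carrier M" "y \<in> carrier M" for x y
      using that by (simp add: lin_add[OF g] lin_closed[OF g] N.M.minus_add)
    show "\<ominus>\<^bsub>N\<^esub> g (c \<odot>\<^bsub>M\<^esub> x) = c \<odot>\<^bsub>N\<^esub> (\<ominus>\<^bsub>N\<^esub> g x)" if "c \<in> carrier R" "x \<in> carrier M" for c x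
      using that by (simp add: lin_smult[OF g] lin_closed[OF g] N.smult_r_minus)
  qed (simp add: lin_closed[OF g])
qed

lemma lin_zero_fun:
  assumes N: "module R N"
  shows "(\<lambda>x. \<zero>\<^bsub>N\<^esub>) \<in> lin_maps R M N"
proof -
  interpret N: module R N by fact
  show ?thesis by (rule lin_mapsI) simp_all
qed

lemma lin_cong:
  assumes M: "module R M" and f: "f \<in> lin_maps R M N" and eq: "\<And>x. x \<in> carrier M \<Longrightarrow> g x = f x"
  shows "g \<in> lin_maps R M N"
proof -
  interpret M: module R M by fact
  show ?thesis by (rule lin_mapsI) (simp_all add: eq lin_closed[OF f] lin_add[OF f] lin_smult[OF f])
qed

section \<open>Submodules and quotients\<close>

lemma submodule_preimage:
  assumes M: "module R M" and N: "module R N" and f: "f \<in> lin_maps R M N" and K: "submodule K R N"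
  shows "submodule {x \<in> carrier M. f x \<in> K} R M"
proof -
  interpret M: module R M by fact
  interpret N: module R N by fact
  note k = N.submoduleE[OF K]
  have "\<zero>\<^bsub>N\<^esub> \<in> K" using submodule.axioms(1)[OF K] subgroup.one_closed by fastforce
  then show ?thesis
    by (intro M.submoduleI)
      (auto simp: lin_zero[OF M N f] lin_minus[OF M N f] lin_add[OF f] lin_smult[OF f] k)
qed

lemma submodule_zero:
  assumes M: "module R M"
  shows "submodule {\<zero>\<^bsub>M\<^esub>} R M"
proof -
  interpret M: module R M by fact
  show ?thesis by (rule M.submoduleI) auto
qed

lemma submodule_image:
  assumes M: "module R M" and N: "module R N" and f: "f \<in> lin_maps R M N"
  shows "submodule (f ` carrier M) R N"
proof -
  interpret M: module R M by fact
  interpret N: module R N by fact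
  show ?thesis
  proof (rule N.submoduleI)
    show "f ` carrier M \<subseteq> carrier N" using lin_closed[OF f] by auto
    show "\<zero>\<^bsub>N\<^esub> \<in> f ` carrier M" using lin_zero[OF M N f] by force
    show "\<ominus>\<^bsub>N\<^esub> a \<in> f ` carrier M" if a: "a \<in> f ` carrier M" for a
    proof -
      obtain x where x: "x \<in> carrier M" "a = f x" using a by auto
      then have "\<ominus>\<^bsub>N\<^esub> a = f (\<ominus>\<^bsub>M\<^esub> x)" using lin_minus[OF M N f] by simp
      then show ?thesis using x by simp
    qed
    show "a \<oplus>\<^bsub>N\<^esub> b \<in> f ` carrier M" if ab: "a \<in> f ` carrier M" "b \<in> f ` carrier M" for a b
    proof -
      obtain x y where x: "x \<in> carrier M" "a = f x" "y \<in> carrier M" "b = f y" using ab by auto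
      then have "a \<oplus>\<^bsub>N\<^esub> b = f (x \<oplus>\<^bsub>M\<^esub> y)" using lin_add[OF f] by simp
      then show ?thesis using x by simp
    qed
    show "c \<odot>\<^bsub>N\<^esub> a \<in> f ` carrier M" if ca: "c \<in> carrier R" "a \<in> f ` carrier M" for c a
    proof -
      obtain x where x: "x \<in> carrier M" "a = f x" using ca by auto
      then have "c \<odot>\<^bsub>N\<^esub> a = f (c \<odot>\<^bsub>M\<^esub> x)" using lin_smult[OF f] ca by simp
      then show ?thesis using x ca by simp
    qed
  qed
qed

lemma submodule_mod_span:
  assumes M: "module R M" and S: "S \<subseteq> carrier M"
  shows "submodule (mod_span R M S) R M"
proof -
  interpret M: module R M by fact
  let ?N = "{N. submodule N R M \<and> S \<subseteq> N}"
  have car: "carrier M \<in> ?N" using M.carrier_is_submodule S by simp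
  have N: "submodule N R M" if "N \<in> ?N" for N using that by simp
  show ?thesis unfolding mod_span_def
  proof (rule M.submoduleI)
    show "\<Inter>?N \<subseteq> carrier M" using car by (rule Inter_lower)
    show "\<zero>\<^bsub>M\<^esub> \<in> \<Inter>?N"
    proof (rule InterI)
      fix N assume "N \<in> ?N"
      from subgroup.one_closed[OF submodule.axioms(1)[OF N[OF this]]] show "\<zero>\<^bsub>M\<^esub> \<in> N" by simp
    qed
    fix a assume a: "a \<in> \<Inter>?N"
    show "\<ominus>\<^bsub>M\<^esub> a \<in> \<Inter>?N"
      by (rule InterI, rule M.submoduleE(3)[OF N]) (assumption, rule InterD[OF a], assumption)
    show "a \<oplus>\<^bsub>M\<^esub> b \<in> \<Inter>?N" if b: "b \<in> \<Inter>?N" for b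
      by (rule InterI, rule M.submoduleE(5)[OF N]) (assumption, rule InterD[OF a], assumption, rule InterD[OF b], assumption)
    show "c \<odot>\<^bsub>M\<^esub> a \<in> \<Inter>?N" if c: "c \<in> carrier R" for c
      by (rule InterI, rule M.submoduleE(4)[OF N _ ]) (assumption, rule c, rule InterD[OF a], assumption)
  qed
qed

lemma mod_span_superset: "S \<subseteq> mod_span R M S"
  by (auto simp: mod_span_def)

lemma mod_span_minimal: "submodule N R M \<Longrightarrow> S \<subseteq> N \<Longrightarrow> mod_span R M S \<subseteq> N"
  by (auto simp: mod_span_def)

lemma lin_kills_span:
  assumes M: "module R M" and N: "module R N" and f: "f \<in> lin_maps R M N"
    and S: "S \<subseteq> carrier M" "\<And>s. s \<in> S \<Longrightarrow> f s = \<zero>\<^bsub>N\<^esub>" and x: "x \<in> mod_span R M S"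
  shows "f x = \<zero>\<^bsub>N\<^esub>"
proof -
  have "mod_span R M S \<subseteq> {x \<in> carrier M. f x \<in> {\<zero>\<^bsub>N\<^esub>}}"
    by (rule mod_span_minimal[OF submodule_preimage[OF M N f submodule_zero[OF N]]]) (use S in auto)
  then show ?thesis using x by auto
qed

lemma quotient_simps [simp]:
  "carrier (quotient_module M N) = a_rcosets\<^bsub>M\<^esub> N"
  "zero (quotient_module M N) = N"
  "add (quotient_module M N) = (\<lambda>X Y. X <+>\<^bsub>M\<^esub> Y)"
  by (simp_all add: quotient_module_def)

lemma submodule_abelian_subgroup:
  assumes "module R M" "submodule N R M"
  shows "abelian_subgroup N M"
  using assms by (intro abelian_subgroupI3) (auto simp: additive_subgroup_def module_def submodule_def)

lemma carrier_quotient: "carrier (quotient_module M N) = (\<lambda>x. N +>\<^bsub>M\<^esub> x) ` carrier M"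
  by (auto simp: A_RCOSETS_def RCOSETS_def a_r_coset_def)

lemma coset_eq_iff:
  assumes M: "module R M" and N: "submodule N R M" and x: "x \<in> carrier M" and y: "y \<in> carrier M"
  shows "N +>\<^bsub>M\<^esub> x = N +>\<^bsub>M\<^esub> y \<longleftrightarrow> x \<ominus>\<^bsub>M\<^esub> y \<in> N"
proof -
  interpret M: module R M by fact
  interpret N: abelian_subgroup N M using submodule_abelian_subgroup[OF M N] .
  have "x \<in> N +>\<^bsub>M\<^esub> y \<longleftrightarrow> x \<ominus>\<^bsub>M\<^esub> y \<in> N"
  proof
    assume "x \<in> N +>\<^bsub>M\<^esub> y"
    then obtain h where "h \<in> N" "x = h \<oplus>\<^bsub>M\<^esub> y" by (auto simp: a_r_coset_def' )
    then show "x \<ominus>\<^bsub>M\<^esub> y \<in> N" using y by (simp add: a_minus_def M.M.a_assoc M.M.r_neg)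
  next
    assume "x \<ominus>\<^bsub>M\<^esub> y \<in> N"
    moreover have "x = (x \<ominus>\<^bsub>M\<^esub> y) \<oplus>\<^bsub>M\<^esub> y" using x y by (simp add: a_minus_def M.M.a_assoc M.M.l_neg)
    ultimately show "x \<in> N +>\<^bsub>M\<^esub> y" by (auto simp: a_r_coset_def')
  qed
  then show ?thesis
    using N.a_repr_independence'[of x y] N.a_rcos_self[OF x] y by auto
qed

lemma coset_zero_iff:
  assumes M: "module R M" and N: "submodule N R M" and x: "x \<in> carrier M"
  shows "N +>\<^bsub>M\<^esub> x = N \<longleftrightarrow> x \<in> N"
proof -
  interpret M: module R M by fact
  have s: "N \<subseteq> carrier M" using M.submoduleE(1)[OF N] .
  have z: "N +>\<^bsub>M\<^esub> \<zero>\<^bsub>M\<^esub> = N" using s by simp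
  have "\<ominus>\<^bsub>M\<^esub> \<zero>\<^bsub>M\<^esub> = \<zero>\<^bsub>M\<^esub>" using M.M.minus_equality[of "\<zero>\<^bsub>M\<^esub>" "\<zero>\<^bsub>M\<^esub>"] by simp
  then have "x \<ominus>\<^bsub>M\<^esub> \<zero>\<^bsub>M\<^esub> = x" using x by (simp only: a_minus_def M.M.r_zero)
  then show ?thesis using coset_eq_iff[OF M N x M.M.zero_closed] unfolding z by simp
qed

lemma quotient_smult:
  assumes M: "module R M" and N: "submodule N R M" and c: "c \<in> carrier R" and x: "x \<in> carrier M"
  shows "c \<odot>\<^bsub>quotient_module M N\<^esub> (N +>\<^bsub>M\<^esub> x) = N +>\<^bsub>M\<^esub> (c \<odot>\<^bsub>M\<^esub> x)"
proof -
  interpret M: module R M by fact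
  interpret N: abelian_subgroup N M using submodule_abelian_subgroup[OF M N] .
  have "N +>\<^bsub>M\<^esub> (c \<odot>\<^bsub>M\<^esub> y) = N +>\<^bsub>M\<^esub> (c \<odot>\<^bsub>M\<^esub> x)" if "y \<in> N +>\<^bsub>M\<^esub> x" for y
  proof -
    have y: "y \<in> carrier M" using that x N.a_elemrcos_carrier by blast
    have "N +>\<^bsub>M\<^esub> y = N +>\<^bsub>M\<^esub> x" using that x N.a_repr_independence' by simp
    then have "y \<ominus>\<^bsub>M\<^esub> x \<in> N" using coset_eq_iff[OF M N y x] by simp
    then have "c \<odot>\<^bsub>M\<^esub> (y \<ominus>\<^bsub>M\<^esub> x) \<in> N" using M.submoduleE(4)[OF N c] by simp
    also have "c \<odot>\<^bsub>M\<^esub> (y \<ominus>\<^bsub>M\<^esub> x) = c \<odot>\<^bsub>M\<^esub> y \<ominus>\<^bsub>M\<^esub> c \<odot>\<^bsub>M\<^esub> x"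
      using c x y by (simp add: a_minus_def M.smult_r_distr M.smult_r_minus)
    finally show ?thesis using coset_eq_iff[OF M N, of "c \<odot>\<^bsub>M\<^esub> y" "c \<odot>\<^bsub>M\<^esub> x"] c x y by simp
  qed
  then have "(\<Union>y\<in>N +>\<^bsub>M\<^esub> x. N +>\<^bsub>M\<^esub> (c \<odot>\<^bsub>M\<^esub> y)) = N +>\<^bsub>M\<^esub> (c \<odot>\<^bsub>M\<^esub> x)"
    using N.a_rcos_self[OF x] by blast
  then show ?thesis by (simp add: quotient_module_def)
qed

lemma quotient_add:
  assumes M: "module R M" and N: "submodule N R M" and x: "x \<in> carrier M" and y: "y \<in> carrier M"
  shows "(N +>\<^bsub>M\<^esub> x) \<oplus>\<^bsub>quotient_module M N\<^esub> (N +>\<^bsub>M\<^esub> y) = N +>\<^bsub>M\<^esub> (x \<oplus>\<^bsub>M\<^esub> y)"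
  using abelian_subgroup.a_rcos_sum[OF submodule_abelian_subgroup[OF M N] x y] by simp

lemma quotient_is_module:
  assumes M: "module R M" and N: "submodule N R M"
  shows "module R (quotient_module M N)"
proof -
  interpret M: module R M by fact
  interpret N: abelian_subgroup N M using submodule_abelian_subgroup[OF M N] .
  let ?Q = "quotient_module M N"
  have ex: "\<exists>x\<in>carrier M. X = N +>\<^bsub>M\<^esub> x" if "X \<in> carrier ?Q" for X
    using that unfolding carrier_quotient by auto
  have mem: "N +>\<^bsub>M\<^esub> x \<in> carrier ?Q" if "x \<in> carrier M" for x using that unfolding carrier_quotient by auto
  note qa = quotient_add[OF M N]
  have z: "N +>\<^bsub>M\<^esub> \<zero>\<^bsub>M\<^esub> = \<zero>\<^bsub>?Q\<^esub>" using M.submoduleE(1)[OF N] by simp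
  have ab: "abelian_group ?Q"
  proof (rule abelian_groupI)
    show "\<zero>\<^bsub>?Q\<^esub> \<in> carrier ?Q" unfolding z[symmetric] by (rule mem) simp
    fix X assume "X \<in> carrier ?Q"
    then obtain x where x: "x \<in> carrier M" "X = N +>\<^bsub>M\<^esub> x" using ex by blast
    show "\<zero>\<^bsub>?Q\<^esub> \<oplus>\<^bsub>?Q\<^esub> X = X" unfolding z[symmetric] x(2) qa[OF M.M.zero_closed x(1)] using x by simp
    have "(N +>\<^bsub>M\<^esub> (\<ominus>\<^bsub>M\<^esub> x)) \<oplus>\<^bsub>?Q\<^esub> X = \<zero>\<^bsub>?Q\<^esub>"
      unfolding z[symmetric] x(2) qa[OF M.M.a_inv_closed[OF x(1)] x(1)] using x by (simp add: M.M.l_neg)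
    then show "\<exists>Y\<in>carrier ?Q. Y \<oplus>\<^bsub>?Q\<^esub> X = \<zero>\<^bsub>?Q\<^esub>" using mem[OF M.M.a_inv_closed[OF x(1)]] by blast
    fix Y assume "Y \<in> carrier ?Q"
    then obtain y where y: "y \<in> carrier M" "Y = N +>\<^bsub>M\<^esub> y" using ex by blast
    show "X \<oplus>\<^bsub>?Q\<^esub> Y \<in> carrier ?Q" unfolding x(2) y(2) qa[OF x(1) y(1)] using x y by (intro mem) simp
    show "X \<oplus>\<^bsub>?Q\<^esub> Y = Y \<oplus>\<^bsub>?Q\<^esub> X"
      unfolding x(2) y(2) qa[OF x(1) y(1)] qa[OF y(1) x(1)] using x y by (simp add: M.M.a_comm)
    fix Z assume "Z \<in> carrier ?Q"
    then obtain w where w: "w \<in> carrier M" "Z = N +>\<^bsub>M\<^esub> w" using ex by blast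
    show "X \<oplus>\<^bsub>?Q\<^esub> Y \<oplus>\<^bsub>?Q\<^esub> Z = X \<oplus>\<^bsub>?Q\<^esub> (Y \<oplus>\<^bsub>?Q\<^esub> Z)"
      using x(1) y(1) w(1) unfolding x(2) y(2) w(2) by (simp only: qa M.M.a_closed M.M.a_assoc)
  qed
  show ?thesis
  proof (rule moduleI[OF M.R.is_cring ab])
    fix a X assume a: "a \<in> carrier R" and "X \<in> carrier ?Q"
    then obtain x where x: "x \<in> carrier M" "X = N +>\<^bsub>M\<^esub> x" using ex by blast
    show "a \<odot>\<^bsub>?Q\<^esub> X \<in> carrier ?Q" unfolding x(2) quotient_smult[OF M N a x(1)] using a x by (intro mem) simp
  next
    fix a b X assume a: "a \<in> carrier R" and b: "b \<in> carrier R" and "X \<in> carrier ?Q"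
    then obtain x where x: "x \<in> carrier M" "X = N +>\<^bsub>M\<^esub> x" using ex by blast
    show "(a \<oplus>\<^bsub>R\<^esub> b) \<odot>\<^bsub>?Q\<^esub> X = a \<odot>\<^bsub>?Q\<^esub> X \<oplus>\<^bsub>?Q\<^esub> b \<odot>\<^bsub>?Q\<^esub> X"
      using a b x(1) unfolding x(2)
      by (simp only: quotient_smult[OF M N] quotient_add[OF M N] M.smult_closed M.R.a_closed M.smult_l_distr)
    show "(a \<otimes>\<^bsub>R\<^esub> b) \<odot>\<^bsub>?Q\<^esub> X = a \<odot>\<^bsub>?Q\<^esub> (b \<odot>\<^bsub>?Q\<^esub> X)"
      using a b x(1) unfolding x(2)
      by (simp only: quotient_smult[OF M N] M.smult_closed M.R.m_closed M.smult_assoc1)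
  next
    fix a X Y assume a: "a \<in> carrier R" and "X \<in> carrier ?Q" "Y \<in> carrier ?Q"
    then obtain x y where x: "x \<in> carrier M" "X = N +>\<^bsub>M\<^esub> x" "y \<in> carrier M" "Y = N +>\<^bsub>M\<^esub> y" using ex by blast
    show "a \<odot>\<^bsub>?Q\<^esub> (X \<oplus>\<^bsub>?Q\<^esub> Y) = a \<odot>\<^bsub>?Q\<^esub> X \<oplus>\<^bsub>?Q\<^esub> a \<odot>\<^bsub>?Q\<^esub> Y"
      using a x(1,3) unfolding x(2,4)
      by (simp only: quotient_smult[OF M N] quotient_add[OF M N] M.smult_closed M.M.a_closed M.smult_r_distr)
  next
    fix X assume "X \<in> carrier ?Q"
    then obtain x where x: "x \<in> carrier M" "X = N +>\<^bsub>M\<^esub> x" using ex by blast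
    show "\<one>\<^bsub>R\<^esub> \<odot>\<^bsub>?Q\<^esub> X = X" unfolding x(2) using x(1) by (simp only: quotient_smult[OF M N] M.R.one_closed M.smult_one)
  qed
qed

lemma quotient_proj:
  assumes M: "module R M" and N: "submodule N R M"
  shows "(\<lambda>x. N +>\<^bsub>M\<^esub> x) \<in> lin_maps R M (quotient_module M N)"
  by (rule lin_mapsI) (auto simp only: carrier_quotient quotient_add[OF M N] quotient_smult[OF M N])

lemma induced_coset:
  assumes M: "module R M" and N: "submodule N R M" and P: "module R P" and f: "f \<in> lin_maps R M P"
    and kill: "\<And>x. x \<in> N \<Longrightarrow> f x = \<zero>\<^bsub>P\<^esub>" and x: "x \<in> carrier M"
  shows "induced f (N +>\<^bsub>M\<^esub> x) = f x"
proof -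
  interpret M: module R M by fact
  interpret P: module R P by fact
  interpret N: abelian_subgroup N M using submodule_abelian_subgroup[OF M N] .
  have "f y = f x" if "y \<in> N +>\<^bsub>M\<^esub> x" for y
  proof -
    obtain h where h: "h \<in> N" "y = h \<oplus>\<^bsub>M\<^esub> x" using \<open>y \<in> N +>\<^bsub>M\<^esub> x\<close> by (auto simp: a_r_coset_def')
    then have "h \<in> carrier M" by auto
    then show ?thesis using h kill x by (simp add: lin_add[OF f] lin_closed[OF f])
  qed
  then have "f ` (N +>\<^bsub>M\<^esub> x) = {f x}" using N.a_rcos_self[OF x] by blast
  then show ?thesis by (simp add: induced_def)
qed

lemma induced_lin:
  assumes M: "module R M" and N: "submodule N R M" and P: "module R P" and f: "f \<in> lin_maps R M P"
    and kill: "\<And>x. x \<in> N \<Longrightarrow> f x = \<zero>\<^bsub>P\<^esub>"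
  shows "induced f \<in> lin_maps R (quotient_module M N) P"
proof -
  interpret M: module R M by fact
  have i: "induced f (N +>\<^bsub>M\<^esub> x) = f x" if "x \<in> carrier M" for x
    by (rule induced_coset[OF M N P f _ that]) (rule kill)
  have ex: "\<exists>x\<in>carrier M. X = N +>\<^bsub>M\<^esub> x" if "X \<in> carrier (quotient_module M N)" for X
    using that unfolding carrier_quotient by auto
  show ?thesis
  proof (rule lin_mapsI)
    fix X Y assume "X \<in> carrier (quotient_module M N)" "Y \<in> carrier (quotient_module M N)"
    then obtain x y where x: "x \<in> carrier M" "X = N +>\<^bsub>M\<^esub> x" "y \<in> carrier M" "Y = N +>\<^bsub>M\<^esub> y" using ex by blast
    show "induced f X \<in> carrier P" unfolding x(2) i[OF x(1)] using lin_closed[OF f x(1)] .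
    show "induced f (X \<oplus>\<^bsub>quotient_module M N\<^esub> Y) = induced f X \<oplus>\<^bsub>P\<^esub> induced f Y"
      unfolding x(2,4) quotient_add[OF M N x(1,3)] using x(1,3) by (simp add: i lin_add[OF f])
  next
    fix c X assume c: "c \<in> carrier R" and "X \<in> carrier (quotient_module M N)"
    then obtain x where x: "x \<in> carrier M" "X = N +>\<^bsub>M\<^esub> x" using ex by blast
    show "induced f (c \<odot>\<^bsub>quotient_module M N\<^esub> X) = c \<odot>\<^bsub>P\<^esub> induced f X"
      unfolding x(2) quotient_smult[OF M N c x(1)] using c x(1) by (simp add: i lin_smult[OF f])
  qed
qed

section \<open>Free modules and presentations\<close>

lemma free_simps [simp]:
  "zero (free_module R X) = (\<lambda>x. \<zero>\<^bsub>R\<^esub>)"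
  "add (free_module R X) = (\<lambda>\<phi> \<psi> x. \<phi> x \<oplus>\<^bsub>R\<^esub> \<psi> x)"
  "module.smult (free_module R X) = (\<lambda>c \<phi> x. c \<otimes>\<^bsub>R\<^esub> \<phi> x)"
  by (simp_all add: free_module_def)

lemma free_carrier:
  "\<phi> \<in> carrier (free_module R X) \<longleftrightarrow>
     finite {x. \<phi> x \<noteq> \<zero>\<^bsub>R\<^esub>} \<and> {x. \<phi> x \<noteq> \<zero>\<^bsub>R\<^esub>} \<subseteq> X \<and> (\<forall>x. \<phi> x \<in> carrier R)"
  by (auto simp: free_module_def)

lemma free_is_module:
  assumes "cring R"
  shows "module R (free_module R X)"
proof -
  interpret R: cring R by fact
  let ?F = "free_module R X"
  have ab: "abelian_group ?F"
  proof (rule abelian_groupI)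
    fix \<phi> \<psi> assume p: "\<phi> \<in> carrier ?F" "\<psi> \<in> carrier ?F"
    have "{x. \<phi> x \<oplus>\<^bsub>R\<^esub> \<psi> x \<noteq> \<zero>\<^bsub>R\<^esub>} \<subseteq> {x. \<phi> x \<noteq> \<zero>\<^bsub>R\<^esub>} \<union> {x. \<psi> x \<noteq> \<zero>\<^bsub>R\<^esub>}" by auto
    then show "\<phi> \<oplus>\<^bsub>?F\<^esub> \<psi> \<in> carrier ?F"
      using p unfolding free_carrier free_simps by (auto intro: finite_subset)
  next
    fix \<phi> assume p: "\<phi> \<in> carrier ?F"
    have "{x. \<ominus>\<^bsub>R\<^esub> \<phi> x \<noteq> \<zero>\<^bsub>R\<^esub>} \<subseteq> {x. \<phi> x \<noteq> \<zero>\<^bsub>R\<^esub>}" by auto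
    then have "(\<lambda>x. \<ominus>\<^bsub>R\<^esub> \<phi> x) \<in> carrier ?F" using p unfolding free_carrier by (auto intro: finite_subset)
    moreover have "(\<lambda>x. \<ominus>\<^bsub>R\<^esub> \<phi> x) \<oplus>\<^bsub>?F\<^esub> \<phi> = \<zero>\<^bsub>?F\<^esub>" using p by (simp add: free_carrier R.l_neg)
    ultimately show "\<exists>y\<in>carrier ?F. y \<oplus>\<^bsub>?F\<^esub> \<phi> = \<zero>\<^bsub>?F\<^esub>" by blast
  qed (auto simp: free_carrier R.a_ac)
  show ?thesis
  proof (rule moduleI[OF assms ab])
    fix a \<phi> assume a: "a \<in> carrier R" and p: "\<phi> \<in> carrier ?F"
    have "{x. a \<otimes>\<^bsub>R\<^esub> \<phi> x \<noteq> \<zero>\<^bsub>R\<^esub>} \<subseteq> {x. \<phi> x \<noteq> \<zero>\<^bsub>R\<^esub>}" using a by auto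
    then show "a \<odot>\<^bsub>?F\<^esub> \<phi> \<in> carrier ?F" using a p unfolding free_carrier free_simps by (auto intro: finite_subset)
  qed (auto simp: free_carrier R.l_distr R.r_distr R.m_assoc)
qed

lemma free_gen_carrier:
  assumes "cring R" "x \<in> X"
  shows "free_gen R x \<in> carrier (free_module R X)"
proof -
  interpret R: cring R by fact
  have "{y. free_gen R x y \<noteq> \<zero>\<^bsub>R\<^esub>} \<subseteq> {x}" by (auto simp: free_gen_def)
  then show ?thesis using assms(2) unfolding free_carrier by (auto intro: finite_subset simp: free_gen_def)
qed

text \<open>The definition sums over the support. Here the support may be enlarged, so that two elements can be
  added over a common index set.\<close>

lemma free_extend_finsum:
  assumes N: "module R N" and f: "\<And>x. x \<in> X \<Longrightarrow> f x \<in> carrier N"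
    and p: "\<phi> \<in> carrier (free_module R X)" and S: "finite S" "{x. \<phi> x \<noteq> \<zero>\<^bsub>R\<^esub>} \<subseteq> S" "S \<subseteq> X"
  shows "free_extend R N f \<phi> = (\<Oplus>\<^bsub>N\<^esub>x\<in>S. \<phi> x \<odot>\<^bsub>N\<^esub> f x)"
proof -
  interpret N: module R N by fact
  show ?thesis unfolding free_extend_def
    by (rule N.M.add.finprod_mono_neutral_cong_left) (use S f p in \<open>auto simp: free_carrier\<close>)
qed

lemma free_extend_gen:
  assumes N: "module R N" and f: "\<And>x. x \<in> X \<Longrightarrow> f x \<in> carrier N" and x: "x \<in> X"
  shows "free_extend R N f (free_gen R x) = f x"
proof -
  interpret N: module R N by fact
  have "free_extend R N f (free_gen R x) = (\<Oplus>\<^bsub>N\<^esub>y\<in>{x}. free_gen R x y \<odot>\<^bsub>N\<^esub> f y)"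
    by (rule free_extend_finsum[OF N f free_gen_carrier[OF N.R.is_cring x]])
      (use x in \<open>auto simp: free_gen_def\<close>)
  also have "\<dots> = f x" using f[OF x] by (simp add: free_gen_def)
  finally show ?thesis .
qed

lemma free_extend_lin:
  assumes N: "module R N" and f: "\<And>x. x \<in> X \<Longrightarrow> f x \<in> carrier N"
  shows "free_extend R N f \<in> lin_maps R (free_module R X) N"
proof -
  interpret N: module R N by fact
  let ?F = "free_module R X"
  interpret F: module R ?F by (rule free_is_module[OF N.R.is_cring])
  note ext = free_extend_finsum[OF N f]
  show ?thesis
  proof (rule lin_mapsI)
    fix \<phi> assume p: "\<phi> \<in> carrier ?F"
    show "free_extend R N f \<phi> \<in> carrier N"
      unfolding free_extend_def using p f by (auto simp: free_carrier intro!: N.M.finsum_closed)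
  next
    fix \<phi> \<psi> assume p: "\<phi> \<in> carrier ?F" and q: "\<psi> \<in> carrier ?F"
    let ?S = "{x. \<phi> x \<noteq> \<zero>\<^bsub>R\<^esub>} \<union> {x. \<psi> x \<noteq> \<zero>\<^bsub>R\<^esub>}"
    have S: "finite ?S" "?S \<subseteq> X" using p q by (auto simp: free_carrier)
    have s: "{x. (\<phi> \<oplus>\<^bsub>?F\<^esub> \<psi>) x \<noteq> \<zero>\<^bsub>R\<^esub>} \<subseteq> ?S" by auto
    have c: "\<phi> x \<in> carrier R" "\<psi> x \<in> carrier R" for x using p q by (auto simp: free_carrier)
    have fS: "f x \<in> carrier N" if "x \<in> ?S" for x using that S f by blast
    have "free_extend R N f (\<phi> \<oplus>\<^bsub>?F\<^esub> \<psi>) = (\<Oplus>\<^bsub>N\<^esub>x\<in>?S. (\<phi> \<oplus>\<^bsub>?F\<^esub> \<psi>) x \<odot>\<^bsub>N\<^esub> f x)"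
      by (rule ext[OF _ F.M.a_closed[OF p q] S(1) s S(2)])
    also have "\<dots> = (\<Oplus>\<^bsub>N\<^esub>x\<in>?S. \<phi> x \<odot>\<^bsub>N\<^esub> f x \<oplus>\<^bsub>N\<^esub> \<psi> x \<odot>\<^bsub>N\<^esub> f x)"
      using fS c by (intro N.M.finsum_cong') (auto simp: N.smult_l_distr)
    also have "\<dots> = (\<Oplus>\<^bsub>N\<^esub>x\<in>?S. \<phi> x \<odot>\<^bsub>N\<^esub> f x) \<oplus>\<^bsub>N\<^esub> (\<Oplus>\<^bsub>N\<^esub>x\<in>?S. \<psi> x \<odot>\<^bsub>N\<^esub> f x)"
      using fS c by (intro N.M.finsum_addf) auto
    also have "(\<Oplus>\<^bsub>N\<^esub>x\<in>?S. \<phi> x \<odot>\<^bsub>N\<^esub> f x) = free_extend R N f \<phi>"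
      by (rule ext[OF _ p S(1) _ S(2), symmetric]) auto
    also have "(\<Oplus>\<^bsub>N\<^esub>x\<in>?S. \<psi> x \<odot>\<^bsub>N\<^esub> f x) = free_extend R N f \<psi>"
      by (rule ext[OF _ q S(1) _ S(2), symmetric]) auto
    finally show "free_extend R N f (\<phi> \<oplus>\<^bsub>?F\<^esub> \<psi>) = free_extend R N f \<phi> \<oplus>\<^bsub>N\<^esub> free_extend R N f \<psi>" .
  next
    fix c \<phi> assume c: "c \<in> carrier R" and p: "\<phi> \<in> carrier ?F"
    let ?S = "{x. \<phi> x \<noteq> \<zero>\<^bsub>R\<^esub>}"
    have S: "finite ?S" "?S \<subseteq> X" using p by (auto simp: free_carrier)
    have s: "{x. (c \<odot>\<^bsub>?F\<^esub> \<phi>) x \<noteq> \<zero>\<^bsub>R\<^esub>} \<subseteq> ?S" using c by auto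
    have cp: "\<phi> x \<in> carrier R" for x using p by (auto simp: free_carrier)
    have fS: "f x \<in> carrier N" if "x \<in> ?S" for x using that S f by blast
    have "free_extend R N f (c \<odot>\<^bsub>?F\<^esub> \<phi>) = (\<Oplus>\<^bsub>N\<^esub>x\<in>?S. (c \<odot>\<^bsub>?F\<^esub> \<phi>) x \<odot>\<^bsub>N\<^esub> f x)"
      by (rule ext[OF _ F.smult_closed[OF c p] S(1) s S(2)])
    also have "\<dots> = (\<Oplus>\<^bsub>N\<^esub>x\<in>?S. c \<odot>\<^bsub>N\<^esub> (\<phi> x \<odot>\<^bsub>N\<^esub> f x))"
      using fS cp c by (intro N.M.finsum_cong') (auto simp: N.smult_assoc1)
    also have "\<dots> = c \<odot>\<^bsub>N\<^esub> (\<Oplus>\<^bsub>N\<^esub>x\<in>?S. \<phi> x \<odot>\<^bsub>N\<^esub> f x)"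
      using fS cp c S by (intro N.finsum_smult_ldistr[symmetric]) auto
    finally show "free_extend R N f (c \<odot>\<^bsub>?F\<^esub> \<phi>) = c \<odot>\<^bsub>N\<^esub> free_extend R N f \<phi>"
      by (simp add: free_extend_def)
  qed
qed

lemma free_lin_eq:
  assumes N: "module R N" and f: "f \<in> lin_maps R (free_module R X) N" and g: "g \<in> lin_maps R (free_module R X) N"
    and eq: "\<And>x. x \<in> X \<Longrightarrow> f (free_gen R x) = g (free_gen R x)" and p: "\<phi> \<in> carrier (free_module R X)"
  shows "f \<phi> = g \<phi>"
proof -
  interpret N: module R N by fact
  let ?F = "free_module R X"
  have F: "module R ?F" by (rule free_is_module[OF N.R.is_cring])
  interpret F: module R ?F by fact
  have "finite S \<Longrightarrow> S \<subseteq> X \<Longrightarrow> \<phi> \<in> carrier ?F \<Longrightarrow> {x. \<phi> x \<noteq> \<zero>\<^bsub>R\<^esub>} \<subseteq> S \<Longrightarrow> f \<phi> = g \<phi>" for S \<phi>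
  proof (induction S arbitrary: \<phi> rule: finite_induct)
    case empty
    then have "\<phi> = \<zero>\<^bsub>?F\<^esub>" by auto
    then show ?case using lin_zero[OF F N f] lin_zero[OF F N g] by simp
  next
    case (insert x S)
    let ?\<psi> = "\<phi>(x := \<zero>\<^bsub>R\<^esub>)"
    have x: "x \<in> X" using insert by simp
    have px: "\<phi> x \<in> carrier R" "\<And>y. \<phi> y \<in> carrier R" using insert by (auto simp: free_carrier)
    have sub: "{y. ?\<psi> y \<noteq> \<zero>\<^bsub>R\<^esub>} \<subseteq> {y. \<phi> y \<noteq> \<zero>\<^bsub>R\<^esub>} \<inter> S" using insert.prems by auto
    have psi: "?\<psi> \<in> carrier ?F" using insert.prems sub by (auto simp: free_carrier intro: finite_subset)
    have gx: "free_gen R x \<in> carrier ?F" by (rule free_gen_carrier[OF N.R.is_cring x])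
    have split: "\<phi> = ?\<psi> \<oplus>\<^bsub>?F\<^esub> \<phi> x \<odot>\<^bsub>?F\<^esub> free_gen R x" using px by (auto simp: free_gen_def)
    have cl: "\<phi> x \<odot>\<^bsub>?F\<^esub> free_gen R x \<in> carrier ?F" by (rule F.smult_closed[OF px(1) gx])
    have d: "h \<phi> = h ?\<psi> \<oplus>\<^bsub>N\<^esub> \<phi> x \<odot>\<^bsub>N\<^esub> h (free_gen R x)" if h: "h \<in> lin_maps R ?F N" for h
    proof -
      have "h \<phi> = h (?\<psi> \<oplus>\<^bsub>?F\<^esub> \<phi> x \<odot>\<^bsub>?F\<^esub> free_gen R x)" using split by (rule arg_cong)
      also have "\<dots> = h ?\<psi> \<oplus>\<^bsub>N\<^esub> \<phi> x \<odot>\<^bsub>N\<^esub> h (free_gen R x)"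
        unfolding lin_add[OF h psi cl] lin_smult[OF h px(1) gx] ..
      finally show ?thesis .
    qed
    have "f ?\<psi> = g ?\<psi>" by (rule insert.IH[OF _ psi]) (use insert.prems sub in auto)
    then show ?case unfolding d[OF f] d[OF g] eq[OF x] by simp
  qed
  then show ?thesis using p unfolding free_carrier by blast
qed

context
  fixes R :: "('k, 'r) ring_scheme" and X :: "'x set" and S :: "('x \<Rightarrow> 'k) set"
  assumes R: "cring R" and S: "S \<subseteq> carrier (free_module R X)"
begin

lemma pres_submodule: "submodule (mod_span R (free_module R X) S) R (free_module R X)"
  by (rule submodule_mod_span[OF free_is_module[OF R] S])

lemma pres_is_module: "module R (pres_module R X S)"
  unfolding pres_module_def by (rule quotient_is_module[OF free_is_module[OF R] pres_submodule])

lemma pres_gen_closed: "x \<in> X \<Longrightarrow> pres_gen R X S x \<in> carrier (pres_module R X S)"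
  unfolding pres_module_def pres_gen_def
  by (rule lin_closed[OF quotient_proj[OF free_is_module[OF R] pres_submodule] free_gen_carrier[OF R]])

lemma pres_lift:
  assumes N: "module R N" and f: "\<And>x. x \<in> X \<Longrightarrow> f x \<in> carrier N"
    and kill: "\<And>s. s \<in> S \<Longrightarrow> free_extend R N f s = \<zero>\<^bsub>N\<^esub>"
  shows pres_lift_lin: "pres_lift R N f \<in> lin_maps R (pres_module R X S) N"
    and pres_lift_gen: "x \<in> X \<Longrightarrow> pres_lift R N f (pres_gen R X S x) = f x"
proof -
  note F = free_is_module[OF R, of X]
  have e: "free_extend R N f \<in> lin_maps R (free_module R X) N" by (rule free_extend_lin[OF N]) (rule f)
  have k: "free_extend R N f s = \<zero>\<^bsub>N\<^esub>" if "s \<in> mod_span R (free_module R X) S" for s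
    by (rule lin_kills_span[OF F N e S _ that]) (rule kill)
  show "pres_lift R N f \<in> lin_maps R (pres_module R X S) N"
    unfolding pres_lift_def pres_module_def by (rule induced_lin[OF F pres_submodule N e]) (rule k)
  show "pres_lift R N f (pres_gen R X S x) = f x" if "x \<in> X"
    unfolding pres_lift_def pres_gen_def
    by (subst induced_coset[OF F pres_submodule N e _ free_gen_carrier[OF R that]], erule k)
      (rule free_extend_gen[OF N f that])
qed

lemma pres_lin_eq:
  assumes N: "module R N" and f: "f \<in> lin_maps R (pres_module R X S) N" and g: "g \<in> lin_maps R (pres_module R X S) N"
    and eq: "\<And>x. x \<in> X \<Longrightarrow> f (pres_gen R X S x) = g (pres_gen R X S x)" and p: "p \<in> carrier (pres_module R X S)"
  shows "f p = g p"
proof -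
  let ?N = "mod_span R (free_module R X) S" and ?F = "free_module R X"
  note F = free_is_module[OF R, of X]
  note pr = quotient_proj[OF F pres_submodule]
  obtain \<phi> where phi: "\<phi> \<in> carrier ?F" "p = ?N +>\<^bsub>?F\<^esub> \<phi>"
    using p unfolding pres_module_def carrier_quotient by auto
  have "f (?N +>\<^bsub>?F\<^esub> \<phi>) = g (?N +>\<^bsub>?F\<^esub> \<phi>)"
    by (rule free_lin_eq[OF N lin_comp[OF pr f[unfolded pres_module_def]] lin_comp[OF pr g[unfolded pres_module_def]] _ phi(1)])
      (use eq in \<open>simp add: pres_gen_def\<close>)
  then show ?thesis using phi by simp
qed

end

text \<open>The projection to the quotient by \<open>P\<close> and the zero map agree on the generators, hence everywhere.\<close>

lemma pres_generated:
  assumes R: "cring R" and S: "S \<subseteq> carrier (free_module R X)"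
    and P: "submodule P R (pres_module R X S)" and gen: "\<And>x. x \<in> X \<Longrightarrow> pres_gen R X S x \<in> P"
    and p: "p \<in> carrier (pres_module R X S)"
  shows "p \<in> P"
proof -
  note M = pres_is_module[OF R S]
  let ?Q = "quotient_module (pres_module R X S) P"
  note Q = quotient_is_module[OF M P] and pr = quotient_proj[OF M P]
  have "P +>\<^bsub>pres_module R X S\<^esub> p = \<zero>\<^bsub>?Q\<^esub>"
  proof (rule pres_lin_eq[OF R S Q pr lin_zero_fun[OF Q] _ p])
    fix x assume "x \<in> X"
    then show "P +>\<^bsub>pres_module R X S\<^esub> pres_gen R X S x = \<zero>\<^bsub>?Q\<^esub>"
      using coset_zero_iff[OF M P pres_gen_closed[OF R S]] gen by simp
  qed
  then show ?thesis using coset_zero_iff[OF M P p] by simp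
qed

section \<open>Presentations with additive and scalar relations\<close>

context
  fixes R :: "('k, 'r) ring_scheme" and X :: "'x set"
  assumes R: "cring R"
begin

abbreviation (input) "FF \<equiv> free_module R X"

text \<open>The relations of the tensor product and of the Hochschild modules are all of two shapes, one for sums
  and one for multiples. The lemmas of this part settle the two shapes once and for all: on one side a
  map that respects them, on the other the identities that they impose on the classes of generators.\<close>

lemma free_add_rel_closed:
  assumes "x \<in> X" "y \<in> X" "z \<in> X"
  shows "free_gen R x \<ominus>\<^bsub>FF\<^esub> (free_gen R y \<oplus>\<^bsub>FF\<^esub> free_gen R z) \<in> carrier FF"
proof -
  interpret F: module R FF by (rule free_is_module[OF R])
  show ?thesis using assms by (intro F.M.minus_closed F.M.a_closed free_gen_carrier[OF R])
qed

lemma free_smult_rel_closed: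
  assumes "x \<in> X" "y \<in> X" "c \<in> carrier R"
  shows "free_gen R x \<ominus>\<^bsub>FF\<^esub> c \<odot>\<^bsub>FF\<^esub> free_gen R y \<in> carrier FF"
proof -
  interpret F: module R FF by (rule free_is_module[OF R])
  show ?thesis using assms by (intro F.M.minus_closed F.smult_closed free_gen_carrier[OF R])
qed

lemma free_extend_add_rel:
  assumes N: "module R N" and f: "\<And>x. x \<in> X \<Longrightarrow> f x \<in> carrier N" and xyz: "x \<in> X" "y \<in> X" "z \<in> X"
    and eq: "f x = f y \<oplus>\<^bsub>N\<^esub> f z"
  shows "free_extend R N f (free_gen R x \<ominus>\<^bsub>FF\<^esub> (free_gen R y \<oplus>\<^bsub>FF\<^esub> free_gen R z)) = \<zero>\<^bsub>N\<^esub>"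
proof -
  interpret N: module R N by fact
  have F: "module R FF" by (rule free_is_module[OF R])
  interpret F: module R FF by fact
  have e: "free_extend R N f \<in> lin_maps R FF N" by (rule free_extend_lin[OF N]) (rule f)
  have g: "free_gen R x \<in> carrier FF" "free_gen R y \<in> carrier FF" "free_gen R z \<in> carrier FF"
    using xyz by (auto intro!: free_gen_carrier[OF R] simp del: free_simps)
  have v: "free_extend R N f (free_gen R x) = f x" if "x \<in> X" for x
    by (rule free_extend_gen[OF N _ that]) (rule f)
  show ?thesis
    unfolding lin_diff[OF F N e g(1) F.M.a_closed[OF g(2,3)]] lin_add[OF e g(2,3)] v[OF xyz(1)] v[OF xyz(2)] v[OF xyz(3)] eq
    unfolding a_minus_def by (rule N.M.r_neg) (use f xyz in simp)
qed

lemma free_extend_smult_rel: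
  assumes N: "module R N" and f: "\<And>x. x \<in> X \<Longrightarrow> f x \<in> carrier N" and xy: "x \<in> X" "y \<in> X" and c: "c \<in> carrier R"
    and eq: "f x = c \<odot>\<^bsub>N\<^esub> f y"
  shows "free_extend R N f (free_gen R x \<ominus>\<^bsub>FF\<^esub> c \<odot>\<^bsub>FF\<^esub> free_gen R y) = \<zero>\<^bsub>N\<^esub>"
proof -
  interpret N: module R N by fact
  have F: "module R FF" by (rule free_is_module[OF R])
  interpret F: module R FF by fact
  have e: "free_extend R N f \<in> lin_maps R FF N" by (rule free_extend_lin[OF N]) (rule f)
  have g: "free_gen R x \<in> carrier FF" "free_gen R y \<in> carrier FF"
    using xy by (auto intro!: free_gen_carrier[OF R] simp del: free_simps)
  have v: "free_extend R N f (free_gen R x) = f x" if "x \<in> X" for x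
    by (rule free_extend_gen[OF N _ that]) (rule f)
  show ?thesis
    unfolding lin_diff[OF F N e g(1) F.smult_closed[OF c g(2)]] lin_smult[OF e c g(2)] v[OF xy(1)] v[OF xy(2)] eq
    unfolding a_minus_def by (rule N.M.r_neg) (use f xy c in simp)
qed

lemma pres_gen_add:
  assumes S: "S \<subseteq> carrier FF" and xyz: "x \<in> X" "y \<in> X" "z \<in> X"
    and rel: "free_gen R x \<ominus>\<^bsub>FF\<^esub> (free_gen R y \<oplus>\<^bsub>FF\<^esub> free_gen R z) \<in> S"
  shows "pres_gen R X S x = pres_gen R X S y \<oplus>\<^bsub>pres_module R X S\<^esub> pres_gen R X S z"
proof -
  have F: "module R FF" by (rule free_is_module[OF R])
  interpret F: module R FF by fact
  have g: "free_gen R x \<in> carrier FF" "free_gen R y \<in> carrier FF" "free_gen R z \<in> carrier FF"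
    using xyz by (auto intro!: free_gen_carrier[OF R] simp del: free_simps)
  note sub = pres_submodule[OF R S]
  have "free_gen R x \<ominus>\<^bsub>FF\<^esub> (free_gen R y \<oplus>\<^bsub>FF\<^esub> free_gen R z) \<in> mod_span R FF S"
    using mod_span_superset rel by (rule subsetD)
  then show ?thesis
    unfolding pres_gen_def pres_module_def quotient_add[OF F sub g(2,3)]
    using coset_eq_iff[OF F sub g(1) F.M.a_closed[OF g(2,3)]] by (rule iffD2[rotated])
qed

lemma pres_gen_smult:
  assumes S: "S \<subseteq> carrier FF" and xy: "x \<in> X" "y \<in> X" and c: "c \<in> carrier R"
    and rel: "free_gen R x \<ominus>\<^bsub>FF\<^esub> c \<odot>\<^bsub>FF\<^esub> free_gen R y \<in> S"
  shows "pres_gen R X S x = c \<odot>\<^bsub>pres_module R X S\<^esub> pres_gen R X S y"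
proof -
  have F: "module R FF" by (rule free_is_module[OF R])
  interpret F: module R FF by fact
  have g: "free_gen R x \<in> carrier FF" "free_gen R y \<in> carrier FF"
    using xy by (auto intro!: free_gen_carrier[OF R] simp del: free_simps)
  note sub = pres_submodule[OF R S]
  have "free_gen R x \<ominus>\<^bsub>FF\<^esub> c \<odot>\<^bsub>FF\<^esub> free_gen R y \<in> mod_span R FF S"
    using mod_span_superset rel by (rule subsetD)
  then show ?thesis
    unfolding pres_gen_def pres_module_def quotient_smult[OF F sub c g(2)]
    using coset_eq_iff[OF F sub g(1) F.smult_closed[OF c g(2)]] by (rule iffD2[rotated])
qed

end

section \<open>Tensor products\<close>

definition bilin :: "('k, 'r) ring_scheme \<Rightarrow> ('k, 'x) module \<Rightarrow> ('k, 'y) module \<Rightarrow> ('k, 'z) module \<Rightarrow>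
    ('x \<Rightarrow> 'y \<Rightarrow> 'z) \<Rightarrow> bool" where
  "bilin R M N P f \<longleftrightarrow>
     (\<forall>x\<in>carrier M. f x \<in> lin_maps R N P) \<and> (\<forall>y\<in>carrier N. (\<lambda>x. f x y) \<in> lin_maps R M P)"

context
  fixes R :: "('k, 'r) ring_scheme" and M :: "('k, 'x) module" and N :: "('k, 'y) module"
  assumes M: "module R M" and N: "module R N"
begin

lemma tensor_rels_closed: "tensor_rels R M N \<subseteq> carrier (free_module R (carrier M \<times> carrier N))"
proof -
  interpret M: module R M by (rule M)
  interpret N: module R N by (rule N)
  show ?thesis unfolding tensor_rels_def Let_def
    by (intro Un_least subsetI) (elim CollectE exE conjE, hypsubst,
      (rule free_add_rel_closed[OF module_cring[OF M]] free_smult_rel_closed[OF module_cring[OF M]]; simp))+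
qed

lemma tensor_relI:
  fixes F g
  defines "F \<equiv> free_module R (carrier M \<times> carrier N)" and "g \<equiv> free_gen R"
  shows "\<lbrakk>x \<in> carrier M; x' \<in> carrier M; y \<in> carrier N\<rbrakk> \<Longrightarrow>
      g (x \<oplus>\<^bsub>M\<^esub> x', y) \<ominus>\<^bsub>F\<^esub> (g (x, y) \<oplus>\<^bsub>F\<^esub> g (x', y)) \<in> tensor_rels R M N"
    and "\<lbrakk>x \<in> carrier M; y \<in> carrier N; y' \<in> carrier N\<rbrakk> \<Longrightarrow>
      g (x, y \<oplus>\<^bsub>N\<^esub> y') \<ominus>\<^bsub>F\<^esub> (g (x, y) \<oplus>\<^bsub>F\<^esub> g (x, y')) \<in> tensor_rels R M N"
    and "\<lbrakk>c \<in> carrier R; x \<in> carrier M; y \<in> carrier N\<rbrakk> \<Longrightarrow>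
      g (c \<odot>\<^bsub>M\<^esub> x, y) \<ominus>\<^bsub>F\<^esub> c \<odot>\<^bsub>F\<^esub> g (x, y) \<in> tensor_rels R M N"
    and "\<lbrakk>c \<in> carrier R; x \<in> carrier M; y \<in> carrier N\<rbrakk> \<Longrightarrow>
      g (x, c \<odot>\<^bsub>N\<^esub> y) \<ominus>\<^bsub>F\<^esub> c \<odot>\<^bsub>F\<^esub> g (x, y) \<in> tensor_rels R M N"
  unfolding tensor_rels_def Let_def F_def g_def
  subgoal by (rule UnI1, rule UnI1, rule UnI1, rule CollectI, intro exI conjI, rule refl, assumption+)
  subgoal by (rule UnI1, rule UnI1, rule UnI2, rule CollectI, intro exI conjI, rule refl, assumption+)
  subgoal by (rule UnI1, rule UnI2, rule CollectI, intro exI conjI, rule refl, assumption+)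
  subgoal by (rule UnI2, rule CollectI, intro exI conjI, rule refl, assumption+)
  done

lemma tensor_is_module: "module R (tensor R M N)"
  unfolding tensor_def by (rule pres_is_module[OF module_cring[OF M] tensor_rels_closed])

lemma tensor_pure_closed: "x \<in> carrier M \<Longrightarrow> y \<in> carrier N \<Longrightarrow> tensor_pure R M N x y \<in> carrier (tensor R M N)"
  unfolding tensor_def tensor_pure_def by (rule pres_gen_closed[OF module_cring[OF M] tensor_rels_closed]) simp

lemma tensor_pure_bilin: "bilin R M N (tensor R M N) (tensor_pure R M N)"
proof -
  interpret M: module R M by (rule M)
  interpret N: module R N by (rule N)
  show ?thesis unfolding bilin_def
  proof (intro conjI ballI lin_mapsI)
    fix x y assume "x \<in> carrier M" "y \<in> carrier N"
    then show "tensor_pure R M N x y \<in> carrier (tensor R M N)" by (rule tensor_pure_closed)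
  next
    fix x y assume "y \<in> carrier N" "x \<in> carrier M"
    then show "tensor_pure R M N x y \<in> carrier (tensor R M N)" by (intro tensor_pure_closed)
  next
    fix x y y' assume a: "x \<in> carrier M" "y \<in> carrier N" "y' \<in> carrier N"
    show "tensor_pure R M N x (y \<oplus>\<^bsub>N\<^esub> y') = tensor_pure R M N x y \<oplus>\<^bsub>tensor R M N\<^esub> tensor_pure R M N x y'"
      unfolding tensor_def tensor_pure_def
      by (rule pres_gen_add[OF module_cring[OF M] tensor_rels_closed _ _ _ tensor_relI(2)[OF a]]) (use a in simp_all)
  next
    fix x c y assume a: "x \<in> carrier M" "c \<in> carrier R" "y \<in> carrier N"
    show "tensor_pure R M N x (c \<odot>\<^bsub>N\<^esub> y) = c \<odot>\<^bsub>tensor R M N\<^esub> tensor_pure R M N x y"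
      unfolding tensor_def tensor_pure_def
      by (rule pres_gen_smult[OF module_cring[OF M] tensor_rels_closed _ _ a(2) tensor_relI(4)[OF a(2,1,3)]]) (use a in simp_all)
  next
    fix y x x' assume a: "y \<in> carrier N" "x \<in> carrier M" "x' \<in> carrier M"
    show "tensor_pure R M N (x \<oplus>\<^bsub>M\<^esub> x') y = tensor_pure R M N x y \<oplus>\<^bsub>tensor R M N\<^esub> tensor_pure R M N x' y"
      unfolding tensor_def tensor_pure_def
      by (rule pres_gen_add[OF module_cring[OF M] tensor_rels_closed _ _ _ tensor_relI(1)[OF a(2,3,1)]]) (use a in simp_all)
  next
    fix y c x assume a: "y \<in> carrier N" "c \<in> carrier R" "x \<in> carrier M"
    show "tensor_pure R M N (c \<odot>\<^bsub>M\<^esub> x) y = c \<odot>\<^bsub>tensor R M N\<^esub> tensor_pure R M N x y"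
      unfolding tensor_def tensor_pure_def
      by (rule pres_gen_smult[OF module_cring[OF M] tensor_rels_closed _ _ a(2) tensor_relI(3)[OF a(2,3,1)]]) (use a in simp_all)
  qed
qed

lemma tensor_lin_eq:
  assumes P: "module R P" and f: "f \<in> lin_maps R (tensor R M N) P" and g: "g \<in> lin_maps R (tensor R M N) P"
    and eq: "\<And>x y. x \<in> carrier M \<Longrightarrow> y \<in> carrier N \<Longrightarrow> f (tensor_pure R M N x y) = g (tensor_pure R M N x y)"
    and p: "p \<in> carrier (tensor R M N)"
  shows "f p = g p"
  by (rule pres_lin_eq[OF module_cring[OF M] tensor_rels_closed P f[unfolded tensor_def] g[unfolded tensor_def] _ p[unfolded tensor_def]])
    (use eq in \<open>auto simp: tensor_pure_def\<close>)

lemma tensor_lift: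
  assumes P: "module R P" and f: "bilin R M N P f"
  shows tensor_lift_lin: "pres_lift R P (\<lambda>(x, y). f x y) \<in> lin_maps R (tensor R M N) P"
    and tensor_lift_pure: "x \<in> carrier M \<Longrightarrow> y \<in> carrier N \<Longrightarrow>
       pres_lift R P (\<lambda>(x, y). f x y) (tensor_pure R M N x y) = f x y"
proof -
  interpret M: module R M by (rule M)
  interpret N: module R N by (rule N)
  let ?X = "carrier M \<times> carrier N"
  let ?f = "\<lambda>(x, y). f x y"
  have f1: "f x \<in> lin_maps R N P" if "x \<in> carrier M" for x using f that by (simp add: bilin_def)
  have f2: "(\<lambda>x. f x y) \<in> lin_maps R M P" if "y \<in> carrier N" for y using f that by (simp add: bilin_def)
  have cl: "?f x \<in> carrier P" if "x \<in> ?X" for x using that lin_closed[OF f1] by auto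
  have kill: "free_extend R P ?f s = \<zero>\<^bsub>P\<^esub>" if s: "s \<in> tensor_rels R M N" for s
    using s unfolding tensor_rels_def Let_def
    apply (elim UnE CollectE exE conjE; hypsubst)
    subgoal by (rule free_extend_add_rel[OF module_cring[OF M] P, where X = ?X]) (use lin_add[OF f2] in \<open>auto intro!: lin_closed[OF f1]\<close>)
    subgoal by (rule free_extend_add_rel[OF module_cring[OF M] P, where X = ?X]) (use lin_add[OF f1] in \<open>auto intro!: lin_closed[OF f1]\<close>)
    subgoal by (rule free_extend_smult_rel[OF module_cring[OF M] P, where X = ?X]) (use lin_smult[OF f2] in \<open>auto intro!: lin_closed[OF f1]\<close>)
    subgoal by (rule free_extend_smult_rel[OF module_cring[OF M] P, where X = ?X]) (use lin_smult[OF f1] in \<open>auto intro!: lin_closed[OF f1]\<close>)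
    done
  show "pres_lift R P ?f \<in> lin_maps R (tensor R M N) P"
    unfolding tensor_def by (rule pres_lift_lin[OF module_cring[OF M] tensor_rels_closed P]) (erule cl, erule kill)
  show "pres_lift R P ?f (tensor_pure R M N x y) = f x y" if "x \<in> carrier M" "y \<in> carrier N"
    unfolding tensor_pure_def
    using pres_lift_gen[OF module_cring[OF M] tensor_rels_closed P, of ?f "(x, y)"] cl kill that by simp
qed

end

section \<open>Hochschild modules\<close>

definition multilin :: "('k, 'r) ring_scheme \<Rightarrow> ('k, 'a) module \<Rightarrow> ('k, 'm) module \<Rightarrow> nat \<Rightarrow> ('k, 'z) module \<Rightarrow>
    ('m \<times> 'a list \<Rightarrow> 'z) \<Rightarrow> bool" where
  "multilin R B M n N f \<longleftrightarrow>
     (\<forall>m bs. (m, bs) \<in> hoch_gens B M n \<longrightarrow> (\<lambda>m. f (m, bs)) \<in> lin_maps R M N) \<and>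
     (\<forall>m bs i. (m, bs) \<in> hoch_gens B M n \<and> i < n \<longrightarrow> (\<lambda>b. f (m, bs[i := b])) \<in> lin_maps R B N)"

lemma hoch_gens_update:
  "(m, bs) \<in> hoch_gens B M n \<Longrightarrow> b \<in> carrier B \<Longrightarrow> (m, bs[i := b]) \<in> hoch_gens B M n"
  using set_update_subset_insert[of bs i b] by (auto simp: hoch_gens_def)

lemma multilinD:
  assumes "multilin R B M n N f"
  shows "(m, bs) \<in> hoch_gens B M n \<Longrightarrow> (\<lambda>m. f (m, bs)) \<in> lin_maps R M N"
    and "(m, bs) \<in> hoch_gens B M n \<Longrightarrow> i < n \<Longrightarrow> (\<lambda>b. f (m, bs[i := b])) \<in> lin_maps R B N"
    and "x \<in> hoch_gens B M n \<Longrightarrow> f x \<in> carrier N"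
proof -
  show 1: "(m, bs) \<in> hoch_gens B M n \<Longrightarrow> (\<lambda>m. f (m, bs)) \<in> lin_maps R M N" for m bs
    using assms by (auto simp: multilin_def)
  show "(m, bs) \<in> hoch_gens B M n \<Longrightarrow> i < n \<Longrightarrow> (\<lambda>b. f (m, bs[i := b])) \<in> lin_maps R B N"
    using assms by (auto simp: multilin_def)
  show "x \<in> hoch_gens B M n \<Longrightarrow> f x \<in> carrier N"
    by (cases x) (use lin_closed[OF 1] in \<open>auto simp: hoch_gens_def\<close>)
qed

context
  fixes R :: "('k, 'r) ring_scheme" and B :: "('k, 'a) module" and M :: "('k, 'm) module" and n :: nat
  assumes B: "module R B" and M: "module R M"
begin

lemma hoch_rels_closed: "hoch_rels R B M n \<subseteq> carrier (free_module R (hoch_gens B M n))"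
proof -
  interpret M: module R M by (rule M)
  interpret B: module R B by (rule B)
  have 1: "(m', bs) \<in> hoch_gens B M n" if "(m, bs) \<in> hoch_gens B M n" "m' \<in> carrier M" for m m' bs
    using that by (auto simp: hoch_gens_def)
  have 2: "m \<in> carrier M" if "(m, bs) \<in> hoch_gens B M n" for m bs using that by (auto simp: hoch_gens_def)
  show ?thesis unfolding hoch_rels_def Let_def
    apply (intro Un_least subsetI; elim CollectE exE conjE; hypsubst)
    subgoal by (rule free_add_rel_closed[OF module_cring[OF M]]) (auto intro: 1 dest: 2)
    subgoal by (rule free_smult_rel_closed[OF module_cring[OF M]]) (auto intro: 1 dest: 2)
    subgoal by (rule free_add_rel_closed[OF module_cring[OF M]]) (auto intro: hoch_gens_update)
    subgoal by (rule free_smult_rel_closed[OF module_cring[OF M]]) (auto intro: hoch_gens_update)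
    done
qed

lemma hoch_is_module: "module R (hoch R B M n)"
  unfolding hoch_def by (rule pres_is_module[OF module_cring[OF M] hoch_rels_closed])

lemma hoch_pure_closed: "x \<in> hoch_gens B M n \<Longrightarrow> hoch_pure R B M n x \<in> carrier (hoch R B M n)"
  unfolding hoch_def hoch_pure_def by (rule pres_gen_closed[OF module_cring[OF M] hoch_rels_closed])

lemma hoch_pure_multilin: "multilin R B M n (hoch R B M n) (hoch_pure R B M n)"
proof -
  interpret M: module R M by (rule M)
  interpret B: module R B by (rule B)
  have 1: "(m', bs) \<in> hoch_gens B M n" if "(m, bs) \<in> hoch_gens B M n" "m' \<in> carrier M" for m m' bs
    using that by (auto simp: hoch_gens_def)
  show ?thesis unfolding multilin_def
  proof (intro conjI allI impI lin_mapsI)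
    fix m bs m' assume "(m, bs) \<in> hoch_gens B M n" "m' \<in> carrier M"
    then show "hoch_pure R B M n (m', bs) \<in> carrier (hoch R B M n)" by (rule hoch_pure_closed[OF 1])
  next
    fix m bs m' m'' assume a: "(m, bs) \<in> hoch_gens B M n" "m' \<in> carrier M" "m'' \<in> carrier M"
    have g: "(m', bs) \<in> hoch_gens B M n" using a(1) a(2) by (rule 1)
    have "free_gen R (m' \<oplus>\<^bsub>M\<^esub> m'', bs) \<ominus>\<^bsub>free_module R (hoch_gens B M n)\<^esub>
       (free_gen R (m', bs) \<oplus>\<^bsub>free_module R (hoch_gens B M n)\<^esub> free_gen R (m'', bs)) \<in> hoch_rels R B M n"
      unfolding hoch_rels_def Let_def using g a(3) by blast
    then show "hoch_pure R B M n (m' \<oplus>\<^bsub>M\<^esub> m'', bs) = hoch_pure R B M n (m', bs) \<oplus>\<^bsub>hoch R B M n\<^esub> hoch_pure R B M n (m'', bs)"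
      unfolding hoch_def hoch_pure_def
      by (intro pres_gen_add[OF module_cring[OF M] hoch_rels_closed]) (use a 1 in auto)
  next
    fix m bs c m' assume a: "(m, bs) \<in> hoch_gens B M n" "c \<in> carrier R" "m' \<in> carrier M"
    have g: "(m', bs) \<in> hoch_gens B M n" using a(1) a(3) by (rule 1)
    have "free_gen R (c \<odot>\<^bsub>M\<^esub> m', bs) \<ominus>\<^bsub>free_module R (hoch_gens B M n)\<^esub>
       c \<odot>\<^bsub>free_module R (hoch_gens B M n)\<^esub> free_gen R (m', bs) \<in> hoch_rels R B M n"
      unfolding hoch_rels_def Let_def using g a(2) by blast
    then show "hoch_pure R B M n (c \<odot>\<^bsub>M\<^esub> m', bs) = c \<odot>\<^bsub>hoch R B M n\<^esub> hoch_pure R B M n (m', bs)"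
      unfolding hoch_def hoch_pure_def
      by (intro pres_gen_smult[OF module_cring[OF M] hoch_rels_closed]) (use a 1 in auto)
  next
    fix m bs i b assume "(m, bs) \<in> hoch_gens B M n \<and> i < n" "b \<in> carrier B"
    then show "hoch_pure R B M n (m, bs[i := b]) \<in> carrier (hoch R B M n)"
      by (intro hoch_pure_closed hoch_gens_update) auto
  next
    fix m bs i b b' assume a: "(m, bs) \<in> hoch_gens B M n \<and> i < n" "b \<in> carrier B" "b' \<in> carrier B"
    have "free_gen R (m, bs[i := b \<oplus>\<^bsub>B\<^esub> b']) \<ominus>\<^bsub>free_module R (hoch_gens B M n)\<^esub>
       (free_gen R (m, bs[i := b]) \<oplus>\<^bsub>free_module R (hoch_gens B M n)\<^esub> free_gen R (m, bs[i := b'])) \<in> hoch_rels R B M n"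
      unfolding hoch_rels_def Let_def using a by blast
    then show "hoch_pure R B M n (m, bs[i := b \<oplus>\<^bsub>B\<^esub> b'])
        = hoch_pure R B M n (m, bs[i := b]) \<oplus>\<^bsub>hoch R B M n\<^esub> hoch_pure R B M n (m, bs[i := b'])"
      unfolding hoch_def hoch_pure_def
      by (intro pres_gen_add[OF module_cring[OF M] hoch_rels_closed]) (use a in \<open>auto intro: hoch_gens_update\<close>)
  next
    fix m bs i c b assume a: "(m, bs) \<in> hoch_gens B M n \<and> i < n" "c \<in> carrier R" "b \<in> carrier B"
    have "free_gen R (m, bs[i := c \<odot>\<^bsub>B\<^esub> b]) \<ominus>\<^bsub>free_module R (hoch_gens B M n)\<^esub>
       c \<odot>\<^bsub>free_module R (hoch_gens B M n)\<^esub> free_gen R (m, bs[i := b]) \<in> hoch_rels R B M n"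
      unfolding hoch_rels_def Let_def using a by blast
    then show "hoch_pure R B M n (m, bs[i := c \<odot>\<^bsub>B\<^esub> b])
        = c \<odot>\<^bsub>hoch R B M n\<^esub> hoch_pure R B M n (m, bs[i := b])"
      unfolding hoch_def hoch_pure_def
      by (intro pres_gen_smult[OF module_cring[OF M] hoch_rels_closed]) (use a in \<open>auto intro: hoch_gens_update\<close>)
  qed
qed

lemma hoch_lin_eq:
  assumes P: "module R P" and f: "f \<in> lin_maps R (hoch R B M n) P" and g: "g \<in> lin_maps R (hoch R B M n) P"
    and eq: "\<And>x. x \<in> hoch_gens B M n \<Longrightarrow> f (hoch_pure R B M n x) = g (hoch_pure R B M n x)"
    and p: "p \<in> carrier (hoch R B M n)"
  shows "f p = g p"
  by (rule pres_lin_eq[OF module_cring[OF M] hoch_rels_closed P f[unfolded hoch_def] g[unfolded hoch_def] _ p[unfolded hoch_def]])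
    (use eq in \<open>simp add: hoch_pure_def\<close>)

lemma hoch_generated:
  assumes P: "submodule P R (hoch R B M n)" and gen: "\<And>x. x \<in> hoch_gens B M n \<Longrightarrow> hoch_pure R B M n x \<in> P"
    and p: "p \<in> carrier (hoch R B M n)"
  shows "p \<in> P"
  by (rule pres_generated[OF module_cring[OF M] hoch_rels_closed P[unfolded hoch_def] _ p[unfolded hoch_def]])
    (use gen in \<open>simp add: hoch_pure_def\<close>)

lemma hoch_lift:
  assumes P: "module R P" and f: "multilin R B M n P f"
  shows hoch_lift_lin: "pres_lift R P f \<in> lin_maps R (hoch R B M n) P"
    and hoch_lift_pure: "x \<in> hoch_gens B M n \<Longrightarrow> pres_lift R P f (hoch_pure R B M n x) = f x"
proof -
  interpret M: module R M by (rule M)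
  interpret B: module R B by (rule B)
  let ?X = "hoch_gens B M n"
  have cl: "f x \<in> carrier P" if "x \<in> ?X" for x using multilinD(3)[OF f that] .
  have 1: "(m', bs) \<in> hoch_gens B M n" if "(m, bs) \<in> hoch_gens B M n" "m' \<in> carrier M" for m m' bs
    using that by (auto simp: hoch_gens_def)
  have 2: "m \<in> carrier M" if "(m, bs) \<in> hoch_gens B M n" for m bs using that by (auto simp: hoch_gens_def)
  have kill: "free_extend R P f s = \<zero>\<^bsub>P\<^esub>" if s: "s \<in> hoch_rels R B M n" for s
    using s unfolding hoch_rels_def Let_def
  proof (elim UnE CollectE exE conjE; hypsubst)
    fix m m' bs assume a: "(m, bs) \<in> ?X" "m' \<in> carrier M"
    show "free_extend R P f (free_gen R (m \<oplus>\<^bsub>M\<^esub> m', bs) \<ominus>\<^bsub>free_module R ?X\<^esub>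
       (free_gen R (m, bs) \<oplus>\<^bsub>free_module R ?X\<^esub> free_gen R (m', bs))) = \<zero>\<^bsub>P\<^esub>"
      by (rule free_extend_add_rel[OF module_cring[OF M] P cl])
        (use a 1[OF a(1)] 2[OF a(1)] lin_add[OF multilinD(1)[OF f a(1)]] in simp_all)
  next
    fix c m bs assume a: "c \<in> carrier R" "(m, bs) \<in> ?X"
    show "free_extend R P f (free_gen R (c \<odot>\<^bsub>M\<^esub> m, bs) \<ominus>\<^bsub>free_module R ?X\<^esub>
       c \<odot>\<^bsub>free_module R ?X\<^esub> free_gen R (m, bs)) = \<zero>\<^bsub>P\<^esub>"
      by (rule free_extend_smult_rel[OF module_cring[OF M] P cl])
        (use a 1[OF a(2)] 2[OF a(2)] lin_smult[OF multilinD(1)[OF f a(2)]] in simp_all)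
  next
    fix m bs i b b' assume a: "(m, bs) \<in> ?X" "i < n" "b \<in> carrier B" "b' \<in> carrier B"
    show "free_extend R P f (free_gen R (m, bs[i := b \<oplus>\<^bsub>B\<^esub> b']) \<ominus>\<^bsub>free_module R ?X\<^esub>
       (free_gen R (m, bs[i := b]) \<oplus>\<^bsub>free_module R ?X\<^esub> free_gen R (m, bs[i := b']))) = \<zero>\<^bsub>P\<^esub>"
      by (rule free_extend_add_rel[OF module_cring[OF M] P cl])
        (use a hoch_gens_update[OF a(1)] lin_add[OF multilinD(2)[OF f a(1,2)]] in simp_all)
  next
    fix c m bs i b assume a: "c \<in> carrier R" "(m, bs) \<in> ?X" "i < n" "b \<in> carrier B"
    show "free_extend R P f (free_gen R (m, bs[i := c \<odot>\<^bsub>B\<^esub> b]) \<ominus>\<^bsub>free_module R ?X\<^esub>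
       c \<odot>\<^bsub>free_module R ?X\<^esub> free_gen R (m, bs[i := b])) = \<zero>\<^bsub>P\<^esub>"
      by (rule free_extend_smult_rel[OF module_cring[OF M] P cl])
        (use a hoch_gens_update[OF a(2)] lin_smult[OF multilinD(2)[OF f a(2,3)]] in simp_all)
  qed
  show "pres_lift R P f \<in> lin_maps R (hoch R B M n) P"
    unfolding hoch_def by (rule pres_lift_lin[OF module_cring[OF M] hoch_rels_closed P]) (erule cl, erule kill)
  show "pres_lift R P f (hoch_pure R B M n x) = f x" if "x \<in> hoch_gens B M n"
    unfolding hoch_pure_def
    by (rule pres_lift_gen[OF module_cring[OF M] hoch_rels_closed P _ _ that]) (erule cl, erule kill)
qed

lemma multilin_sum:
  assumes "module R N" "finite S" "\<And>i. i \<in> S \<Longrightarrow> multilin R B M n N (f i)"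
  shows "multilin R B M n N (\<lambda>x. \<Oplus>\<^bsub>N\<^esub>i\<in>S. f i x)"
  using assms unfolding multilin_def by (auto intro!: lin_sum_fun)

lemma multilin_smult:
  assumes "module R N" "c \<in> carrier R" "multilin R B M n N f"
  shows "multilin R B M n N (\<lambda>x. c \<odot>\<^bsub>N\<^esub> f x)"
  using assms unfolding multilin_def by (auto intro!: lin_smult_fun)

end

text \<open>A map of generators is slotwise if each argument, with the others fixed, enters the result linearly and
  in a single place: either a tensor factor or the coefficient. Faces, permutations, insertions and
  maps induced by linear maps are of this kind.\<close>

definition slotwise :: "('k, 'r) ring_scheme \<Rightarrow> ('k, 'a) module \<Rightarrow> ('k, 'm) module \<Rightarrow> nat \<Rightarrow>
    ('k, 'b) module \<Rightarrow> ('k, 'p) module \<Rightarrow> nat \<Rightarrow> ('m \<times> 'a list \<Rightarrow> 'p \<times> 'b list) \<Rightarrow> bool" where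
  "slotwise R B M n B' M' k g \<longleftrightarrow>
     (\<forall>m bs. (m, bs) \<in> hoch_gens B M n \<longrightarrow>
        (\<exists>\<phi> \<in> lin_maps R M M'. \<exists>bs'. length bs' = k \<and> set bs' \<subseteq> carrier B' \<and>
           (\<forall>m\<in>carrier M. g (m, bs) = (\<phi> m, bs')))) \<and>
     (\<forall>m bs i. (m, bs) \<in> hoch_gens B M n \<and> i < n \<longrightarrow>
        (\<exists>\<phi> \<in> lin_maps R B B'. \<exists>m' bs' i'. (m', bs') \<in> hoch_gens B' M' k \<and> i' < k \<and>
           (\<forall>b\<in>carrier B. g (m, bs[i := b]) = (m', bs'[i' := \<phi> b]))) \<or>
        (\<exists>\<phi> \<in> lin_maps R B M'. \<exists>bs'. length bs' = k \<and> set bs' \<subseteq> carrier B' \<and>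
           (\<forall>b\<in>carrier B. g (m, bs[i := b]) = (\<phi> b, bs'))))"

lemma slotwise_closed:
  assumes "slotwise R B M n B' M' k g" "x \<in> hoch_gens B M n"
  shows "g x \<in> hoch_gens B' M' k"
proof -
  obtain m bs where x: "x = (m, bs)" by force
  obtain \<phi> bs' where "\<phi> \<in> lin_maps R M M'" "length bs' = k" "set bs' \<subseteq> carrier B'" "\<forall>m\<in>carrier M. g (m, bs) = (\<phi> m, bs')"
    using assms unfolding slotwise_def x by metis
  then show ?thesis using assms(2) lin_closed[of \<phi> R M M' m] unfolding x by (auto simp: hoch_gens_def)
qed

text \<open>By this lemma the operators on the Hochschild modules are well defined: a prescription on generators
  respects the relations once it is slotwise in each summand.\<close>

lemma multilin_slotwise:
  assumes B: "module R B" and M: "module R M" and f: "multilin R B' M' k N f" and g: "slotwise R B M n B' M' k g"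
  shows "multilin R B M n N (\<lambda>x. f (g x))"
  unfolding multilin_def
proof (intro conjI allI impI)
  interpret M: module R M by (rule M)
  fix m bs assume a: "(m, bs) \<in> hoch_gens B M n"
  then have "m \<in> carrier M" by (auto simp: hoch_gens_def)
  obtain \<phi> bs' where p: "\<phi> \<in> lin_maps R M M'" "length bs' = k" "set bs' \<subseteq> carrier B'" "\<forall>m\<in>carrier M. g (m, bs) = (\<phi> m, bs')"
    using g a unfolding slotwise_def by metis
  then have "(\<phi> m, bs') \<in> hoch_gens B' M' k" using lin_closed[OF p(1) \<open>m \<in> carrier M\<close>] by (simp add: hoch_gens_def)
  from lin_comp[OF p(1) multilinD(1)[OF f this]]
  show "(\<lambda>m. f (g (m, bs))) \<in> lin_maps R M N"
    by (rule lin_cong[OF M]) (use p(4) in simp)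
next
  interpret B: module R B by (rule B)
  fix m bs i assume a: "(m, bs) \<in> hoch_gens B M n \<and> i < n"
  then consider (1) \<phi> m' bs' i' where "\<phi> \<in> lin_maps R B B'" "(m', bs') \<in> hoch_gens B' M' k" "i' < k"
      "\<forall>b\<in>carrier B. g (m, bs[i := b]) = (m', bs'[i' := \<phi> b])"
    | (2) \<phi> bs' where "\<phi> \<in> lin_maps R B M'" "length bs' = k" "set bs' \<subseteq> carrier B'" "\<forall>b\<in>carrier B. g (m, bs[i := b]) = (\<phi> b, bs')"
    using g unfolding slotwise_def by metis
  then show "(\<lambda>b. f (g (m, bs[i := b]))) \<in> lin_maps R B N"
  proof cases
    case 1
    from lin_comp[OF 1(1) multilinD(2)[OF f 1(2,3)]] show ?thesis
      by (rule lin_cong[OF B]) (use 1(4) in simp)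
  next
    case 2
    then have "(\<phi> \<zero>\<^bsub>B\<^esub>, bs') \<in> hoch_gens B' M' k" using lin_closed[OF 2(1)] by (simp add: hoch_gens_def)
    from lin_comp[OF 2(1) multilinD(1)[OF f this]] show ?thesis
      by (rule lin_cong[OF B]) (use 2(4) in simp)
  qed
qed

section \<open>Transfer of formal identities\<close>

lemma rat_ring_hom:
  assumes "\<iota> \<in> ring_hom rat_ring R"
  shows "\<iota> x \<in> carrier R" "\<iota> (x + y) = \<iota> x \<oplus>\<^bsub>R\<^esub> \<iota> y" "\<iota> (x * y) = \<iota> x \<otimes>\<^bsub>R\<^esub> \<iota> y" "\<iota> 1 = \<one>\<^bsub>R\<^esub>"
  using assms ring_hom_closed[OF assms, of x] ring_hom_add[OF assms, of x y] ring_hom_mult[OF assms, of x y]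
    ring_hom_one[OF assms]
  by (simp_all add: rat_ring_def)

context
  fixes R :: "'k ring" and \<iota> :: "rat \<Rightarrow> 'k" and N :: "('k, 'y) module"
  assumes N: "module R N" and \<iota>: "\<iota> \<in> ring_hom rat_ring R"
begin

interpretation N: module R N by (rule N)

lemmas iota = rat_ring_hom[OF \<iota>]

lemma iota_0: "\<iota> 0 = \<zero>\<^bsub>R\<^esub>"
proof -
  have "\<iota> 0 \<oplus>\<^bsub>R\<^esub> \<iota> 0 = \<iota> 0" using iota(2)[of 0 0] by simp
  then show ?thesis using iota(1)[of 0] N.R.add.l_cancel_one by metis
qed

lemma finsum_fiber:
  assumes S: "finite S" and Z: "finite Z" and \<phi>: "\<phi> ` S \<subseteq> Z" and G: "\<And>z. z \<in> Z \<Longrightarrow> G z \<in> carrier N"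
  shows "(\<Oplus>\<^bsub>N\<^esub>i\<in>S. \<iota> (w i) \<odot>\<^bsub>N\<^esub> G (\<phi> i))
     = (\<Oplus>\<^bsub>N\<^esub>z\<in>Z. \<iota> (\<Sum>i\<in>S. w i * (if \<phi> i = z then 1 else 0)) \<odot>\<^bsub>N\<^esub> G z)"
  using S \<phi>
proof (induction S)
  case empty
  have "(\<Oplus>\<^bsub>N\<^esub>z\<in>Z. \<iota> 0 \<odot>\<^bsub>N\<^esub> G z) = (\<Oplus>\<^bsub>N\<^esub>z\<in>Z. \<zero>\<^bsub>N\<^esub>)"
    using G by (intro N.M.finsum_cong') (auto simp: iota_0)
  then show ?case by simp
next
  case (insert i S)
  let ?c = "\<lambda>z. \<Sum>i\<in>S. w i * (if \<phi> i = z then 1 else 0)"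
  let ?d = "\<lambda>z. w i * (if \<phi> i = z then 1 else 0)"
  have z: "\<phi> i \<in> Z" using insert by auto
  have "(\<Oplus>\<^bsub>N\<^esub>z\<in>Z. \<iota> (\<Sum>i\<in>insert i S. w i * (if \<phi> i = z then 1 else 0)) \<odot>\<^bsub>N\<^esub> G z)
     = (\<Oplus>\<^bsub>N\<^esub>z\<in>Z. \<iota> (?d z) \<odot>\<^bsub>N\<^esub> G z \<oplus>\<^bsub>N\<^esub> \<iota> (?c z) \<odot>\<^bsub>N\<^esub> G z)"
    using insert G iota(1) by (intro N.M.finsum_cong') (auto simp: iota(2) N.smult_l_distr)
  also have "\<dots> = (\<Oplus>\<^bsub>N\<^esub>z\<in>Z. \<iota> (?d z) \<odot>\<^bsub>N\<^esub> G z) \<oplus>\<^bsub>N\<^esub> (\<Oplus>\<^bsub>N\<^esub>z\<in>Z. \<iota> (?c z) \<odot>\<^bsub>N\<^esub> G z)"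
    using G iota(1) by (intro N.M.finsum_addf) auto
  also have "(\<Oplus>\<^bsub>N\<^esub>z\<in>Z. \<iota> (?d z) \<odot>\<^bsub>N\<^esub> G z) = (\<Oplus>\<^bsub>N\<^esub>z\<in>{\<phi> i}. \<iota> (w i) \<odot>\<^bsub>N\<^esub> G z)"
    using Z z G iota(1) by (intro N.M.add.finprod_mono_neutral_cong_right) (auto simp: iota_0)
  also have "\<dots> = \<iota> (w i) \<odot>\<^bsub>N\<^esub> G (\<phi> i)" using z G iota(1) by simp
  also have "\<iota> (w i) \<odot>\<^bsub>N\<^esub> G (\<phi> i) \<oplus>\<^bsub>N\<^esub> (\<Oplus>\<^bsub>N\<^esub>z\<in>Z. \<iota> (?c z) \<odot>\<^bsub>N\<^esub> G z)
      = (\<Oplus>\<^bsub>N\<^esub>i\<in>insert i S. \<iota> (w i) \<odot>\<^bsub>N\<^esub> G (\<phi> i))"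
    using insert G iota(1) by (subst N.M.finsum_insert) auto
  finally show ?case by simp
qed

text \<open>An identity of formal rational combinations of generators holds in every module over a ring containing
  the rationals. Formal combinations are compared by the values of all rational functions \<open>F\<close> on them,
  so that the combinatorics takes place in ordinary sums of rational numbers. The proof collects the
  summands with the same generator and tests with indicator functions.\<close>

lemma finsum_transfer:
  assumes S: "finite S" and T: "finite T"
    and G: "\<And>i. i \<in> S \<Longrightarrow> G (\<phi> i) \<in> carrier N" "\<And>j. j \<in> T \<Longrightarrow> G (\<psi> j) \<in> carrier N"
    and eq: "\<And>F :: 'x \<Rightarrow> rat. (\<Sum>i\<in>S. w i * F (\<phi> i)) = (\<Sum>j\<in>T. v j * F (\<psi> j))"
  shows "(\<Oplus>\<^bsub>N\<^esub>i\<in>S. \<iota> (w i) \<odot>\<^bsub>N\<^esub> G (\<phi> i)) = (\<Oplus>\<^bsub>N\<^esub>j\<in>T. \<iota> (v j) \<odot>\<^bsub>N\<^esub> G (\<psi> j))"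
proof -
  let ?Z = "\<phi> ` S \<union> \<psi> ` T"
  have Z: "finite ?Z" using S T by simp
  have GZ: "G z \<in> carrier N" if "z \<in> ?Z" for z using G that by auto
  have 1: "(\<Oplus>\<^bsub>N\<^esub>i\<in>S. \<iota> (w i) \<odot>\<^bsub>N\<^esub> G (\<phi> i))
     = (\<Oplus>\<^bsub>N\<^esub>z\<in>?Z. \<iota> (\<Sum>i\<in>S. w i * (if \<phi> i = z then 1 else 0)) \<odot>\<^bsub>N\<^esub> G z)"
    by (rule finsum_fiber[OF S Z _ GZ]) auto
  have 2: "(\<Oplus>\<^bsub>N\<^esub>j\<in>T. \<iota> (v j) \<odot>\<^bsub>N\<^esub> G (\<psi> j))
     = (\<Oplus>\<^bsub>N\<^esub>z\<in>?Z. \<iota> (\<Sum>j\<in>T. v j * (if \<psi> j = z then 1 else 0)) \<odot>\<^bsub>N\<^esub> G z)"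
    by (rule finsum_fiber[OF T Z _ GZ]) auto
  have "(\<Sum>i\<in>S. w i * (if \<phi> i = z then 1 else 0)) = (\<Sum>j\<in>T. v j * (if \<psi> j = z then 1 else 0))" for z
    using eq[of "\<lambda>y. if y = z then 1 else 0"] .
  then show ?thesis unfolding 1 2 by simp
qed

lemma finsum_finsum:
  assumes S: "finite S" and T: "\<And>i. i \<in> S \<Longrightarrow> finite (T i)" and G: "\<And>i j. i \<in> S \<Longrightarrow> j \<in> T i \<Longrightarrow> G i j \<in> carrier N"
  shows "(\<Oplus>\<^bsub>N\<^esub>i\<in>S. \<iota> (w i) \<odot>\<^bsub>N\<^esub> (\<Oplus>\<^bsub>N\<^esub>j\<in>T i. \<iota> (v i j) \<odot>\<^bsub>N\<^esub> G i j))
     = (\<Oplus>\<^bsub>N\<^esub>x\<in>Sigma S T. \<iota> (w (fst x) * v (fst x) (snd x)) \<odot>\<^bsub>N\<^esub> G (fst x) (snd x))"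
  using S T G
proof (induction S)
  case empty
  then show ?case by simp
next
  case (insert i S)
  let ?h = "\<lambda>x. \<iota> (w (fst x) * v (fst x) (snd x)) \<odot>\<^bsub>N\<^esub> G (fst x) (snd x)"
  have U: "Sigma (insert i S) T = Pair i ` T i \<union> Sigma S T" by auto
  have fin: "finite (Pair i ` T i)" "finite (Sigma S T)" using insert by auto
  have c: "\<iota> (v k j) \<odot>\<^bsub>N\<^esub> G k j \<in> carrier N" if "k \<in> insert i S" "j \<in> T k" for k j
    by (rule N.smult_closed[OF iota(1) insert.prems(2)[OF that]])
  have ci: "(\<Oplus>\<^bsub>N\<^esub>j\<in>T i'. \<iota> (v i' j) \<odot>\<^bsub>N\<^esub> G i' j) \<in> carrier N" if "i' \<in> insert i S" for i'
    using c[OF that] by (intro N.M.finsum_closed) auto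
  have hc: "?h x \<in> carrier N" if "x \<in> Sigma (insert i S) T" for x
    by (rule N.smult_closed[OF iota(1) insert.prems(2)]) (use that in auto)
  have "(\<Oplus>\<^bsub>N\<^esub>x\<in>Pair i ` T i. ?h x) = (\<Oplus>\<^bsub>N\<^esub>j\<in>T i. ?h (i, j))"
    using hc by (subst N.M.finsum_reindex) (auto simp: inj_on_def)
  also have "\<dots> = (\<Oplus>\<^bsub>N\<^esub>j\<in>T i. \<iota> (w i) \<odot>\<^bsub>N\<^esub> (\<iota> (v i j) \<odot>\<^bsub>N\<^esub> G i j))"
    using insert.prems(2)[of i] iota(1) by (intro N.M.finsum_cong') (auto simp: iota(3) N.smult_assoc1)
  also have "\<dots> = \<iota> (w i) \<odot>\<^bsub>N\<^esub> (\<Oplus>\<^bsub>N\<^esub>j\<in>T i. \<iota> (v i j) \<odot>\<^bsub>N\<^esub> G i j)"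
    using insert.prems(1)[of i] c[of i] iota(1) by (intro N.finsum_smult_ldistr[symmetric]) auto
  finally have 1: "(\<Oplus>\<^bsub>N\<^esub>x\<in>Pair i ` T i. ?h x) = \<iota> (w i) \<odot>\<^bsub>N\<^esub> (\<Oplus>\<^bsub>N\<^esub>j\<in>T i. \<iota> (v i j) \<odot>\<^bsub>N\<^esub> G i j)" .
  have IH: "(\<Oplus>\<^bsub>N\<^esub>i\<in>S. \<iota> (w i) \<odot>\<^bsub>N\<^esub> (\<Oplus>\<^bsub>N\<^esub>j\<in>T i. \<iota> (v i j) \<odot>\<^bsub>N\<^esub> G i j)) = (\<Oplus>\<^bsub>N\<^esub>x\<in>Sigma S T. ?h x)"
    by (rule insert.IH) (use insert.prems in auto)
  have "(\<Oplus>\<^bsub>N\<^esub>x\<in>Sigma (insert i S) T. ?h x) = (\<Oplus>\<^bsub>N\<^esub>x\<in>Pair i ` T i. ?h x) \<oplus>\<^bsub>N\<^esub> (\<Oplus>\<^bsub>N\<^esub>x\<in>Sigma S T. ?h x)"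
    unfolding U using fin insert.hyps(2) hc by (intro N.M.finsum_Un_disjoint) auto
  also have "\<dots> = (\<Oplus>\<^bsub>N\<^esub>i\<in>insert i S. \<iota> (w i) \<odot>\<^bsub>N\<^esub> (\<Oplus>\<^bsub>N\<^esub>j\<in>T i. \<iota> (v i j) \<odot>\<^bsub>N\<^esub> G i j))"
    unfolding 1 IH[symmetric] using insert.hyps ci iota(1) by (subst N.M.finsum_insert) auto
  finally show ?case by simp
qed

end

section \<open>The Hochschild complex and its shuffle operators\<close>

lemma mrg_update:
  assumes bs: "length bs = Suc N" and q: "q < N"
  shows "j < q \<Longrightarrow> mrg mu q (bs[j := b]) = (mrg mu q bs)[j := b]"
    and "mrg mu q (bs[q := b]) = (mrg mu q bs)[q := mu b (bs ! Suc q)]"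
    and "mrg mu q (bs[Suc q := b]) = (mrg mu q bs)[q := mu (bs ! q) b]"
    and "Suc q < j \<Longrightarrow> j \<le> N \<Longrightarrow> mrg mu q (bs[j := b]) = (mrg mu q bs)[j - 1 := b]"
  using assms by (intro nth_equalityI; auto simp: nth_mrg length_mrg nth_list_update)+

text \<open>What the complexes \<open>C(A, M)\<close>, \<open>C(I, M)\<close> and \<open>C(A, A)\<close> have in common: a commutative, possibly
  nonunital algebra \<open>B\<close> and a symmetric bimodule \<open>M\<close>.\<close>

locale hoch_datum =
  fixes R :: "'k ring" and \<iota> :: "rat \<Rightarrow> 'k" and B :: "('k, 'a) module" and M :: "('k, 'm) module"
    and l :: "'a \<Rightarrow> 'm \<Rightarrow> 'm" and r :: "'m \<Rightarrow> 'a \<Rightarrow> 'm"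
  assumes iota_hom: "\<iota> \<in> ring_hom rat_ring R"
    and B_mod: "module R B" and M_mod: "module R M"
    and mult_lin: "a \<in> carrier B \<Longrightarrow> (\<lambda>b. b \<otimes>\<^bsub>B\<^esub> a) \<in> lin_maps R B B"
    and mult_comm: "\<lbrakk>a \<in> carrier B; b \<in> carrier B\<rbrakk> \<Longrightarrow> a \<otimes>\<^bsub>B\<^esub> b = b \<otimes>\<^bsub>B\<^esub> a"
    and mult_assoc: "\<lbrakk>a \<in> carrier B; b \<in> carrier B; c \<in> carrier B\<rbrakk> \<Longrightarrow>
       (a \<otimes>\<^bsub>B\<^esub> b) \<otimes>\<^bsub>B\<^esub> c = a \<otimes>\<^bsub>B\<^esub> (b \<otimes>\<^bsub>B\<^esub> c)"
    and act_lin: "a \<in> carrier B \<Longrightarrow> (\<lambda>m. r m a) \<in> lin_maps R M M"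
    and act_lin': "m \<in> carrier M \<Longrightarrow> r m \<in> lin_maps R B M"
    and act_sym: "\<lbrakk>a \<in> carrier B; m \<in> carrier M\<rbrakk> \<Longrightarrow> l a m = r m a"
    and act_mult': "\<lbrakk>a \<in> carrier B; b \<in> carrier B; m \<in> carrier M\<rbrakk> \<Longrightarrow> r m (a \<otimes>\<^bsub>B\<^esub> b) = r (r m a) b"
begin

abbreviation "gens \<equiv> hoch_gens B M"
abbreviation "pure \<equiv> hoch_pure R B M"
abbreviation "H \<equiv> hoch R B M"
abbreviation "d \<equiv> hoch_boundary R B M l r"
abbreviation "act \<equiv> ga_act R \<iota> B M"

lemmas H_mod = hoch_is_module[OF B_mod M_mod]
lemmas pure_closed = hoch_pure_closed[OF B_mod M_mod]
lemmas iota = rat_ring_hom[OF iota_hom]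
lemmas H_lin_eq = hoch_lin_eq[OF B_mod M_mod]
lemmas transfer = finsum_transfer[OF _ iota_hom]

lemma R_cr: "cring R" using B_mod by (simp add: module_def)

lemma gens_iff: "(m, bs) \<in> gens n \<longleftrightarrow> m \<in> carrier M \<and> length bs = n \<and> set bs \<subseteq> carrier B"
  by (auto simp: hoch_gens_def)

lemma mult_closed: "a \<in> carrier B \<Longrightarrow> b \<in> carrier B \<Longrightarrow> a \<otimes>\<^bsub>B\<^esub> b \<in> carrier B"
  by (rule lin_closed[OF mult_lin])

lemma act_closed: "a \<in> carrier B \<Longrightarrow> m \<in> carrier M \<Longrightarrow> r m a \<in> carrier M"
  by (rule lin_closed[OF act_lin])

lemma mult_lin': "a \<in> carrier B \<Longrightarrow> (\<lambda>b. a \<otimes>\<^bsub>B\<^esub> b) \<in> lin_maps R B B"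
  by (rule lin_cong[OF B_mod mult_lin]) (simp_all add: mult_comm)

lemma lact_lin: "a \<in> carrier B \<Longrightarrow> (\<lambda>m. l a m) \<in> lin_maps R M M"
  by (rule lin_cong[OF M_mod act_lin]) (simp_all add: act_sym)

lemma lact_lin': "m \<in> carrier M \<Longrightarrow> (\<lambda>a. l a m) \<in> lin_maps R B M"
  by (rule lin_cong[OF B_mod act_lin']) (simp_all add: act_sym)

lemma iota_neg1: "\<iota> (- 1) = \<ominus>\<^bsub>R\<^esub> \<one>\<^bsub>R\<^esub>"
proof -
  interpret R: cring R by (rule R_cr)
  have "\<iota> (- 1) \<oplus>\<^bsub>R\<^esub> \<one>\<^bsub>R\<^esub> = \<iota> 0" using iota(2)[of "- 1" 1] iota(4) by simp
  also have "\<iota> 0 = \<zero>\<^bsub>R\<^esub>" by (rule iota_0[OF B_mod iota_hom])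
  finally show ?thesis using R.minus_equality[of "\<iota> (- 1)" "\<one>\<^bsub>R\<^esub>"] iota(1) by simp
qed

lemma iota_sign: "(\<ominus>\<^bsub>R\<^esub> \<one>\<^bsub>R\<^esub>) [^]\<^bsub>R\<^esub> i = \<iota> ((- 1) ^ i)" for i :: nat
proof -
  interpret R: cring R by (rule R_cr)
  show ?thesis
  proof (induction i)
    case 0
    then show ?case by (simp add: iota(4))
  next
    case (Suc i)
    then show ?case using iota(3)[of "(- 1) ^ i" "- 1"] by (simp add: iota_neg1)
  qed
qed

text \<open>In the first and the last face one tensor factor becomes a part of the coefficient; this is why
  \<open>slotwise\<close> allows an argument to end up there.\<close>

lemma face_slotwise:
  assumes i: "i \<le> Suc N"
  shows "slotwise R B M (Suc N) B M N (face B l r (Suc N) i)"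
proof -
  consider (0) "i = 0" | (mid) q where "i = Suc q" "q < N" | (last) "i = Suc N"
    using i by (cases i) (auto simp: less_Suc_eq_le le_less)
  then show ?thesis
  proof cases
    case 0
    show ?thesis unfolding slotwise_def 0
    proof (intro conjI allI impI)
      fix m bs assume g: "(m, bs) \<in> gens (Suc N)"
      then obtain a as where bs: "bs = a # as" "a \<in> carrier B" "set as \<subseteq> carrier B" "length as = N"
        by (cases bs) (auto simp: gens_iff)
      show "\<exists>\<phi>\<in>lin_maps R M M. \<exists>bs'. length bs' = N \<and> set bs' \<subseteq> carrier B \<and>
          (\<forall>m\<in>carrier M. face B l r (Suc N) 0 (m, bs) = (\<phi> m, bs'))"
        by (intro bexI[OF _ act_lin[OF bs(2)]] exI[of _ as]) (simp add: bs face_simps)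
    next
      fix m bs i assume "(m, bs) \<in> gens (Suc N) \<and> i < Suc N"
      then have g: "(m, bs) \<in> gens (Suc N)" and i: "i < Suc N" by auto
      then obtain a as where bs: "bs = a # as" "a \<in> carrier B" "set as \<subseteq> carrier B" "length as = N"
        by (cases bs) (auto simp: gens_iff)
      have m: "m \<in> carrier M" using g by (simp add: gens_iff)
      show "(\<exists>\<phi> \<in> lin_maps R B B. \<exists>m' bs' i'. (m', bs') \<in> gens N \<and> i' < N \<and>
           (\<forall>b\<in>carrier B. face B l r (Suc N) 0 (m, bs[i := b]) = (m', bs'[i' := \<phi> b]))) \<or>
        (\<exists>\<phi> \<in> lin_maps R B M. \<exists>bs'. length bs' = N \<and> set bs' \<subseteq> carrier B \<and>
           (\<forall>b\<in>carrier B. face B l r (Suc N) 0 (m, bs[i := b]) = (\<phi> b, bs')))"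
      proof (cases i)
        case 0
        show ?thesis
          by (intro disjI2 bexI[OF _ act_lin'[OF m]] exI[of _ as]) (simp add: bs face_simps 0)
      next
        case (Suc j)
        show ?thesis
          by (intro disjI1 bexI[OF _ lin_id] exI[of _ "r m a"] exI[of _ as] exI[of _ j])
            (use i in \<open>simp add: bs face_simps Suc gens_iff act_closed m\<close>)
      qed
    qed
  next
    case (mid q)
    have f: "face B l r (Suc N) i (m, bs) = (m, mrg (monoid.mult B) q bs)" for m bs
      using mid by (simp add: face_simps)
    have cl: "set (mrg (monoid.mult B) q bs) \<subseteq> carrier B \<and> length (mrg (monoid.mult B) q bs) = N"
      if "length bs = Suc N" "set bs \<subseteq> carrier B" for bs
    proof -
      have n: "bs ! q \<in> carrier B" "bs ! Suc q \<in> carrier B" using that mid by (auto simp: subset_eq)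
      have "set (take q bs) \<subseteq> carrier B" "set (drop (q + 2) bs) \<subseteq> carrier B"
        using that set_take_subset[of q bs] set_drop_subset[of "q + 2" bs] by blast+
      then show ?thesis using that mid mult_closed[OF n] by (simp add: mrg_def)
    qed
    show ?thesis unfolding slotwise_def f
    proof (intro conjI allI impI)
      fix m bs assume g: "(m, bs) \<in> gens (Suc N)"
      then have bs: "length bs = Suc N" "set bs \<subseteq> carrier B" by (auto simp: gens_iff)
      show "\<exists>\<phi>\<in>lin_maps R M M. \<exists>bs'. length bs' = N \<and> set bs' \<subseteq> carrier B \<and>
          (\<forall>m\<in>carrier M. (m, mrg (monoid.mult B) q bs) = (\<phi> m, bs'))"
        by (intro bexI[OF _ lin_id] exI[of _ "mrg (monoid.mult B) q bs"]) (simp add: cl[OF bs])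
    next
      fix m bs j assume "(m, bs) \<in> gens (Suc N) \<and> j < Suc N"
      then have bs: "length bs = Suc N" "set bs \<subseteq> carrier B" and m: "m \<in> carrier M" and j: "j < Suc N"
        by (auto simp: gens_iff)
      have n: "bs ! q \<in> carrier B" "bs ! Suc q \<in> carrier B" using bs mid by (auto simp: subset_eq)
      have g: "(m, mrg (monoid.mult B) q bs) \<in> gens N" using cl[OF bs] m by (simp add: gens_iff)
      note u = mrg_update[OF bs(1) mid(2)]
      consider "j < q" | "j = q" | "j = Suc q" | "Suc q < j" by linarith
      then have "\<exists>\<phi> \<in> lin_maps R B B. \<exists>m' bs' i'. (m', bs') \<in> gens N \<and> i' < N \<and>
           (\<forall>b\<in>carrier B. (m, mrg (monoid.mult B) q (bs[j := b])) = (m', bs'[i' := \<phi> b]))"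
      proof cases
        case 1
        then show ?thesis using mid(2)
          by (intro bexI[OF _ lin_id] exI[of _ m] exI[of _ "mrg (monoid.mult B) q bs"] exI[of _ j]) (simp add: g u(1))
      next
        case 2
        then show ?thesis using mid(2)
          by (intro bexI[OF _ mult_lin[OF n(2)]] exI[of _ m] exI[of _ "mrg (monoid.mult B) q bs"] exI[of _ q])
            (simp add: g u(2))
      next
        case 3
        then show ?thesis using mid(2)
          by (intro bexI[OF _ mult_lin'[OF n(1)]] exI[of _ m] exI[of _ "mrg (monoid.mult B) q bs"] exI[of _ q])
            (simp add: g u(3))
      next
        case 4
        have "mrg (monoid.mult B) q (bs[j := b]) = (mrg (monoid.mult B) q bs)[j - 1 := b]" for b
          by (rule u(4)) (use 4 j in auto)
        moreover have "j - 1 < N" using 4 j by linarith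
        ultimately show ?thesis
          by (intro bexI[OF _ lin_id] exI[of _ m] exI[of _ "mrg (monoid.mult B) q bs"] exI[of _ "j - 1"]) (simp add: g)
      qed
      then show "(\<exists>\<phi> \<in> lin_maps R B B. \<exists>m' bs' i'. (m', bs') \<in> gens N \<and> i' < N \<and>
           (\<forall>b\<in>carrier B. (m, mrg (monoid.mult B) q (bs[j := b])) = (m', bs'[i' := \<phi> b]))) \<or>
        (\<exists>\<phi> \<in> lin_maps R B M. \<exists>bs'. length bs' = N \<and> set bs' \<subseteq> carrier B \<and>
           (\<forall>b\<in>carrier B. (m, mrg (monoid.mult B) q (bs[j := b])) = (\<phi> b, bs')))"
        by (rule disjI1)
    qed
  next
    case last
    show ?thesis unfolding slotwise_def last face_simps
    proof (intro conjI allI impI)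
      fix m bs assume g: "(m, bs) \<in> gens (Suc N)"
      then obtain a as where bs: "bs = as @ [a]" "a \<in> carrier B" "set as \<subseteq> carrier B" "length as = N"
        by (cases bs rule: rev_cases) (auto simp: gens_iff)
      show "\<exists>\<phi>\<in>lin_maps R M M. \<exists>bs'. length bs' = N \<and> set bs' \<subseteq> carrier B \<and>
          (\<forall>m\<in>carrier M. (l (bs ! N) m, butlast bs) = (\<phi> m, bs'))"
        by (intro bexI[OF _ lact_lin[OF bs(2)]] exI[of _ as]) (simp add: bs nth_append)
    next
      fix m bs i assume "(m, bs) \<in> gens (Suc N) \<and> i < Suc N"
      then have g: "(m, bs) \<in> gens (Suc N)" and i: "i < Suc N" by auto
      then obtain a as where bs: "bs = as @ [a]" "a \<in> carrier B" "set as \<subseteq> carrier B" "length as = N"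
        by (cases bs rule: rev_cases) (auto simp: gens_iff)
      have m: "m \<in> carrier M" using g by (simp add: gens_iff)
      show "(\<exists>\<phi> \<in> lin_maps R B B. \<exists>m' bs' i'. (m', bs') \<in> gens N \<and> i' < N \<and>
           (\<forall>b\<in>carrier B. (l (bs[i := b] ! N) m, butlast (bs[i := b])) = (m', bs'[i' := \<phi> b]))) \<or>
        (\<exists>\<phi> \<in> lin_maps R B M. \<exists>bs'. length bs' = N \<and> set bs' \<subseteq> carrier B \<and>
           (\<forall>b\<in>carrier B. (l (bs[i := b] ! N) m, butlast (bs[i := b])) = (\<phi> b, bs')))"
      proof (cases "i = N")
        case True
        show ?thesis
          by (intro disjI2 bexI[OF _ lact_lin'[OF m]] exI[of _ as]) (use bs True in \<open>auto simp: list_update_append nth_append\<close>)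
      next
        case False
        show ?thesis
          by (intro disjI1 bexI[OF _ lin_id] exI[of _ "l a m"] exI[of _ as] exI[of _ i])
            (use i False bs in \<open>auto simp: list_update_append nth_append gens_iff act_closed act_sym m\<close>)
      qed
    qed
  qed
qed

lemma face_closed: "i \<le> Suc N \<Longrightarrow> x \<in> gens (Suc N) \<Longrightarrow> face B l r (Suc N) i x \<in> gens N"
  by (rule slotwise_closed[OF face_slotwise])

lemma boundary_multilin:
  "multilin R B M (Suc N) (H N) (\<lambda>x. \<Oplus>\<^bsub>H N\<^esub>i\<in>{0..Suc N}.
        ((\<ominus>\<^bsub>R\<^esub> \<one>\<^bsub>R\<^esub>) [^]\<^bsub>R\<^esub> i) \<odot>\<^bsub>H N\<^esub> pure N (face B l r (Suc N) i x))"
  unfolding iota_sign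
  by (intro multilin_sum[OF B_mod M_mod H_mod finite_atLeastAtMost] multilin_smult[OF B_mod M_mod H_mod] iota(1)
      multilin_slotwise[OF B_mod M_mod hoch_pure_multilin[OF B_mod M_mod]] face_slotwise) simp

lemma d_lin: "d (Suc N) \<in> lin_maps R (H (Suc N)) (H N)"
  using hoch_lift_lin[OF B_mod M_mod H_mod boundary_multilin] by (simp add: hoch_boundary_def)

lemma d_pure:
  "x \<in> gens (Suc N) \<Longrightarrow> d (Suc N) (pure (Suc N) x)
     = (\<Oplus>\<^bsub>H N\<^esub>i\<in>{0..Suc N}. \<iota> ((-1) ^ i) \<odot>\<^bsub>H N\<^esub> pure N (face B l r (Suc N) i x))"
  using hoch_lift_pure[OF B_mod M_mod H_mod boundary_multilin] by (simp add: hoch_boundary_def iota_sign)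

lemma perm_slotwise:
  assumes s: "\<sigma> \<in> sym_perms n"
  shows "slotwise R B M n B M n (\<lambda>(m, bs). (m, permute_list \<sigma> bs))"
proof -
  have p: "\<sigma> permutes {..<n}" using s by (simp add: sym_perms_def)
  show ?thesis unfolding slotwise_def prod.case
  proof (intro conjI allI impI)
    fix m bs assume g: "(m, bs) \<in> gens n"
    show "\<exists>\<phi>\<in>lin_maps R M M. \<exists>bs'. length bs' = n \<and> set bs' \<subseteq> carrier B \<and>
        (\<forall>m\<in>carrier M. (m, permute_list \<sigma> bs) = (\<phi> m, bs'))"
      by (intro bexI[OF _ lin_id] exI[of _ "permute_list \<sigma> bs"]) (use g p in \<open>simp add: gens_iff set_permute_list\<close>)
  next
    fix m bs i assume a: "(m, bs) \<in> gens n \<and> i < n"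
    have inv: "pinv \<sigma> i < n" using a permutes_in_image[OF permutes_inv[OF p]] by auto
    have eq: "permute_list \<sigma> (bs[i := b]) = (permute_list \<sigma> bs)[pinv \<sigma> i := b]" for b
    proof (rule nth_equalityI)
      fix k assume "k < length (permute_list \<sigma> (bs[i := b]))"
      then have k: "k < n" using a by (simp add: gens_iff)
      have "\<sigma> k < n" using k permutes_in_image[OF p] by auto
      moreover have "\<sigma> k = i \<longleftrightarrow> k = pinv \<sigma> i"
        using permutes_inverses[OF p] by metis
      ultimately show "permute_list \<sigma> (bs[i := b]) ! k = (permute_list \<sigma> bs)[pinv \<sigma> i := b] ! k"
        using a p k inv by (simp add: gens_iff permute_list_nth nth_list_update) metis
    qed simp
    show "(\<exists>\<phi> \<in> lin_maps R B B. \<exists>m' bs' i'. (m', bs') \<in> gens n \<and> i' < n \<and>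
         (\<forall>b\<in>carrier B. (m, permute_list \<sigma> (bs[i := b])) = (m', bs'[i' := \<phi> b]))) \<or>
      (\<exists>\<phi> \<in> lin_maps R B M. \<exists>bs'. length bs' = n \<and> set bs' \<subseteq> carrier B \<and>
         (\<forall>b\<in>carrier B. (m, permute_list \<sigma> (bs[i := b])) = (\<phi> b, bs')))"
      by (intro disjI1 bexI[OF _ lin_id] exI[of _ m] exI[of _ "permute_list \<sigma> bs"] exI[of _ "pinv \<sigma> i"])
        (use a p in \<open>simp add: eq inv gens_iff set_permute_list\<close>)
  qed
qed

lemma perm_act_multilin:
  assumes s: "\<sigma> \<in> sym_perms n"
  shows "multilin R B M n (H n) (\<lambda>(m, bs). pure n (m, permute_list (pinv \<sigma>) bs))"
  using multilin_slotwise[OF B_mod M_mod hoch_pure_multilin[OF B_mod M_mod] perm_slotwise[OF sym_perms_inv[OF s]]]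
  by (simp add: case_prod_unfold)

lemma perm_act_lin: "\<sigma> \<in> sym_perms n \<Longrightarrow> perm_act R B M n \<sigma> \<in> lin_maps R (H n) (H n)"
  unfolding perm_act_def by (rule hoch_lift_lin[OF B_mod M_mod H_mod perm_act_multilin])

lemma perm_act_pure:
  "\<sigma> \<in> sym_perms n \<Longrightarrow> (m, bs) \<in> gens n \<Longrightarrow>
     perm_act R B M n \<sigma> (pure n (m, bs)) = pure n (m, permute_list (pinv \<sigma>) bs)"
  using hoch_lift_pure[OF B_mod M_mod H_mod perm_act_multilin] by (simp add: perm_act_def)

lemma permute_gens: "\<sigma> \<in> sym_perms n \<Longrightarrow> (m, bs) \<in> gens n \<Longrightarrow> (m, permute_list \<sigma> bs) \<in> gens n"
  using slotwise_closed[OF perm_slotwise] by fastforce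

lemma act_lin_map: "act n f \<in> lin_maps R (H n) (H n)"
  unfolding ga_act_def[abs_def]
  by (intro lin_sum_fun[OF H_mod finite_sym_perms] lin_smult_fun[OF H_mod iota(1)] perm_act_lin)

lemma act_pure:
  assumes g: "(m, bs) \<in> gens n"
  shows "act n f (pure n (m, bs)) = (\<Oplus>\<^bsub>H n\<^esub>\<sigma>\<in>sym_perms n. \<iota> (f \<sigma>) \<odot>\<^bsub>H n\<^esub> pure n (m, permute_list (pinv \<sigma>) bs))"
proof -
  interpret H: module R "H n" by (rule H_mod)
  show ?thesis unfolding ga_act_def
    by (rule H.M.finsum_cong') (use g in \<open>auto simp: perm_act_pure iota(1) pure_closed permute_gens sym_perms_inv\<close>)
qed

lemma act_mult:
  assumes x: "x \<in> carrier (H n)"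
  shows "act n f (act n g x) = act n (ga_mult n f g) x"
proof (rule H_lin_eq[OF H_mod lin_comp[OF act_lin_map act_lin_map] act_lin_map _ x])
  interpret H: module R "H n" by (rule H_mod)
  fix y assume "y \<in> gens n"
  then obtain m bs where y: "y = (m, bs)" and gy: "(m, bs) \<in> gens n" by (cases y) auto
  have len: "length bs = n" using gy by (simp add: gens_iff)
  let ?S = "sym_perms n"
  have pc: "pure n (m, permute_list (pinv \<sigma>) bs) \<in> carrier (H n)" if "\<sigma> \<in> ?S" for \<sigma>
    using that gy by (intro pure_closed permute_gens sym_perms_inv)
  have comp: "permute_list (pinv \<sigma>) (permute_list (pinv \<tau>) bs) = permute_list (pinv (\<sigma> \<circ> \<tau>)) bs"
    if "\<sigma> \<in> ?S" "\<tau> \<in> ?S" for \<sigma> \<tau>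
  proof -
    have p: "\<sigma> permutes {..<n}" "\<tau> permutes {..<n}" using that by (auto simp: sym_perms_def)
    have "pinv (\<sigma> \<circ> \<tau>) = pinv \<tau> \<circ> pinv \<sigma>"
      by (rule o_inv_distrib) (use p permutes_bij in blast)+
    then show ?thesis using permute_list_compose[of "pinv \<sigma>" bs "pinv \<tau>"] permutes_inv[OF p(1)] len by simp
  qed
  have "act n f (act n g (pure n y))
     = (\<Oplus>\<^bsub>H n\<^esub>\<tau>\<in>?S. act n f (\<iota> (g \<tau>) \<odot>\<^bsub>H n\<^esub> pure n (m, permute_list (pinv \<tau>) bs)))"
    unfolding y act_pure[OF gy] by (rule lin_finsum[OF H_mod H_mod act_lin_map]) (use pc iota(1) in auto)
  also have "\<dots> = (\<Oplus>\<^bsub>H n\<^esub>\<tau>\<in>?S. \<iota> (g \<tau>) \<odot>\<^bsub>H n\<^esub> (\<Oplus>\<^bsub>H n\<^esub>\<sigma>\<in>?S. \<iota> (f \<sigma>) \<odot>\<^bsub>H n\<^esub>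
       pure n (m, permute_list (pinv \<sigma>) (permute_list (pinv \<tau>) bs))))"
  proof (rule H.M.finsum_cong'[OF refl])
    have g': "(m, permute_list (pinv \<tau>) bs) \<in> gens n" if "\<tau> \<in> ?S" for \<tau>
      using that gy by (intro permute_gens sym_perms_inv)
    fix \<tau> assume t: "\<tau> \<in> ?S"
    show "act n f (\<iota> (g \<tau>) \<odot>\<^bsub>H n\<^esub> pure n (m, permute_list (pinv \<tau>) bs))
       = \<iota> (g \<tau>) \<odot>\<^bsub>H n\<^esub> (\<Oplus>\<^bsub>H n\<^esub>\<sigma>\<in>?S. \<iota> (f \<sigma>) \<odot>\<^bsub>H n\<^esub>
         pure n (m, permute_list (pinv \<sigma>) (permute_list (pinv \<tau>) bs)))"
      using lin_smult[OF act_lin_map iota(1) pc[OF t]] act_pure[OF g'[OF t]] by simp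
  next
    have g': "(m, permute_list (pinv \<tau>) bs) \<in> gens n" if "\<tau> \<in> ?S" for \<tau>
      using that gy by (intro permute_gens sym_perms_inv)
    show "(\<lambda>\<tau>. \<iota> (g \<tau>) \<odot>\<^bsub>H n\<^esub> (\<Oplus>\<^bsub>H n\<^esub>\<sigma>\<in>?S. \<iota> (f \<sigma>) \<odot>\<^bsub>H n\<^esub>
         pure n (m, permute_list (pinv \<sigma>) (permute_list (pinv \<tau>) bs)))) \<in> ?S \<rightarrow> carrier (H n)"
      by (intro Pi_I H.smult_closed iota(1) H.M.finsum_closed pure_closed permute_gens[OF _ g'] sym_perms_inv)
  qed
  also have "\<dots> = (\<Oplus>\<^bsub>H n\<^esub>x\<in>?S \<times> ?S. \<iota> (g (fst x) * f (snd x)) \<odot>\<^bsub>H n\<^esub>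
       pure n (m, permute_list (pinv (snd x)) (permute_list (pinv (fst x)) bs)))"
    by (rule finsum_finsum[OF H_mod iota_hom])
      (use gy in \<open>auto intro!: pure_closed permute_gens sym_perms_inv\<close>)
  also have "\<dots> = (\<Oplus>\<^bsub>H n\<^esub>\<rho>\<in>?S. \<iota> (ga_mult n f g \<rho>) \<odot>\<^bsub>H n\<^esub> pure n (m, permute_list (pinv \<rho>) bs))"
  proof (rule transfer[OF H_mod, where G = "pure n"])
    fix F :: "'m \<times> 'a list \<Rightarrow> rat"
    have "(\<Sum>x\<in>?S \<times> ?S. g (fst x) * f (snd x) * F (m, permute_list (pinv (snd x)) (permute_list (pinv (fst x)) bs)))
       = (\<Sum>\<tau>\<in>?S. \<Sum>\<sigma>\<in>?S. g \<tau> * f \<sigma> * F (m, permute_list (pinv (\<sigma> \<circ> \<tau>)) bs))"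
      unfolding sum.cartesian_product by (rule sum.cong[OF refl]) (auto simp: comp)
    also have "\<dots> = (\<Sum>\<sigma>\<in>?S. \<Sum>\<tau>\<in>?S. g \<tau> * f \<sigma> * F (m, permute_list (pinv (\<sigma> \<circ> \<tau>)) bs))" by (rule sum.swap)
    also have "\<dots> = (\<Sum>\<rho>\<in>?S. ga_mult n f g \<rho> * F (m, permute_list (pinv \<rho>) bs))"
      by (simp add: sum_ga_mult sum_distrib_left mult_ac)
    finally show "(\<Sum>x\<in>?S \<times> ?S. g (fst x) * f (snd x) * F (m, permute_list (pinv (snd x)) (permute_list (pinv (fst x)) bs)))
      = (\<Sum>\<rho>\<in>?S. ga_mult n f g \<rho> * F (m, permute_list (pinv \<rho>) bs))" .
  qed (use gy in \<open>auto intro!: pure_closed permute_gens sym_perms_inv\<close>)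
  also have "\<dots> = act n (ga_mult n f g) (pure n y)" unfolding y act_pure[OF gy] ..
  finally show "act n f (act n g (pure n y)) = act n (ga_mult n f g) (pure n y)" .
qed

lemma act_one: "x \<in> carrier (H n) \<Longrightarrow> act n ga_one x = x"
proof (rule H_lin_eq[OF H_mod act_lin_map lin_id])
  interpret H: module R "H n" by (rule H_mod)
  fix y assume "y \<in> gens n"
  then obtain m bs where y: "y = (m, bs)" and gy: "(m, bs) \<in> gens n" by (cases y) auto
  have "act n ga_one (pure n y) = (\<Oplus>\<^bsub>H n\<^esub>u\<in>{()}. \<iota> 1 \<odot>\<^bsub>H n\<^esub> pure n (m, bs))"
    unfolding y act_pure[OF gy]
  proof (rule transfer[OF H_mod, where G = "pure n" and \<psi> = "\<lambda>_. (m, bs)" and v = "\<lambda>_. 1"])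
    fix F :: "'m \<times> 'a list \<Rightarrow> rat"
    show "(\<Sum>\<sigma>\<in>sym_perms n. ga_one \<sigma> * F (m, permute_list (pinv \<sigma>) bs)) = (\<Sum>u\<in>{()}. 1 * F (m, bs))"
      using sum_ga_one[where n = n and F = "\<lambda>\<sigma>. F (m, permute_list (pinv \<sigma>) bs)"] by (simp add: inv_id[unfolded id_def] id_def)
  qed (use gy in \<open>auto intro!: pure_closed permute_gens sym_perms_inv\<close>)
  also have "\<dots> = pure n y" using pure_closed[OF gy] by (simp add: iota(4) y)
  finally show "act n ga_one (pure n y) = pure n y" .
qed

lemma perm_act_closed: "\<sigma> \<in> sym_perms n \<Longrightarrow> x \<in> carrier (H n) \<Longrightarrow> perm_act R B M n \<sigma> x \<in> carrier (H n)"
  by (rule lin_closed[OF perm_act_lin])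

lemma act_closed': "x \<in> carrier (H n) \<Longrightarrow> act n f x \<in> carrier (H n)"
  by (rule lin_closed[OF act_lin_map])

lemma act_add:
  assumes x: "x \<in> carrier (H n)"
  shows "act n (\<lambda>\<sigma>. f \<sigma> + g \<sigma>) x = act n f x \<oplus>\<^bsub>H n\<^esub> act n g x"
proof -
  interpret H: module R "H n" by (rule H_mod)
  have "act n (\<lambda>\<sigma>. f \<sigma> + g \<sigma>) x = (\<Oplus>\<^bsub>H n\<^esub>\<sigma>\<in>sym_perms n.
     \<iota> (f \<sigma>) \<odot>\<^bsub>H n\<^esub> perm_act R B M n \<sigma> x \<oplus>\<^bsub>H n\<^esub> \<iota> (g \<sigma>) \<odot>\<^bsub>H n\<^esub> perm_act R B M n \<sigma> x)"
    unfolding ga_act_def using x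
    by (intro H.M.finsum_cong') (auto simp: iota(2) H.smult_l_distr iota(1) perm_act_closed)
  also have "\<dots> = act n f x \<oplus>\<^bsub>H n\<^esub> act n g x"
    unfolding ga_act_def using x by (intro H.M.finsum_addf) (auto simp: iota(1) perm_act_closed)
  finally show ?thesis .
qed

lemma act_zero:
  assumes x: "x \<in> carrier (H n)"
  shows "act n (\<lambda>_. 0) x = \<zero>\<^bsub>H n\<^esub>"
proof -
  interpret H: module R "H n" by (rule H_mod)
  show ?thesis unfolding ga_act_def
    using x by (intro H.M.add.finprod_one_eqI) (simp add: iota_0[OF B_mod iota_hom] perm_act_closed)
qed

lemma act_scale:
  assumes x: "x \<in> carrier (H n)"
  shows "act n (\<lambda>\<sigma>. c * f \<sigma>) x = \<iota> c \<odot>\<^bsub>H n\<^esub> act n f x"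
proof -
  interpret H: module R "H n" by (rule H_mod)
  have "act n (\<lambda>\<sigma>. c * f \<sigma>) x = (\<Oplus>\<^bsub>H n\<^esub>\<sigma>\<in>sym_perms n. \<iota> c \<odot>\<^bsub>H n\<^esub> (\<iota> (f \<sigma>) \<odot>\<^bsub>H n\<^esub> perm_act R B M n \<sigma> x))"
    unfolding ga_act_def using x
    by (intro H.M.finsum_cong') (auto simp: iota(3) H.smult_assoc1 iota(1) perm_act_closed)
  also have "\<dots> = \<iota> c \<odot>\<^bsub>H n\<^esub> act n f x"
    unfolding ga_act_def using x by (intro H.finsum_smult_ldistr[symmetric]) (auto simp: iota(1) perm_act_closed)
  finally show ?thesis .
qed

lemma lsort_gens: "(m, bs) \<in> gens n \<Longrightarrow> (m, lsort n f bs) \<in> gens n"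
  by (simp add: gens_iff)

text \<open>The group algebra acts through inverses of permutations, and \<open>adams\<close> is a sum of inverses of
  sorting permutations; the two inversions cancel.\<close>

lemma act_adams_pure:
  assumes g: "(m, bs) \<in> gens n"
  shows "act n (adams n p) (pure n (m, bs))
     = (\<Oplus>\<^bsub>H n\<^esub>f\<in>labels n p. \<iota> (lsign n f) \<odot>\<^bsub>H n\<^esub> pure n (m, lsort n f bs))"
  unfolding act_pure[OF g]
proof (rule transfer[OF H_mod, where G = "pure n"])
  fix F :: "'m \<times> 'a list \<Rightarrow> rat"
  have "pinv (pinv (sort_rank n f)) = sort_rank n f" for f
    using permutes_inv_inv[OF sort_rank_permutes] .
  then show "(\<Sum>\<sigma>\<in>sym_perms n. adams n p \<sigma> * F (m, permute_list (pinv \<sigma>) bs))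
     = (\<Sum>f\<in>labels n p. lsign n f * F (m, lsort n f bs))"
    unfolding sum_adams[of n p "\<lambda>\<sigma>. F (m, permute_list (pinv \<sigma>) bs)"] by (simp add: lsign_def lsort_def)
qed (use g in \<open>auto intro!: pure_closed permute_gens sym_perms_inv lsort_gens\<close>)

lemma adams_boundary:
  assumes x: "x \<in> carrier (H (Suc N))"
  shows "d (Suc N) (act (Suc N) (adams (Suc N) 2) x) = act N (adams N 2) (d (Suc N) x)"
proof (rule H_lin_eq[OF H_mod lin_comp[OF act_lin_map d_lin] lin_comp[OF d_lin act_lin_map] _ x])
  interpret H: module R "H N" by (rule H_mod)
  fix y assume "y \<in> gens (Suc N)"
  then obtain m bs where y: "y = (m, bs)" and gy: "(m, bs) \<in> gens (Suc N)" by (cases y) auto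
  have len: "length bs = Suc N" and sub: "set bs \<subseteq> carrier B" and m: "m \<in> carrier M" using gy by (auto simp: gens_iff)
  let ?n = "Suc N"
  have fc: "face B l r ?n i (m, lsort ?n f bs) \<in> gens N" if "i \<in> {0..?n}" for i f
    using that gy by (intro face_closed lsort_gens) auto
  have fc': "face B l r ?n i (m, bs) \<in> gens N" if "i \<in> {0..?n}" for i
    using that gy by (intro face_closed) auto
  have fs: "map_prod id (lsort N f) z \<in> gens N" if "z \<in> gens N" for z f
    using that by (cases z) (simp add: gens_iff)
  have "d ?n (act ?n (adams ?n 2) (pure ?n y))
     = (\<Oplus>\<^bsub>H N\<^esub>f\<in>labels ?n 2. d ?n (\<iota> (lsign ?n f) \<odot>\<^bsub>H ?n\<^esub> pure ?n (m, lsort ?n f bs)))"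
    unfolding y act_adams_pure[OF gy]
    by (rule lin_finsum[OF H_mod H_mod d_lin])
      (use module.smult_closed[OF H_mod iota(1) pure_closed[OF lsort_gens[OF gy]]] in blast)
  also have "\<dots> = (\<Oplus>\<^bsub>H N\<^esub>f\<in>labels ?n 2. \<iota> (lsign ?n f) \<odot>\<^bsub>H N\<^esub> (\<Oplus>\<^bsub>H N\<^esub>i\<in>{0..?n}. \<iota> ((-1) ^ i) \<odot>\<^bsub>H N\<^esub>
       pure N (face B l r ?n i (m, lsort ?n f bs))))"
  proof (rule H.M.finsum_cong'[OF refl])
    show "(\<lambda>f. \<iota> (lsign ?n f) \<odot>\<^bsub>H N\<^esub> (\<Oplus>\<^bsub>H N\<^esub>i\<in>{0..?n}. \<iota> ((-1) ^ i) \<odot>\<^bsub>H N\<^esub>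
       pure N (face B l r ?n i (m, lsort ?n f bs)))) \<in> labels ?n 2 \<rightarrow> carrier (H N)"
      by (intro Pi_I H.smult_closed iota(1) H.M.finsum_closed pure_closed fc)
    fix f
    show "d ?n (\<iota> (lsign ?n f) \<odot>\<^bsub>H ?n\<^esub> pure ?n (m, lsort ?n f bs)) = \<iota> (lsign ?n f) \<odot>\<^bsub>H N\<^esub>
       (\<Oplus>\<^bsub>H N\<^esub>i\<in>{0..?n}. \<iota> ((-1) ^ i) \<odot>\<^bsub>H N\<^esub> pure N (face B l r ?n i (m, lsort ?n f bs)))"
      unfolding lin_smult[OF d_lin iota(1) pure_closed[OF lsort_gens[OF gy]]] d_pure[OF lsort_gens[OF gy]] ..
  qed
  also have "\<dots> = (\<Oplus>\<^bsub>H N\<^esub>x\<in>labels ?n 2 \<times> {0..?n}. \<iota> (lsign ?n (fst x) * (-1) ^ snd x) \<odot>\<^bsub>H N\<^esub>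
       pure N (face B l r ?n (snd x) (m, lsort ?n (fst x) bs)))"
    by (rule finsum_finsum[OF H_mod iota_hom]) (simp_all add: pure_closed fc del: atLeastAtMost_iff)
  also have "\<dots> = (\<Oplus>\<^bsub>H N\<^esub>x\<in>{0..?n} \<times> labels N 2. \<iota> ((-1) ^ fst x * lsign N (snd x)) \<odot>\<^bsub>H N\<^esub>
       pure N (map_prod id (lsort N (snd x)) (face B l r ?n (fst x) (m, bs))))"
  proof (rule transfer[OF H_mod, where G = "pure N"])
    fix F :: "'m \<times> 'a list \<Rightarrow> rat"
    have "(\<Sum>x\<in>labels ?n 2 \<times> {0..?n}. lsign ?n (fst x) * (-1) ^ snd x * F (face B l r ?n (snd x) (m, lsort ?n (fst x) bs)))
       = (\<Sum>f\<in>labels ?n 2. \<Sum>i\<in>{0..?n}. lsign ?n f * (-1) ^ i * F (face B l r ?n i (m, lsort ?n f bs)))"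
      by (simp only: sum.cartesian_product case_prod_unfold)
    also have "\<dots> = (\<Sum>f\<in>labels N 2. \<Sum>j\<in>{0..?n}. lsign N f * (-1) ^ j * F (map_prod id (lsort N f) (face B l r ?n j (m, bs))))"
    proof (rule shuffle_boundary[OF len])
      fix a b assume ab: "a \<in> set bs" "b \<in> set bs"
      then show "a \<otimes>\<^bsub>B\<^esub> b = b \<otimes>\<^bsub>B\<^esub> a" using sub by (intro mult_comm) auto
      show "l a m = r m a" using ab sub m by (intro act_sym) auto
    qed
    also have "\<dots> = (\<Sum>j\<in>{0..?n}. \<Sum>f\<in>labels N 2. lsign N f * (-1) ^ j * F (map_prod id (lsort N f) (face B l r ?n j (m, bs))))"
      by (rule sum.swap)
    also have "\<dots> = (\<Sum>x\<in>{0..?n} \<times> labels N 2. (-1) ^ fst x * lsign N (snd x) *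
        F (map_prod id (lsort N (snd x)) (face B l r ?n (fst x) (m, bs))))"
      by (simp only: sum.cartesian_product case_prod_unfold mult.commute[of "lsign N _"])
    finally show "(\<Sum>x\<in>labels ?n 2 \<times> {0..?n}. lsign ?n (fst x) * (-1) ^ snd x * F (face B l r ?n (snd x) (m, lsort ?n (fst x) bs)))
       = (\<Sum>x\<in>{0..?n} \<times> labels N 2. (-1) ^ fst x * lsign N (snd x) *
        F (map_prod id (lsort N (snd x)) (face B l r ?n (fst x) (m, bs))))" .
  next
    fix x assume "x \<in> labels ?n 2 \<times> {0..?n}"
    then have "snd x \<in> {0..?n}" by (auto simp del: atLeastAtMost_iff)
    then show "pure N (face B l r ?n (snd x) (m, lsort ?n (fst x) bs)) \<in> carrier (H N)"
      by (intro pure_closed fc)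
  next
    fix x assume "x \<in> {0..?n} \<times> labels N 2"
    then have "fst x \<in> {0..?n}" by (auto simp del: atLeastAtMost_iff)
    then show "pure N (map_prod id (lsort N (snd x)) (face B l r ?n (fst x) (m, bs))) \<in> carrier (H N)"
      by (intro pure_closed fs fc')
  qed simp_all
  also have "\<dots> = (\<Oplus>\<^bsub>H N\<^esub>i\<in>{0..?n}. \<iota> ((-1) ^ i) \<odot>\<^bsub>H N\<^esub> (\<Oplus>\<^bsub>H N\<^esub>f\<in>labels N 2. \<iota> (lsign N f) \<odot>\<^bsub>H N\<^esub>
       pure N (map_prod id (lsort N f) (face B l r ?n i (m, bs)))))"
    by (rule finsum_finsum[OF H_mod iota_hom, symmetric]) (simp_all add: pure_closed fc' fs del: atLeastAtMost_iff)
  also have "\<dots> = (\<Oplus>\<^bsub>H N\<^esub>i\<in>{0..?n}. act N (adams N 2) (\<iota> ((-1) ^ i) \<odot>\<^bsub>H N\<^esub> pure N (face B l r ?n i (m, bs))))"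
  proof (rule H.M.finsum_cong'[OF refl])
    show "(\<lambda>i. act N (adams N 2) (\<iota> ((-1) ^ i) \<odot>\<^bsub>H N\<^esub> pure N (face B l r ?n i (m, bs)))) \<in> {0..?n} \<rightarrow> carrier (H N)"
      by (intro Pi_I act_closed' H.smult_closed iota(1) pure_closed fc')
    fix i assume i: "i \<in> {0..?n}"
    obtain m' bs' where z: "face B l r ?n i (m, bs) = (m', bs')" by force
    have gz: "(m', bs') \<in> gens N" using fc'[OF i] z by simp
    show "\<iota> ((-1) ^ i) \<odot>\<^bsub>H N\<^esub> (\<Oplus>\<^bsub>H N\<^esub>f\<in>labels N 2. \<iota> (lsign N f) \<odot>\<^bsub>H N\<^esub>
       pure N (map_prod id (lsort N f) (face B l r ?n i (m, bs))))
      = act N (adams N 2) (\<iota> ((-1) ^ i) \<odot>\<^bsub>H N\<^esub> pure N (face B l r ?n i (m, bs)))"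
      unfolding z lin_smult[OF act_lin_map iota(1) pure_closed[OF gz]] act_adams_pure[OF gz] by simp
  qed
  also have "\<dots> = act N (adams N 2) (d ?n (pure ?n y))"
    unfolding y d_pure[OF gy]
    by (rule lin_finsum[OF H_mod H_mod act_lin_map, symmetric]) (intro H.smult_closed iota(1) pure_closed fc')
  finally show "d ?n (act ?n (adams ?n 2) (pure ?n y)) = act N (adams N 2) (d ?n (pure ?n y))" .
qed

lemma d_closed: "x \<in> carrier (H (Suc N)) \<Longrightarrow> d (Suc N) x \<in> carrier (H N)"
  by (rule lin_closed[OF d_lin])

lemma act_sh:
  assumes n: "n \<ge> 1" and x: "x \<in> carrier (H n)"
  shows "act n (sh n) x = act n (adams n 2) x \<oplus>\<^bsub>H n\<^esub> \<iota> (- 2) \<odot>\<^bsub>H n\<^esub> x"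
proof -
  have "sh n = (\<lambda>\<sigma>. adams n 2 \<sigma> + (- 2) * ga_one \<sigma>)" unfolding adams_two[OF n] by simp
  then have "act n (sh n) x = act n (adams n 2) x \<oplus>\<^bsub>H n\<^esub> act n (\<lambda>\<sigma>. (- 2) * ga_one \<sigma>) x"
    using act_add[OF x, of "adams n 2" "\<lambda>\<sigma>. (- 2) * ga_one \<sigma>"] by simp
  then show ?thesis unfolding act_scale[OF x] act_one[OF x] .
qed

lemma sh_boundary:
  assumes x: "x \<in> carrier (H (Suc N))"
  shows "d (Suc N) (act (Suc N) (sh (Suc N)) x) = act N (sh N) (d (Suc N) x)"
proof (cases N)
  case 0
  have "sh (Suc 0) = (\<lambda>_. 0)" "sh 0 = (\<lambda>_. 0)" by (simp_all add: sh_def fun_eq_iff)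
  then show ?thesis unfolding 0 using x d_closed[OF x]
    by (simp add: act_zero 0 lin_zero[OF H_mod H_mod d_lin[of 0]])
next
  case (Suc N')
  interpret H': module R "H (Suc N)" by (rule H_mod)
  have N: "N \<ge> 1" using Suc by simp
  have "d (Suc N) (act (Suc N) (sh (Suc N)) x)
     = d (Suc N) (act (Suc N) (adams (Suc N) 2) x) \<oplus>\<^bsub>H N\<^esub> \<iota> (- 2) \<odot>\<^bsub>H N\<^esub> d (Suc N) x"
    using x iota(1) by (simp add: act_sh lin_add[OF d_lin] lin_smult[OF d_lin] act_closed')
  also have "\<dots> = act N (sh N) (d (Suc N) x)"
    unfolding adams_boundary[OF x] act_sh[OF N d_closed[OF x]] ..
  finally show ?thesis .
qed

abbreviation "e n \<equiv> act n (eulerian n 1)"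

lemma sh_e: "x \<in> carrier (H n) \<Longrightarrow> act n (sh n) (e n x) = \<zero>\<^bsub>H n\<^esub>"
  by (simp add: act_mult sh_eulerian_1[unfolded One_nat_def] act_zero)

lemma e_sh: "x \<in> carrier (H n) \<Longrightarrow> e n (act n (sh n) x) = \<zero>\<^bsub>H n\<^esub>"
  by (simp add: act_mult eulerian_1_sh[unfolded One_nat_def] act_zero)

text \<open>One cofactor \<open>q\<close> serves on both sides of \<open>sh\<close>: the first form shows that \<open>e\<close> is the identity modulo
  shuffles, the second that \<open>e\<close> fixes whatever \<open>sh\<close> kills.\<close>

lemma e_decomp:
  "\<exists>q. (\<forall>x \<in> carrier (H n). e n x = x \<oplus>\<^bsub>H n\<^esub> act n (sh n) (act n q x)) \<and>
       (\<forall>x \<in> carrier (H n). e n x = x \<oplus>\<^bsub>H n\<^esub> act n q (act n (sh n) x))"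
proof -
  obtain q where q: "eulerian n 1 = (\<lambda>\<sigma>. ga_one \<sigma> + ga_mult n (sh n) q \<sigma>)"
    "ga_mult n (sh n) q = ga_mult n q (sh n)"
    using eulerian_1_decomp[of n] by blast
  have "e n x = x \<oplus>\<^bsub>H n\<^esub> act n (ga_mult n (sh n) q) x" if "x \<in> carrier (H n)" for x
    unfolding q(1) act_add[OF that] act_one[OF that] ..
  then show ?thesis by (intro exI[of _ q]) (simp add: act_mult q(2))
qed

lemma e_idem:
  assumes x: "x \<in> carrier (H n)"
  shows "e n (e n x) = e n x"
proof -
  interpret H: module R "H n" by (rule H_mod)
  obtain q where q: "\<forall>x \<in> carrier (H n). e n x = x \<oplus>\<^bsub>H n\<^esub> act n q (act n (sh n) x)"
    using e_decomp by blast
  then have "e n (e n x) = e n x \<oplus>\<^bsub>H n\<^esub> act n q (act n (sh n) (e n x))" using act_closed'[OF x] by blast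
  then show ?thesis using act_closed'[OF x] unfolding sh_e[OF x] lin_zero[OF H_mod H_mod act_lin_map] by simp
qed

text \<open>The expression \<open>e d e x\<close> is evaluated in two ways. Since \<open>e x\<close> is \<open>x\<close> plus a shuffle, and \<open>d\<close> maps
  shuffles to shuffles, which \<open>e\<close> kills, it equals \<open>e d x\<close>. Since \<open>sh\<close> kills \<open>e x\<close>, it kills \<open>d e x\<close>, so
  \<open>e\<close> fixes the latter.\<close>

lemma e_boundary:
  assumes x: "x \<in> carrier (H (Suc N))"
  shows "d (Suc N) (e (Suc N) x) = e N (d (Suc N) x)"
proof -
  interpret H: module R "H N" by (rule H_mod)
  let ?n = "Suc N"
  obtain q where q: "\<forall>x \<in> carrier (H ?n). e ?n x = x \<oplus>\<^bsub>H ?n\<^esub> act ?n (sh ?n) (act ?n q x)"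
    using e_decomp by blast
  obtain q' where q': "\<forall>x \<in> carrier (H N). e N x = x \<oplus>\<^bsub>H N\<^esub> act N q' (act N (sh N) x)"
    using e_decomp by blast
  have ex: "e ?n x \<in> carrier (H ?n)" and dx: "d ?n x \<in> carrier (H N)" and qx: "act ?n q x \<in> carrier (H ?n)"
    using x by (auto intro: act_closed' d_closed)
  have "e N (d ?n (e ?n x)) = e N (d ?n x \<oplus>\<^bsub>H N\<^esub> act N (sh N) (d ?n (act ?n q x)))"
    unfolding bspec[OF q x] lin_add[OF d_lin x act_closed'[OF qx]] sh_boundary[OF qx] ..
  also have "\<dots> = e N (d ?n x)"
    unfolding lin_add[OF act_lin_map dx act_closed'[OF d_closed[OF qx]]] e_sh[OF d_closed[OF qx]]
    using act_closed'[OF dx] by simp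
  finally have 1: "e N (d ?n (e ?n x)) = e N (d ?n x)" .
  have "e N (d ?n (e ?n x)) = d ?n (e ?n x) \<oplus>\<^bsub>H N\<^esub> act N q' (act N (sh N) (d ?n (e ?n x)))"
    using q' d_closed[OF ex] by blast
  also have "\<dots> = d ?n (e ?n x)"
    unfolding sh_boundary[OF ex, symmetric] sh_e[OF x] lin_zero[OF H_mod H_mod d_lin] lin_zero[OF H_mod H_mod act_lin_map]
    using d_closed[OF ex] by simp
  finally show ?thesis using 1 by simp
qed

lemma d_d:
  assumes x: "x \<in> carrier (H (Suc (Suc N)))"
  shows "d (Suc N) (d (Suc (Suc N)) x) = \<zero>\<^bsub>H N\<^esub>"
proof (rule H_lin_eq[OF H_mod lin_comp[OF d_lin d_lin] lin_zero_fun[OF H_mod] _ x])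
  interpret H: module R "H N" by (rule H_mod)
  let ?n = "Suc N" and ?k = "Suc (Suc N)"
  fix y assume "y \<in> gens ?k"
  then obtain m bs where y: "y = (m, bs)" and gy: "(m, bs) \<in> gens ?k" by (cases y) auto
  have len: "length bs = ?k" and sub: "set bs \<subseteq> carrier B" and m: "m \<in> carrier M" using gy by (auto simp: gens_iff)
  have fc: "face B l r ?k i y \<in> gens ?n" if "i \<in> {0..?k}" for i
    unfolding y by (rule face_closed[OF _ gy]) (use that in simp)
  have fc': "face B l r ?n j (face B l r ?k i y) \<in> gens N" if "i \<in> {0..?k}" "j \<in> {0..?n}" for i j
    by (rule face_closed[OF _ fc[OF that(1)]]) (use that in simp)
  have "d ?n (d ?k (pure ?k y)) = (\<Oplus>\<^bsub>H N\<^esub>i\<in>{0..?k}. d ?n (\<iota> ((-1) ^ i) \<odot>\<^bsub>H ?n\<^esub> pure ?n (face B l r ?k i y)))"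
    unfolding y d_pure[OF gy]
    by (rule lin_finsum[OF H_mod H_mod d_lin])
      (rule module.smult_closed[OF H_mod iota(1) pure_closed], rule fc[unfolded y])
  also have "\<dots> = (\<Oplus>\<^bsub>H N\<^esub>i\<in>{0..?k}. \<iota> ((-1) ^ i) \<odot>\<^bsub>H N\<^esub> (\<Oplus>\<^bsub>H N\<^esub>j\<in>{0..?n}. \<iota> ((-1) ^ j) \<odot>\<^bsub>H N\<^esub>
      pure N (face B l r ?n j (face B l r ?k i y))))"
  proof (rule H.M.finsum_cong'[OF refl])
    show "(\<lambda>i. \<iota> ((-1) ^ i) \<odot>\<^bsub>H N\<^esub> (\<Oplus>\<^bsub>H N\<^esub>j\<in>{0..?n}. \<iota> ((-1) ^ j) \<odot>\<^bsub>H N\<^esub>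
      pure N (face B l r ?n j (face B l r ?k i y)))) \<in> {0..?k} \<rightarrow> carrier (H N)"
      by (intro Pi_I H.smult_closed iota(1) H.M.finsum_closed pure_closed fc')
    fix i assume i: "i \<in> {0..?k}"
    show "d ?n (\<iota> ((-1) ^ i) \<odot>\<^bsub>H ?n\<^esub> pure ?n (face B l r ?k i y)) = \<iota> ((-1) ^ i) \<odot>\<^bsub>H N\<^esub>
       (\<Oplus>\<^bsub>H N\<^esub>j\<in>{0..?n}. \<iota> ((-1) ^ j) \<odot>\<^bsub>H N\<^esub> pure N (face B l r ?n j (face B l r ?k i y)))"
      unfolding lin_smult[OF d_lin iota(1) pure_closed[OF fc[OF i]]] d_pure[OF fc[OF i]] ..
  qed
  also have "\<dots> = (\<Oplus>\<^bsub>H N\<^esub>x\<in>{0..?k} \<times> {0..?n}. \<iota> ((-1) ^ fst x * (-1) ^ snd x) \<odot>\<^bsub>H N\<^esub>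
      pure N (face B l r ?n (snd x) (face B l r ?k (fst x) y)))"
    by (rule finsum_finsum[OF H_mod iota_hom]) (simp_all add: pure_closed fc' del: atLeastAtMost_iff)
  also have "\<dots> = (\<Oplus>\<^bsub>H N\<^esub>x\<in>{}. \<iota> 0 \<odot>\<^bsub>H N\<^esub> pure N x)"
  proof (rule transfer[OF H_mod, where G = "pure N" and \<psi> = "\<lambda>x. x" and v = "\<lambda>_. 0"])
    fix F :: "'m \<times> 'a list \<Rightarrow> rat"
    have "(\<Sum>i\<in>{0..?k}. \<Sum>j\<in>{0..?n}. (-1) ^ i * (-1) ^ j * F (face B l r ?n j (face B l r ?k i y))) = 0"
    proof (rule alternating_faces_cancel)
      fix i j assume ij: "i \<le> j" "j \<le> ?n"
      have c: "a \<in> carrier B" if "a \<in> set bs" for a using sub that by blast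
      have "face B l r ?n j (face B l r ?k i (m, bs)) = face B l r ?n i (face B l r ?k (Suc j) (m, bs))"
      proof (rule face_face[OF len _ ij])
        fix a b assume ab: "a \<in> set bs" "b \<in> set bs"
        note c = c[OF ab(1)] c[OF ab(2)]
        show "r m (a \<otimes>\<^bsub>B\<^esub> b) = r (r m a) b" using act_mult'[OF c m] .
        show "l (a \<otimes>\<^bsub>B\<^esub> b) m = l a (l b m)"
          using c m by (simp add: act_sym mult_closed act_closed mult_comm[of a b] act_mult')
        have "r m (a \<otimes>\<^bsub>B\<^esub> b) = r m (b \<otimes>\<^bsub>B\<^esub> a)" using c by (simp add: mult_comm)
        then show "r (l a m) b = l a (r m b)"
          using c m by (simp add: act_sym act_closed act_mult')
      qed (use c in \<open>auto intro: mult_assoc\<close>)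
      then show "F (face B l r ?n j (face B l r ?k i y)) = F (face B l r ?n i (face B l r ?k (Suc j) y))"
        unfolding y by simp
    qed
    then show "(\<Sum>x\<in>{0..?k} \<times> {0..?n}. (-1) ^ fst x * (-1) ^ snd x * F (face B l r ?n (snd x) (face B l r ?k (fst x) y)))
       = (\<Sum>x\<in>{}. 0 * F x)"
      by (simp only: sum.cartesian_product case_prod_unfold sum.empty)
  next
    fix x assume "x \<in> {0..?k} \<times> {0..?n}"
    then have "fst x \<in> {0..?k}" "snd x \<in> {0..?n}" by (auto simp del: atLeastAtMost_iff)
    then show "pure N (face B l r ?n (snd x) (face B l r ?k (fst x) y)) \<in> carrier (H N)"
      by (intro pure_closed fc')
  qed simp_all
  finally show "d ?n (d ?k (pure ?k y)) = \<zero>\<^bsub>H N\<^esub>" by simp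
qed

end

context
  fixes R :: "'k ring" and \<iota> :: "rat \<Rightarrow> 'k" and N :: "('k, 'y) module"
  assumes N: "module R N" and \<iota>: "\<iota> \<in> ring_hom rat_ring R"
begin

interpretation N: module R N by (rule N)

lemma finsum_transfer2:
  assumes S: "finite S" "finite S'" and T: "finite T" "finite T'"
    and G: "\<And>i. i \<in> S \<Longrightarrow> G (\<phi> i) \<in> carrier N" "\<And>i. i \<in> S' \<Longrightarrow> G (\<phi>' i) \<in> carrier N"
      "\<And>j. j \<in> T \<Longrightarrow> G (\<psi> j) \<in> carrier N" "\<And>j. j \<in> T' \<Longrightarrow> G (\<psi>' j) \<in> carrier N"
    and eq: "\<And>F :: 'x \<Rightarrow> rat. (\<Sum>i\<in>S. w i * F (\<phi> i)) + (\<Sum>i\<in>S'. w' i * F (\<phi>' i))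
       = (\<Sum>j\<in>T. v j * F (\<psi> j)) + (\<Sum>j\<in>T'. v' j * F (\<psi>' j))"
  shows "(\<Oplus>\<^bsub>N\<^esub>i\<in>S. \<iota> (w i) \<odot>\<^bsub>N\<^esub> G (\<phi> i)) \<oplus>\<^bsub>N\<^esub> (\<Oplus>\<^bsub>N\<^esub>i\<in>S'. \<iota> (w' i) \<odot>\<^bsub>N\<^esub> G (\<phi>' i))
     = (\<Oplus>\<^bsub>N\<^esub>j\<in>T. \<iota> (v j) \<odot>\<^bsub>N\<^esub> G (\<psi> j)) \<oplus>\<^bsub>N\<^esub> (\<Oplus>\<^bsub>N\<^esub>j\<in>T'. \<iota> (v' j) \<odot>\<^bsub>N\<^esub> G (\<psi>' j))"
proof -
  let ?Z = "(\<phi> ` S \<union> \<phi>' ` S') \<union> (\<psi> ` T \<union> \<psi>' ` T')"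
  have Z: "finite ?Z" using S T by simp
  have GZ: "G z \<in> carrier N" if "z \<in> ?Z" for z using G that by auto
  note iota = rat_ring_hom[OF \<iota>]
  have add: "(\<Oplus>\<^bsub>N\<^esub>z\<in>?Z. \<iota> (a z) \<odot>\<^bsub>N\<^esub> G z) \<oplus>\<^bsub>N\<^esub> (\<Oplus>\<^bsub>N\<^esub>z\<in>?Z. \<iota> (b z) \<odot>\<^bsub>N\<^esub> G z)
      = (\<Oplus>\<^bsub>N\<^esub>z\<in>?Z. \<iota> (a z + b z) \<odot>\<^bsub>N\<^esub> G z)" for a b
  proof -
    have c: "\<iota> (a z) \<odot>\<^bsub>N\<^esub> G z \<in> carrier N" if "z \<in> ?Z" for a z by (rule N.smult_closed[OF iota(1) GZ[OF that]])
    have "(\<Oplus>\<^bsub>N\<^esub>z\<in>?Z. \<iota> (a z + b z) \<odot>\<^bsub>N\<^esub> G z) = (\<Oplus>\<^bsub>N\<^esub>z\<in>?Z. \<iota> (a z) \<odot>\<^bsub>N\<^esub> G z \<oplus>\<^bsub>N\<^esub> \<iota> (b z) \<odot>\<^bsub>N\<^esub> G z)"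
    proof (rule N.M.finsum_cong'[OF refl])
      show "(\<lambda>z. \<iota> (a z) \<odot>\<^bsub>N\<^esub> G z \<oplus>\<^bsub>N\<^esub> \<iota> (b z) \<odot>\<^bsub>N\<^esub> G z) \<in> ?Z \<rightarrow> carrier N"
        by (rule Pi_I, rule N.M.a_closed; rule c)
      fix z assume "z \<in> ?Z"
      then show "\<iota> (a z + b z) \<odot>\<^bsub>N\<^esub> G z = \<iota> (a z) \<odot>\<^bsub>N\<^esub> G z \<oplus>\<^bsub>N\<^esub> \<iota> (b z) \<odot>\<^bsub>N\<^esub> G z"
        unfolding iota(2) by (intro N.smult_l_distr iota(1) GZ)
    qed
    also have "\<dots> = (\<Oplus>\<^bsub>N\<^esub>z\<in>?Z. \<iota> (a z) \<odot>\<^bsub>N\<^esub> G z) \<oplus>\<^bsub>N\<^esub> (\<Oplus>\<^bsub>N\<^esub>z\<in>?Z. \<iota> (b z) \<odot>\<^bsub>N\<^esub> G z)"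
      by (rule N.M.finsum_addf; rule Pi_I; rule c)
    finally show ?thesis by (rule sym)
  qed
  have fib': "(\<Oplus>\<^bsub>N\<^esub>i\<in>S. \<iota> (w i) \<odot>\<^bsub>N\<^esub> G (\<phi> i)) = (\<Oplus>\<^bsub>N\<^esub>z\<in>?Z. \<iota> (\<Sum>i\<in>S. w i * (if \<phi> i = z then 1 else 0)) \<odot>\<^bsub>N\<^esub> G z)"
    "(\<Oplus>\<^bsub>N\<^esub>i\<in>S'. \<iota> (w' i) \<odot>\<^bsub>N\<^esub> G (\<phi>' i)) = (\<Oplus>\<^bsub>N\<^esub>z\<in>?Z. \<iota> (\<Sum>i\<in>S'. w' i * (if \<phi>' i = z then 1 else 0)) \<odot>\<^bsub>N\<^esub> G z)"
    "(\<Oplus>\<^bsub>N\<^esub>i\<in>T. \<iota> (v i) \<odot>\<^bsub>N\<^esub> G (\<psi> i)) = (\<Oplus>\<^bsub>N\<^esub>z\<in>?Z. \<iota> (\<Sum>i\<in>T. v i * (if \<psi> i = z then 1 else 0)) \<odot>\<^bsub>N\<^esub> G z)"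
    "(\<Oplus>\<^bsub>N\<^esub>i\<in>T'. \<iota> (v' i) \<odot>\<^bsub>N\<^esub> G (\<psi>' i)) = (\<Oplus>\<^bsub>N\<^esub>z\<in>?Z. \<iota> (\<Sum>i\<in>T'. v' i * (if \<psi>' i = z then 1 else 0)) \<odot>\<^bsub>N\<^esub> G z)"
    subgoal by (rule finsum_fiber[OF N \<iota> S(1) Z]) (blast, erule GZ)
    subgoal by (rule finsum_fiber[OF N \<iota> S(2) Z]) (blast, erule GZ)
    subgoal by (rule finsum_fiber[OF N \<iota> T(1) Z]) (blast, erule GZ)
    subgoal by (rule finsum_fiber[OF N \<iota> T(2) Z]) (blast, erule GZ)
    done
  show ?thesis unfolding fib' add
    using eq[of "\<lambda>y. if y = _ then 1 else 0"] by simp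
qed

end

section \<open>The insertion homotopy\<close>

locale aug_datum = hoch_datum R \<iota> A M l r
  for R :: "'k ring" and \<iota> :: "rat \<Rightarrow> 'k" and A :: "('k, 'a) module" and M :: "('k, 'm) module"
    and l :: "'a \<Rightarrow> 'm \<Rightarrow> 'm" and r :: "'m \<Rightarrow> 'a \<Rightarrow> 'm" +
  fixes \<epsilon> :: "'a \<Rightarrow> 'k"
  assumes A_cring: "cring A"
    and A_assoc2: "\<lbrakk>c \<in> carrier R; x \<in> carrier A; y \<in> carrier A\<rbrakk> \<Longrightarrow> (c \<odot>\<^bsub>A\<^esub> x) \<otimes>\<^bsub>A\<^esub> y = c \<odot>\<^bsub>A\<^esub> (x \<otimes>\<^bsub>A\<^esub> y)"
    and eps_hom: "\<epsilon> \<in> ring_hom A R"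
    and eps_smult: "\<lbrakk>c \<in> carrier R; a \<in> carrier A\<rbrakk> \<Longrightarrow> \<epsilon> (c \<odot>\<^bsub>A\<^esub> a) = c \<otimes>\<^bsub>R\<^esub> \<epsilon> a"
    and act_one_right: "m \<in> carrier M \<Longrightarrow> r m \<one>\<^bsub>A\<^esub> = m"
begin

text \<open>The projection of \<open>A = I \<oplus> k 1\<close> onto \<open>I\<close>.\<close>

definition \<pi> where "\<pi> a = a \<ominus>\<^bsub>A\<^esub> \<epsilon> a \<odot>\<^bsub>A\<^esub> \<one>\<^bsub>A\<^esub>"

sublocale AA: module R A by (rule B_mod)
sublocale AR: cring A by (rule A_cring)

lemma eps_closed: "a \<in> carrier A \<Longrightarrow> \<epsilon> a \<in> carrier R"
  by (rule ring_hom_closed[OF eps_hom])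

lemma eps_one: "\<epsilon> \<one>\<^bsub>A\<^esub> = \<one>\<^bsub>R\<^esub>"
  by (rule ring_hom_one[OF eps_hom])

lemma eps_add: "\<lbrakk>a \<in> carrier A; b \<in> carrier A\<rbrakk> \<Longrightarrow> \<epsilon> (a \<oplus>\<^bsub>A\<^esub> b) = \<epsilon> a \<oplus>\<^bsub>R\<^esub> \<epsilon> b"
  by (rule ring_hom_add[OF eps_hom])

lemma eps_mult: "\<lbrakk>a \<in> carrier A; b \<in> carrier A\<rbrakk> \<Longrightarrow> \<epsilon> (a \<otimes>\<^bsub>A\<^esub> b) = \<epsilon> a \<otimes>\<^bsub>R\<^esub> \<epsilon> b"
  by (rule ring_hom_mult[OF eps_hom])

lemma eps_unit_lin: "(\<lambda>a. \<epsilon> a \<odot>\<^bsub>A\<^esub> \<one>\<^bsub>A\<^esub>) \<in> lin_maps R A A"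
  by (rule lin_mapsI) (simp_all add: eps_closed eps_add eps_smult AA.smult_l_distr AA.smult_assoc1)

lemma pi_lin: "\<pi> \<in> lin_maps R A A"
  unfolding \<pi>_def[abs_def] by (rule lin_diff_fun[OF B_mod lin_id eps_unit_lin])

lemma pi_closed: "a \<in> carrier A \<Longrightarrow> \<pi> a \<in> carrier A"
  by (rule lin_closed[OF pi_lin])

lemma pi_split: "a \<in> carrier A \<Longrightarrow> a \<ominus>\<^bsub>A\<^esub> \<pi> a = \<epsilon> a \<odot>\<^bsub>A\<^esub> \<one>\<^bsub>A\<^esub>"
proof -
  assume a: "a \<in> carrier A"
  define u where "u = \<epsilon> a \<odot>\<^bsub>A\<^esub> \<one>\<^bsub>A\<^esub>"
  have u: "u \<in> carrier A" using a by (simp add: u_def eps_closed)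
  have "a \<ominus>\<^bsub>A\<^esub> (a \<ominus>\<^bsub>A\<^esub> u) = u" using a u by algebra
  then show ?thesis by (simp add: \<pi>_def u_def)
qed

text \<open>The failure of \<open>\<pi>\<close> to be multiplicative. Each term on the right has one of the two factors replaced
  by its augmentation, which is what makes the error terms of the homotopy telescope.\<close>

lemma pi_mult:
  assumes a: "a \<in> carrier A" and b: "b \<in> carrier A"
  shows "\<pi> (a \<otimes>\<^bsub>A\<^esub> b) \<ominus>\<^bsub>A\<^esub> \<pi> a \<otimes>\<^bsub>A\<^esub> \<pi> b = \<epsilon> a \<odot>\<^bsub>A\<^esub> \<pi> b \<oplus>\<^bsub>A\<^esub> \<epsilon> b \<odot>\<^bsub>A\<^esub> \<pi> a"
proof -
  define u where "u = \<epsilon> a \<odot>\<^bsub>A\<^esub> \<one>\<^bsub>A\<^esub>"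
  define v where "v = \<epsilon> b \<odot>\<^bsub>A\<^esub> \<one>\<^bsub>A\<^esub>"
  have uv: "u \<in> carrier A" "v \<in> carrier A" using a b by (simp_all add: u_def v_def eps_closed)
  have sc: "\<epsilon> a \<odot>\<^bsub>A\<^esub> x = u \<otimes>\<^bsub>A\<^esub> x" "\<epsilon> b \<odot>\<^bsub>A\<^esub> x = v \<otimes>\<^bsub>A\<^esub> x" if "x \<in> carrier A" for x
    using a b that by (simp_all add: u_def v_def A_assoc2 eps_closed)
  have "\<pi> a = a \<ominus>\<^bsub>A\<^esub> u" "\<pi> b = b \<ominus>\<^bsub>A\<^esub> v" by (simp_all add: \<pi>_def u_def v_def)
  moreover have "\<pi> (a \<otimes>\<^bsub>A\<^esub> b) = a \<otimes>\<^bsub>A\<^esub> b \<ominus>\<^bsub>A\<^esub> u \<otimes>\<^bsub>A\<^esub> v"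
    using a b uv by (simp add: \<pi>_def eps_mult AA.smult_assoc1 eps_closed v_def[symmetric] sc)
  ultimately show ?thesis using a b uv
    by (simp add: sc) algebra
qed

abbreviation "ins \<equiv> hins \<pi> \<one>\<^bsub>A\<^esub>"

lemma map_pi_set: "set as \<subseteq> carrier A \<Longrightarrow> set (map \<pi> as) \<subseteq> carrier A"
  using pi_closed by auto

lemma ins_gens:
  assumes g: "(m, as) \<in> gens n" and j: "j \<le> n"
  shows "(m, ins j as) \<in> gens (Suc n)"
proof -
  have "set (take j as) \<subseteq> carrier A" "set (drop j as) \<subseteq> carrier A"
    using g set_take_subset[of j as] set_drop_subset[of j as] by (auto simp: gens_iff)
  then show ?thesis using g j map_pi_set[of "take j as"] by (simp add: gens_iff hins_def)
qed

lemma ins_slotwise: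
  assumes j: "j \<le> n"
  shows "slotwise R A M n A M (Suc n) (map_prod id (ins j))"
  unfolding slotwise_def map_prod_simp id_apply
proof (intro conjI allI impI)
  fix m as assume g: "(m, as) \<in> gens n"
  show "\<exists>\<phi>\<in>lin_maps R M M. \<exists>bs'. length bs' = Suc n \<and> set bs' \<subseteq> carrier A \<and>
      (\<forall>m\<in>carrier M. (m, ins j as) = (\<phi> m, bs'))"
    by (intro bexI[OF _ lin_id] exI[of _ "ins j as"]) (use ins_gens[OF g j] in \<open>simp add: gens_iff\<close>)
next
  fix m as i assume "(m, as) \<in> gens n \<and> i < n"
  then have g: "(m, as) \<in> gens n" and i: "i < n" by auto
  have len: "length as = n" using g by (simp add: gens_iff)
  note g' = ins_gens[OF g j]
  have "\<exists>\<phi> \<in> lin_maps R A A. \<exists>m' bs' i'. (m', bs') \<in> gens (Suc n) \<and> i' < Suc n \<and>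
      (\<forall>b\<in>carrier A. (m, ins j (as[i := b])) = (m', bs'[i' := \<phi> b]))"
  proof (cases "i < j")
    case True
    have "ins j (as[i := b]) = (ins j as)[i := \<pi> b]" for b
      using len j i True by (intro nth_equalityI) (auto simp: length_hins nth_hins nth_list_update)
    then show ?thesis
      by (intro bexI[OF _ pi_lin] exI[of _ m] exI[of _ "ins j as"] exI[of _ i]) (use g' i in simp)
  next
    case False
    have "ins j (as[i := b]) = (ins j as)[Suc i := b]" for b
      using len j i False by (intro nth_equalityI) (auto simp: length_hins nth_hins nth_list_update)
    then show ?thesis
      by (intro bexI[OF _ lin_id] exI[of _ m] exI[of _ "ins j as"] exI[of _ "Suc i"]) (use g' i in simp)
  qed
  then show "(\<exists>\<phi> \<in> lin_maps R A A. \<exists>m' bs' i'. (m', bs') \<in> gens (Suc n) \<and> i' < Suc n \<and>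
         (\<forall>b\<in>carrier A. (m, ins j (as[i := b])) = (m', bs'[i' := \<phi> b]))) \<or>
      (\<exists>\<phi> \<in> lin_maps R A M. \<exists>bs'. length bs' = Suc n \<and> set bs' \<subseteq> carrier A \<and>
         (\<forall>b\<in>carrier A. (m, ins j (as[i := b])) = (\<phi> b, bs')))" by (rule disjI1)
qed

definition htpy where
  "htpy n = pres_lift R (H (Suc n)) (\<lambda>x. \<Oplus>\<^bsub>H (Suc n)\<^esub>j\<in>{0..n}. \<iota> ((-1) ^ j) \<odot>\<^bsub>H (Suc n)\<^esub> pure (Suc n) (map_prod id (ins j) x))"

lemma htpy_multilin:
  "multilin R A M n (H (Suc n)) (\<lambda>x. \<Oplus>\<^bsub>H (Suc n)\<^esub>j\<in>{0..n}. \<iota> ((-1) ^ j) \<odot>\<^bsub>H (Suc n)\<^esub> pure (Suc n) (map_prod id (ins j) x))"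
  by (intro multilin_sum[OF B_mod M_mod H_mod finite_atLeastAtMost] multilin_smult[OF B_mod M_mod H_mod] iota(1)
      multilin_slotwise[OF B_mod M_mod hoch_pure_multilin[OF B_mod M_mod]] ins_slotwise) simp

lemma htpy_lin: "htpy n \<in> lin_maps R (H n) (H (Suc n))"
  unfolding htpy_def by (rule hoch_lift_lin[OF B_mod M_mod H_mod htpy_multilin])

lemma htpy_pure:
  "x \<in> gens n \<Longrightarrow> htpy n (pure n x)
     = (\<Oplus>\<^bsub>H (Suc n)\<^esub>j\<in>{0..n}. \<iota> ((-1) ^ j) \<odot>\<^bsub>H (Suc n)\<^esub> pure (Suc n) (map_prod id (ins j) x))"
  unfolding htpy_def by (rule hoch_lift_pure[OF B_mod M_mod H_mod htpy_multilin])

lemma htpy_gens: "j \<le> n \<Longrightarrow> x \<in> gens n \<Longrightarrow> map_prod id (ins j) x \<in> gens (Suc n)"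
  by (rule slotwise_closed[OF ins_slotwise])

lemma d_htpy_pure:
  assumes g: "x \<in> gens n"
  shows "d (Suc n) (htpy n (pure n x)) = (\<Oplus>\<^bsub>H n\<^esub>z\<in>{0..n} \<times> {0..Suc n}. \<iota> ((-1) ^ fst z * (-1) ^ snd z) \<odot>\<^bsub>H n\<^esub>
     pure n (face A l r (Suc n) (snd z) (map_prod id (ins (fst z)) x)))"
proof -
  interpret H: module R "H n" by (rule H_mod)
  interpret H1: module R "H (Suc n)" by (rule H_mod)
  have gj: "map_prod id (ins j) x \<in> gens (Suc n)" if "j \<in> {0..n}" for j using that by (intro htpy_gens g) simp
  have fj: "face A l r (Suc n) i (map_prod id (ins j) x) \<in> gens n" if "j \<in> {0..n}" "i \<in> {0..Suc n}" for i j
    by (rule face_closed[OF _ gj[OF that(1)]]) (use that in simp)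
  have "d (Suc n) (htpy n (pure n x)) = (\<Oplus>\<^bsub>H n\<^esub>j\<in>{0..n}. d (Suc n) (\<iota> ((-1) ^ j) \<odot>\<^bsub>H (Suc n)\<^esub> pure (Suc n) (map_prod id (ins j) x)))"
    unfolding htpy_pure[OF g] by (rule lin_finsum[OF H_mod H_mod d_lin]) (rule H1.smult_closed[OF iota(1) pure_closed[OF gj]])
  also have "\<dots> = (\<Oplus>\<^bsub>H n\<^esub>j\<in>{0..n}. \<iota> ((-1) ^ j) \<odot>\<^bsub>H n\<^esub> (\<Oplus>\<^bsub>H n\<^esub>i\<in>{0..Suc n}. \<iota> ((-1) ^ i) \<odot>\<^bsub>H n\<^esub>
      pure n (face A l r (Suc n) i (map_prod id (ins j) x))))"
  proof (rule H.M.finsum_cong'[OF refl])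
    show "(\<lambda>j. \<iota> ((-1) ^ j) \<odot>\<^bsub>H n\<^esub> (\<Oplus>\<^bsub>H n\<^esub>i\<in>{0..Suc n}. \<iota> ((-1) ^ i) \<odot>\<^bsub>H n\<^esub>
      pure n (face A l r (Suc n) i (map_prod id (ins j) x)))) \<in> {0..n} \<rightarrow> carrier (H n)"
      by (intro Pi_I H.smult_closed iota(1) H.M.finsum_closed pure_closed fj)
    fix j assume j: "j \<in> {0..n}"
    show "d (Suc n) (\<iota> ((-1) ^ j) \<odot>\<^bsub>H (Suc n)\<^esub> pure (Suc n) (map_prod id (ins j) x)) = \<iota> ((-1) ^ j) \<odot>\<^bsub>H n\<^esub>
       (\<Oplus>\<^bsub>H n\<^esub>i\<in>{0..Suc n}. \<iota> ((-1) ^ i) \<odot>\<^bsub>H n\<^esub> pure n (face A l r (Suc n) i (map_prod id (ins j) x)))"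
      unfolding lin_smult[OF d_lin iota(1) pure_closed[OF gj[OF j]]] d_pure[OF gj[OF j]] ..
  qed
  also have "\<dots> = (\<Oplus>\<^bsub>H n\<^esub>z\<in>{0..n} \<times> {0..Suc n}. \<iota> ((-1) ^ fst z * (-1) ^ snd z) \<odot>\<^bsub>H n\<^esub>
     pure n (face A l r (Suc n) (snd z) (map_prod id (ins (fst z)) x)))"
    by (rule finsum_finsum[OF H_mod iota_hom]) (simp_all add: pure_closed fj del: atLeastAtMost_iff)
  finally show ?thesis .
qed

lemma htpy_d_pure:
  assumes g: "x \<in> gens (Suc N)"
  shows "htpy N (d (Suc N) (pure (Suc N) x)) = (\<Oplus>\<^bsub>H (Suc N)\<^esub>z\<in>{0..Suc N} \<times> {0..N}. \<iota> ((-1) ^ fst z * (-1) ^ snd z) \<odot>\<^bsub>H (Suc N)\<^esub>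
     pure (Suc N) (map_prod id (ins (snd z)) (face A l r (Suc N) (fst z) x)))"
proof -
  interpret H: module R "H N" by (rule H_mod)
  interpret H1: module R "H (Suc N)" by (rule H_mod)
  have gi: "face A l r (Suc N) i x \<in> gens N" if "i \<in> {0..Suc N}" for i using that by (intro face_closed g) simp
  have fj: "map_prod id (ins j) (face A l r (Suc N) i x) \<in> gens (Suc N)" if "i \<in> {0..Suc N}" "j \<in> {0..N}" for i j
    by (rule htpy_gens[OF _ gi[OF that(1)]]) (use that in simp)
  have "htpy N (d (Suc N) (pure (Suc N) x)) = (\<Oplus>\<^bsub>H (Suc N)\<^esub>i\<in>{0..Suc N}. htpy N (\<iota> ((-1) ^ i) \<odot>\<^bsub>H N\<^esub> pure N (face A l r (Suc N) i x)))"
    unfolding d_pure[OF g] by (rule lin_finsum[OF H_mod H_mod htpy_lin]) (rule H.smult_closed[OF iota(1) pure_closed[OF gi]])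
  also have "\<dots> = (\<Oplus>\<^bsub>H (Suc N)\<^esub>i\<in>{0..Suc N}. \<iota> ((-1) ^ i) \<odot>\<^bsub>H (Suc N)\<^esub> (\<Oplus>\<^bsub>H (Suc N)\<^esub>j\<in>{0..N}. \<iota> ((-1) ^ j) \<odot>\<^bsub>H (Suc N)\<^esub>
      pure (Suc N) (map_prod id (ins j) (face A l r (Suc N) i x))))"
  proof (rule H1.M.finsum_cong'[OF refl])
    show "(\<lambda>i. \<iota> ((-1) ^ i) \<odot>\<^bsub>H (Suc N)\<^esub> (\<Oplus>\<^bsub>H (Suc N)\<^esub>j\<in>{0..N}. \<iota> ((-1) ^ j) \<odot>\<^bsub>H (Suc N)\<^esub>
      pure (Suc N) (map_prod id (ins j) (face A l r (Suc N) i x)))) \<in> {0..Suc N} \<rightarrow> carrier (H (Suc N))"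
      by (intro Pi_I H1.smult_closed iota(1) H1.M.finsum_closed pure_closed fj)
    fix i assume i: "i \<in> {0..Suc N}"
    show "htpy N (\<iota> ((-1) ^ i) \<odot>\<^bsub>H N\<^esub> pure N (face A l r (Suc N) i x)) = \<iota> ((-1) ^ i) \<odot>\<^bsub>H (Suc N)\<^esub>
       (\<Oplus>\<^bsub>H (Suc N)\<^esub>j\<in>{0..N}. \<iota> ((-1) ^ j) \<odot>\<^bsub>H (Suc N)\<^esub> pure (Suc N) (map_prod id (ins j) (face A l r (Suc N) i x)))"
      unfolding lin_smult[OF htpy_lin iota(1) pure_closed[OF gi[OF i]]] htpy_pure[OF gi[OF i]] ..
  qed
  also have "\<dots> = (\<Oplus>\<^bsub>H (Suc N)\<^esub>z\<in>{0..Suc N} \<times> {0..N}. \<iota> ((-1) ^ fst z * (-1) ^ snd z) \<odot>\<^bsub>H (Suc N)\<^esub>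
     pure (Suc N) (map_prod id (ins (snd z)) (face A l r (Suc N) (fst z) x)))"
    by (rule finsum_finsum[OF H_mod iota_hom]) (simp_all add: pure_closed fj del: atLeastAtMost_iff)
  finally show ?thesis .
qed

lemma ins_face_unit:
  assumes g: "(m, as) \<in> gens n" and j: "j \<le> n"
  shows "face A l r (Suc n) j (m, ins j as) = face A l r (Suc n) (Suc j) (m, ins j as)"
proof -
  have as: "length as = n" "set as \<subseteq> carrier A" and m: "m \<in> carrier M" using g by (auto simp: gens_iff)
  have c: "x \<in> carrier A" if "x \<in> set as" for x using as that by blast
  have u: "r m \<one>\<^bsub>A\<^esub> = m" "l \<one>\<^bsub>A\<^esub> m = m" using m by (simp_all add: act_sym act_one_right)
  have u2: "\<one>\<^bsub>A\<^esub> \<otimes>\<^bsub>A\<^esub> x = x" "\<pi> x \<otimes>\<^bsub>A\<^esub> \<one>\<^bsub>A\<^esub> = \<pi> x" if "x \<in> set as" for x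
    using c[OF that] pi_closed by simp_all
  show ?thesis
    using face_hins_unit[OF as(1) j, where B = A and l = l and r = r and m = m and e = "\<one>\<^bsub>A\<^esub>" and \<pi> = \<pi>] u u2 by simp
qed

text \<open>The tensor with the factor of index \<open>i - 1\<close> replaced by its augmentation, after the \<open>j\<close>-th insertion.
  The value at \<open>i = 0\<close> is zero: with it, the error of the face \<open>0\<close>, which involves only one tensor
  factor, has the same shape as that of the inner faces.\<close>

definition omit where
  "omit n m as j i = (case i of 0 \<Rightarrow> \<zero>\<^bsub>H n\<^esub> | Suc p \<Rightarrow> \<epsilon> (as ! p) \<odot>\<^bsub>H n\<^esub> pure n (m, ins j (del p as)))"

lemma del_gens:
  assumes "(m, as) \<in> gens (Suc N)" "p \<le> N"
  shows "(m, del p as) \<in> gens N"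
  using assms set_take_subset[of p as] set_drop_subset[of "Suc p" as] by (auto simp: gens_iff del_def)

lemma omit_closed:
  assumes g: "(m, as) \<in> gens (Suc N)" and j: "j \<le> N" and i: "i \<le> Suc N"
  shows "omit (Suc N) m as j i \<in> carrier (H (Suc N))"
proof -
  interpret H: module R "H (Suc N)" by (rule H_mod)
  show ?thesis
  proof (cases i)
    case (Suc p)
    then have p: "p \<le> N" using i by simp
    have "as ! p \<in> carrier A" using g p by (auto simp: gens_iff subset_eq)
    then show ?thesis unfolding omit_def Suc using ins_gens[OF del_gens[OF g p] j]
      by (simp add: eps_closed pure_closed)
  qed (simp add: omit_def)
qed

text \<open>For an inner face the difference is \<open>\<pi>(ab) - \<pi>(a) \<pi>(b)\<close> in one slot, and for the face \<open>0\<close> it is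
  \<open>m a - m \<pi>(a) = \<epsilon>(a) m\<close>. The result involves two consecutive indices and thus telescopes in an
  alternating sum over \<open>i\<close>.\<close>

lemma face_ins_difference:
  assumes g: "(m, as) \<in> gens (Suc N)" and ij: "i \<le> j" "j \<le> N"
  shows "pure (Suc N) (map_prod id (ins j) (face A l r (Suc N) i (m, as)))
      \<ominus>\<^bsub>H (Suc N)\<^esub> pure (Suc N) (face A l r (Suc (Suc N)) i (m, ins (Suc j) as))
    = omit (Suc N) m as j i \<oplus>\<^bsub>H (Suc N)\<^esub> omit (Suc N) m as j (Suc i)"
proof -
  let ?n = "Suc N"
  interpret H: module R "H ?n" by (rule H_mod)
  have as: "length as = ?n" "set as \<subseteq> carrier A" and m: "m \<in> carrier M" using g by (auto simp: gens_iff)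
  have c: "as ! k \<in> carrier A" if "k \<le> N" for k using as that by (auto simp: subset_eq)
  note ml = hoch_pure_multilin[OF B_mod M_mod, of ?n]
  show ?thesis
  proof (cases i)
    case 0
    obtain a bs where ab: "as = a # bs" "length bs = N" using as by (cases as) auto
    have a: "a \<in> carrier A" using c[of 0] ab by simp
    have gL: "(m, ins j bs) \<in> gens ?n"
      using ins_gens[OF del_gens[OF g, of 0] ij(2)] by (simp add: del_def ab)
    define \<psi> where "\<psi> = (\<lambda>x. pure ?n (r m x, ins j bs))"
    have psi: "\<psi> \<in> lin_maps R A (H ?n)"
      unfolding \<psi>_def by (rule lin_comp[OF act_lin'[OF m] multilinD(1)[OF ml gL]])
    have "pure ?n (map_prod id (ins j) (face A l r ?n 0 (m, as))) = \<psi> a"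
      by (simp add: face_simps ab \<psi>_def)
    moreover have "pure ?n (face A l r (Suc ?n) 0 (m, ins (Suc j) as)) = \<psi> (\<pi> a)"
      by (simp add: face_simps ab \<psi>_def hins_def)
    moreover have "\<psi> a \<ominus>\<^bsub>H ?n\<^esub> \<psi> (\<pi> a) = \<epsilon> a \<odot>\<^bsub>H ?n\<^esub> \<psi> \<one>\<^bsub>A\<^esub>"
      unfolding lin_diff[OF B_mod H_mod psi a pi_closed[OF a], symmetric] pi_split[OF a]
      by (rule lin_smult[OF psi eps_closed[OF a]]) simp
    moreover have "\<psi> \<one>\<^bsub>A\<^esub> = pure ?n (m, ins j (del 0 as))"
      by (simp add: \<psi>_def act_one_right m del_def ab)
    ultimately show ?thesis unfolding 0
      using a pure_closed[OF gL] eps_closed[OF a] by (simp add: omit_def ab del_def)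
  next
    case (Suc q)
    then have q: "q < j" "Suc q \<le> N" "q \<le> N" using ij by auto
    let ?a = "as ! q" and ?b = "as ! Suc q"
    have ca: "?a \<in> carrier A" "?b \<in> carrier A" using c q by auto
    have gK: "(m, ins j (del q as)) \<in> gens ?n" by (rule ins_gens[OF del_gens[OF g q(3)] ij(2)])
    define \<psi> where "\<psi> = (\<lambda>x. pure ?n (m, (ins j (del q as))[q := x]))"
    have psi: "\<psi> \<in> lin_maps R A (H ?n)"
      unfolding \<psi>_def by (rule multilinD(2)[OF ml gK]) (use q ij in simp)
    have ldel: "length (del p as) = N" if "p \<le> N" for p using as that by (simp add: length_del)
    have lm: "length (mrg (monoid.mult A) q as) = N" using as q by (simp add: length_mrg)
    have li: "length (ins (Suc j) as) = Suc ?n" using as ij by (simp add: length_hins)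
    have "ins j (mrg (monoid.mult A) q as) = (ins j (del q as))[q := \<pi> (?a \<otimes>\<^bsub>A\<^esub> ?b)]"
      using as q ij ldel[OF q(3)] lm
      by (intro nth_equalityI) (auto simp: length_hins nth_hins nth_list_update nth_mrg nth_del skip_def)
    then have 1: "pure ?n (map_prod id (ins j) (face A l r ?n (Suc q) (m, as))) = \<psi> (\<pi> (?a \<otimes>\<^bsub>A\<^esub> ?b))"
      using q by (simp add: face_simps \<psi>_def)
    have "mrg (monoid.mult A) q (ins (Suc j) as) = (ins j (del q as))[q := \<pi> ?a \<otimes>\<^bsub>A\<^esub> \<pi> ?b]"
      using as q ij ldel[OF q(3)] li
      by (intro nth_equalityI) (auto simp: length_hins length_mrg nth_hins nth_list_update nth_mrg nth_del skip_def)
    then have 2: "pure ?n (face A l r (Suc ?n) (Suc q) (m, ins (Suc j) as)) = \<psi> (\<pi> ?a \<otimes>\<^bsub>A\<^esub> \<pi> ?b)"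
      using q by (simp add: face_simps \<psi>_def)
    have "ins j (del q as) = (ins j (del q as))[q := \<pi> ?b]"
      using as q ij ldel[OF q(3)]
      by (intro nth_equalityI) (auto simp: length_hins nth_hins nth_list_update nth_del skip_def)
    then have 3: "pure ?n (m, ins j (del q as)) = \<psi> (\<pi> ?b)" by (simp add: \<psi>_def)
    have "ins j (del (Suc q) as) = (ins j (del q as))[q := \<pi> ?a]"
      using as q ij ldel[OF q(3)] ldel[OF q(2)]
      by (intro nth_equalityI) (auto simp: length_hins nth_hins nth_list_update nth_del skip_def)
    then have 4: "pure ?n (m, ins j (del (Suc q) as)) = \<psi> (\<pi> ?a)" by (simp add: \<psi>_def)
    have "\<psi> (\<pi> (?a \<otimes>\<^bsub>A\<^esub> ?b)) \<ominus>\<^bsub>H ?n\<^esub> \<psi> (\<pi> ?a \<otimes>\<^bsub>A\<^esub> \<pi> ?b)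
        = \<psi> (\<epsilon> ?a \<odot>\<^bsub>A\<^esub> \<pi> ?b \<oplus>\<^bsub>A\<^esub> \<epsilon> ?b \<odot>\<^bsub>A\<^esub> \<pi> ?a)"
      unfolding pi_mult[OF ca, symmetric]
      by (rule lin_diff[OF B_mod H_mod psi, symmetric]) (use ca pi_closed in simp_all)
    also have "\<dots> = \<epsilon> ?a \<odot>\<^bsub>H ?n\<^esub> \<psi> (\<pi> ?b) \<oplus>\<^bsub>H ?n\<^esub> \<epsilon> ?b \<odot>\<^bsub>H ?n\<^esub> \<psi> (\<pi> ?a)"
      using ca pi_closed eps_closed by (simp add: lin_add[OF psi] lin_smult[OF psi])
    finally show ?thesis unfolding Suc 1 2 by (simp add: omit_def 3 4)
  qed
qed

definition part_pi where
  "part_pi n m as j = pure n (m, map \<pi> (take j as) @ drop j as)"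

text \<open>If the factor in front of the inserted unit is omitted, the unit takes its place, and
  \<open>\<epsilon>(a) 1 = a - \<pi>(a)\<close>.\<close>

lemma omit_last:
  assumes g: "(m, as) \<in> gens (Suc N)" and j: "j \<le> N"
  shows "omit (Suc N) m as j (Suc j) = part_pi (Suc N) m as j \<ominus>\<^bsub>H (Suc N)\<^esub> part_pi (Suc N) m as (Suc j)"
proof -
  let ?n = "Suc N"
  interpret H: module R "H ?n" by (rule H_mod)
  have as: "length as = ?n" "set as \<subseteq> carrier A" and m: "m \<in> carrier M" using g by (auto simp: gens_iff)
  have ca: "as ! j \<in> carrier A" using as j by (auto simp: subset_eq)
  note ml = hoch_pure_multilin[OF B_mod M_mod, of ?n]
  have gK: "(m, ins j (del j as)) \<in> gens ?n" by (rule ins_gens[OF del_gens[OF g j] j])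
  define \<psi> where "\<psi> = (\<lambda>x. pure ?n (m, (ins j (del j as))[j := x]))"
  have psi: "\<psi> \<in> lin_maps R A (H ?n)"
    unfolding \<psi>_def by (rule multilinD(2)[OF ml gK]) (use j in simp)
  have ldel: "length (del j as) = N" using as j by (simp add: length_del)
  have nd: "del j as ! k = as ! skip j k" if "k < N" for k using as j that by (simp add: nth_del)
  have "map \<pi> (take j as) @ drop j as = (ins j (del j as))[j := as ! j]"
    using as(1) j by (intro nth_equalityI) (auto simp: length_hins nth_hins nth_list_update nd ldel skip_def nth_append)
  then have 1: "part_pi ?n m as j = \<psi> (as ! j)" by (simp add: \<psi>_def part_pi_def)
  have "map \<pi> (take (Suc j) as) @ drop (Suc j) as = (ins j (del j as))[j := \<pi> (as ! j)]"
    using as(1) j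
    by (intro nth_equalityI) (auto simp: length_hins nth_hins nth_list_update nd ldel skip_def nth_append less_Suc_eq)
  then have 2: "part_pi ?n m as (Suc j) = \<psi> (\<pi> (as ! j))" by (simp add: \<psi>_def part_pi_def)
  have "ins j (del j as) = (ins j (del j as))[j := \<one>\<^bsub>A\<^esub>]"
    using as j ldel
    by (intro nth_equalityI) (auto simp: length_hins nth_hins nth_list_update)
  then have 3: "pure ?n (m, ins j (del j as)) = \<psi> \<one>\<^bsub>A\<^esub>" by (simp add: \<psi>_def)
  have "\<psi> (as ! j) \<ominus>\<^bsub>H ?n\<^esub> \<psi> (\<pi> (as ! j)) = \<epsilon> (as ! j) \<odot>\<^bsub>H ?n\<^esub> \<psi> \<one>\<^bsub>A\<^esub>"
    unfolding lin_diff[OF B_mod H_mod psi ca pi_closed[OF ca], symmetric] pi_split[OF ca]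
    by (rule lin_smult[OF psi eps_closed[OF ca]]) simp
  then show ?thesis by (simp add: omit_def 1 2 3)
qed

lemma part_pi_closed:
  assumes g: "(m, as) \<in> gens n"
  shows "part_pi n m as j \<in> carrier (H n)"
proof -
  have "set (take j as) \<subseteq> carrier A" "set (drop j as) \<subseteq> carrier A"
    using g set_take_subset[of j as] set_drop_subset[of j as] by (auto simp: gens_iff)
  then have "(m, map \<pi> (take j as) @ drop j as) \<in> gens n"
    using g map_pi_set[of "take j as"] by (simp add: gens_iff)
  then show ?thesis unfolding part_pi_def by (rule pure_closed)
qed

text \<open>After the cancellations of \<open>homotopy_cancel\<close>, the sum over the faces telescopes by
  \<open>face_ins_difference\<close>; the sum over the insertions of what is left telescopes by \<open>omit_last\<close>.\<close>

lemma homotopy_pure: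
  assumes g: "(m, as) \<in> gens (Suc N)"
  shows "d (Suc (Suc N)) (htpy (Suc N) (pure (Suc N) (m, as))) \<oplus>\<^bsub>H (Suc N)\<^esub> htpy N (d (Suc N) (pure (Suc N) (m, as)))
    = pure (Suc N) (m, as) \<ominus>\<^bsub>H (Suc N)\<^esub> pure (Suc N) (m, map \<pi> as)"
proof -
  let ?n = "Suc N" and ?x = "(m, as)"
  interpret H: module R "H ?n" by (rule H_mod)
  have len: "length as = ?n" using g by (simp add: gens_iff)
  let ?T = "Sigma {..<?n} (\<lambda>j. {0..j})"
  let ?a = "\<lambda>j i. face A l r (Suc ?n) i (m, ins j as)"
  let ?b = "\<lambda>j i. map_prod id (ins j) (face A l r ?n i ?x)"
  let ?s = "\<lambda>z. (- 1) ^ fst z * (- 1) ^ snd z :: rat"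
  have ga: "?a j i \<in> gens ?n" if "j \<le> ?n" "i \<le> Suc ?n" for i j
    by (rule face_closed[OF that(2) ins_gens[OF g that(1)]])
  have gb: "?b j i \<in> gens ?n" if "j \<le> N" "i \<le> ?n" for i j
    by (rule htpy_gens[OF that(1) face_closed[OF that(2) g]])
  have sT: "(\<Sum>z\<in>?T. f z) = (\<Sum>j<?n. \<Sum>i\<in>{0..j}. f (j, i))" for f :: "nat \<times> nat \<Rightarrow> rat"
    by (subst sum.Sigma) (simp_all add: case_prod_unfold del: sum.lessThan_Suc)
  have T: "fst z \<le> N" "snd z \<le> fst z" "snd z \<le> Suc N" if "z \<in> ?T" for z using that by auto
  have "d (Suc ?n) (htpy ?n (pure ?n ?x)) \<oplus>\<^bsub>H ?n\<^esub> htpy N (d ?n (pure ?n ?x))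
    = (\<Oplus>\<^bsub>H ?n\<^esub>z\<in>{0..?n} \<times> {0..Suc ?n}. \<iota> (?s z) \<odot>\<^bsub>H ?n\<^esub> pure ?n (?a (fst z) (snd z)))
      \<oplus>\<^bsub>H ?n\<^esub> (\<Oplus>\<^bsub>H ?n\<^esub>z\<in>{0..?n} \<times> {0..N}. \<iota> (?s z) \<odot>\<^bsub>H ?n\<^esub> pure ?n (?b (snd z) (fst z)))"
    unfolding d_htpy_pure[OF g] htpy_d_pure[OF g] by simp
  also have "\<dots> = (\<Oplus>\<^bsub>H ?n\<^esub>z\<in>?T. \<iota> (?s z) \<odot>\<^bsub>H ?n\<^esub> pure ?n (?b (fst z) (snd z)))
      \<oplus>\<^bsub>H ?n\<^esub> (\<Oplus>\<^bsub>H ?n\<^esub>z\<in>?T. \<iota> (- ?s z) \<odot>\<^bsub>H ?n\<^esub> pure ?n (?a (Suc (fst z)) (snd z)))"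
  proof (rule finsum_transfer2[OF H_mod iota_hom, where G = "pure ?n"])
    fix F :: "'m \<times> 'a list \<Rightarrow> rat"
    have "(\<Sum>j\<in>{0..?n}. \<Sum>i\<in>{0..Suc ?n}. (- 1) ^ j * (- 1) ^ i * F (?a j i))
        + (\<Sum>i\<in>{0..?n}. \<Sum>j<?n. (- 1) ^ i * (- 1) ^ j * F (?b j i))
      = (\<Sum>j<?n. \<Sum>i\<in>{0..j}. (- 1) ^ j * (- 1) ^ i * (F (?b j i) - F (?a (Suc j) i)))"
    proof (rule homotopy_cancel)
      show "F (?a j j) = F (?a j (Suc j))" if "j \<le> ?n" for j
        using ins_face_unit[OF g that] by simp
      show "F (?a j (Suc i)) = F (?b j i)" if "j < i" "i \<le> ?n" for i j
        using face_hins_commute[OF len that, of A l r m \<pi> "\<one>\<^bsub>A\<^esub>"] by simp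
    qed
    moreover have "{..<?n} = {0..N}" by auto
    ultimately show "(\<Sum>z\<in>{0..?n} \<times> {0..Suc ?n}. ?s z * F (?a (fst z) (snd z)))
        + (\<Sum>z\<in>{0..?n} \<times> {0..N}. ?s z * F (?b (snd z) (fst z)))
      = (\<Sum>z\<in>?T. ?s z * F (?b (fst z) (snd z))) + (\<Sum>z\<in>?T. - ?s z * F (?a (Suc (fst z)) (snd z)))"
      unfolding sT by (simp only: sum.cartesian_product case_prod_unfold diff_conv_add_uminus distrib_left
         sum.distrib fst_conv snd_conv mult_minus_left mult_minus_right sum_negf)
  next
    show "pure ?n (?a (fst z) (snd z)) \<in> carrier (H ?n)" if "z \<in> {0..?n} \<times> {0..Suc ?n}" for z
      by (rule pure_closed[OF ga]) (use that in auto)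
    show "pure ?n (?b (snd z) (fst z)) \<in> carrier (H ?n)" if "z \<in> {0..?n} \<times> {0..N}" for z
      by (rule pure_closed[OF gb]) (use that in auto)
    show "pure ?n (?b (fst z) (snd z)) \<in> carrier (H ?n)" if "z \<in> ?T" for z
      by (rule pure_closed[OF gb]) (use T[OF that] in auto)
    show "pure ?n (?a (Suc (fst z)) (snd z)) \<in> carrier (H ?n)" if "z \<in> ?T" for z
      by (rule pure_closed[OF ga]) (use T[OF that] in auto)
  qed simp_all
  also have "\<dots> = (\<Oplus>\<^bsub>H ?n\<^esub>z\<in>?T. \<iota> (?s z) \<odot>\<^bsub>H ?n\<^esub> omit ?n m as (fst z) (snd z))
      \<oplus>\<^bsub>H ?n\<^esub> (\<Oplus>\<^bsub>H ?n\<^esub>z\<in>?T. \<iota> (?s z) \<odot>\<^bsub>H ?n\<^esub> omit ?n m as (fst z) (Suc (snd z)))"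
  proof -
    have neg: "\<iota> (- c) \<odot>\<^bsub>H ?n\<^esub> y = \<ominus>\<^bsub>H ?n\<^esub> (\<iota> c \<odot>\<^bsub>H ?n\<^esub> y)" if "y \<in> carrier (H ?n)" for c y
    proof -
      have "\<iota> (- c) \<odot>\<^bsub>H ?n\<^esub> y \<oplus>\<^bsub>H ?n\<^esub> \<iota> c \<odot>\<^bsub>H ?n\<^esub> y = \<iota> (- c + c) \<odot>\<^bsub>H ?n\<^esub> y"
        unfolding iota(2) by (rule H.smult_l_distr[OF iota(1) iota(1) that, symmetric])
      also have "\<dots> = \<zero>\<^bsub>H ?n\<^esub>" using that by (simp add: iota_0[OF B_mod iota_hom])
      finally show ?thesis
        by (rule H.M.minus_equality[symmetric]) (use that iota(1) in simp_all)
    qed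
    have cb: "pure ?n (?b (fst z) (snd z)) \<in> carrier (H ?n)" if "z \<in> ?T" for z
      by (rule pure_closed[OF gb]) (use T[OF that] in auto)
    have cA: "pure ?n (?a (Suc (fst z)) (snd z)) \<in> carrier (H ?n)" if "z \<in> ?T" for z
      by (rule pure_closed[OF ga]) (use T[OF that] in auto)
    have o1: "omit ?n m as (fst z) (snd z) \<in> carrier (H ?n)" if "z \<in> ?T" for z
      by (rule omit_closed[OF g]) (use T[OF that] in auto)
    have o2: "omit ?n m as (fst z) (Suc (snd z)) \<in> carrier (H ?n)" if "z \<in> ?T" for z
      by (rule omit_closed[OF g]) (use T[OF that] in auto)
    have "(\<Oplus>\<^bsub>H ?n\<^esub>z\<in>?T. \<iota> (?s z) \<odot>\<^bsub>H ?n\<^esub> pure ?n (?b (fst z) (snd z)))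
      \<oplus>\<^bsub>H ?n\<^esub> (\<Oplus>\<^bsub>H ?n\<^esub>z\<in>?T. \<iota> (- ?s z) \<odot>\<^bsub>H ?n\<^esub> pure ?n (?a (Suc (fst z)) (snd z)))
      = (\<Oplus>\<^bsub>H ?n\<^esub>z\<in>?T. \<iota> (?s z) \<odot>\<^bsub>H ?n\<^esub> pure ?n (?b (fst z) (snd z))
          \<oplus>\<^bsub>H ?n\<^esub> \<iota> (- ?s z) \<odot>\<^bsub>H ?n\<^esub> pure ?n (?a (Suc (fst z)) (snd z)))"
      by (rule H.M.finsum_addf[symmetric]; rule Pi_I; rule H.smult_closed[OF iota(1)]; erule cb cA)
    also have "\<dots> = (\<Oplus>\<^bsub>H ?n\<^esub>z\<in>?T. \<iota> (?s z) \<odot>\<^bsub>H ?n\<^esub> omit ?n m as (fst z) (snd z)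
          \<oplus>\<^bsub>H ?n\<^esub> \<iota> (?s z) \<odot>\<^bsub>H ?n\<^esub> omit ?n m as (fst z) (Suc (snd z)))"
    proof (rule H.M.finsum_cong'[OF refl])
      show "(\<lambda>z. \<iota> (?s z) \<odot>\<^bsub>H ?n\<^esub> omit ?n m as (fst z) (snd z)
          \<oplus>\<^bsub>H ?n\<^esub> \<iota> (?s z) \<odot>\<^bsub>H ?n\<^esub> omit ?n m as (fst z) (Suc (snd z))) \<in> ?T \<rightarrow> carrier (H ?n)"
        by (rule Pi_I, rule H.M.a_closed; rule H.smult_closed[OF iota(1)]; erule o1 o2)
      fix z assume z: "z \<in> ?T"
      have "\<iota> (?s z) \<odot>\<^bsub>H ?n\<^esub> pure ?n (?b (fst z) (snd z)) \<oplus>\<^bsub>H ?n\<^esub> \<iota> (- ?s z) \<odot>\<^bsub>H ?n\<^esub> pure ?n (?a (Suc (fst z)) (snd z))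
        = \<iota> (?s z) \<odot>\<^bsub>H ?n\<^esub> (pure ?n (?b (fst z) (snd z)) \<ominus>\<^bsub>H ?n\<^esub> pure ?n (?a (Suc (fst z)) (snd z)))"
        unfolding neg[OF cA[OF z]] a_minus_def
        using cb[OF z] cA[OF z] iota(1) by (simp only: H.smult_r_distr H.smult_r_minus H.M.a_inv_closed)
      also have "\<dots> = \<iota> (?s z) \<odot>\<^bsub>H ?n\<^esub> (omit ?n m as (fst z) (snd z) \<oplus>\<^bsub>H ?n\<^esub> omit ?n m as (fst z) (Suc (snd z)))"
        using face_ins_difference[OF g T(2,1)[OF z]] by simp
      also have "\<dots> = \<iota> (?s z) \<odot>\<^bsub>H ?n\<^esub> omit ?n m as (fst z) (snd z)
          \<oplus>\<^bsub>H ?n\<^esub> \<iota> (?s z) \<odot>\<^bsub>H ?n\<^esub> omit ?n m as (fst z) (Suc (snd z))"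
        by (rule H.smult_r_distr[OF iota(1) o1[OF z] o2[OF z]])
      finally show "\<iota> (?s z) \<odot>\<^bsub>H ?n\<^esub> pure ?n (?b (fst z) (snd z)) \<oplus>\<^bsub>H ?n\<^esub> \<iota> (- ?s z) \<odot>\<^bsub>H ?n\<^esub> pure ?n (?a (Suc (fst z)) (snd z))
        = \<iota> (?s z) \<odot>\<^bsub>H ?n\<^esub> omit ?n m as (fst z) (snd z)
          \<oplus>\<^bsub>H ?n\<^esub> \<iota> (?s z) \<odot>\<^bsub>H ?n\<^esub> omit ?n m as (fst z) (Suc (snd z))" .
    qed
    also have "\<dots> = (\<Oplus>\<^bsub>H ?n\<^esub>z\<in>?T. \<iota> (?s z) \<odot>\<^bsub>H ?n\<^esub> omit ?n m as (fst z) (snd z))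
      \<oplus>\<^bsub>H ?n\<^esub> (\<Oplus>\<^bsub>H ?n\<^esub>z\<in>?T. \<iota> (?s z) \<odot>\<^bsub>H ?n\<^esub> omit ?n m as (fst z) (Suc (snd z)))"
      by (rule H.M.finsum_addf; rule Pi_I; rule H.smult_closed[OF iota(1)]; erule o1 o2)
    finally show ?thesis .
  qed
  also have "\<dots> = (\<Oplus>\<^bsub>H ?n\<^esub>j\<in>{..<?n}. \<iota> ((- 1) ^ j) \<odot>\<^bsub>H ?n\<^esub> omit ?n m as j 0)
      \<oplus>\<^bsub>H ?n\<^esub> (\<Oplus>\<^bsub>H ?n\<^esub>j\<in>{..<?n}. \<iota> 1 \<odot>\<^bsub>H ?n\<^esub> omit ?n m as j (Suc j))"
  proof (rule finsum_transfer2[OF H_mod iota_hom, where G = "\<lambda>(j, i). omit ?n m as j i"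
        and \<phi> = "\<lambda>z. (fst z, snd z)" and \<phi>' = "\<lambda>z. (fst z, Suc (snd z))"
        and \<psi> = "\<lambda>j. (j, 0)" and \<psi>' = "\<lambda>j. (j, Suc j)", unfolded prod.case])
    fix F :: "nat \<times> nat \<Rightarrow> rat"
    \<comment> \<open>Only the two ends of the alternating sum survive; the lower one is zero by the convention for \<open>omit\<close>.\<close>
    have tel: "(\<Sum>i\<in>{0..j}. (- 1) ^ i * (F (j, i) + F (j, Suc i))) = F (j, 0) + (- 1) ^ j * F (j, Suc j)" for j
    proof -
      have "(\<Sum>i\<in>{0..k}. (- 1) ^ i * (F (j, i) + F (j, Suc i))) = F (j, 0) + (- 1) ^ k * F (j, Suc k)" for k
        by (induction k) (simp_all add: algebra_simps)
      then show ?thesis .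
    qed
    have sq: "(- 1) ^ j * ((- 1) ^ j * x) = (x :: rat)" for j :: nat and x
      by (simp add: mult.assoc[symmetric] power_add[symmetric] mult_2[symmetric])
    have "(\<Sum>z\<in>?T. ?s z * F (fst z, snd z)) + (\<Sum>z\<in>?T. ?s z * F (fst z, Suc (snd z)))
      = (\<Sum>j<?n. (- 1) ^ j * (\<Sum>i\<in>{0..j}. (- 1) ^ i * (F (j, i) + F (j, Suc i))))"
      unfolding sum.distrib[symmetric] sT sum_distrib_left fst_conv snd_conv
      by (intro sum.cong refl) (simp only: distrib_left mult.assoc)
    also have "\<dots> = (\<Sum>j<?n. (- 1) ^ j * F (j, 0)) + (\<Sum>j<?n. 1 * F (j, Suc j))"
      unfolding tel by (simp only: distrib_left sum.distrib sq mult_1_left)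
    finally show "(\<Sum>z\<in>?T. ?s z * F (fst z, snd z)) + (\<Sum>z\<in>?T. ?s z * F (fst z, Suc (snd z)))
      = (\<Sum>j<?n. (- 1) ^ j * F (j, 0)) + (\<Sum>j<?n. 1 * F (j, Suc j))" .
  next
    show "omit ?n m as (fst z) (snd z) \<in> carrier (H ?n)" if "z \<in> ?T" for z
      by (rule omit_closed[OF g]) (use T[OF that] in auto)
    show "omit ?n m as (fst z) (Suc (snd z)) \<in> carrier (H ?n)" if "z \<in> ?T" for z
      by (rule omit_closed[OF g]) (use T[OF that] in auto)
    show "omit ?n m as j 0 \<in> carrier (H ?n)" if "j \<in> {..<?n}" for j
      by (rule omit_closed[OF g]) (use that in auto)
    show "omit ?n m as j (Suc j) \<in> carrier (H ?n)" if "j \<in> {..<?n}" for j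
      by (rule omit_closed[OF g]) (use that in auto)
  qed simp_all
  also have "(\<Oplus>\<^bsub>H ?n\<^esub>j\<in>{..<?n}. \<iota> ((- 1) ^ j) \<odot>\<^bsub>H ?n\<^esub> omit ?n m as j 0) = \<zero>\<^bsub>H ?n\<^esub>"
    by (rule H.M.add.finprod_one_eqI) (simp add: omit_def iota(1))
  also have "(\<Oplus>\<^bsub>H ?n\<^esub>j\<in>{..<?n}. \<iota> 1 \<odot>\<^bsub>H ?n\<^esub> omit ?n m as j (Suc j))
     = (\<Oplus>\<^bsub>H ?n\<^esub>j\<in>{..<?n}. part_pi ?n m as j \<ominus>\<^bsub>H ?n\<^esub> part_pi ?n m as (Suc j))"
  proof (rule H.M.finsum_cong'[OF refl])
    show "(\<lambda>j. part_pi ?n m as j \<ominus>\<^bsub>H ?n\<^esub> part_pi ?n m as (Suc j)) \<in> {..<?n} \<rightarrow> carrier (H ?n)"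
      by (intro Pi_I H.M.minus_closed part_pi_closed g)
    fix j assume "j \<in> {..<?n}"
    then have j: "j \<le> N" by simp
    have "omit ?n m as j (Suc j) \<in> carrier (H ?n)" by (rule omit_closed[OF g j]) (use j in simp)
    then show "\<iota> 1 \<odot>\<^bsub>H ?n\<^esub> omit ?n m as j (Suc j) = part_pi ?n m as j \<ominus>\<^bsub>H ?n\<^esub> part_pi ?n m as (Suc j)"
      using omit_last[OF g j] by (simp add: iota(4))
  qed
  also have "\<dots> = part_pi ?n m as 0 \<ominus>\<^bsub>H ?n\<^esub> part_pi ?n m as ?n"
  proof -
    have "(\<Oplus>\<^bsub>H ?n\<^esub>j\<in>{..<k}. part_pi ?n m as j \<ominus>\<^bsub>H ?n\<^esub> part_pi ?n m as (Suc j))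
       = part_pi ?n m as 0 \<ominus>\<^bsub>H ?n\<^esub> part_pi ?n m as k" for k
    proof (induction k)
      case 0
      then show ?case using part_pi_closed[OF g, of 0] by (simp add: a_minus_def H.M.r_neg)
    next
      case (Suc k)
      note c = part_pi_closed[OF g, of 0] part_pi_closed[OF g, of k] part_pi_closed[OF g, of "Suc k"]
      have "(\<Oplus>\<^bsub>H ?n\<^esub>j\<in>{..<Suc k}. part_pi ?n m as j \<ominus>\<^bsub>H ?n\<^esub> part_pi ?n m as (Suc j))
         = (part_pi ?n m as k \<ominus>\<^bsub>H ?n\<^esub> part_pi ?n m as (Suc k)) \<oplus>\<^bsub>H ?n\<^esub> (part_pi ?n m as 0 \<ominus>\<^bsub>H ?n\<^esub> part_pi ?n m as k)"
        unfolding lessThan_Suc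
        by (subst H.M.finsum_insert) (use part_pi_closed[OF g] in \<open>auto simp: Suc.IH\<close>)
      also have "\<dots> = part_pi ?n m as 0 \<ominus>\<^bsub>H ?n\<^esub> part_pi ?n m as (Suc k)"
        using c unfolding a_minus_def by (simp add: H.M.a_ac H.M.r_neg2 H.M.r_neg1)
      finally show ?case .
    qed
    then show ?thesis .
  qed
  also have "\<dots> = pure ?n ?x \<ominus>\<^bsub>H ?n\<^esub> pure ?n (m, map \<pi> as)" by (simp add: part_pi_def len)
  finally show ?thesis using part_pi_closed[OF g] pure_closed[OF g]
    by (metis H.M.l_zero H.M.minus_closed len part_pi_def append_Nil2 drop_all order_refl take_all)
qed

end

section \<open>Induced maps and the augmentation ideal\<close>

text \<open>The map of Hochschild modules induced by linear maps \<open>\<phi>\<close> of the coefficients and \<open>\<psi>\<close> of the algebras.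
  The projection \<open>\<pi>\<close>, which is linear but not multiplicative, is an instance of \<open>\<psi>\<close>.\<close>

definition hmap :: "('k, 'r) ring_scheme \<Rightarrow> ('k, 'b) module \<Rightarrow> ('k, 'p) module \<Rightarrow> nat \<Rightarrow> ('m \<Rightarrow> 'p) \<Rightarrow> ('a \<Rightarrow> 'b) \<Rightarrow>
    ('m \<times> 'a list \<Rightarrow> 'k) set \<Rightarrow> ('p \<times> 'b list \<Rightarrow> 'k) set" where
  "hmap R B' M' n \<phi> \<psi> = pres_lift R (hoch R B' M' n) (\<lambda>(m, bs). hoch_pure R B' M' n (\<phi> m, map \<psi> bs))"

locale hoch_map = D1: hoch_datum R \<iota> B M l r + D2: hoch_datum R \<iota> B' M' l' r'
  for R :: "'k ring" and \<iota> :: "rat \<Rightarrow> 'k" and B :: "('k, 'a) module" and M :: "('k, 'm) module"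
    and l :: "'a \<Rightarrow> 'm \<Rightarrow> 'm" and r :: "'m \<Rightarrow> 'a \<Rightarrow> 'm"
    and B' :: "('k, 'b) module" and M' :: "('k, 'p) module"
    and l' :: "'b \<Rightarrow> 'p \<Rightarrow> 'p" and r' :: "'p \<Rightarrow> 'b \<Rightarrow> 'p" +
  fixes \<phi> :: "'m \<Rightarrow> 'p" and \<psi> :: "'a \<Rightarrow> 'b"
  assumes phi_lin: "\<phi> \<in> lin_maps R M M'" and psi_lin: "\<psi> \<in> lin_maps R B B'"
begin

abbreviation "\<Phi> n \<equiv> hmap R B' M' n \<phi> \<psi>"

lemma map_gens:
  assumes "(m, bs) \<in> D1.gens n"
  shows "(\<phi> m, map \<psi> bs) \<in> D2.gens n"
  using assms lin_closed[OF phi_lin] lin_closed[OF psi_lin] by (auto simp: D1.gens_iff D2.gens_iff)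

lemma hmap_slotwise: "slotwise R B M n B' M' n (\<lambda>(m, bs). (\<phi> m, map \<psi> bs))"
  unfolding slotwise_def prod.case
proof (intro conjI allI impI)
  fix m bs assume g: "(m, bs) \<in> D1.gens n"
  show "\<exists>\<phi>'\<in>lin_maps R M M'. \<exists>bs'. length bs' = n \<and> set bs' \<subseteq> carrier B' \<and>
      (\<forall>m\<in>carrier M. (\<phi> m, map \<psi> bs) = (\<phi>' m, bs'))"
    by (intro bexI[OF _ phi_lin] exI[of _ "map \<psi> bs"]) (use map_gens[OF g] in \<open>simp add: D2.gens_iff\<close>)
next
  fix m bs i assume g: "(m, bs) \<in> D1.gens n \<and> i < n"
  then have g': "(\<phi> m, map \<psi> bs) \<in> D2.gens n" by (intro map_gens) simp
  show "(\<exists>\<phi>'\<in>lin_maps R B B'. \<exists>m' bs' i'. (m', bs') \<in> D2.gens n \<and> i' < n \<and>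
         (\<forall>b\<in>carrier B. (\<phi> m, map \<psi> (bs[i := b])) = (m', bs'[i' := \<phi>' b]))) \<or>
      (\<exists>\<phi>'\<in>lin_maps R B M'. \<exists>bs'. length bs' = n \<and> set bs' \<subseteq> carrier B' \<and>
         (\<forall>b\<in>carrier B. (\<phi> m, map \<psi> (bs[i := b])) = (\<phi>' b, bs')))"
    by (intro disjI1 bexI[OF _ psi_lin] exI[of _ "\<phi> m"] exI[of _ "map \<psi> bs"] exI[of _ i])
      (use g g' in \<open>simp add: map_update\<close>)
qed

lemma hmap_multilin: "multilin R B M n (D2.H n) (\<lambda>(m, bs). D2.pure n (\<phi> m, map \<psi> bs))"
  using multilin_slotwise[OF D1.B_mod D1.M_mod hoch_pure_multilin[OF D2.B_mod D2.M_mod] hmap_slotwise]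
  by (simp add: case_prod_unfold)

lemma hmap_lin: "\<Phi> n \<in> lin_maps R (D1.H n) (D2.H n)"
  unfolding hmap_def by (rule hoch_lift_lin[OF D1.B_mod D1.M_mod D2.H_mod hmap_multilin])

lemma hmap_pure: "(m, bs) \<in> D1.gens n \<Longrightarrow> \<Phi> n (D1.pure n (m, bs)) = D2.pure n (\<phi> m, map \<psi> bs)"
  using hoch_lift_pure[OF D1.B_mod D1.M_mod D2.H_mod hmap_multilin] by (simp add: hmap_def)

lemma hmap_closed: "x \<in> carrier (D1.H n) \<Longrightarrow> \<Phi> n x \<in> carrier (D2.H n)"
  by (rule lin_closed[OF hmap_lin])

lemma hmap_act:
  assumes x: "x \<in> carrier (D1.H n)"
  shows "\<Phi> n (D1.act n f x) = D2.act n f (\<Phi> n x)"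
proof (rule D1.H_lin_eq[OF D2.H_mod lin_comp[OF D1.act_lin_map hmap_lin] lin_comp[OF hmap_lin D2.act_lin_map] _ x])
  interpret H1: module R "D1.H n" by (rule D1.H_mod)
  interpret H2: module R "D2.H n" by (rule D2.H_mod)
  fix y assume "y \<in> D1.gens n"
  then obtain m bs where y: "y = (m, bs)" and gy: "(m, bs) \<in> D1.gens n" by (cases y) auto
  have pg: "(m, permute_list (pinv \<sigma>) bs) \<in> D1.gens n" if "\<sigma> \<in> sym_perms n" for \<sigma>
    by (rule D1.permute_gens[OF sym_perms_inv[OF that] gy])
  have len: "length bs = n" using gy by (simp add: D1.gens_iff)
  have "\<Phi> n (D1.act n f (D1.pure n y)) = (\<Oplus>\<^bsub>D2.H n\<^esub>\<sigma>\<in>sym_perms n.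
      \<Phi> n (\<iota> (f \<sigma>) \<odot>\<^bsub>D1.H n\<^esub> D1.pure n (m, permute_list (pinv \<sigma>) bs)))"
    unfolding y D1.act_pure[OF gy]
    by (rule lin_finsum[OF D1.H_mod D2.H_mod hmap_lin]) (rule H1.smult_closed[OF D1.iota(1) D1.pure_closed[OF pg]])
  also have "\<dots> = (\<Oplus>\<^bsub>D2.H n\<^esub>\<sigma>\<in>sym_perms n.
      \<iota> (f \<sigma>) \<odot>\<^bsub>D2.H n\<^esub> D2.pure n (\<phi> m, permute_list (pinv \<sigma>) (map \<psi> bs)))"
  proof (rule H2.M.finsum_cong'[OF refl])
    show "(\<lambda>\<sigma>. \<iota> (f \<sigma>) \<odot>\<^bsub>D2.H n\<^esub> D2.pure n (\<phi> m, permute_list (pinv \<sigma>) (map \<psi> bs))) \<in> sym_perms n \<rightarrow> carrier (D2.H n)"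
      by (intro Pi_I H2.smult_closed D2.iota(1) D2.pure_closed D2.permute_gens map_gens gy sym_perms_inv)
    fix \<sigma> assume s: "\<sigma> \<in> sym_perms n"
    then have "pinv \<sigma> permutes {..<length bs}" using sym_perms_inv[OF s] len by (simp add: sym_perms_def)
    then show "\<Phi> n (\<iota> (f \<sigma>) \<odot>\<^bsub>D1.H n\<^esub> D1.pure n (m, permute_list (pinv \<sigma>) bs))
        = \<iota> (f \<sigma>) \<odot>\<^bsub>D2.H n\<^esub> D2.pure n (\<phi> m, permute_list (pinv \<sigma>) (map \<psi> bs))"
      unfolding lin_smult[OF hmap_lin D1.iota(1) D1.pure_closed[OF pg[OF s]]] hmap_pure[OF pg[OF s]]
      by (simp add: permute_list_map)
  qed
  also have "\<dots> = D2.act n f (\<Phi> n (D1.pure n y))"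
    unfolding y hmap_pure[OF gy] D2.act_pure[OF map_gens[OF gy]] ..
  finally show "\<Phi> n (D1.act n f (D1.pure n y)) = D2.act n f (\<Phi> n (D1.pure n y))" .
qed

lemma hmap_d:
  assumes mult: "\<And>a b. a \<in> carrier B \<Longrightarrow> b \<in> carrier B \<Longrightarrow> \<psi> (a \<otimes>\<^bsub>B\<^esub> b) = \<psi> a \<otimes>\<^bsub>B'\<^esub> \<psi> b"
    and rr: "\<And>a m. a \<in> carrier B \<Longrightarrow> m \<in> carrier M \<Longrightarrow> \<phi> (r m a) = r' (\<phi> m) (\<psi> a)"
    and x: "x \<in> carrier (D1.H (Suc N))"
  shows "\<Phi> N (D1.d (Suc N) x) = D2.d (Suc N) (\<Phi> (Suc N) x)"
proof (rule D1.H_lin_eq[OF D2.H_mod lin_comp[OF D1.d_lin hmap_lin] lin_comp[OF hmap_lin D2.d_lin] _ x])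
  interpret H1: module R "D1.H N" by (rule D1.H_mod)
  interpret H2: module R "D2.H N" by (rule D2.H_mod)
  fix y assume "y \<in> D1.gens (Suc N)"
  then obtain m bs where y: "y = (m, bs)" and gy: "(m, bs) \<in> D1.gens (Suc N)" by (cases y) auto
  have len: "length bs = Suc N" and sub: "set bs \<subseteq> carrier B" and m: "m \<in> carrier M" using gy by (auto simp: D1.gens_iff)
  have c: "bs ! k \<in> carrier B" if "k < Suc N" for k using sub len that by (auto simp: subset_eq)
  have fc: "face B' l' r' (Suc N) i (\<phi> m, map \<psi> bs) = (case face B l r (Suc N) i (m, bs) of (m, bs) \<Rightarrow> (\<phi> m, map \<psi> bs))"
    if "i \<le> Suc N" for i
  proof -
    have "i = 0 \<or> (i = Suc (i - 1) \<and> i - 1 < N) \<or> i = Suc N" using that by linarith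
    then consider (0) "i = 0" | (mid) q where "i = Suc q" "q < N" | (last) "i = Suc N" by blast
    then show ?thesis
    proof cases
      case 0
      then show ?thesis using len rr[OF c[of 0] m] by (simp add: face_simps map_tl)
    next
      case mid
      have "mrg (monoid.mult B') q (map \<psi> bs) = map \<psi> (mrg (monoid.mult B) q bs)"
        using mid len mult[OF c[of q] c[of "Suc q"]] by (simp add: mrg_def take_map drop_map)
      then show ?thesis using mid by (simp add: face_simps)
    next
      case last
      have "\<phi> (l (bs ! N) m) = l' (\<psi> (bs ! N)) (\<phi> m)"
        using rr[OF c[of N] m] c[of N] m lin_closed[OF phi_lin m] lin_closed[OF psi_lin c[of N]]
        by (simp add: D1.act_sym D2.act_sym)
      then show ?thesis using last len by (simp add: face_simps map_butlast)
    qed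
  qed
  have f1: "face B l r (Suc N) i (m, bs) \<in> D1.gens N" if "i \<in> {0..Suc N}" for i
    by (rule D1.face_closed[OF _ gy]) (use that in simp)
  have "\<Phi> N (D1.d (Suc N) (D1.pure (Suc N) y)) = (\<Oplus>\<^bsub>D2.H N\<^esub>i\<in>{0..Suc N}.
      \<Phi> N (\<iota> ((-1) ^ i) \<odot>\<^bsub>D1.H N\<^esub> D1.pure N (face B l r (Suc N) i (m, bs))))"
    unfolding y D1.d_pure[OF gy]
    by (rule lin_finsum[OF D1.H_mod D2.H_mod hmap_lin]) (rule H1.smult_closed[OF D1.iota(1) D1.pure_closed[OF f1]])
  also have "\<dots> = (\<Oplus>\<^bsub>D2.H N\<^esub>i\<in>{0..Suc N}.
      \<iota> ((-1) ^ i) \<odot>\<^bsub>D2.H N\<^esub> D2.pure N (face B' l' r' (Suc N) i (\<phi> m, map \<psi> bs)))"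
  proof (rule H2.M.finsum_cong'[OF refl])
    show "(\<lambda>i. \<iota> ((-1) ^ i) \<odot>\<^bsub>D2.H N\<^esub> D2.pure N (face B' l' r' (Suc N) i (\<phi> m, map \<psi> bs))) \<in> {0..Suc N} \<rightarrow> carrier (D2.H N)"
      by (intro Pi_I H2.smult_closed D2.iota(1) D2.pure_closed D2.face_closed map_gens gy) simp
    fix i assume i: "i \<in> {0..Suc N}"
    obtain m' bs' where z: "face B l r (Suc N) i (m, bs) = (m', bs')" by force
    have gz: "(m', bs') \<in> D1.gens N" using f1[OF i] z by simp
    show "\<Phi> N (\<iota> ((-1) ^ i) \<odot>\<^bsub>D1.H N\<^esub> D1.pure N (face B l r (Suc N) i (m, bs)))
       = \<iota> ((-1) ^ i) \<odot>\<^bsub>D2.H N\<^esub> D2.pure N (face B' l' r' (Suc N) i (\<phi> m, map \<psi> bs))"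
      unfolding z lin_smult[OF hmap_lin D1.iota(1) D1.pure_closed[OF gz]] hmap_pure[OF gz]
      using fc[of i] i z by simp
  qed
  also have "\<dots> = D2.d (Suc N) (\<Phi> (Suc N) (D1.pure (Suc N) y))"
    unfolding y hmap_pure[OF gy] D2.d_pure[OF map_gens[OF gy]] ..
  finally show "\<Phi> N (D1.d (Suc N) (D1.pure (Suc N) y)) = D2.d (Suc N) (\<Phi> (Suc N) (D1.pure (Suc N) y))" .
qed

end

context aug_datum
begin

abbreviation "I \<equiv> aug_ideal R A \<epsilon>"

lemma I_iff: "x \<in> carrier I \<longleftrightarrow> x \<in> carrier A \<and> \<epsilon> x = \<zero>\<^bsub>R\<^esub>"
  by (simp add: aug_ideal_def a_kernel_def')

lemma I_simps [simp]: "monoid.mult I = monoid.mult A" "add I = add A" "module.smult I = module.smult A" "zero I = zero A"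
  by (simp_all add: aug_ideal_def)

lemma eps_lin_zero: "\<epsilon> \<zero>\<^bsub>A\<^esub> = \<zero>\<^bsub>R\<^esub>" "a \<in> carrier A \<Longrightarrow> \<epsilon> (\<ominus>\<^bsub>A\<^esub> a) = \<ominus>\<^bsub>R\<^esub> \<epsilon> a"
proof -
  interpret E: ring_hom_ring A R \<epsilon>
    by (rule ring_hom_ringI2) (use eps_hom A_cring R_cr in \<open>auto simp: cring_def\<close>)
  show "\<epsilon> \<zero>\<^bsub>A\<^esub> = \<zero>\<^bsub>R\<^esub>" "a \<in> carrier A \<Longrightarrow> \<epsilon> (\<ominus>\<^bsub>A\<^esub> a) = \<ominus>\<^bsub>R\<^esub> \<epsilon> a" by simp_all
qed

lemma I_submodule: "submodule (carrier I) R A"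
  by (rule AA.submoduleI) (auto simp: I_iff eps_lin_zero eps_add eps_smult)

lemma I_mod: "module R I"
proof -
  have "I = A\<lparr>carrier := carrier I\<rparr>" by (simp add: aug_ideal_def)
  then show ?thesis using submodule.submodule_is_module[OF I_submodule B_mod] by simp
qed

lemma lin_restrict: "f \<in> lin_maps R A N \<Longrightarrow> f \<in> lin_maps R I N"
  by (rule lin_mapsI) (simp_all add: lin_closed lin_add lin_smult I_iff)

lemma I_datum: "hoch_datum R \<iota> I M l r"
proof (rule hoch_datum.intro)
  show "\<iota> \<in> ring_hom rat_ring R" by (rule iota_hom)
  show "module R I" by (rule I_mod)
  show "module R M" by (rule M_mod)
  fix a assume a: "a \<in> carrier I"
  then have a': "a \<in> carrier A" "\<epsilon> a = \<zero>\<^bsub>R\<^esub>" by (auto simp: I_iff)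
  show "(\<lambda>b. b \<otimes>\<^bsub>I\<^esub> a) \<in> lin_maps R I I"
    by (rule lin_mapsI)
      (use a' in \<open>simp_all add: I_iff eps_mult eps_closed lin_add[OF mult_lin] lin_smult[OF mult_lin] mult_closed\<close>)
  show "(\<lambda>m. r m a) \<in> lin_maps R M M" by (rule act_lin[OF a'(1)])
  show "l a m = r m a" if "m \<in> carrier M" for m by (rule act_sym[OF a'(1) that])
  fix b assume "b \<in> carrier I"
  then have b': "b \<in> carrier A" by (simp add: I_iff)
  show "a \<otimes>\<^bsub>I\<^esub> b = b \<otimes>\<^bsub>I\<^esub> a" using mult_comm[OF a'(1) b'] by simp
  show "r m (a \<otimes>\<^bsub>I\<^esub> b) = r (r m a) b" if "m \<in> carrier M" for m using act_mult'[OF a'(1) b' that] by simp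
  fix c assume "c \<in> carrier I"
  then have c': "c \<in> carrier A" by (simp add: I_iff)
  show "a \<otimes>\<^bsub>I\<^esub> b \<otimes>\<^bsub>I\<^esub> c = a \<otimes>\<^bsub>I\<^esub> (b \<otimes>\<^bsub>I\<^esub> c)" using mult_assoc[OF a'(1) b' c'] by simp
next
  show "r m \<in> lin_maps R I M" if "m \<in> carrier M" for m by (rule lin_restrict[OF act_lin'[OF that]])
qed

sublocale KK: hoch_datum R \<iota> I M l r by (rule I_datum)

lemma pi_I: "\<pi> \<in> lin_maps R A I"
proof (rule lin_mapsI)
  show "\<pi> a \<in> carrier I" if "a \<in> carrier A" for a
    using that pi_closed[OF that]
    by (simp add: I_iff \<pi>_def a_minus_def eps_add eps_lin_zero eps_smult eps_closed eps_one AA.R.r_neg)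
qed (simp_all add: lin_add[OF pi_lin] lin_smult[OF pi_lin])

lemma pi_on_I: "b \<in> carrier I \<Longrightarrow> \<pi> b = b"
  by (simp add: I_iff \<pi>_def a_minus_def)

sublocale incl: hoch_map R \<iota> I M l r A M l r "\<lambda>m. m" "\<lambda>a. a"
  by unfold_locales (rule lin_id lin_restrict[OF lin_id])+

sublocale proj: hoch_map R \<iota> A M l r I M l r "\<lambda>m. m" \<pi>
  by unfold_locales (rule lin_id pi_I)+

abbreviation "incl n \<equiv> hmap R A M n (\<lambda>m. m) (\<lambda>a. a)"
abbreviation "proj n \<equiv> hmap R I M n (\<lambda>m. m) \<pi>"

lemma proj_incl:
  assumes x: "x \<in> carrier (KK.H n)"
  shows "proj n (incl n x) = x"
proof (rule KK.H_lin_eq[OF KK.H_mod lin_comp[OF incl.hmap_lin proj.hmap_lin] lin_id _ x])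
  fix y assume "y \<in> KK.gens n"
  then obtain m bs where y: "y = (m, bs)" and gy: "(m, bs) \<in> KK.gens n" by (cases y) auto
  have "map \<pi> bs = bs" using gy pi_on_I by (auto simp: KK.gens_iff subset_eq intro!: map_idI)
  then show "proj n (incl n (KK.pure n y)) = KK.pure n y"
    using incl.hmap_pure[OF gy] proj.hmap_pure[OF incl.map_gens[OF gy]] by (simp add: y)
qed

lemma incl_proj_pure: "(m, as) \<in> gens n \<Longrightarrow> incl n (proj n (pure n (m, as))) = pure n (m, map \<pi> as)"
  using proj.hmap_pure[of m as n] incl.hmap_pure[OF proj.map_gens[of m as n]] by simp

lemma incl_proj_lin: "(\<lambda>x. incl n (proj n x)) \<in> lin_maps R (H n) (H n)"
  by (rule lin_comp[OF proj.hmap_lin incl.hmap_lin])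

lemma homotopy:
  assumes x: "x \<in> carrier (H (Suc N))"
  shows "d (Suc (Suc N)) (htpy (Suc N) x) \<oplus>\<^bsub>H (Suc N)\<^esub> htpy N (d (Suc N) x) = x \<ominus>\<^bsub>H (Suc N)\<^esub> incl (Suc N) (proj (Suc N) x)"
proof (rule H_lin_eq[OF H_mod lin_add_fun[OF H_mod lin_comp[OF htpy_lin d_lin] lin_comp[OF d_lin htpy_lin]]
    lin_diff_fun[OF H_mod lin_id incl_proj_lin] _ x])
  fix y assume "y \<in> gens (Suc N)"
  then obtain m as where y: "y = (m, as)" and gy: "(m, as) \<in> gens (Suc N)" by (cases y) auto
  show "d (Suc (Suc N)) (htpy (Suc N) (pure (Suc N) y)) \<oplus>\<^bsub>H (Suc N)\<^esub> htpy N (d (Suc N) (pure (Suc N) y))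
      = pure (Suc N) y \<ominus>\<^bsub>H (Suc N)\<^esub> incl (Suc N) (proj (Suc N) (pure (Suc N) y))"
    unfolding y incl_proj_pure[OF gy] by (rule homotopy_pure[OF gy])
qed

lemma homotopy_0:
  assumes x: "x \<in> carrier (H 0)"
  shows "incl 0 (proj 0 x) = x" and "d (Suc 0) (htpy 0 x) = \<zero>\<^bsub>H 0\<^esub>"
proof -
  interpret H: module R "H 0" by (rule H_mod)
  show "incl 0 (proj 0 x) = x"
  proof (rule H_lin_eq[OF H_mod incl_proj_lin lin_id _ x])
    fix y assume "y \<in> gens 0"
    then obtain m where y: "y = (m, [])" and gy: "(m, []) \<in> gens 0" by (cases y) (auto simp: gens_iff)
    show "incl 0 (proj 0 (pure 0 y)) = pure 0 y" unfolding y incl_proj_pure[OF gy] by simp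
  qed
  show "d (Suc 0) (htpy 0 x) = \<zero>\<^bsub>H 0\<^esub>"
  proof (rule H_lin_eq[OF H_mod lin_comp[OF htpy_lin d_lin] lin_zero_fun[OF H_mod] _ x])
    fix y assume gy: "y \<in> gens 0"
    then obtain m where y: "y = (m, [])" and gm: "(m, []) \<in> gens 0" by (cases y) (auto simp: gens_iff)
    have c: "face A l r (Suc 0) i (map_prod id (ins 0) y) \<in> gens 0" if "i \<le> Suc 0" for i
      by (rule face_closed[OF that htpy_gens[OF _ gy]]) simp
    have "d (Suc 0) (htpy 0 (pure 0 y)) = (\<Oplus>\<^bsub>H 0\<^esub>x\<in>{}. \<iota> 0 \<odot>\<^bsub>H 0\<^esub> pure 0 x)"
      unfolding d_htpy_pure[OF gy]
    proof (rule transfer[OF H_mod, where G = "pure 0" and \<psi> = "\<lambda>x. x" and v = "\<lambda>_. 0"])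
      fix F :: "'m \<times> 'a list \<Rightarrow> rat"
      have "{0..0 :: nat} \<times> {0..Suc 0} = {(0, 0), (0, Suc 0)}" by auto
      then show "(\<Sum>z\<in>{0..0} \<times> {0..Suc 0}. (- 1) ^ fst z * (- 1) ^ snd z *
            F (face A l r (Suc 0) (snd z) (map_prod id (ins (fst z)) y))) = (\<Sum>x\<in>{}. 0 * F x)"
        using ins_face_unit[OF gm, of 0] by (simp add: y)
    qed (auto intro!: pure_closed c)
    then show "d (Suc 0) (htpy 0 (pure 0 y)) = \<zero>\<^bsub>H 0\<^esub>" by simp
  qed
qed

lemma incl_d: "x \<in> carrier (KK.H (Suc N)) \<Longrightarrow> incl N (KK.d (Suc N) x) = d (Suc N) (incl (Suc N) x)"
  by (rule incl.hmap_d) simp_all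

text \<open>The homotopy identity on cycles, in a form that includes degree \<open>0\<close>, where every element is a cycle.\<close>

lemma cycle_homotopy:
  assumes y: "y \<in> carrier (H N)" and z: "N = 0 \<or> d N y = \<zero>\<^bsub>H (N - 1)\<^esub>"
  shows "y \<ominus>\<^bsub>H N\<^esub> incl N (proj N y) = d (Suc N) (htpy N y)"
proof (cases N)
  case 0
  interpret H: module R "H 0" by (rule H_mod)
  show ?thesis using homotopy_0[of y] y 0 by (simp add: a_minus_def H.M.r_neg)
next
  case (Suc N')
  interpret H: module R "H (Suc N')" by (rule H_mod)
  have "htpy N' (d (Suc N') y) = \<zero>\<^bsub>H (Suc N')\<^esub>"
    using z Suc lin_zero[OF H_mod H_mod htpy_lin] by simp
  then show ?thesis using homotopy[of y N'] y Suc lin_closed[OF d_lin lin_closed[OF htpy_lin]] by simp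
qed

text \<open>By the homotopy identity, inclusion after projection is \<open>1 - d S - S d\<close>, and this commutes with \<open>d\<close>
  as \<open>d d = 0\<close>. The inclusion commutes with \<open>d\<close> and has a left inverse.\<close>

lemma proj_d:
  assumes x: "x \<in> carrier (H (Suc N))"
  shows "proj N (d (Suc N) x) = KK.d (Suc N) (proj (Suc N) x)"
proof -
  interpret H: module R "H N" by (rule H_mod)
  interpret H1: module R "H (Suc N)" by (rule H_mod)
  have dx: "d (Suc N) x \<in> carrier (H N)" using x by (rule d_closed)
  have px: "proj (Suc N) x \<in> carrier (KK.H (Suc N))" by (rule proj.hmap_closed[OF x])
  have ipx: "incl (Suc N) (proj (Suc N) x) \<in> carrier (H (Suc N))" by (rule incl.hmap_closed[OF px])
  have hx: "htpy (Suc N) x \<in> carrier (H (Suc (Suc N)))" by (rule lin_closed[OF htpy_lin x])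
  have hdx: "htpy N (d (Suc N) x) \<in> carrier (H (Suc N))" by (rule lin_closed[OF htpy_lin dx])
  have "N = 0 \<or> d N (d (Suc N) x) = \<zero>\<^bsub>H (N - 1)\<^esub>"
    using x by (cases N) (simp_all add: d_d)
  note 1 = cycle_homotopy[OF dx this]
  have "d (Suc N) (x \<ominus>\<^bsub>H (Suc N)\<^esub> incl (Suc N) (proj (Suc N) x)) = d (Suc N) (htpy N (d (Suc N) x))"
    unfolding homotopy[OF x, symmetric] lin_add[OF d_lin d_closed[OF hx] hdx] d_d[OF hx]
    using d_closed[OF hdx] by simp
  then have 2: "d (Suc N) x \<ominus>\<^bsub>H N\<^esub> d (Suc N) (incl (Suc N) (proj (Suc N) x)) = d (Suc N) (htpy N (d (Suc N) x))"
    unfolding lin_diff[OF H_mod H_mod d_lin x ipx] .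
  have c1: "incl N (proj N (d (Suc N) x)) \<in> carrier (H N)" by (rule lin_closed[OF incl_proj_lin dx])
  have c2: "d (Suc N) (incl (Suc N) (proj (Suc N) x)) \<in> carrier (H N)" by (rule d_closed[OF ipx])
  have "incl N (proj N (d (Suc N) x)) = d (Suc N) (incl (Suc N) (proj (Suc N) x))"
  proof -
    have inv: "u = v \<ominus>\<^bsub>H N\<^esub> (v \<ominus>\<^bsub>H N\<^esub> u)" if "u \<in> carrier (H N)" "v \<in> carrier (H N)" for u v
      using that by (simp add: a_minus_def H.M.minus_add H.M.r_neg2)
    show ?thesis
      using inv[OF c1 dx] inv[OF c2 dx] trans[OF 1 2[symmetric]] by simp
  qed
  also have "\<dots> = incl N (KK.d (Suc N) (proj (Suc N) x))" by (rule incl_d[OF px, symmetric])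
  finally have "proj N (incl N (proj N (d (Suc N) x))) = proj N (incl N (KK.d (Suc N) (proj (Suc N) x)))" by simp
  then show ?thesis
    using proj_incl[OF proj.hmap_closed[OF dx]] proj_incl[OF KK.d_closed[OF px]] by simp
qed

end

section \<open>The action of the algebra on coefficients\<close>

lemma with_smult_simps [simp]:
  "carrier (with_smult M s) = carrier M" "zero (with_smult M s) = zero M" "add (with_smult M s) = add M"
  "module.smult (with_smult M s) = s"
  by (simp_all add: with_smult_def)

lemma a_inv_with_smult [simp]: "a_inv (with_smult M s) = a_inv M"
  by (simp add: a_inv_def m_inv_def fun_eq_iff)

lemma abelian_group_with_smult:
  assumes "abelian_group M"
  shows "abelian_group (with_smult M s)"
proof -
  interpret M: abelian_group M by fact
  show ?thesis
    by (rule abelian_groupI) (auto simp: M.a_ac intro: bexI[of _ "\<ominus>\<^bsub>M\<^esub> x" for x] M.l_neg)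
qed

lemma coset_with_smult [simp]: "N +>\<^bsub>with_smult M s\<^esub> x = N +>\<^bsub>M\<^esub> x"
  by (simp add: a_r_coset_def')

locale hoch_unital = hoch_datum R \<iota> A M l r
  for R :: "'k ring" and \<iota> :: "rat \<Rightarrow> 'k" and A :: "('k, 'a) module" and M :: "('k, 'm) module"
    and l :: "'a \<Rightarrow> 'm \<Rightarrow> 'm" and r :: "'m \<Rightarrow> 'a \<Rightarrow> 'm" +
  assumes A_cr: "cring A" and act_unit: "m \<in> carrier M \<Longrightarrow> r m \<one>\<^bsub>A\<^esub> = m"
begin

text \<open>The action of \<open>a\<close> on the coefficients.\<close>

definition "scal n a = hmap R A M n (\<lambda>m. l a m) (\<lambda>x. x)"

lemma scal_map: "a \<in> carrier A \<Longrightarrow> hoch_map R \<iota> A M l r A M l r (\<lambda>m. l a m) (\<lambda>x. x)"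
  by unfold_locales (rule lact_lin lin_id | assumption)+

lemmas scal_lin = hoch_map.hmap_lin[OF scal_map, folded scal_def]
lemmas scal_act = hoch_map.hmap_act[OF scal_map, folded scal_def]

lemma scal_pure: "a \<in> carrier A \<Longrightarrow> (m, bs) \<in> gens n \<Longrightarrow> scal n a (pure n (m, bs)) = pure n (l a m, bs)"
  using hoch_map.hmap_pure[OF scal_map, of a m bs n] by (simp add: scal_def)

lemma lact_closed: "a \<in> carrier A \<Longrightarrow> m \<in> carrier M \<Longrightarrow> l a m \<in> carrier M"
  by (rule lin_closed[OF lact_lin])

lemma lact_mult: "\<lbrakk>a \<in> carrier A; b \<in> carrier A; m \<in> carrier M\<rbrakk> \<Longrightarrow> l (a \<otimes>\<^bsub>A\<^esub> b) m = l a (l b m)"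
  by (simp add: act_sym mult_closed act_closed mult_comm[of a b] act_mult')

lemma lact_gens: "a \<in> carrier A \<Longrightarrow> (m, bs) \<in> gens n \<Longrightarrow> (l a m, bs) \<in> gens n"
  by (simp add: gens_iff lact_closed)

lemma pure_lin_m: "(m, bs) \<in> gens n \<Longrightarrow> (\<lambda>m. pure n (m, bs)) \<in> lin_maps R M (H n)"
  by (rule multilinD(1)[OF hoch_pure_multilin[OF B_mod M_mod]])

lemma scal_d:
  assumes a: "a \<in> carrier A" and x: "x \<in> carrier (H (Suc N))"
  shows "scal N a (d (Suc N) x) = d (Suc N) (scal (Suc N) a x)"
  unfolding scal_def
proof (rule hoch_map.hmap_d[OF scal_map[OF a] refl _ x])
  fix b m assume b: "b \<in> carrier A" and m: "m \<in> carrier M"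
  have "l a (r m b) = r (r m b) a" "r (l a m) b = r (r m a) b"
    using a b m by (simp_all add: act_sym act_closed)
  moreover have "r m (b \<otimes>\<^bsub>A\<^esub> a) = r m (a \<otimes>\<^bsub>A\<^esub> b)" using a b by (simp add: mult_comm)
  ultimately show "l a (r m b) = r (l a m) b" using a b m by (simp add: act_mult')
qed

lemma scal_closed: "a \<in> carrier A \<Longrightarrow> x \<in> carrier (H n) \<Longrightarrow> scal n a x \<in> carrier (H n)"
  by (rule lin_closed[OF scal_lin])

lemma scal_add:
  assumes a: "a \<in> carrier A" and b: "b \<in> carrier A" and x: "x \<in> carrier (H n)"
  shows "scal n (a \<oplus>\<^bsub>A\<^esub> b) x = scal n a x \<oplus>\<^bsub>H n\<^esub> scal n b x"
proof -
  interpret A: cring A by (rule A_cr)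
  show ?thesis
  proof (rule H_lin_eq[OF H_mod scal_lin lin_add_fun[OF H_mod scal_lin scal_lin] _ x])
    fix y assume "y \<in> gens n"
    then obtain m bs where y: "y = (m, bs)" and g: "(m, bs) \<in> gens n" by (cases y) auto
    have m: "m \<in> carrier M" using g by (simp add: gens_iff)
    show "scal n (a \<oplus>\<^bsub>A\<^esub> b) (pure n y) = scal n a (pure n y) \<oplus>\<^bsub>H n\<^esub> scal n b (pure n y)"
      using a b m by (simp add: y scal_pure[OF _ g] lin_add[OF lact_lin'[OF m]] lin_add[OF pure_lin_m[OF g]] lact_closed)
  qed (use a b in simp_all)
qed

lemma scal_mult:
  assumes a: "a \<in> carrier A" and b: "b \<in> carrier A" and x: "x \<in> carrier (H n)"
  shows "scal n (a \<otimes>\<^bsub>A\<^esub> b) x = scal n a (scal n b x)"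
proof -
  interpret A: cring A by (rule A_cr)
  show ?thesis
  proof (rule H_lin_eq[OF H_mod scal_lin lin_comp[OF scal_lin scal_lin] _ x])
    fix y assume "y \<in> gens n"
    then obtain m bs where y: "y = (m, bs)" and g: "(m, bs) \<in> gens n" by (cases y) auto
    have m: "m \<in> carrier M" using g by (simp add: gens_iff)
    show "scal n (a \<otimes>\<^bsub>A\<^esub> b) (pure n y) = scal n a (scal n b (pure n y))"
      using a b m by (simp add: y scal_pure[OF _ g] scal_pure[OF _ lact_gens[OF b g]] lact_mult)
  qed (use a b in simp_all)
qed

lemma scal_smult:
  assumes a: "a \<in> carrier A" and c: "c \<in> carrier R" and x: "x \<in> carrier (H n)"
  shows "scal n (c \<odot>\<^bsub>A\<^esub> a) x = c \<odot>\<^bsub>H n\<^esub> scal n a x"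
proof -
  interpret A: module R A by (rule B_mod)
  show ?thesis
  proof (rule H_lin_eq[OF H_mod scal_lin lin_smult_fun[OF H_mod c scal_lin] _ x])
    fix y assume "y \<in> gens n"
    then obtain m bs where y: "y = (m, bs)" and g: "(m, bs) \<in> gens n" by (cases y) auto
    have m: "m \<in> carrier M" using g by (simp add: gens_iff)
    show "scal n (c \<odot>\<^bsub>A\<^esub> a) (pure n y) = c \<odot>\<^bsub>H n\<^esub> scal n a (pure n y)"
      using a c m by (simp add: y scal_pure[OF _ g] lin_smult[OF lact_lin'[OF m]] lin_smult[OF pure_lin_m[OF g]] lact_closed)
  qed (use a c in simp_all)
qed

lemma scal_one:
  assumes x: "x \<in> carrier (H n)"
  shows "scal n \<one>\<^bsub>A\<^esub> x = x"
proof -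
  interpret A: cring A by (rule A_cr)
  show ?thesis
  proof (rule H_lin_eq[OF H_mod scal_lin lin_id _ x])
    fix y assume "y \<in> gens n"
    then obtain m bs where y: "y = (m, bs)" and g: "(m, bs) \<in> gens n" by (cases y) auto
    have "m \<in> carrier M" using g by (simp add: gens_iff)
    then show "scal n \<one>\<^bsub>A\<^esub> (pure n y) = pure n y"
      by (simp add: y scal_pure[OF _ g] act_sym act_unit)
  qed simp
qed

lemma scal_scalar: "c \<in> carrier R \<Longrightarrow> x \<in> carrier (H n) \<Longrightarrow> scal n (c \<odot>\<^bsub>A\<^esub> \<one>\<^bsub>A\<^esub>) x = c \<odot>\<^bsub>H n\<^esub> x"
  using scal_smult[of "\<one>\<^bsub>A\<^esub>" c x n] scal_one[of x n] monoid.one_closed[of A] A_cr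
  by (simp add: cring_def ring_def)

abbreviation "HA n \<equiv> with_smult (H n) (scal n)"

lemma HA_mod: "module A (HA n)"
proof -
  interpret H: module R "H n" by (rule H_mod)
  show ?thesis
    by (rule moduleI[OF A_cr abelian_group_with_smult[OF H.M.abelian_group_axioms]])
      (simp_all add: scal_closed scal_add scal_mult scal_one lin_add[OF scal_lin])
qed

lemma HA_lin:
  assumes f: "f \<in> lin_maps R (H n) P" and s: "\<And>a x. a \<in> carrier A \<Longrightarrow> x \<in> carrier (H n) \<Longrightarrow> f (scal n a x) = s a (f x)"
  shows "f \<in> lin_maps A (HA n) (with_smult P s)"
  by (rule lin_mapsI) (simp_all add: lin_closed[OF f] lin_add[OF f] s)

end

section \<open>The Harrison complex\<close>

context aug_datum
begin

lemma A_datum: "hoch_datum R \<iota> A A (monoid.mult A) (monoid.mult A)"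
proof (rule hoch_datum.intro)
  show "\<iota> \<in> ring_hom rat_ring R" by (rule iota_hom)
  show "module R A" by (rule B_mod)
  show "module R A" by (rule B_mod)
  fix a assume a: "a \<in> carrier A"
  show "(\<lambda>b. b \<otimes>\<^bsub>A\<^esub> a) \<in> lin_maps R A A" "(\<lambda>b. b \<otimes>\<^bsub>A\<^esub> a) \<in> lin_maps R A A" by (rule mult_lin[OF a])+
  show "(\<otimes>\<^bsub>A\<^esub>) a \<in> lin_maps R A A" by (rule mult_lin'[OF a])
  fix b assume b: "b \<in> carrier A"
  show "a \<otimes>\<^bsub>A\<^esub> b = b \<otimes>\<^bsub>A\<^esub> a" "a \<otimes>\<^bsub>A\<^esub> b = b \<otimes>\<^bsub>A\<^esub> a" using a b by (rule mult_comm)+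
  fix c assume c: "c \<in> carrier A"
  show "a \<otimes>\<^bsub>A\<^esub> b \<otimes>\<^bsub>A\<^esub> c = a \<otimes>\<^bsub>A\<^esub> (b \<otimes>\<^bsub>A\<^esub> c)" using a b c by (rule mult_assoc)
  show "c \<otimes>\<^bsub>A\<^esub> (a \<otimes>\<^bsub>A\<^esub> b) = c \<otimes>\<^bsub>A\<^esub> a \<otimes>\<^bsub>A\<^esub> b" using mult_assoc[OF c a b] by simp
qed

sublocale AU: hoch_unital R \<iota> A A "monoid.mult A" "monoid.mult A"
  by (rule hoch_unital.intro[OF A_datum], unfold_locales) simp

sublocale MU: hoch_unital R \<iota> A M l r
  by unfold_locales (rule act_one_right)

abbreviation "Sh \<equiv> shuffle_sub R \<iota> A"

lemma sh_gens_closed: "{AU.act n (sh n) (AU.pure n x) | x. x \<in> AU.gens n} \<subseteq> carrier (AU.H n)"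
  by (auto intro!: AU.act_closed' AU.pure_closed)

lemma Sh_submodule_R: "submodule (Sh n) R (AU.H n)"
  unfolding shuffle_sub_def by (rule submodule_mod_span[OF AU.H_mod sh_gens_closed])

lemma Sh_minimal:
  assumes "submodule P R (AU.H n)" "\<And>x. x \<in> AU.gens n \<Longrightarrow> AU.act n (sh n) (AU.pure n x) \<in> P"
  shows "Sh n \<subseteq> P"
  unfolding shuffle_sub_def by (rule mod_span_minimal[OF assms(1)]) (use assms(2) in auto)

lemma Sh_gen: "x \<in> AU.gens n \<Longrightarrow> AU.act n (sh n) (AU.pure n x) \<in> Sh n"
  unfolding shuffle_sub_def by (rule subsetD[OF mod_span_superset]) blast

lemma Sh_closed: "z \<in> Sh n \<Longrightarrow> z \<in> carrier (AU.H n)"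
  using module.submoduleE(1)[OF AU.H_mod Sh_submodule_R] by (rule subsetD)

text \<open>The shuffle submodule is spanned by the shuffles of pure tensors; by linearity it contains all shuffles.\<close>

lemma Sh_act:
  assumes z: "z \<in> carrier (AU.H n)"
  shows "AU.act n (sh n) z \<in> Sh n"
proof -
  have "z \<in> {z \<in> carrier (AU.H n). AU.act n (sh n) z \<in> Sh n}"
    by (rule hoch_generated[OF B_mod B_mod submodule_preimage[OF AU.H_mod AU.H_mod AU.act_lin_map Sh_submodule_R] _ z])
      (simp add: Sh_gen AU.pure_closed)
  then show ?thesis by simp
qed

text \<open>The shuffle submodule is defined as a span over \<open>k\<close>. It is closed under \<open>A\<close> because the coefficient is
  not shuffled.\<close>

lemma Sh_scal:
  assumes a: "a \<in> carrier A" and z: "z \<in> Sh n"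
  shows "AU.scal n a z \<in> Sh n"
proof -
  have "Sh n \<subseteq> {z \<in> carrier (AU.H n). AU.scal n a z \<in> Sh n}"
  proof (rule Sh_minimal[OF submodule_preimage[OF AU.H_mod AU.H_mod AU.scal_lin[OF a] Sh_submodule_R]])
    fix x assume x: "x \<in> AU.gens n"
    then show "AU.act n (sh n) (AU.pure n x) \<in> {z \<in> carrier (AU.H n). AU.scal n a z \<in> Sh n}"
      by (simp add: AU.scal_act[OF a] Sh_act AU.scal_closed[OF a] AU.act_closed' AU.pure_closed)
  qed
  then show ?thesis using z by auto
qed

lemma Sh_d:
  assumes z: "z \<in> Sh (Suc N)"
  shows "AU.d (Suc N) z \<in> Sh N"
proof -
  have "Sh (Suc N) \<subseteq> {z \<in> carrier (AU.H (Suc N)). AU.d (Suc N) z \<in> Sh N}"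
  proof (rule Sh_minimal[OF submodule_preimage[OF AU.H_mod AU.H_mod AU.d_lin Sh_submodule_R]])
    fix x assume x: "x \<in> AU.gens (Suc N)"
    then show "AU.act (Suc N) (sh (Suc N)) (AU.pure (Suc N) x) \<in> {z \<in> carrier (AU.H (Suc N)). AU.d (Suc N) z \<in> Sh N}"
      by (simp add: AU.sh_boundary AU.pure_closed AU.act_closed' Sh_act AU.d_closed)
  qed
  then show ?thesis using z by auto
qed

lemma Sh_submodule: "submodule (Sh n) A (AU.HA n)"
proof -
  interpret HA: module A "AU.HA n" by (rule AU.HA_mod)
  interpret H: module R "AU.H n" by (rule AU.H_mod)
  note e = H.submoduleE[OF Sh_submodule_R]
  show ?thesis
  proof (rule HA.submoduleI)
    show "\<zero>\<^bsub>AU.HA n\<^esub> \<in> Sh n"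
      using subgroup.one_closed[OF submodule.axioms(1)[OF Sh_submodule_R]] by simp
  qed (use e Sh_scal in simp_all)
qed

abbreviation "CH \<equiv> charr R \<iota> A"

lemma charr_eq: "CH n = quotient_module (AU.HA n) (Sh n)"
proof -
  have "hoch_alg R A n = AU.HA n"
    by (simp add: hoch_alg_def AU.scal_def[abs_def] hmap_def)
  then show ?thesis by (simp add: charr_def)
qed

lemma CH_mod: "module A (CH n)"
  unfolding charr_eq by (rule quotient_is_module[OF AU.HA_mod Sh_submodule])

lemma cls_lin: "(\<lambda>z. Sh n +>\<^bsub>AU.H n\<^esub> z) \<in> lin_maps A (AU.HA n) (CH n)"
  using quotient_proj[OF AU.HA_mod Sh_submodule] by (simp add: charr_eq)

lemma cls_surj:
  assumes "y \<in> carrier (CH n)"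
  obtains z where "z \<in> carrier (AU.H n)" "y = Sh n +>\<^bsub>AU.H n\<^esub> z"
  using assms unfolding charr_eq carrier_quotient by auto

lemma cls_zero: "z \<in> Sh n \<Longrightarrow> Sh n +>\<^bsub>AU.H n\<^esub> z = \<zero>\<^bsub>CH n\<^esub>"
  using coset_zero_iff[OF AU.HA_mod Sh_submodule, of z n] Sh_closed[of z n] by (simp add: charr_eq)

lemma AU_d_lin: "AU.d (Suc N) \<in> lin_maps A (AU.HA (Suc N)) (AU.HA N)"
  by (rule AU.HA_lin[OF AU.d_lin]) (simp add: AU.scal_d)

lemma CH_boundary_lin: "charr_boundary R \<iota> A (Suc N) \<in> lin_maps A (CH (Suc N)) (CH N)"
  and CH_boundary_cls: "z \<in> carrier (AU.H (Suc N)) \<Longrightarrow>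
     charr_boundary R \<iota> A (Suc N) (Sh (Suc N) +>\<^bsub>AU.H (Suc N)\<^esub> z) = Sh N +>\<^bsub>AU.H N\<^esub> AU.d (Suc N) z"
proof -
  have lin: "(\<lambda>z. Sh N +>\<^bsub>AU.H N\<^esub> AU.d (Suc N) z) \<in> lin_maps A (AU.HA (Suc N)) (CH N)"
    by (rule lin_comp[OF AU_d_lin cls_lin])
  have kill: "Sh N +>\<^bsub>AU.H N\<^esub> AU.d (Suc N) z = \<zero>\<^bsub>CH N\<^esub>" if "z \<in> Sh (Suc N)" for z
    by (rule cls_zero[OF Sh_d[OF that]])
  have cb: "charr_boundary R \<iota> A (Suc N) = induced (\<lambda>z. Sh N +>\<^bsub>AU.H N\<^esub> AU.d (Suc N) z)"
    by (simp add: charr_boundary_def)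
  show "charr_boundary R \<iota> A (Suc N) \<in> lin_maps A (CH (Suc N)) (CH N)"
    unfolding cb charr_eq[of "Suc N"] by (rule induced_lin[OF AU.HA_mod Sh_submodule CH_mod lin]) (rule kill)
  show "charr_boundary R \<iota> A (Suc N) (Sh (Suc N) +>\<^bsub>AU.H (Suc N)\<^esub> z) = Sh N +>\<^bsub>AU.H N\<^esub> AU.d (Suc N) z"
    if "z \<in> carrier (AU.H (Suc N))"
  proof -
    have "induced (\<lambda>z. Sh N +>\<^bsub>AU.H N\<^esub> AU.d (Suc N) z) (Sh (Suc N) +>\<^bsub>AU.HA (Suc N)\<^esub> z) = Sh N +>\<^bsub>AU.H N\<^esub> AU.d (Suc N) z"
      by (rule induced_coset[OF AU.HA_mod Sh_submodule CH_mod lin]) (erule kill, use that in simp)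
    then show ?thesis unfolding cb by simp
  qed
qed

abbreviation "M' \<equiv> with_smult M (\<lambda>a m. r m a)"

lemma M'_mod: "module A M'"
proof -
  interpret M: module R M by (rule M_mod)
  show ?thesis
    by (rule moduleI[OF A_cring abelian_group_with_smult[OF M.M.abelian_group_axioms]])
      (simp_all add: act_closed lin_add[OF act_lin'] lin_add[OF act_lin] act_one_right act_mult' mult_comm,
       metis act_mult' mult_comm)
qed

abbreviation "T n \<equiv> tensor A M' (CH n)"
abbreviation "Q \<equiv> charr_coeff R \<iota> A M r"

lemma Q_eq: "Q n = with_smult (T n) (\<lambda>c x. (c \<odot>\<^bsub>A\<^esub> \<one>\<^bsub>A\<^esub>) \<odot>\<^bsub>T n\<^esub> x)"
  by (simp add: charr_coeff_def restrict_scalars_def)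

lemma unit_smult:
  "c \<in> carrier R \<Longrightarrow> c \<odot>\<^bsub>A\<^esub> \<one>\<^bsub>A\<^esub> \<in> carrier A"
  "\<lbrakk>c \<in> carrier R; c' \<in> carrier R\<rbrakk> \<Longrightarrow> (c \<otimes>\<^bsub>R\<^esub> c') \<odot>\<^bsub>A\<^esub> \<one>\<^bsub>A\<^esub> = (c \<odot>\<^bsub>A\<^esub> \<one>\<^bsub>A\<^esub>) \<otimes>\<^bsub>A\<^esub> (c' \<odot>\<^bsub>A\<^esub> \<one>\<^bsub>A\<^esub>)"
  by (simp_all add: AA.smult_assoc1 A_assoc2)

lemmas T_mod = tensor_is_module[OF M'_mod CH_mod]

lemma Q_mod: "module R (Q n)"
proof -
  interpret T: module A "T n" by (rule T_mod)
  show ?thesis unfolding Q_eq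
    by (rule moduleI[OF R_cr abelian_group_with_smult[OF T.M.abelian_group_axioms]])
      (simp_all add: unit_smult AA.smult_l_distr T.smult_l_distr T.smult_r_distr T.smult_assoc1)
qed

lemma lin_A_R: "f \<in> lin_maps A (T n) (T k) \<Longrightarrow> f \<in> lin_maps R (Q n) (Q k)"
  unfolding Q_eq by (rule lin_mapsI) (simp_all add: lin_closed lin_add lin_smult unit_smult)

text \<open>The element \<open>m \<otimes> [z]\<close> of \<open>M \<otimes>\<^sub>A CHarr(A)\<close>.\<close>

definition "pure_class n m z = tensor_pure A M' (CH n) m (Sh n +>\<^bsub>AU.H n\<^esub> z)"

lemma tp_lin1: "m \<in> carrier M \<Longrightarrow> tensor_pure A M' (CH n) m \<in> lin_maps A (CH n) (T n)"
  and tp_lin2: "y \<in> carrier (CH n) \<Longrightarrow> (\<lambda>m. tensor_pure A M' (CH n) m y) \<in> lin_maps A M' (T n)"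
  using tensor_pure_bilin[OF M'_mod CH_mod, of n] by (simp_all add: bilin_def)

lemma pure_class_lin_A: "m \<in> carrier M \<Longrightarrow> pure_class n m \<in> lin_maps A (AU.HA n) (T n)"
  unfolding pure_class_def[abs_def] by (rule lin_comp[OF cls_lin tp_lin1])

lemma pure_class_lin: "m \<in> carrier M \<Longrightarrow> pure_class n m \<in> lin_maps R (AU.H n) (Q n)"
proof (rule lin_mapsI)
  assume m: "m \<in> carrier M"
  note k = pure_class_lin_A[OF m, of n]
  show "pure_class n m x \<in> carrier (Q n)" if "x \<in> carrier (AU.H n)" for x
    using lin_closed[OF k, of x] that by (simp add: Q_eq)
  show "pure_class n m (x \<oplus>\<^bsub>AU.H n\<^esub> y) = pure_class n m x \<oplus>\<^bsub>Q n\<^esub> pure_class n m y"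
    if "x \<in> carrier (AU.H n)" "y \<in> carrier (AU.H n)" for x y
    using lin_add[OF k, of x y] that by (simp add: Q_eq)
  show "pure_class n m (c \<odot>\<^bsub>AU.H n\<^esub> x) = c \<odot>\<^bsub>Q n\<^esub> pure_class n m x" if "c \<in> carrier R" "x \<in> carrier (AU.H n)" for c x
    using lin_smult[OF k unit_smult(1)[OF that(1)], of x] that by (simp add: Q_eq AU.scal_scalar)
qed

lemma cls_closed: "z \<in> carrier (AU.H n) \<Longrightarrow> Sh n +>\<^bsub>AU.H n\<^esub> z \<in> carrier (CH n)"
  using lin_closed[OF cls_lin, of z n] by simp

lemma pure_class_lin_m: "z \<in> carrier (AU.H n) \<Longrightarrow> (\<lambda>m. pure_class n m z) \<in> lin_maps A M' (T n)"
  unfolding pure_class_def by (rule tp_lin2[OF cls_closed])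

lemma pure_class_lin_m_R:
  assumes z: "z \<in> carrier (AU.H n)"
  shows "(\<lambda>m. pure_class n m z) \<in> lin_maps R M (Q n)"
proof (rule lin_mapsI)
  note k = pure_class_lin_m[OF z]
  show "pure_class n m z \<in> carrier (Q n)" if "m \<in> carrier M" for m
    using lin_closed[OF k, of m] that by (simp add: Q_eq)
  show "pure_class n (m \<oplus>\<^bsub>M\<^esub> m') z = pure_class n m z \<oplus>\<^bsub>Q n\<^esub> pure_class n m' z" if "m \<in> carrier M" "m' \<in> carrier M" for m m'
    using lin_add[OF k, of m m'] that by (simp add: Q_eq)
  show "pure_class n (c \<odot>\<^bsub>M\<^esub> m) z = c \<odot>\<^bsub>Q n\<^esub> pure_class n m z" if "c \<in> carrier R" "m \<in> carrier M" for c m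
  proof -
    have "c \<odot>\<^bsub>M\<^esub> m = r m (c \<odot>\<^bsub>A\<^esub> \<one>\<^bsub>A\<^esub>)"
      using lin_smult[OF act_lin'[OF that(2)] that(1), of "\<one>\<^bsub>A\<^esub>"] that by (simp add: act_one_right)
    then show ?thesis using lin_smult[OF k unit_smult(1)[OF that(1)], of m] that by (simp add: Q_eq)
  qed
qed

text \<open>The map \<open>m \<otimes> as \<mapsto> m \<otimes> [1 \<otimes> as]\<close> from \<open>C(A, M)\<close> to the Harrison complex.\<close>

definition "to_harr n = pres_lift R (Q n) (\<lambda>(m, as). pure_class n m (AU.pure n (\<one>\<^bsub>A\<^esub>, as)))"

lemma one_gens: "(m, as) \<in> gens n \<Longrightarrow> (\<one>\<^bsub>A\<^esub>, as) \<in> AU.gens n"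
  by (simp add: gens_iff AU.gens_iff)

lemma to_harr_multilin: "multilin R A M n (Q n) (\<lambda>(m, as). pure_class n m (AU.pure n (\<one>\<^bsub>A\<^esub>, as)))"
  unfolding multilin_def prod.case
proof (intro conjI allI impI)
  fix m as assume g: "(m, as) \<in> gens n"
  show "(\<lambda>m. pure_class n m (AU.pure n (\<one>\<^bsub>A\<^esub>, as))) \<in> lin_maps R M (Q n)"
    by (rule pure_class_lin_m_R[OF AU.pure_closed[OF one_gens[OF g]]])
next
  fix m as i assume "(m, as) \<in> gens n \<and> i < n"
  then have g: "(m, as) \<in> gens n" and i: "i < n" and m: "m \<in> carrier M" by (auto simp: gens_iff)
  show "(\<lambda>b. pure_class n m (AU.pure n (\<one>\<^bsub>A\<^esub>, as[i := b]))) \<in> lin_maps R A (Q n)"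
    by (rule lin_comp[OF multilinD(2)[OF hoch_pure_multilin[OF B_mod B_mod] one_gens[OF g] i] pure_class_lin[OF m]])
qed

lemma to_harr_lin: "to_harr n \<in> lin_maps R (H n) (Q n)"
  unfolding to_harr_def by (rule hoch_lift_lin[OF B_mod M_mod Q_mod to_harr_multilin])

lemma to_harr_pure: "(m, as) \<in> gens n \<Longrightarrow> to_harr n (pure n (m, as)) = pure_class n m (AU.pure n (\<one>\<^bsub>A\<^esub>, as))"
  using hoch_lift_pure[OF B_mod M_mod Q_mod to_harr_multilin] by (simp add: to_harr_def)

text \<open>The map \<open>a \<otimes> as \<mapsto> a m \<otimes> as\<close> from \<open>C(A, A)\<close> to \<open>C(A, M)\<close>. As \<open>A \<rightarrow> M, a \<mapsto> a m\<close> is a map of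
  modules, it commutes with the boundary and the group algebra; every pure tensor is of the form
  \<open>coeff_map m (1 \<otimes> as)\<close>, so identities for \<open>C(A, M)\<close> reduce to \<open>C(A, A)\<close>.\<close>

definition "coeff_map n m = hmap R A M n (\<lambda>a. l a m) (\<lambda>x. x)"

lemma coeff_map_map: "m \<in> carrier M \<Longrightarrow> hoch_map R \<iota> A A (monoid.mult A) (monoid.mult A) A M l r (\<lambda>a. l a m) (\<lambda>x. x)"
  by unfold_locales (rule lact_lin' lin_id | assumption)+

lemmas coeff_map_lin = hoch_map.hmap_lin[OF coeff_map_map, folded coeff_map_def]
lemmas coeff_map_act = hoch_map.hmap_act[OF coeff_map_map, folded coeff_map_def]

lemma coeff_map_closed: "m \<in> carrier M \<Longrightarrow> z \<in> carrier (AU.H n) \<Longrightarrow> coeff_map n m z \<in> carrier (H n)"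
  by (rule lin_closed[OF coeff_map_lin])

lemma coeff_map_pure: "m \<in> carrier M \<Longrightarrow> (a, as) \<in> AU.gens n \<Longrightarrow> coeff_map n m (AU.pure n (a, as)) = pure n (l a m, as)"
  using hoch_map.hmap_pure[OF coeff_map_map, of m a as n] by (simp add: coeff_map_def)

lemma coeff_map_d:
  assumes m: "m \<in> carrier M" and z: "z \<in> carrier (AU.H (Suc N))"
  shows "coeff_map N m (AU.d (Suc N) z) = d (Suc N) (coeff_map (Suc N) m z)"
  unfolding coeff_map_def
proof (rule hoch_map.hmap_d[OF coeff_map_map[OF m] refl _ z])
  fix b a assume b: "b \<in> carrier A" and a: "a \<in> carrier A"
  show "l (a \<otimes>\<^bsub>A\<^esub> b) m = r (l a m) b"
    using a b m by (simp add: act_sym mult_closed act_mult')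
qed

lemma pure_coeff_map: "(m, as) \<in> gens n \<Longrightarrow> pure n (m, as) = coeff_map n m (AU.pure n (\<one>\<^bsub>A\<^esub>, as))"
  using coeff_map_pure[OF _ one_gens[of m as n]] by (simp add: gens_iff act_sym act_one_right)

text \<open>In \<open>M \<otimes>\<^sub>A CHarr(A)\<close> the element \<open>a\<close> moves across the tensor sign: \<open>a m \<otimes> [1 \<otimes> as] = m \<otimes> [a \<otimes> as]\<close>.\<close>

lemma to_harr_coeff_map:
  assumes m: "m \<in> carrier M" and z: "z \<in> carrier (AU.H n)"
  shows "to_harr n (coeff_map n m z) = pure_class n m z"
proof (rule AU.H_lin_eq[OF Q_mod lin_comp[OF coeff_map_lin[OF m] to_harr_lin] pure_class_lin[OF m] _ z])
  fix y assume "y \<in> AU.gens n"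
  then obtain a as where y: "y = (a, as)" and gy: "(a, as) \<in> AU.gens n" by (cases y) auto
  have a: "a \<in> carrier A" and one: "(\<one>\<^bsub>A\<^esub>, as) \<in> AU.gens n" using gy by (auto simp: AU.gens_iff)
  have g: "(l a m, as) \<in> gens n" using gy m by (simp add: AU.gens_iff gens_iff MU.lact_closed)
  have "to_harr n (coeff_map n m (AU.pure n y)) = pure_class n (r m a) (AU.pure n (\<one>\<^bsub>A\<^esub>, as))"
    unfolding y coeff_map_pure[OF m gy] to_harr_pure[OF g] using a m by (simp add: act_sym)
  also have "\<dots> = a \<odot>\<^bsub>T n\<^esub> pure_class n m (AU.pure n (\<one>\<^bsub>A\<^esub>, as))"
    using lin_smult[OF pure_class_lin_m[OF AU.pure_closed[OF one]] a, of m] m by simp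
  also have "\<dots> = pure_class n m (AU.scal n a (AU.pure n (\<one>\<^bsub>A\<^esub>, as)))"
    using lin_smult[OF pure_class_lin_A[OF m] a, of "AU.pure n (\<one>\<^bsub>A\<^esub>, as)" n] AU.pure_closed[OF one] by simp
  also have "\<dots> = pure_class n m (AU.pure n y)"
    unfolding y AU.scal_pure[OF a one] using a by simp
  finally show "to_harr n (coeff_map n m (AU.pure n y)) = pure_class n m (AU.pure n y)" .
qed

lemma pure_class_sh:
  assumes m: "m \<in> carrier M" and z: "z \<in> Sh n"
  shows "pure_class n m z = \<zero>\<^bsub>T n\<^esub>"
  unfolding pure_class_def cls_zero[OF z] by (rule lin_zero[OF CH_mod T_mod tp_lin1[OF m]])

lemma to_harr_sh:
  assumes x: "x \<in> carrier (H n)"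
  shows "to_harr n (act n (sh n) x) = \<zero>\<^bsub>Q n\<^esub>"
proof (rule H_lin_eq[OF Q_mod lin_comp[OF act_lin_map to_harr_lin] lin_zero_fun[OF Q_mod] _ x])
  fix y assume "y \<in> gens n"
  then obtain m as where y: "y = (m, as)" and gy: "(m, as) \<in> gens n" by (cases y) auto
  have m: "m \<in> carrier M" using gy by (simp add: gens_iff)
  note one = AU.pure_closed[OF one_gens[OF gy]]
  show "to_harr n (act n (sh n) (pure n y)) = \<zero>\<^bsub>Q n\<^esub>"
    unfolding y pure_coeff_map[OF gy] coeff_map_act[OF m one, symmetric] to_harr_coeff_map[OF m AU.act_closed'[OF one]]
      pure_class_sh[OF m Sh_act[OF one]] by (simp add: Q_eq)
qed

text \<open>The idempotent is the identity modulo shuffles, and shuffles are zero in the Harrison complex.\<close>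

lemma to_harr_e:
  assumes x: "x \<in> carrier (H n)"
  shows "to_harr n (e n x) = to_harr n x"
proof -
  interpret Q: module R "Q n" by (rule Q_mod)
  obtain q where "\<forall>x \<in> carrier (H n). e n x = x \<oplus>\<^bsub>H n\<^esub> act n (sh n) (act n q x)"
    using e_decomp by blast
  then have "to_harr n (e n x) = to_harr n (x \<oplus>\<^bsub>H n\<^esub> act n (sh n) (act n q x))" using x by simp
  also have "\<dots> = to_harr n x"
    unfolding lin_add[OF to_harr_lin x act_closed'[OF act_closed'[OF x]]] to_harr_sh[OF act_closed'[OF x]]
    using lin_closed[OF to_harr_lin x] by simp
  finally show ?thesis .
qed

abbreviation "dQ \<equiv> charr_coeff_boundary R \<iota> A M r"

lemma dQ_bilin: "bilin A M' (CH (Suc N)) (T N) (\<lambda>m y. tensor_pure A M' (CH N) m (charr_boundary R \<iota> A (Suc N) y))"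
  unfolding bilin_def
  using lin_comp[OF CH_boundary_lin tp_lin1] tp_lin2[OF lin_closed[OF CH_boundary_lin]] by simp

lemma dQ_lin_A: "dQ (Suc N) \<in> lin_maps A (T (Suc N)) (T N)"
  unfolding charr_coeff_boundary_def id_tensor_def
  using tensor_lift_lin[OF M'_mod CH_mod T_mod dQ_bilin] by simp

lemma dQ_lin: "dQ (Suc N) \<in> lin_maps R (Q (Suc N)) (Q N)"
  by (rule lin_A_R[OF dQ_lin_A])

lemma dQ_pure_class:
  assumes m: "m \<in> carrier M" and z: "z \<in> carrier (AU.H (Suc N))"
  shows "dQ (Suc N) (pure_class (Suc N) m z) = pure_class N m (AU.d (Suc N) z)"
  using tensor_lift_pure[OF M'_mod CH_mod T_mod dQ_bilin, of m "Sh (Suc N) +>\<^bsub>AU.H (Suc N)\<^esub> z"] m cls_closed[OF z]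
  by (simp add: pure_class_def charr_coeff_boundary_def id_tensor_def CH_boundary_cls[OF z])

lemma to_harr_d:
  assumes x: "x \<in> carrier (H (Suc N))"
  shows "to_harr N (d (Suc N) x) = dQ (Suc N) (to_harr (Suc N) x)"
proof (rule H_lin_eq[OF Q_mod lin_comp[OF d_lin to_harr_lin] lin_comp[OF to_harr_lin dQ_lin] _ x])
  fix y assume "y \<in> gens (Suc N)"
  then obtain m as where y: "y = (m, as)" and gy: "(m, as) \<in> gens (Suc N)" by (cases y) auto
  have m: "m \<in> carrier M" using gy by (simp add: gens_iff)
  note one = AU.pure_closed[OF one_gens[OF gy]]
  show "to_harr N (d (Suc N) (pure (Suc N) y)) = dQ (Suc N) (to_harr (Suc N) (pure (Suc N) y))"
    unfolding y pure_coeff_map[OF gy] coeff_map_d[OF m one, symmetric] to_harr_coeff_map[OF m AU.d_closed[OF one]]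
      to_harr_coeff_map[OF m one] dQ_pure_class[OF m one] ..
qed

text \<open>The map \<open>m \<otimes> [a \<otimes> as] \<mapsto> e (a m \<otimes> as)\<close> from the Harrison complex to \<open>C(A, M)\<close>, which is independent
  of the representative by \<open>e_coeff_map_kill\<close>.\<close>

definition "from_harr n = pres_lift A (MU.HA n) (\<lambda>(m, y). induced (\<lambda>z. e n (coeff_map n m z)) y)"

lemma coeff_map_scal:
  assumes a: "a \<in> carrier A" and m: "m \<in> carrier M" and z: "z \<in> carrier (AU.H n)"
  shows "coeff_map n m (AU.scal n a z) = MU.scal n a (coeff_map n m z)" "coeff_map n (r m a) z = MU.scal n a (coeff_map n m z)"
proof -
  have rm: "r m a \<in> carrier M" by (rule act_closed[OF a m])
  show "coeff_map n m (AU.scal n a z) = MU.scal n a (coeff_map n m z)"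
  proof (rule AU.H_lin_eq[OF H_mod lin_comp[OF AU.scal_lin[OF a] coeff_map_lin[OF m]] lin_comp[OF coeff_map_lin[OF m] MU.scal_lin[OF a]] _ z])
    fix y assume "y \<in> AU.gens n"
    then obtain b as where y: "y = (b, as)" and gy: "(b, as) \<in> AU.gens n" by (cases y) auto
    have b: "b \<in> carrier A" using gy by (simp add: AU.gens_iff)
    have g: "(l b m, as) \<in> gens n" using gy m by (simp add: AU.gens_iff gens_iff MU.lact_closed)
    show "coeff_map n m (AU.scal n a (AU.pure n y)) = MU.scal n a (coeff_map n m (AU.pure n y))"
      unfolding y AU.scal_pure[OF a gy] coeff_map_pure[OF m AU.lact_gens[OF a gy]] coeff_map_pure[OF m gy] MU.scal_pure[OF a g]
      by (simp add: MU.lact_mult a b m)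
  qed
  show "coeff_map n (r m a) z = MU.scal n a (coeff_map n m z)"
  proof (rule AU.H_lin_eq[OF H_mod coeff_map_lin[OF rm] lin_comp[OF coeff_map_lin[OF m] MU.scal_lin[OF a]] _ z])
    fix y assume "y \<in> AU.gens n"
    then obtain b as where y: "y = (b, as)" and gy: "(b, as) \<in> AU.gens n" by (cases y) auto
    have b: "b \<in> carrier A" using gy by (simp add: AU.gens_iff)
    have g: "(l b m, as) \<in> gens n" using gy m by (simp add: AU.gens_iff gens_iff MU.lact_closed)
    have "l b (r m a) = l a (l b m)"
      using MU.lact_mult[OF a b m] MU.lact_mult[OF b a m] a b m by (simp add: act_sym mult_comm)
    then show "coeff_map n (r m a) (AU.pure n y) = MU.scal n a (coeff_map n m (AU.pure n y))"
      unfolding y coeff_map_pure[OF rm gy] coeff_map_pure[OF m gy] MU.scal_pure[OF a g] by simp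
  qed
qed

lemma coeff_map_add:
  assumes m: "m \<in> carrier M" "m' \<in> carrier M" and z: "z \<in> carrier (AU.H n)"
  shows "coeff_map n (m \<oplus>\<^bsub>M\<^esub> m') z = coeff_map n m z \<oplus>\<^bsub>H n\<^esub> coeff_map n m' z"
proof -
  interpret M: module R M by (rule M_mod)
  have mm: "m \<oplus>\<^bsub>M\<^esub> m' \<in> carrier M" using m by simp
  show ?thesis
  proof (rule AU.H_lin_eq[OF H_mod coeff_map_lin[OF mm] lin_add_fun[OF H_mod coeff_map_lin[OF m(1)] coeff_map_lin[OF m(2)]] _ z])
    fix y assume "y \<in> AU.gens n"
    then obtain b as where y: "y = (b, as)" and gy: "(b, as) \<in> AU.gens n" by (cases y) auto
    have b: "b \<in> carrier A" using gy by (simp add: AU.gens_iff)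
    have g: "(l b m, as) \<in> gens n" using gy m by (simp add: AU.gens_iff gens_iff MU.lact_closed)
    show "coeff_map n (m \<oplus>\<^bsub>M\<^esub> m') (AU.pure n y) = coeff_map n m (AU.pure n y) \<oplus>\<^bsub>H n\<^esub> coeff_map n m' (AU.pure n y)"
      unfolding y coeff_map_pure[OF mm gy] coeff_map_pure[OF m(1) gy] coeff_map_pure[OF m(2) gy] lin_add[OF lact_lin[OF b] m]
      by (rule lin_add[OF MU.pure_lin_m[OF g]]) (use b m in \<open>simp_all add: MU.lact_closed\<close>)
  qed
qed

lemma e_scal: "a \<in> carrier A \<Longrightarrow> x \<in> carrier (H n) \<Longrightarrow> e n (MU.scal n a x) = MU.scal n a (e n x)"
  by (rule MU.scal_act[symmetric])

lemma e_coeff_map_lin: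
  assumes m: "m \<in> carrier M"
  shows "(\<lambda>z. e n (coeff_map n m z)) \<in> lin_maps A (AU.HA n) (MU.HA n)"
  by (rule AU.HA_lin[OF lin_comp[OF coeff_map_lin[OF m] act_lin_map]])
    (simp add: coeff_map_scal m e_scal coeff_map_closed del: One_nat_def)

lemma e_coeff_map_kill:
  assumes m: "m \<in> carrier M" and z: "z \<in> Sh n"
  shows "e n (coeff_map n m z) = \<zero>\<^bsub>MU.HA n\<^esub>"
proof -
  have "Sh n \<subseteq> {z \<in> carrier (AU.H n). e n (coeff_map n m z) \<in> {\<zero>\<^bsub>H n\<^esub>}}"
  proof (rule Sh_minimal[OF submodule_preimage[OF AU.H_mod H_mod lin_comp[OF coeff_map_lin[OF m] act_lin_map] submodule_zero[OF H_mod]]])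
    fix x assume "x \<in> AU.gens n"
    note x = AU.pure_closed[OF this]
    show "AU.act n (sh n) (AU.pure n x) \<in> {z \<in> carrier (AU.H n). e n (coeff_map n m z) \<in> {\<zero>\<^bsub>H n\<^esub>}}"
      using AU.act_closed'[OF x] e_sh[OF coeff_map_closed[OF m x]] by (simp add: coeff_map_act[OF m x])
  qed
  then show ?thesis using z by auto
qed

lemma from_harr_val:
  assumes m: "m \<in> carrier M" and z: "z \<in> carrier (AU.H n)"
  shows "induced (\<lambda>z. e n (coeff_map n m z)) (Sh n +>\<^bsub>AU.H n\<^esub> z) = e n (coeff_map n m z)"
proof -
  have "induced (\<lambda>z. e n (coeff_map n m z)) (Sh n +>\<^bsub>AU.HA n\<^esub> z) = e n (coeff_map n m z)"
    by (rule induced_coset[OF AU.HA_mod Sh_submodule MU.HA_mod e_coeff_map_lin[OF m]]) (erule e_coeff_map_kill[OF m], use z in simp)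
  then show ?thesis by (simp del: One_nat_def)
qed

lemma from_harr_bilin: "bilin A M' (CH n) (MU.HA n) (\<lambda>m y. induced (\<lambda>z. e n (coeff_map n m z)) y)"
  unfolding bilin_def
proof (intro conjI ballI)
  fix m assume "m \<in> carrier M'"
  then have m: "m \<in> carrier M" by simp
  show "(\<lambda>y. induced (\<lambda>z. e n (coeff_map n m z)) y) \<in> lin_maps A (CH n) (MU.HA n)"
    unfolding charr_eq by (rule induced_lin[OF AU.HA_mod Sh_submodule MU.HA_mod e_coeff_map_lin[OF m]]) (rule e_coeff_map_kill[OF m])
next
  fix y assume "y \<in> carrier (CH n)"
  then obtain z where z: "z \<in> carrier (AU.H n)" and y: "y = Sh n +>\<^bsub>AU.H n\<^esub> z" by (rule cls_surj)
  interpret M: module R M by (rule M_mod)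
  show "(\<lambda>m. induced (\<lambda>z. e n (coeff_map n m z)) y) \<in> lin_maps A M' (MU.HA n)"
    unfolding y
    by (rule lin_mapsI)
      (simp_all add: from_harr_val[OF _ z] act_closed act_closed' coeff_map_closed z coeff_map_add lin_add[OF act_lin_map]
        coeff_map_scal(2) e_scal del: One_nat_def)
qed

lemma from_harr_lin_A: "from_harr n \<in> lin_maps A (T n) (MU.HA n)"
  unfolding from_harr_def using tensor_lift_lin[OF M'_mod CH_mod MU.HA_mod from_harr_bilin] by simp

lemma from_harr_pure_class:
  assumes m: "m \<in> carrier M" and z: "z \<in> carrier (AU.H n)"
  shows "from_harr n (pure_class n m z) = e n (coeff_map n m z)"
  using tensor_lift_pure[OF M'_mod CH_mod MU.HA_mod from_harr_bilin, of m "Sh n +>\<^bsub>AU.H n\<^esub> z" n] m cls_closed[OF z]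
  by (simp add: pure_class_def from_harr_def from_harr_val[OF m z] del: One_nat_def)

lemma Q_carrier [simp]: "carrier (Q n) = carrier (T n)"
  by (simp add: Q_eq)

lemma from_harr_closed: "t \<in> carrier (Q n) \<Longrightarrow> from_harr n t \<in> carrier (H n)"
  using lin_closed[OF from_harr_lin_A, of t n] by simp

lemma from_harr_lin: "from_harr n \<in> lin_maps R (Q n) (H n)"
proof (rule lin_mapsI)
  show "from_harr n t \<in> carrier (H n)" if "t \<in> carrier (Q n)" for t using that by (rule from_harr_closed)
  show "from_harr n (s \<oplus>\<^bsub>Q n\<^esub> t) = from_harr n s \<oplus>\<^bsub>H n\<^esub> from_harr n t" if "s \<in> carrier (Q n)" "t \<in> carrier (Q n)" for s t
    using lin_add[OF from_harr_lin_A, of s n t] that by (simp add: Q_eq)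
  show "from_harr n (c \<odot>\<^bsub>Q n\<^esub> t) = c \<odot>\<^bsub>H n\<^esub> from_harr n t" if "c \<in> carrier R" "t \<in> carrier (Q n)" for c t
    using lin_smult[OF from_harr_lin_A unit_smult(1)[OF that(1)], of t n] that MU.scal_scalar[OF that(1) from_harr_closed[OF that(2)]]
    by (simp add: Q_eq)
qed

lemma from_harr_to_harr:
  assumes x: "x \<in> carrier (H n)"
  shows "from_harr n (to_harr n x) = e n x"
proof (rule H_lin_eq[OF H_mod lin_comp[OF to_harr_lin from_harr_lin] act_lin_map _ x])
  fix y assume "y \<in> gens n"
  then obtain m as where y: "y = (m, as)" and gy: "(m, as) \<in> gens n" by (cases y) auto
  have m: "m \<in> carrier M" using gy by (simp add: gens_iff)
  note one = AU.pure_closed[OF one_gens[OF gy]]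
  show "from_harr n (to_harr n (pure n y)) = e n (pure n y)"
    unfolding y pure_coeff_map[OF gy] to_harr_coeff_map[OF m one] from_harr_pure_class[OF m one] ..
qed

text \<open>Linearity over \<open>A\<close>, and not only over \<open>k\<close>, is what allows \<open>to_harr \<circ> from_harr\<close> to be computed on the
  elements \<open>m \<otimes> y\<close> of the tensor product over \<open>A\<close>.\<close>

lemma to_harr_lin_A: "to_harr n \<in> lin_maps A (MU.HA n) (T n)"
proof -
  interpret T: module A "T n" by (rule T_mod)
  have "to_harr n (MU.scal n a x) = a \<odot>\<^bsub>T n\<^esub> to_harr n x" if a: "a \<in> carrier A" and x: "x \<in> carrier (H n)" for a x
  proof (rule H_lin_eq[OF Q_mod lin_comp[OF MU.scal_lin[OF a] to_harr_lin] lin_comp[OF to_harr_lin lin_A_R[OF lin_smult_fun[OF T_mod a lin_id]]] _ x])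
    fix y assume "y \<in> gens n"
    then obtain m as where y: "y = (m, as)" and gy: "(m, as) \<in> gens n" by (cases y) auto
    have m: "m \<in> carrier M" using gy by (simp add: gens_iff)
    note one = AU.pure_closed[OF one_gens[OF gy]]
    show "to_harr n (MU.scal n a (pure n y)) = a \<odot>\<^bsub>T n\<^esub> to_harr n (pure n y)"
      unfolding y MU.scal_pure[OF a gy] to_harr_pure[OF gy] to_harr_pure[OF MU.lact_gens[OF a gy]]
      using lin_smult[OF pure_class_lin_m[OF one] a, of m] m a by (simp add: act_sym)
  qed
  then show ?thesis
    using to_harr_lin[of n] by (intro lin_mapsI) (simp_all add: lin_maps_def Q_eq Pi_iff)
qed

lemma to_harr_from_harr:
  assumes t: "t \<in> carrier (Q n)"
  shows "to_harr n (from_harr n t) = t"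
proof (rule tensor_lin_eq[OF M'_mod CH_mod T_mod lin_comp[OF from_harr_lin_A to_harr_lin_A] lin_id])
  show "t \<in> carrier (T n)" using t by simp
  fix m y assume "m \<in> carrier M'" "y \<in> carrier (CH n)"
  then obtain z where m: "m \<in> carrier M" and z: "z \<in> carrier (AU.H n)" and y: "y = Sh n +>\<^bsub>AU.H n\<^esub> z"
    using cls_surj by (metis with_smult_simps(1))
  have "to_harr n (from_harr n (pure_class n m z)) = pure_class n m z"
    unfolding from_harr_pure_class[OF m z] to_harr_e[OF coeff_map_closed[OF m z]] to_harr_coeff_map[OF m z] ..
  then show "to_harr n (from_harr n (tensor_pure A M' (CH n) m y)) = tensor_pure A M' (CH n) m y"
    by (simp add: pure_class_def y)
qed

lemma e_from_harr: "t \<in> carrier (Q n) \<Longrightarrow> e n (from_harr n t) = from_harr n t"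
  using from_harr_to_harr[OF from_harr_closed[of t n]] to_harr_from_harr[of t n] by simp

text \<open>The boundary of \<open>Q\<close> inherits \<open>d d = 0\<close> from \<open>C(A, M)\<close>, because \<open>to_harr\<close> is a surjective chain map.\<close>

lemma dQ_dQ:
  assumes t: "t \<in> carrier (Q (Suc (Suc N)))"
  shows "dQ (Suc N) (dQ (Suc (Suc N)) t) = \<zero>\<^bsub>Q N\<^esub>"
proof -
  note b = from_harr_closed[OF t]
  have "dQ (Suc N) (dQ (Suc (Suc N)) (to_harr (Suc (Suc N)) (from_harr (Suc (Suc N)) t))) = to_harr N (d (Suc N) (d (Suc (Suc N)) (from_harr (Suc (Suc N)) t)))"
    unfolding to_harr_d[OF b, symmetric] to_harr_d[OF d_closed[OF b], symmetric] ..
  also have "\<dots> = \<zero>\<^bsub>Q N\<^esub>" unfolding d_d[OF b] by (rule lin_zero[OF H_mod Q_mod to_harr_lin])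
  finally show ?thesis unfolding to_harr_from_harr[OF t] .
qed

lemma from_harr_d:
  assumes t: "t \<in> carrier (Q (Suc N))"
  shows "from_harr N (dQ (Suc N) t) = d (Suc N) (from_harr (Suc N) t)"
proof -
  note b = from_harr_closed[OF t]
  have "from_harr N (dQ (Suc N) (to_harr (Suc N) (from_harr (Suc N) t))) = d (Suc N) (e (Suc N) (from_harr (Suc N) t))"
    unfolding to_harr_d[OF b, symmetric] from_harr_to_harr[OF d_closed[OF b]] e_boundary[OF b] ..
  then show ?thesis unfolding to_harr_from_harr[OF t] e_from_harr[OF t] .
qed

end

section \<open>Homology\<close>

locale chain_complex =
  fixes R :: "('k, 'r) ring_scheme" and C :: "nat \<Rightarrow> ('k, 'x) module" and d :: "nat \<Rightarrow> 'x \<Rightarrow> 'x"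
  assumes C_mod: "module R (C n)"
    and d_lin: "d (Suc n) \<in> lin_maps R (C (Suc n)) (C n)"
    and d_d: "x \<in> carrier (C (Suc (Suc n))) \<Longrightarrow> d (Suc n) (d (Suc (Suc n)) x) = \<zero>\<^bsub>C n\<^esub>"
begin

abbreviation "Z n \<equiv> cycles C d n"
abbreviation "B n \<equiv> boundaries C d n"
abbreviation "Zm n \<equiv> (C n)\<lparr>carrier := Z n\<rparr>"

lemma cycles_0: "Z 0 = carrier (C 0)" and cycles_Suc: "Z (Suc n) = {x \<in> carrier (C (Suc n)). d (Suc n) x \<in> {\<zero>\<^bsub>C n\<^esub>}}"
  by (auto simp: cycles_def)

lemma cycles_submodule: "submodule (Z n) R (C n)"
proof (cases n)
  case 0
  then show ?thesis using module.carrier_is_submodule[OF C_mod[of 0]] by (simp add: cycles_0)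
next
  case (Suc k)
  show ?thesis unfolding Suc cycles_Suc
    by (rule submodule_preimage[OF C_mod C_mod d_lin submodule_zero[OF C_mod]])
qed

lemma Zm_mod: "module R (Zm n)"
  by (rule submodule.submodule_is_module[OF cycles_submodule C_mod])

lemma d_cycle: "x \<in> carrier (C (Suc n)) \<Longrightarrow> d (Suc n) x \<in> Z n"
  by (cases n) (simp_all add: cycles_def lin_closed[OF d_lin] d_d)

lemma boundaries_submodule: "submodule (B n) R (Zm n)"
proof -
  have "d (Suc n) \<in> lin_maps R (C (Suc n)) (Zm n)"
    by (rule lin_mapsI) (simp_all add: d_cycle lin_add[OF d_lin] lin_smult[OF d_lin])
  from submodule_image[OF C_mod Zm_mod this] show ?thesis by (simp add: boundaries_def)
qed

lemma homology_eq: "homology C d n = quotient_module (Zm n) (B n)"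
  by (simp add: homology_def)

lemma homology_mod: "module R (homology C d n)"
  unfolding homology_eq by (rule quotient_is_module[OF Zm_mod boundaries_submodule])

end

lemma lin_inj:
  assumes M: "module R M" and N: "module R N" and f: "f \<in> lin_maps R M N"
    and ker: "\<And>x. x \<in> carrier M \<Longrightarrow> f x = \<zero>\<^bsub>N\<^esub> \<Longrightarrow> x = \<zero>\<^bsub>M\<^esub>"
  shows "inj_on f (carrier M)"
proof (rule inj_onI)
  interpret M: module R M by (rule M)
  interpret N: module R N by (rule N)
  fix x y assume x: "x \<in> carrier M" and y: "y \<in> carrier M" and eq: "f x = f y"
  have "f (x \<ominus>\<^bsub>M\<^esub> y) = \<zero>\<^bsub>N\<^esub>"
    unfolding lin_diff[OF M N f x y] eq using lin_closed[OF f y] by (simp add: a_minus_def N.M.r_neg)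
  then have "x \<ominus>\<^bsub>M\<^esub> y = \<zero>\<^bsub>M\<^esub>" using ker[of "x \<ominus>\<^bsub>M\<^esub> y"] x y by simp
  then have "(x \<ominus>\<^bsub>M\<^esub> y) \<oplus>\<^bsub>M\<^esub> y = y" using y by simp
  then show "x = y" using x y by (simp add: a_minus_def M.M.a_assoc M.M.l_neg)
qed

text \<open>A chain map with a chain left inverse is injective on homology; a homotopy, required on cycles only,
  makes it surjective.\<close>

lemma homology_iso:
  assumes C: "chain_complex R C dC" and D: "chain_complex R D dD"
    and f: "\<And>n. f n \<in> lin_maps R (C n) (D n)" and g: "\<And>n. g n \<in> lin_maps R (D n) (C n)"
    and fd: "\<And>n x. x \<in> carrier (C (Suc n)) \<Longrightarrow> f n (dC (Suc n) x) = dD (Suc n) (f (Suc n) x)"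
    and gd: "\<And>n y. y \<in> carrier (D (Suc n)) \<Longrightarrow> g n (dD (Suc n) y) = dC (Suc n) (g (Suc n) y)"
    and gf: "\<And>n x. x \<in> carrier (C n) \<Longrightarrow> g n (f n x) = x"
    and htp: "\<And>n y. y \<in> cycles D dD n \<Longrightarrow> \<exists>w\<in>carrier (D (Suc n)). y \<ominus>\<^bsub>D n\<^esub> f n (g n y) = dD (Suc n) w"
  shows "\<exists>h. h \<in> lin_isos R (homology C dC n) (homology D dD n)"
proof -
  interpret C: chain_complex R C dC by (rule C)
  interpret D: chain_complex R D dD by (rule D)
  interpret Dn: module R "D n" by (rule D.C_mod)
  have fZ: "f n x \<in> D.Z n" if x: "x \<in> C.Z n" for x
  proof (cases n)
    case 0
    then show ?thesis using x lin_closed[OF f] by (simp add: C.cycles_0 D.cycles_0)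
  next
    case (Suc k)
    then show ?thesis using x lin_closed[OF f[of n], of x] fd[of x k] lin_zero[OF C.C_mod D.C_mod f[of k]]
      by (simp add: C.cycles_Suc D.cycles_Suc)
  qed
  have gZ: "g n y \<in> C.Z n" if y: "y \<in> D.Z n" for y
  proof (cases n)
    case 0
    then show ?thesis using y lin_closed[OF g] by (simp add: C.cycles_0 D.cycles_0)
  next
    case (Suc k)
    then show ?thesis using y lin_closed[OF g[of n], of y] gd[of y k] lin_zero[OF D.C_mod C.C_mod g[of k]]
      by (simp add: C.cycles_Suc D.cycles_Suc)
  qed
  have fB: "f n x \<in> D.B n" if "x \<in> C.B n" for x
    using that fd lin_closed[OF f] by (auto simp: boundaries_def)
  have gB: "g n y \<in> C.B n" if "y \<in> D.B n" for y
    using that gd lin_closed[OF g] by (auto simp: boundaries_def)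
  have subZ: "x \<in> carrier (C n)" if "x \<in> C.Z n" for x using that by (simp add: cycles_def)
  have subZ': "y \<in> carrier (D n)" if "y \<in> D.Z n" for y using that by (simp add: cycles_def)
  have fm: "f n \<in> lin_maps R (C.Zm n) (D.Zm n)"
    by (rule lin_mapsI) (simp_all add: fZ subZ lin_add[OF f] lin_smult[OF f])
  note projD = quotient_proj[OF D.Zm_mod D.boundaries_submodule, of n, folded D.homology_eq]
  let ?F = "\<lambda>x. D.B n +>\<^bsub>D.Zm n\<^esub> f n x"
  have F: "?F \<in> lin_maps R (C.Zm n) (homology D dD n)" by (rule lin_comp[OF fm projD])
  have zeroD: "D.B n +>\<^bsub>D.Zm n\<^esub> y = \<zero>\<^bsub>homology D dD n\<^esub> \<longleftrightarrow> y \<in> D.B n" if "y \<in> D.Z n" for y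
    using coset_zero_iff[OF D.Zm_mod D.boundaries_submodule, of y n] that by (simp add: D.homology_eq)
  have zeroC: "C.B n +>\<^bsub>C.Zm n\<^esub> x = \<zero>\<^bsub>homology C dC n\<^esub> \<longleftrightarrow> x \<in> C.B n" if "x \<in> C.Z n" for x
    using coset_zero_iff[OF C.Zm_mod C.boundaries_submodule, of x n] that by (simp add: C.homology_eq)
  have BZ: "x \<in> C.Z n" if "x \<in> C.B n" for x using that C.d_cycle by (auto simp: boundaries_def)
  have BZ': "x \<in> D.Z n" if "x \<in> D.B n" for x using that D.d_cycle by (auto simp: boundaries_def)
  have kill: "?F x = \<zero>\<^bsub>homology D dD n\<^esub>" if "x \<in> C.B n" for x
    using zeroD[OF fZ[OF BZ[OF that]]] fB[OF that] by simp
  let ?h = "induced ?F"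
  have h: "?h \<in> lin_maps R (homology C dC n) (homology D dD n)"
    unfolding C.homology_eq
    by (rule induced_lin[OF C.Zm_mod C.boundaries_submodule D.homology_mod F]) (erule kill)
  have hv: "?h (C.B n +>\<^bsub>C.Zm n\<^esub> x) = ?F x" if "x \<in> C.Z n" for x
    by (rule induced_coset[OF C.Zm_mod C.boundaries_submodule D.homology_mod F]) (erule kill, use that in simp)
  have carC: "carrier (homology C dC n) = (\<lambda>x. C.B n +>\<^bsub>C.Zm n\<^esub> x) ` C.Z n"
    unfolding C.homology_eq carrier_quotient by simp
  have carD: "carrier (homology D dD n) = (\<lambda>x. D.B n +>\<^bsub>D.Zm n\<^esub> x) ` D.Z n"
    unfolding D.homology_eq carrier_quotient by simp
  have inj: "inj_on ?h (carrier (homology C dC n))"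
  proof (rule lin_inj[OF C.homology_mod D.homology_mod h])
    fix X assume "X \<in> carrier (homology C dC n)" and X0: "?h X = \<zero>\<^bsub>homology D dD n\<^esub>"
    then obtain x where x: "x \<in> C.Z n" "X = C.B n +>\<^bsub>C.Zm n\<^esub> x" unfolding carC by blast
    have "f n x \<in> D.B n" using X0 zeroD[OF fZ[OF x(1)]] unfolding x(2) hv[OF x(1)] by simp
    from gB[OF this] have "x \<in> C.B n" using gf[OF subZ[OF x(1)]] by simp
    then show "X = \<zero>\<^bsub>homology C dC n\<^esub>" using zeroC[OF x(1)] x(2) by simp
  qed
  have "carrier (homology D dD n) \<subseteq> ?h ` carrier (homology C dC n)"
  proof
    fix Y assume "Y \<in> carrier (homology D dD n)"
    then obtain y where y: "y \<in> D.Z n" and Y: "Y = D.B n +>\<^bsub>D.Zm n\<^esub> y" unfolding carD by blast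
    obtain w where w: "w \<in> carrier (D (Suc n))" "y \<ominus>\<^bsub>D n\<^esub> f n (g n y) = dD (Suc n) w" using htp[OF y] by blast
    let ?x = "g n y" and ?b = "dD (Suc n) w"
    have b: "?b \<in> D.B n" using w(1) by (simp add: boundaries_def)
    have x: "?x \<in> C.Z n" by (rule gZ[OF y])
    have yc: "y \<in> carrier (D n)" "f n ?x \<in> carrier (D n)" using subZ'[OF y] subZ'[OF fZ[OF x]] by auto
    have "?b \<oplus>\<^bsub>D n\<^esub> f n ?x = y"
      unfolding w(2)[symmetric] using yc by (simp add: a_minus_def Dn.M.a_assoc Dn.M.l_neg)
    then have "Y = D.B n +>\<^bsub>D.Zm n\<^esub> (?b \<oplus>\<^bsub>D.Zm n\<^esub> f n ?x)" using Y by simp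
    also have "\<dots> = (D.B n +>\<^bsub>D.Zm n\<^esub> ?b) \<oplus>\<^bsub>homology D dD n\<^esub> ?F ?x"
      using lin_add[OF projD, of ?b "f n ?x"] BZ'[OF b] fZ[OF x] by simp
    also have "D.B n +>\<^bsub>D.Zm n\<^esub> ?b = \<zero>\<^bsub>homology D dD n\<^esub>" using zeroD[OF BZ'[OF b]] b by simp
    also have "\<zero>\<^bsub>homology D dD n\<^esub> \<oplus>\<^bsub>homology D dD n\<^esub> ?F ?x = ?F ?x"
    proof -
      interpret HD: module R "homology D dD n" by (rule D.homology_mod)
      show ?thesis using lin_closed[OF F, of ?x] x by simp
    qed
    finally have "Y = ?h (C.B n +>\<^bsub>C.Zm n\<^esub> ?x)" using hv[OF x] by simp
    then show "Y \<in> ?h ` carrier (homology C dC n)" using x unfolding carC by blast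
  qed
  then have "?h ` carrier (homology C dC n) = carrier (homology D dD n)" using lin_closed[OF h] by blast
  then have "?h \<in> lin_isos R (homology C dC n) (homology D dD n)"
    using h inj by (simp add: lin_isos_def bij_betw_def)
  then show ?thesis by blast
qed

context aug_datum
begin

abbreviation "EK \<equiv> eulerian1_complex R \<iota> I M"

lemma EK_eq: "EK n = (KK.H n)\<lparr>carrier := KK.e n ` carrier (KK.H n)\<rparr>"
  by (simp add: eulerian1_complex_def)

lemma EK_submodule: "submodule (KK.e n ` carrier (KK.H n)) R (KK.H n)"
  by (rule submodule_image[OF KK.H_mod KK.H_mod KK.act_lin_map])

lemma EK_mod: "module R (EK n)"
  unfolding EK_eq by (rule submodule.submodule_is_module[OF EK_submodule KK.H_mod])

text \<open>For an idempotent, the image is the set of fixed points.\<close>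

lemma EK_carrier: "x \<in> carrier (EK n) \<longleftrightarrow> x \<in> carrier (KK.H n) \<and> KK.e n x = x"
  unfolding EK_eq using KK.act_closed' KK.e_idem by (auto simp del: One_nat_def simp: image_iff)

lemma EK_complex: "chain_complex R EK KK.d"
proof (rule chain_complex.intro)
  show "module R (EK n)" for n by (rule EK_mod)
  show "KK.d (Suc n) \<in> lin_maps R (EK (Suc n)) (EK n)" for n
  proof (rule lin_mapsI)
    show "KK.d (Suc n) x \<in> carrier (EK n)" if "x \<in> carrier (EK (Suc n))" for x
      using that KK.d_closed[of x n] KK.e_boundary[of x n] unfolding EK_carrier by simp
    show "KK.d (Suc n) (x \<oplus>\<^bsub>EK (Suc n)\<^esub> y) = KK.d (Suc n) x \<oplus>\<^bsub>EK n\<^esub> KK.d (Suc n) y"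
      if "x \<in> carrier (EK (Suc n))" "y \<in> carrier (EK (Suc n))" for x y
      using lin_add[OF KK.d_lin, of x n y] that unfolding EK_carrier by (simp add: EK_eq)
    show "KK.d (Suc n) (c \<odot>\<^bsub>EK (Suc n)\<^esub> x) = c \<odot>\<^bsub>EK n\<^esub> KK.d (Suc n) x"
      if "c \<in> carrier R" "x \<in> carrier (EK (Suc n))" for c x
      using lin_smult[OF KK.d_lin, of c x n] that unfolding EK_carrier by (simp add: EK_eq)
  qed
  show "KK.d (Suc n) (KK.d (Suc (Suc n)) x) = \<zero>\<^bsub>EK n\<^esub>" if "x \<in> carrier (EK (Suc (Suc n)))" for n x
    using that KK.d_d[of x n] unfolding EK_carrier by (simp add: EK_eq)
qed

lemma Q_complex: "chain_complex R Q dQ"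
  by (rule chain_complex.intro) (rule Q_mod dQ_lin | erule dQ_dQ)+

text \<open>The maps \<open>e K \<rightarrow> C \<rightarrow> Q\<close> and \<open>Q \<rightarrow> C \<rightarrow> K\<close> of the introduction, with the homotopy
  \<open>to_harr \<circ> htpy \<circ> from_harr\<close>.\<close>

lemma EK_homology_iso: "\<exists>h. h \<in> lin_isos R (homology EK KK.d n) (harr R \<iota> A M r n)"
  unfolding harr_def
proof (rule homology_iso[OF EK_complex Q_complex, where f = "\<lambda>n x. to_harr n (incl n x)" and g = "\<lambda>n t. proj n (from_harr n t)"])
  have EKl: "f \<in> lin_maps R (EK n) N" if "f \<in> lin_maps R (KK.H n) N" for f n and N :: "('k, 'z) module"
    by (rule lin_mapsI) (use lin_closed[OF that] lin_add[OF that] lin_smult[OF that] in \<open>simp_all only: EK_carrier\<close>, simp_all add: EK_eq)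
  show "(\<lambda>x. to_harr n (incl n x)) \<in> lin_maps R (EK n) (Q n)" for n
    by (rule EKl[OF lin_comp[OF incl.hmap_lin to_harr_lin]])
  have gl: "(\<lambda>t. proj n (from_harr n t)) \<in> lin_maps R (Q n) (KK.H n)" for n
    by (rule lin_comp[OF from_harr_lin proj.hmap_lin])
  have ge: "KK.e n (proj n (from_harr n t)) = proj n (from_harr n t)" if "t \<in> carrier (Q n)" for n t
    using proj.hmap_act[OF from_harr_closed[OF that], of "eulerian n 1"] e_from_harr[OF that] by simp
  show "(\<lambda>t. proj n (from_harr n t)) \<in> lin_maps R (Q n) (EK n)" for n
  proof (rule lin_mapsI)
    show "proj n (from_harr n t) \<in> carrier (EK n)" if "t \<in> carrier (Q n)" for t
      using that lin_closed[OF gl that] ge[OF that] unfolding EK_carrier by blast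
    show "proj n (from_harr n (s \<oplus>\<^bsub>Q n\<^esub> t)) = proj n (from_harr n s) \<oplus>\<^bsub>EK n\<^esub> proj n (from_harr n t)"
      if "s \<in> carrier (Q n)" "t \<in> carrier (Q n)" for s t
      using lin_add[OF gl that] by (simp add: EK_eq)
    show "proj n (from_harr n (c \<odot>\<^bsub>Q n\<^esub> t)) = c \<odot>\<^bsub>EK n\<^esub> proj n (from_harr n t)" if "c \<in> carrier R" "t \<in> carrier (Q n)" for c t
      using lin_smult[OF gl that] by (simp add: EK_eq)
  qed
  show "to_harr n (incl n (KK.d (Suc n) x)) = dQ (Suc n) (to_harr (Suc n) (incl (Suc n) x))"
    if "x \<in> carrier (EK (Suc n))" for n x
    using that incl_d[of x n] to_harr_d[OF incl.hmap_closed[of x "Suc n"]] unfolding EK_carrier by simp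
  show "proj n (from_harr n (dQ (Suc n) t)) = KK.d (Suc n) (proj (Suc n) (from_harr (Suc n) t))"
    if "t \<in> carrier (Q (Suc n))" for n t
    unfolding from_harr_d[OF that] proj_d[OF from_harr_closed[OF that]] ..
  show "proj n (from_harr n (to_harr n (incl n x))) = x" if "x \<in> carrier (EK n)" for n x
  proof -
    have x: "x \<in> carrier (KK.H n)" "KK.e n x = x" using that unfolding EK_carrier by auto
    note i = incl.hmap_closed[OF x(1)]
    show ?thesis unfolding from_harr_to_harr[OF i] proj.hmap_act[OF i] proj_incl[OF x(1)] by (rule x(2))
  qed
  show "\<exists>w\<in>carrier (Q (Suc n)). t \<ominus>\<^bsub>Q n\<^esub> to_harr n (incl n (proj n (from_harr n t))) = dQ (Suc n) w"
    if t: "t \<in> cycles Q dQ n" for n t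
  proof -
    have tc: "t \<in> carrier (Q n)" using t by (simp add: cycles_def)
    note b = from_harr_closed[OF tc]
    have "n = 0 \<or> d n (from_harr n t) = \<zero>\<^bsub>H (n - 1)\<^esub>"
    proof (cases n)
      case (Suc k)
      then have "dQ (Suc k) t = \<zero>\<^bsub>Q k\<^esub>" using t by (simp add: cycles_def)
      then show ?thesis
        using from_harr_d[of t k] tc Suc lin_zero[OF Q_mod H_mod from_harr_lin[of k]] by simp
    qed simp
    note ch = cycle_homotopy[OF b this]
    have ipb: "incl n (proj n (from_harr n t)) \<in> carrier (H n)" by (rule lin_closed[OF incl_proj_lin b])
    have hb: "htpy n (from_harr n t) \<in> carrier (H (Suc n))" by (rule lin_closed[OF htpy_lin b])
    have "t \<ominus>\<^bsub>Q n\<^esub> to_harr n (incl n (proj n (from_harr n t)))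
       = to_harr n (from_harr n t) \<ominus>\<^bsub>Q n\<^esub> to_harr n (incl n (proj n (from_harr n t)))"
      unfolding to_harr_from_harr[OF tc] ..
    also have "\<dots> = to_harr n (d (Suc n) (htpy n (from_harr n t)))"
      unfolding lin_diff[OF H_mod Q_mod to_harr_lin b ipb, symmetric] ch ..
    also have "\<dots> = dQ (Suc n) (to_harr (Suc n) (htpy n (from_harr n t)))" by (rule to_harr_d[OF hb])
    finally show ?thesis using lin_closed[OF to_harr_lin hb] by blast
  qed
qed

end

theorem corollary3p8:
  fixes R :: "'k ring" and A :: "('k, 'a) module" and M :: "('k, 'm) module"
    and \<iota> :: "rat \<Rightarrow> 'k" and \<epsilon> :: "'a \<Rightarrow> 'k"
    and l :: "'a \<Rightarrow> 'm \<Rightarrow> 'm" and r :: "'m \<Rightarrow> 'a \<Rightarrow> 'm" and n :: nat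
  assumes "cring R"
    and "\<iota> \<in> ring_hom rat_ring R" and "inj \<iota>"
    and "augmented_algebra R A \<epsilon>"
    and "symmetric_bimodule R A M l r"
    and "flat_module R M"
  shows "\<exists>h. h \<in> lin_isos R
    (homology (eulerian1_complex R \<iota> (aug_ideal R A \<epsilon>) M)
       (hoch_boundary R (aug_ideal R A \<epsilon>) M l r) n)
    (harr R \<iota> A M r n)"
proof -
  interpret S: symmetric_bimodule R A M l r by fact
  interpret E: augmented_algebra R A \<epsilon> by fact
  have "hoch_datum R \<iota> A M l r"
  proof (rule hoch_datum.intro)
    show "\<iota> \<in> ring_hom rat_ring R" by fact
    show "module R A" by (rule S.module)
    show "module R M" by (rule S.MM.module_axioms)
    show "(\<lambda>b. b \<otimes>\<^bsub>A\<^esub> a) \<in> lin_maps R A A" if "a \<in> carrier A" for a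
      by (rule lin_mapsI) (use that in \<open>simp_all add: S.l_distr S.smult_assoc2\<close>)
    show "a \<otimes>\<^bsub>A\<^esub> b = b \<otimes>\<^bsub>A\<^esub> a" if "a \<in> carrier A" "b \<in> carrier A" for a b
      using that by (rule S.m_comm)
    show "a \<otimes>\<^bsub>A\<^esub> b \<otimes>\<^bsub>A\<^esub> c = a \<otimes>\<^bsub>A\<^esub> (b \<otimes>\<^bsub>A\<^esub> c)"
      if "a \<in> carrier A" "b \<in> carrier A" "c \<in> carrier A" for a b c
      using that by (rule S.m_assoc)
    show "(\<lambda>m. r m a) \<in> lin_maps R M M" if "a \<in> carrier A" for a
      by (rule lin_mapsI) (use that in \<open>simp_all add: S.r_closed S.r_add_left S.r_smult_left\<close>)
    show "r m \<in> lin_maps R A M" if "m \<in> carrier M" for m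
      by (rule lin_mapsI) (use that in \<open>simp_all add: S.r_closed S.r_add_right S.r_smult_right\<close>)
    show "l a m = r m a" if "a \<in> carrier A" "m \<in> carrier M" for a m
      using that by (rule S.symmetric)
    show "r m (a \<otimes>\<^bsub>A\<^esub> b) = r (r m a) b" if "a \<in> carrier A" "b \<in> carrier A" "m \<in> carrier M" for a b m
      using that by (rule S.r_assoc)
  qed
  then interpret D: aug_datum R \<iota> A M l r \<epsilon>
  proof (rule aug_datum.intro)
    show "aug_datum_axioms R A M r \<epsilon>"
    proof (rule aug_datum_axioms.intro)
      show "cring A" by (rule S.M_cring)
      show "\<epsilon> \<in> ring_hom A R" by (rule E.aug_ring_hom)
      show "(c \<odot>\<^bsub>A\<^esub> x) \<otimes>\<^bsub>A\<^esub> y = c \<odot>\<^bsub>A\<^esub> (x \<otimes>\<^bsub>A\<^esub> y)"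
        if "c \<in> carrier R" "x \<in> carrier A" "y \<in> carrier A" for c x y
        using that by (rule S.smult_assoc2)
      show "\<epsilon> (c \<odot>\<^bsub>A\<^esub> a) = c \<otimes>\<^bsub>R\<^esub> \<epsilon> a" if "c \<in> carrier R" "a \<in> carrier A" for c a
        using that by (rule E.aug_smult)
      show "r m \<one>\<^bsub>A\<^esub> = m" if "m \<in> carrier M" for m using that by (rule S.r_one)
    qed
  qed
  show ?thesis by (rule D.EK_homology_iso)
qed

end
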